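(* Let $T$ be a complete, model complete o-minimal theory extending $\mathrm{RCF}$, let $\mathcal M\models T$ and let $\delta$ be a $T$-derivation on $\mathcal M$. The following are equivalent: (1) $(\mathcal M,\delta)\models T^\delta_G$, i.e. $\delta$ is generic. (2) For each $n$ and each $L(M)$-definable set $X\subseteq M^{2n}$, if $\dim_L(\pi_n(X))=n$, then there is $\bar a\in M^n$ with $(\bar a,\delta\bar a)\in X$.
   Context: $T$ is a theory in a language $L$ extending the language of ordered rings. For $\mathcal M\models T$ with underlying set $M$ and $A\subseteq M$, "$L(A)$-definable" means definable in $\mathcal M$ by an $L$-formula with parameters from $A$. For a map $\delta:M\to M$ and a tuple $\bar u=(u_1,\dots,u_n)$ put $\delta\bar u=(\delta u_1,\dots,\delta u_n)$; $\mathbf J_f$ denotes the Jacobian matrix of $f$. A map $\delta:M\to M$ is a $T$-derivation on $\mathcal M$ if for every $n$, every open $U\subseteq M^n$ and every $L(\emptyset)$-definable $\mathcal C^1$-function $f:U\to M$ we have $\delta f(\bar u)=\mathbf J_f(\bar u)\,\delta\bar u$ for all $\bar u\in U$. $T^\delta$ is the theory, in the language $L^\delta=L\cup\{\delta\}$, extending $T$ by axioms stating that $\delta$ is a $T$-derivation. For $a\in M$ let $\mathscr J^n_\delta(a)=(a,\delta a,\dots,\delta^n a)$. Let $\pi_n$ be projection onto the first $n$ coordinates and $\dim_L$ the usual o-minimal dimension. The $T$-derivation $\delta$ is generic if for every $n$ and every $L(M)$-definable $A\subseteq M^{n+1}$ with $\dim_L(\pi_n(A))=n$ there is $a\in M$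 with $\mathscr J^n_\delta(a)\in A$. $T^\delta_G$ is the theory extending $T^\delta$ by the axiom scheme asserting that $\delta$ is generic. *)

theory Defs
  imports "HOL-Library.Extended_Real"
begin

section \<open>First-order languages extending the language of ordered rings\<close>

datatype 'f fsym = Zero | One | Plus | Minus | Times | Fn 'f
datatype 'r rsym = Less | Rl 'r

text \<open>
  A language extending \<open>(0, 1, +, -, *, <)\<close> (with unary \<open>-\<close>) is given by the arities of its
  additional symbols. Those elements of the symbol types that have no arity do not belong
  to the language, so the set of additional symbols may be empty.
\<close>

record ('f, 'r) lang =
  fn_arity :: "'f \<Rightarrow> nat option"
  rl_arity :: "'r \<Rightarrow> nat option"

primrec farity :: "('f, 'r) lang \<Rightarrow> 'f fsym \<Rightarrow> nat option" where
  "farity L Zero = Some 0"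
| "farity L One = Some 0"
| "farity L Plus = Some 2"
| "farity L Minus = Some 1"
| "farity L Times = Some 2"
| "farity L (Fn f) = fn_arity L f"

primrec rarity :: "('f, 'r) lang \<Rightarrow> 'r rsym \<Rightarrow> nat option" where
  "rarity L Less = Some 2"
| "rarity L (Rl r) = rl_arity L r"

text \<open>Variables are de Bruijn indices: \<open>FEx\<close> binds index 0.\<close>

datatype 'f trm = Var nat | App "'f fsym" "'f trm list"

datatype ('f, 'r) fm =
    Eq "'f trm" "'f trm"
  | Rel "'r rsym" "'f trm list"
  | FNot "('f, 'r) fm"
  | FAnd "('f, 'r) fm" "('f, 'r) fm"
  | FEx "('f, 'r) fm"

abbreviation FOr :: "('f, 'r) fm \<Rightarrow> ('f, 'r) fm \<Rightarrow> ('f, 'r) fm" where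
  "FOr p q \<equiv> FNot (FAnd (FNot p) (FNot q))"
abbreviation FImp :: "('f, 'r) fm \<Rightarrow> ('f, 'r) fm \<Rightarrow> ('f, 'r) fm" where
  "FImp p q \<equiv> FNot (FAnd p (FNot q))"
abbreviation FAll :: "('f, 'r) fm \<Rightarrow> ('f, 'r) fm" where
  "FAll p \<equiv> FNot (FEx (FNot p))"

primrec wf_trm :: "('f, 'r) lang \<Rightarrow> 'f trm \<Rightarrow> bool" where
  "wf_trm L (Var i) = True"
| "wf_trm L (App f ts) = (farity L f = Some (length ts) \<and> list_all (wf_trm L) ts)"

primrec wf_fm :: "('f, 'r) lang \<Rightarrow> ('f, 'r) fm \<Rightarrow> bool" where
  "wf_fm L (Eq s t) = (wf_trm L s \<and> wf_trm L t)"
| "wf_fm L (Rel r ts) = (rarity L r = Some (length ts) \<and> list_all (wf_trm L) ts)"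
| "wf_fm L (FNot p) = wf_fm L p"
| "wf_fm L (FAnd p q) = (wf_fm L p \<and> wf_fm L q)"
| "wf_fm L (FEx p) = wf_fm L p"

primrec fv_trm :: "'f trm \<Rightarrow> nat set" where
  "fv_trm (Var i) = {i}"
| "fv_trm (App f ts) = \<Union> (set (map fv_trm ts))"

primrec fv :: "('f, 'r) fm \<Rightarrow> nat set" where
  "fv (Eq s t) = fv_trm s \<union> fv_trm t"
| "fv (Rel r ts) = (\<Union>t\<in>set ts. fv_trm t)"
| "fv (FNot p) = fv p"
| "fv (FAnd p q) = fv p \<union> fv q"
| "fv (FEx p) = {i. Suc i \<in> fv p}"

definition sentence :: "('f, 'r) lang \<Rightarrow> ('f, 'r) fm \<Rightarrow> bool" where
  "sentence L p \<longleftrightarrow> wf_fm L p \<and> fv p = {}"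

section \<open>Structures and satisfaction\<close>

record ('f, 'r, 'a) fo_structure =
  universe :: "'a set"
  fn :: "'f fsym \<Rightarrow> 'a list \<Rightarrow> 'a"
  rl :: "'r rsym \<Rightarrow> 'a list \<Rightarrow> bool"

definition is_structure :: "('f, 'r) lang \<Rightarrow> ('f, 'r, 'a) fo_structure \<Rightarrow> bool" where
  "is_structure L M \<longleftrightarrow> universe M \<noteq> {} \<and>
     (\<forall>f xs. farity L f = Some (length xs) \<and> set xs \<subseteq> universe M \<longrightarrow> fn M f xs \<in> universe M)"

primrec val :: "('f, 'r, 'a) fo_structure \<Rightarrow> (nat \<Rightarrow> 'a) \<Rightarrow> 'f trm \<Rightarrow> 'a" where
  "val M v (Var i) = v i"
| "val M v (App f ts) = fn M f (map (val M v) ts)"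

primrec sat :: "('f, 'r, 'a) fo_structure \<Rightarrow> (nat \<Rightarrow> 'a) \<Rightarrow> ('f, 'r) fm \<Rightarrow> bool" where
  "sat M v (Eq s t) = (val M v s = val M v t)"
| "sat M v (Rel r ts) = rl M r (map (val M v) ts)"
| "sat M v (FNot p) = (\<not> sat M v p)"
| "sat M v (FAnd p q) = (sat M v p \<and> sat M v q)"
| "sat M v (FEx p) = (\<exists>a\<in>universe M. sat M (case_nat a v) p)"

definition holds :: "('f, 'r, 'a) fo_structure \<Rightarrow> ('f, 'r) fm \<Rightarrow> bool" where
  "holds M p \<longleftrightarrow> (\<forall>v. range v \<subseteq> universe M \<longrightarrow> sat M v p)"

definition models :: "('f, 'r) lang \<Rightarrow> ('f, 'r, 'a) fo_structure \<Rightarrow> ('f, 'r) fm set \<Rightarrow> bool" where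
  "models L M T \<longleftrightarrow> is_structure L M \<and> (\<forall>p\<in>T. holds M p)"

definition substructure ::
  "('f, 'r) lang \<Rightarrow> ('f, 'r, 'a) fo_structure \<Rightarrow> ('f, 'r, 'a) fo_structure \<Rightarrow> bool" where
  "substructure L M N \<longleftrightarrow> universe M \<subseteq> universe N \<and>
     (\<forall>f xs. farity L f = Some (length xs) \<and> set xs \<subseteq> universe M \<longrightarrow> fn M f xs = fn N f xs) \<and>
     (\<forall>r xs. rarity L r = Some (length xs) \<and> set xs \<subseteq> universe M \<longrightarrow> rl M r xs = rl N r xs)"

definition elementary_substructure ::
  "('f, 'r) lang \<Rightarrow> ('f, 'r, 'a) fo_structure \<Rightarrow> ('f, 'r, 'a) fo_structure \<Rightarrow> bool" where
  "elementary_substructure L M N \<longleftrightarrow> substructure L M N \<and>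
     (\<forall>p v. wf_fm L p \<and> range v \<subseteq> universe M \<longrightarrow> (sat M v p \<longleftrightarrow> sat N v p))"

section \<open>Definable sets and o-minimality\<close>

text \<open>The power \<open>M^n\<close> consists of the lists of length \<open>n\<close> over the underlying set of \<open>M\<close>.\<close>

definition tuples :: "('f, 'r, 'a) fo_structure \<Rightarrow> nat \<Rightarrow> 'a list set" where
  "tuples M n = {xs. length xs = n \<and> set xs \<subseteq> universe M}"

text \<open>
  The first \<open>n\<close> free variables range over the coordinates; the remaining ones are
  filled with parameters from \<open>B\<close>. For \<open>B = {}\<close> there are no remaining free variables.
\<close>

definition definable ::
  "('f, 'r) lang \<Rightarrow> ('f, 'r, 'a) fo_structure \<Rightarrow> 'a set \<Rightarrow> nat \<Rightarrow> 'a list set \<Rightarrow> bool" where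
  "definable L M B n A \<longleftrightarrow> (\<exists>p e. wf_fm L p \<and> (\<forall>i\<in>fv p. n \<le> i \<longrightarrow> e i \<in> B) \<and>
     A = {xs \<in> tuples M n. sat M (\<lambda>i. if i < n then xs ! i else e i) p})"

definition definable_fun ::
  "('f, 'r) lang \<Rightarrow> ('f, 'r, 'a) fo_structure \<Rightarrow> 'a set \<Rightarrow> nat \<Rightarrow> 'a list set \<Rightarrow> ('a list \<Rightarrow> 'a) \<Rightarrow> bool"
  where "definable_fun L M B n U f \<longleftrightarrow> U \<subseteq> tuples M n \<and> (\<forall>u\<in>U. f u \<in> universe M) \<and>
     definable L M B (Suc n) {u @ [f u] |u. u \<in> U}"

definition lt :: "('f, 'r, 'a) fo_structure \<Rightarrow> 'a \<Rightarrow> 'a \<Rightarrow> bool" where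
  "lt M x y = rl M Less [x, y]"

definition linearly_ordered :: "('f, 'r, 'a) fo_structure \<Rightarrow> bool" where
  "linearly_ordered M \<longleftrightarrow>
     (\<forall>x\<in>universe M. \<not> lt M x x) \<and>
     (\<forall>x\<in>universe M. \<forall>y\<in>universe M. \<forall>z\<in>universe M. lt M x y \<and> lt M y z \<longrightarrow> lt M x z) \<and>
     (\<forall>x\<in>universe M. \<forall>y\<in>universe M. lt M x y \<or> x = y \<or> lt M y x)"

text \<open>
  The endpoints of an open interval lie in the structure or are infinite; an infinite
  endpoint (minus infinity below, plus infinity above) is written \<open>None\<close>.
\<close>

definition above :: "('f, 'r, 'a) fo_structure \<Rightarrow> 'a option \<Rightarrow> 'a \<Rightarrow> bool" where
  "above M l x = (case l of None \<Rightarrow> True | Some a \<Rightarrow> lt M a x)"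

definition below :: "('f, 'r, 'a) fo_structure \<Rightarrow> 'a \<Rightarrow> 'a option \<Rightarrow> bool" where
  "below M x u = (case u of None \<Rightarrow> True | Some b \<Rightarrow> lt M x b)"

definition point_or_interval :: "('f, 'r, 'a) fo_structure \<Rightarrow> 'a set \<Rightarrow> bool" where
  "point_or_interval M S \<longleftrightarrow> (\<exists>a\<in>universe M. S = {a}) \<or>
     (\<exists>l u. set_option l \<subseteq> universe M \<and> set_option u \<subseteq> universe M \<and>
        S = {x \<in> universe M. above M l x \<and> below M x u})"

definition o_minimal :: "('f, 'r) lang \<Rightarrow> ('f, 'r, 'a) fo_structure \<Rightarrow> bool" where
  "o_minimal L M \<longleftrightarrow> linearly_ordered M \<and>
     (\<forall>A. definable L M (universe M) 1 A \<longrightarrow>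
        (\<exists>F. finite F \<and> (\<forall>S\<in>F. point_or_interval M S) \<and> {x. [x] \<in> A} = \<Union>F))"

section \<open>Theories\<close>

text \<open>
  Properties of theories refer to all models. HOL cannot quantify over types, so the
  models range over those whose underlying set consists of elements of the type
  \<open>('f, 'r) fm\<close>. Its cardinality is the maximum of aleph-0 and the number of symbols, so by
  the downward Loewenheim-Skolem theorem (applied to pairs of models for model
  completeness) none of the notions below changes if larger models are admitted.
\<close>

type_synonym ('f, 'r) small_structure = "('f, 'r, ('f, 'r) fm) fo_structure"

definition entails :: "('f, 'r) lang \<Rightarrow> ('f, 'r) fm set \<Rightarrow> ('f, 'r) fm \<Rightarrow> bool" where
  "entails L T p \<longleftrightarrow> (\<forall>N :: ('f, 'r) small_structure. models L N T \<longrightarrow> holds N p)"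

definition complete_theory :: "('f, 'r) lang \<Rightarrow> ('f, 'r) fm set \<Rightarrow> bool" where
  "complete_theory L T \<longleftrightarrow> (\<forall>p. sentence L p \<longrightarrow> entails L T p \<or> entails L T (FNot p))"

definition model_complete :: "('f, 'r) lang \<Rightarrow> ('f, 'r) fm set \<Rightarrow> bool" where
  "model_complete L T \<longleftrightarrow> (\<forall>(M :: ('f, 'r) small_structure) N.
     models L M T \<and> models L N T \<and> substructure L M N \<longrightarrow> elementary_substructure L M N)"

definition o_minimal_theory :: "('f, 'r) lang \<Rightarrow> ('f, 'r) fm set \<Rightarrow> bool" where
  "o_minimal_theory L T \<longleftrightarrow>
     (\<forall>N :: ('f, 'r) small_structure. models L N T \<longrightarrow> o_minimal L N)"

abbreviation tadd :: "'f trm \<Rightarrow> 'f trm \<Rightarrow> 'f trm" where "tadd s t \<equiv> App Plus [s, t]"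
abbreviation tmul :: "'f trm \<Rightarrow> 'f trm \<Rightarrow> 'f trm" where "tmul s t \<equiv> App Times [s, t]"
abbreviation tneg :: "'f trm \<Rightarrow> 'f trm" where "tneg t \<equiv> App Minus [t]"
abbreviation tzero :: "'f trm" where "tzero \<equiv> App Zero []"
abbreviation tone :: "'f trm" where "tone \<equiv> App One []"
abbreviation FLess :: "'f trm \<Rightarrow> 'f trm \<Rightarrow> ('f, 'r) fm" where "FLess s t \<equiv> Rel Less [s, t]"

text \<open>The general monic polynomial of degree \<open>n\<close> in \<open>Var 0\<close>, with coefficients \<open>Var 1, ..., Var n\<close>.\<close>

primrec monic_trm :: "nat \<Rightarrow> 'f trm" where
  "monic_trm 0 = tone"
| "monic_trm (Suc n) = tadd (tmul (monic_trm n) (Var 0)) (Var (Suc n))"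

definition RCF :: "('f, 'r) fm set" where
  "RCF =
    (let x = Var 0; y = Var 1; z = Var 2 in
     { FAll (FAll (FAll (Eq (tadd (tadd x y) z) (tadd x (tadd y z))))),
       FAll (FAll (Eq (tadd x y) (tadd y x))),
       FAll (Eq (tadd x tzero) x),
       FAll (Eq (tadd x (tneg x)) tzero),
       FAll (FAll (FAll (Eq (tmul (tmul x y) z) (tmul x (tmul y z))))),
       FAll (FAll (Eq (tmul x y) (tmul y x))),
       FAll (Eq (tmul x tone) x),
       FAll (FAll (FAll (Eq (tmul x (tadd y z)) (tadd (tmul x y) (tmul x z))))),
       FNot (Eq tzero tone),
       FAll (FImp (FNot (Eq x tzero)) (FEx (Eq (tmul (Var 1) (Var 0)) tone))),
       FAll (FNot (FLess x x)),
       FAll (FAll (FAll (FImp (FAnd (FLess x y) (FLess y z)) (FLess x z)))),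
       FAll (FAll (FOr (FLess x y) (FOr (Eq x y) (FLess y x)))),
       FAll (FAll (FAll (FImp (FLess x y) (FLess (tadd x z) (tadd y z))))),
       FAll (FAll (FImp (FAnd (FLess tzero x) (FLess tzero y)) (FLess tzero (tmul x y)))),
       FAll (FImp (FLess tzero x) (FEx (Eq (tmul (Var 0) (Var 0)) (Var 1)))) })
     \<union> {(FAll ^^ n) (FEx (Eq (monic_trm n) tzero)) |n. odd n}"

definition extends_RCF :: "('f, 'r) lang \<Rightarrow> ('f, 'r) fm set \<Rightarrow> bool" where
  "extends_RCF L T \<longleftrightarrow> (\<forall>p\<in>RCF. entails L T p)"

section \<open>Cells and dimension\<close>

definition mzero :: "('f, 'r, 'a) fo_structure \<Rightarrow> 'a" where "mzero M = fn M Zero []"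
definition madd :: "('f, 'r, 'a) fo_structure \<Rightarrow> 'a \<Rightarrow> 'a \<Rightarrow> 'a" where "madd M x y = fn M Plus [x, y]"
definition mmul :: "('f, 'r, 'a) fo_structure \<Rightarrow> 'a \<Rightarrow> 'a \<Rightarrow> 'a" where "mmul M x y = fn M Times [x, y]"
definition mneg :: "('f, 'r, 'a) fo_structure \<Rightarrow> 'a \<Rightarrow> 'a" where "mneg M x = fn M Minus [x]"
definition msub :: "('f, 'r, 'a) fo_structure \<Rightarrow> 'a \<Rightarrow> 'a \<Rightarrow> 'a" where "msub M x y = madd M x (mneg M y)"

definition mabs :: "('f, 'r, 'a) fo_structure \<Rightarrow> 'a \<Rightarrow> 'a" where
  "mabs M x = (if lt M x (mzero M) then mneg M x else x)"

definition msum :: "('f, 'r, 'a) fo_structure \<Rightarrow> 'a list \<Rightarrow> 'a" where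
  "msum M xs = foldr (madd M) xs (mzero M)"

definition mpos :: "('f, 'r, 'a) fo_structure \<Rightarrow> 'a set" where
  "mpos M = {e \<in> universe M. lt M (mzero M) e}"

definition cont_on ::
  "('f, 'r, 'a) fo_structure \<Rightarrow> nat \<Rightarrow> 'a list set \<Rightarrow> ('a list \<Rightarrow> 'a) \<Rightarrow> bool" where
  "cont_on M n U f \<longleftrightarrow> (\<forall>u\<in>U. \<forall>e\<in>mpos M. \<exists>d\<in>mpos M. \<forall>w\<in>U.
     (\<forall>i<n. lt M (mabs M (msub M (w ! i) (u ! i))) d) \<longrightarrow> lt M (mabs M (msub M (f w) (f u))) e)"

definition definable_cont ::
  "('f, 'r) lang \<Rightarrow> ('f, 'r, 'a) fo_structure \<Rightarrow> nat \<Rightarrow> 'a list set \<Rightarrow> ('a list \<Rightarrow> 'a) \<Rightarrow> bool" where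
  "definable_cont L M n U f \<longleftrightarrow> definable_fun L M (universe M) n U f \<and> cont_on M n U f"

text \<open>
  \<open>cell L M is C\<close>: the set \<open>C\<close> is an \<open>(i_1, ..., i_n)\<close>-cell in \<open>M^n\<close>, where \<open>is = [i_1, ..., i_n]\<close>.
  A boundary function \<open>None\<close> of a band stands for the constant minus infinity (below) or
  plus infinity (above).
\<close>

inductive cell ::
  "('f, 'r) lang \<Rightarrow> ('f, 'r, 'a) fo_structure \<Rightarrow> nat list \<Rightarrow> 'a list set \<Rightarrow> bool"
  for L M where
  point: "cell L M [] {[]}"
| graph: "cell L M is C \<Longrightarrow> definable_cont L M (length is) C f \<Longrightarrow>
    cell L M (is @ [0]) {xs @ [f xs] |xs. xs \<in> C}"
| band: "cell L M is C \<Longrightarrow>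
    (\<forall>f\<in>set_option l. definable_cont L M (length is) C f) \<Longrightarrow>
    (\<forall>g\<in>set_option h. definable_cont L M (length is) C g) \<Longrightarrow>
    (\<forall>f\<in>set_option l. \<forall>g\<in>set_option h. \<forall>xs\<in>C. lt M (f xs) (g xs)) \<Longrightarrow>
    cell L M (is @ [1])
      {xs @ [y] |xs y. xs \<in> C \<and> y \<in> universe M \<and>
         above M (map_option (\<lambda>f. f xs) l) y \<and> below M y (map_option (\<lambda>g. g xs) h)}"

text \<open>
  The supremum is a maximum unless \<open>A\<close> contains no cell; for definable \<open>A\<close> this means
  \<open>A = {}\<close>, and then the dimension is minus infinity.
\<close>

definition omin_dim :: "('f, 'r) lang \<Rightarrow> ('f, 'r, 'a) fo_structure \<Rightarrow> 'a list set \<Rightarrow> ereal" where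
  "omin_dim L M A = Sup {ereal (real (sum_list is)) |is C. cell L M is C \<and> C \<subseteq> A}"

section \<open>T-derivations\<close>

definition open_in :: "('f, 'r, 'a) fo_structure \<Rightarrow> nat \<Rightarrow> 'a list set \<Rightarrow> bool" where
  "open_in M n U \<longleftrightarrow> U \<subseteq> tuples M n \<and>
     (\<forall>u\<in>U. \<exists>a\<in>tuples M n. \<exists>b\<in>tuples M n.
        (\<forall>i<n. lt M (a ! i) (u ! i) \<and> lt M (u ! i) (b ! i)) \<and>
        {x \<in> tuples M n. \<forall>i<n. lt M (a ! i) (x ! i) \<and> lt M (x ! i) (b ! i)} \<subseteq> U)"

text \<open>
  \<open>d\<close> is the limit of the difference quotients \<open>(f (u + h e_i) - f u) / h\<close> as \<open>h\<close> tends to 0;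
  the inequality is multiplied by \<open>\<bar>h\<bar>\<close> to avoid division.
\<close>

definition has_partial ::
  "('f, 'r, 'a) fo_structure \<Rightarrow> 'a list set \<Rightarrow> ('a list \<Rightarrow> 'a) \<Rightarrow> nat \<Rightarrow> 'a list \<Rightarrow> 'a \<Rightarrow> bool" where
  "has_partial M U f i u d \<longleftrightarrow> d \<in> universe M \<and>
     (\<forall>e\<in>mpos M. \<exists>r\<in>mpos M. \<forall>h\<in>universe M.
        h \<noteq> mzero M \<and> lt M (mabs M h) r \<and> u[i := madd M (u ! i) h] \<in> U \<longrightarrow>
        lt M (mabs M (msub M (msub M (f (u[i := madd M (u ! i) h])) (f u)) (mmul M d h)))
               (mmul M e (mabs M h)))"

definition partial_deriv ::
  "('f, 'r, 'a) fo_structure \<Rightarrow> 'a list set \<Rightarrow> ('a list \<Rightarrow> 'a) \<Rightarrow> nat \<Rightarrow> 'a list \<Rightarrow> 'a" where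
  "partial_deriv M U f i u = (THE d. has_partial M U f i u d)"

definition C1_on ::
  "('f, 'r, 'a) fo_structure \<Rightarrow> nat \<Rightarrow> 'a list set \<Rightarrow> ('a list \<Rightarrow> 'a) \<Rightarrow> bool" where
  "C1_on M n U f \<longleftrightarrow> (\<forall>i<n. (\<forall>u\<in>U. \<exists>d. has_partial M U f i u d) \<and>
     cont_on M n U (partial_deriv M U f i))"

text \<open>The Jacobian matrix of a scalar function of \<open>n\<close> variables is a row vector.\<close>

definition jacobian ::
  "('f, 'r, 'a) fo_structure \<Rightarrow> nat \<Rightarrow> 'a list set \<Rightarrow> ('a list \<Rightarrow> 'a) \<Rightarrow> 'a list \<Rightarrow> 'a list" where
  "jacobian M n U f u = map (\<lambda>i. partial_deriv M U f i u) [0..<n]"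

definition T_derivation ::
  "('f, 'r) lang \<Rightarrow> ('f, 'r, 'a) fo_structure \<Rightarrow> ('a \<Rightarrow> 'a) \<Rightarrow> bool" where
  "T_derivation L M \<delta> \<longleftrightarrow> \<delta> ` universe M \<subseteq> universe M \<and>
     (\<forall>n U f. open_in M n U \<and> definable_fun L M {} n U f \<and> C1_on M n U f \<longrightarrow>
        (\<forall>u\<in>U. \<delta> (f u) = msum M (map2 (mmul M) (jacobian M n U f u) (map \<delta> u))))"

definition jet :: "('a \<Rightarrow> 'a) \<Rightarrow> nat \<Rightarrow> 'a \<Rightarrow> 'a list" where
  "jet \<delta> n a = map (\<lambda>i. (\<delta> ^^ i) a) [0..<Suc n]"

definition generic ::
  "('f, 'r) lang \<Rightarrow> ('f, 'r, 'a) fo_structure \<Rightarrow> ('a \<Rightarrow> 'a) \<Rightarrow> bool" where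
  "generic L M \<delta> \<longleftrightarrow>
     (\<forall>n A. definable L M (universe M) (Suc n) A \<and> omin_dim L M (take n ` A) = ereal (real n) \<longrightarrow>
        (\<exists>a\<in>universe M. jet \<delta> n a \<in> A))"

text \<open>
  Models of the theories \<open>T^delta\<close> and \<open>T^delta_G\<close> in the language with an added symbol for
  \<open>delta\<close>, given directly by the conditions that their axiom schemes express.
\<close>

definition models_T_delta ::
  "('f, 'r) lang \<Rightarrow> ('f, 'r) fm set \<Rightarrow> ('f, 'r, 'a) fo_structure \<Rightarrow> ('a \<Rightarrow> 'a) \<Rightarrow> bool" where
  "models_T_delta L T M \<delta> \<longleftrightarrow> models L M T \<and> T_derivation L M \<delta>"

definition models_T_delta_G ::
  "('f, 'r) lang \<Rightarrow> ('f, 'r) fm set \<Rightarrow> ('f, 'r, 'a) fo_structure \<Rightarrow> ('a \<Rightarrow> 'a) \<Rightarrow> bool" where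
  "models_T_delta_G L T M \<delta> \<longleftrightarrow> models_T_delta L T M \<delta> \<and> generic L M \<delta>"

end

theory Submission
  imports Defs
begin

text \<open>
  If (2) holds, apply it to the set of all \<open>(x, y)\<close> such that \<open>(x, y_n)\<close> lies in the given set and
  \<open>y_i = x_{i+1}\<close> for \<open>i < n\<close>: a solution is a jet.
  Conversely, definable choice reduces (2) to solving a system \<open>\<delta> (a_i) = F_i(a)\<close> with definable \<open>F\<close> on
  a box. A solution is determined by a single element, the linear combination \<open>c = \<Sum>i. p_i * a_i\<close>, for suitable
  coefficients \<open>p_i\<close>: by the chain rule the derivatives of \<open>c\<close> of order less than \<open>n\<close> must be definable
  functions \<open>\<Phi>_k(a)\<close>. By genericity the \<open>p_i\<close> can be chosen such that \<open>\<Phi>\<close> is nearly a linear isomorphism, so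
  that its image contains a box, and genericity again gives \<open>c\<close> and \<open>a\<close> with \<open>c^(k) = \<Phi>_k(a)\<close> for \<open>k < n\<close> and
  \<open>c^(n) = \<Phi>_n(a)\<close>. Differentiating the first \<open>n\<close> equations by the chain rule, the invertible Jacobian
  matrix of \<open>\<Phi>\<close> shows \<open>\<delta> (a_i) = F_i(a)\<close>.

  Cell decomposition is avoided. By the Loewenheim-Skolem theorem \<open>M\<close> is an
  o-minimal ordered field, and the facts needed about \<open>n\<close> variables (definable choice, generic continuity
  and differentiability, Fubini) follow from o-minimality by induction on \<open>n\<close>, with \<open>contains a box\<close> in
  the place of \<open>has dimension n\<close>.
\<close>

section \<open>Transporting the structure to a type\<close>

text \<open>A T-derivation obeys the chain rule only for parameter-free functions, while the
  right-hand sides F of the system have parameters in M. The parameters are therefore replaced by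
  additional variables of a parameter-free function; its derivatives with respect to them contribute
  an inhomogeneous term, which is definable because \<delta> maps parameters to constants. That this
  function is differentiable at the parameters in question is forced by taking their number minimal.
  The Jacobian matrix of \<Phi> involves the derivatives of the a_i along the system, which are
  beyond control. Yet their partial derivatives are bounded on a small box, and the bound is known
  before the p_i are chosen. Genericity prescribes each p_i^(j) with j < n up to an error of 1: as
  \<open>\<Lambda> ^ Suc i\<close> for j = i and as 0 otherwise. Then the term p_k^(k) * a_k
  dominates the partial derivatives of \<Phi>_k; the powers increase with i because the
  contributions of p_i^(i) with i < k must be negligible there as well. The field need not be
  complete, so suprema, choices and inverse functions all have to come from definability.\<close>

locale carrier_ordered_field =
  fixes U :: "'a set" and zero one :: 'a and add :: "'a \<Rightarrow> 'a \<Rightarrow> 'a" and neg :: "'a \<Rightarrow> 'a"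
    and mul :: "'a \<Rightarrow> 'a \<Rightarrow> 'a" and less :: "'a \<Rightarrow> 'a \<Rightarrow> bool"
  assumes zero_closed: "zero \<in> U" and one_closed: "one \<in> U" and neg_closed: "x \<in> U \<Longrightarrow> neg x \<in> U"
    and add_closed: "x \<in> U \<Longrightarrow> y \<in> U \<Longrightarrow> add x y \<in> U"
    and mul_closed: "x \<in> U \<Longrightarrow> y \<in> U \<Longrightarrow> mul x y \<in> U"
    and add_assoc: "x \<in> U \<Longrightarrow> y \<in> U \<Longrightarrow> z \<in> U \<Longrightarrow> add (add x y) z = add x (add y z)"
    and add_comm: "x \<in> U \<Longrightarrow> y \<in> U \<Longrightarrow> add x y = add y x"
    and add_zero: "x \<in> U \<Longrightarrow> add x zero = x"
    and add_neg: "x \<in> U \<Longrightarrow> add x (neg x) = zero"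
    and mul_assoc: "x \<in> U \<Longrightarrow> y \<in> U \<Longrightarrow> z \<in> U \<Longrightarrow> mul (mul x y) z = mul x (mul y z)"
    and mul_comm: "x \<in> U \<Longrightarrow> y \<in> U \<Longrightarrow> mul x y = mul y x"
    and mul_one: "x \<in> U \<Longrightarrow> mul x one = x"
    and distrib: "x \<in> U \<Longrightarrow> y \<in> U \<Longrightarrow> z \<in> U \<Longrightarrow> mul x (add y z) = add (mul x y) (mul x z)"
    and zero_not_one: "zero \<noteq> one"
    and inverse_ex: "x \<in> U \<Longrightarrow> x \<noteq> zero \<Longrightarrow> \<exists>y\<in>U. mul x y = one"
    and less_irrefl: "x \<in> U \<Longrightarrow> \<not> less x x"
    and less_trans: "x \<in> U \<Longrightarrow> y \<in> U \<Longrightarrow> z \<in> U \<Longrightarrow> less x y \<Longrightarrow> less y z \<Longrightarrow> less x z"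
    and less_linear: "x \<in> U \<Longrightarrow> y \<in> U \<Longrightarrow> less x y \<or> x = y \<or> less y x"
    and add_mono: "x \<in> U \<Longrightarrow> y \<in> U \<Longrightarrow> z \<in> U \<Longrightarrow> less x y \<Longrightarrow> less (add x z) (add y z)"
    and mul_pos: "x \<in> U \<Longrightarrow> y \<in> U \<Longrightarrow> less zero x \<Longrightarrow> less zero y \<Longrightarrow> less zero (mul x y)"

abbreviation ordered_field :: "('f, 'r, 'a) fo_structure \<Rightarrow> bool" where
  "ordered_field M \<equiv> carrier_ordered_field (universe M) (fn M Zero []) (fn M One []) (\<lambda>x y. fn M Plus [x, y])
     (\<lambda>x. fn M Minus [x]) (\<lambda>x y. fn M Times [x, y]) (\<lambda>x y. rl M Less [x, y])"

text \<open>
  HOL has no types depending on terms, but a proof by contradiction only needs one structure: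
  the type \<open>point\<close> below is the universe of a fixed counterexample,
  chosen once and for all (or a copy of the rationals, if there is none).
\<close>

definition violates :: "('f, 'r) lang \<Rightarrow> ('f, 'r, 'a) fo_structure \<Rightarrow> ('a \<Rightarrow> 'a) \<Rightarrow> bool" where
  "violates L M \<delta> \<longleftrightarrow> ordered_field M \<and> is_structure L M \<and> o_minimal L M \<and> T_derivation L M \<delta> \<and>
    \<not> (generic L M \<delta> \<longleftrightarrow>
      (\<forall>n X. definable L M (universe M) (2 * n) X \<and> omin_dim L M (take n ` X) = ereal (real n) \<longrightarrow>
        (\<exists>a\<in>tuples M n. a @ map \<delta> a \<in> X)))"

definition violator :: "('f, 'r, 'a) fo_structure" where
  "violator = (SOME M. \<exists>(L :: ('f, 'r) lang) \<delta>. violates L M \<delta>)"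

definition rat_structure :: "('f, 'r, 'a + rat) fo_structure" where
  "rat_structure = \<lparr>universe = range Inr,
     fn = (\<lambda>f xs. let qs = map projr xs in Inr (case f of Zero \<Rightarrow> 0 | One \<Rightarrow> 1 | Plus \<Rightarrow> qs ! 0 + qs ! 1
        | Minus \<Rightarrow> - (qs ! 0) | Times \<Rightarrow> qs ! 0 * qs ! 1 | Fn _ \<Rightarrow> 0)),
     rl = (\<lambda>r xs. projr (xs ! 0) < projr (xs ! 1))\<rparr>"

text \<open>The summand \<open>rat\<close> leaves room for the fallback: there may be no ordered
  field on \<open>'a\<close> at all, yet the typedef below needs one for all type arguments.\<close>

definition base_structure :: "('f, 'r, 'a + rat) fo_structure" where
  "base_structure = (if ordered_field (violator :: ('f, 'r, 'a) fo_structure)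
     then \<lparr>universe = Inl ` universe (violator :: ('f, 'r, 'a) fo_structure),
       fn = (\<lambda>f xs. Inl (fn (violator :: ('f, 'r, 'a) fo_structure) f (map projl xs))),
       rl = (\<lambda>r xs. rl (violator :: ('f, 'r, 'a) fo_structure) r (map projl xs))\<rparr>
     else rat_structure)"

lemma ordered_field_rat_structure: "ordered_field rat_structure"
proof -
  have inv: "q \<noteq> 0 \<Longrightarrow> \<exists>y. q * y = 1" for q :: rat
    by (rule exI[of _ "1 / q"]) simp
  show ?thesis
    apply unfold_locales
    apply (auto simp: rat_structure_def algebra_simps)
    using inv by blast
qed

lemma ordered_field_base_structure: "ordered_field (base_structure :: ('f, 'r, 'a + rat) fo_structure)"
proof (cases "ordered_field (violator :: ('f, 'r, 'a) fo_structure)")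
  case True
  let ?V = "violator :: ('f, 'r, 'a) fo_structure"
  interpret v: carrier_ordered_field "universe ?V" "fn ?V Zero []"
    "fn ?V One []" "\<lambda>x y. fn ?V Plus [x, y]" "\<lambda>x. fn ?V Minus [x]" "\<lambda>x y. fn ?V Times [x, y]"
    "\<lambda>x y. rl ?V Less [x, y]"
    by (rule True)
  show ?thesis
    unfolding base_structure_def using True
    apply unfold_locales
    subgoal by (simp add: v.zero_closed)
    subgoal by (simp add: v.one_closed)
    subgoal by (auto intro: v.neg_closed)
    subgoal by (auto intro: v.add_closed)
    subgoal by (auto intro: v.mul_closed)
    subgoal by (auto intro: v.add_assoc)
    subgoal by (auto intro: v.add_comm)
    subgoal by (auto intro: v.add_zero)
    subgoal by (auto intro: v.add_neg)
    subgoal by (auto intro: v.mul_assoc)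
    subgoal by (auto intro: v.mul_comm)
    subgoal by (auto intro: v.mul_one)
    subgoal by (auto intro: v.distrib)
    subgoal by (simp add: v.zero_not_one)
    subgoal using v.inverse_ex by (auto, blast)
    subgoal by (auto dest: v.less_irrefl)
    subgoal by (auto intro: v.less_trans)
    subgoal using v.less_linear by (auto, blast)
    subgoal by (auto intro: v.add_mono)
    subgoal by (auto intro: v.mul_pos)
    done
next
  case False
  then show ?thesis
    unfolding base_structure_def using ordered_field_rat_structure by simp
qed

typedef ('f, 'r, 'a) point = "universe (base_structure :: ('f, 'r, 'a + rat) fo_structure)"
  using carrier_ordered_field.zero_closed[OF ordered_field_base_structure] by blast

instantiation point :: (type, type, type) linordered_field
begin
definition "zero_point = (Abs_point (fn (base_structure :: ('a, 'b, 'c + rat) fo_structure) Zero []) :: ('a, 'b, 'c) point)"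
definition "one_point = (Abs_point (fn (base_structure :: ('a, 'b, 'c + rat) fo_structure) One []) :: ('a, 'b, 'c) point)"
definition "plus_point (x :: ('a, 'b, 'c) point) (y :: ('a, 'b, 'c) point) = (Abs_point (fn (base_structure :: ('a, 'b, 'c + rat) fo_structure) Plus [Rep_point x, Rep_point y]) :: ('a, 'b, 'c) point)"
definition "uminus_point (x :: ('a, 'b, 'c) point) = (Abs_point (fn (base_structure :: ('a, 'b, 'c + rat) fo_structure) Minus [Rep_point x]) :: ('a, 'b, 'c) point)"
definition "times_point (x :: ('a, 'b, 'c) point) (y :: ('a, 'b, 'c) point) = (Abs_point (fn (base_structure :: ('a, 'b, 'c + rat) fo_structure) Times [Rep_point x, Rep_point y]) :: ('a, 'b, 'c) point)"
definition "minus_point (x :: ('a, 'b, 'c) point) y = x + - (y :: ('a, 'b, 'c) point)"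
definition "less_point (x :: ('a, 'b, 'c) point) (y :: ('a, 'b, 'c) point) = rl (base_structure :: ('a, 'b, 'c + rat) fo_structure) Less [Rep_point x, Rep_point (y :: ('a, 'b, 'c) point)]"
definition "less_eq_point (x :: ('a, 'b, 'c) point) y \<longleftrightarrow> x < y \<or> x = (y :: ('a, 'b, 'c) point)"
definition "inverse_point (x :: ('a, 'b, 'c) point) = (if x = 0 then 0 else (SOME y :: ('a, 'b, 'c) point. x * y = 1))"
definition "divide_point (x :: ('a, 'b, 'c) point) y = x * inverse (y :: ('a, 'b, 'c) point)"
definition "abs_point (x :: ('a, 'b, 'c) point) = (if x < 0 then - x else (x :: ('a, 'b, 'c) point))"
definition "sgn_point (x :: ('a, 'b, 'c) point) = (if x = 0 then 0 else if 0 < x then 1 else - 1 :: ('a, 'b, 'c) point)"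

lemma Rep_point_ops:
  fixes x y :: "('a, 'b, 'c) point"
  defines "B \<equiv> base_structure :: ('a, 'b, 'c + rat) fo_structure"
  shows "Rep_point (0 :: ('a, 'b, 'c) point) = fn B Zero []" "Rep_point (1 :: ('a, 'b, 'c) point) = fn B One []"
    "Rep_point (x + y) = fn B Plus [Rep_point x, Rep_point y]" "Rep_point (- x) = fn B Minus [Rep_point x]"
    "Rep_point (x * y) = fn B Times [Rep_point x, Rep_point y]"
  unfolding zero_point_def one_point_def plus_point_def uminus_point_def times_point_def B_def
  by (simp_all add: Abs_point_inverse Rep_point carrier_ordered_field.zero_closed[OF ordered_field_base_structure]
    carrier_ordered_field.one_closed[OF ordered_field_base_structure]
    carrier_ordered_field.neg_closed[OF ordered_field_base_structure]
    carrier_ordered_field.add_closed[OF ordered_field_base_structure]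
    carrier_ordered_field.mul_closed[OF ordered_field_base_structure])

instance
proof
  let ?B = "base_structure :: ('a, 'b, 'c + rat) fo_structure"
  interpret B: carrier_ordered_field "universe ?B" "fn ?B Zero []" "fn ?B One []" "\<lambda>x y. fn ?B Plus [x, y]"
    "\<lambda>x. fn ?B Minus [x]" "\<lambda>x y. fn ?B Times [x, y]" "\<lambda>x y. rl ?B Less [x, y]"
    by (rule ordered_field_base_structure)
  note defs = Rep_point_inject[symmetric] Rep_point_ops less_point_def
  note U = Rep_point
  fix a b c :: "('a, 'b, 'c) point"
  show assoc: "a + b + c = a + (b + c)" for a b c :: "('a, 'b, 'c) point"
    unfolding defs by (rule B.add_assoc) (rule U)+
  show comm: "a + b = b + a" for a b :: "('a, 'b, 'c) point"
    unfolding defs by (rule B.add_comm) (rule U)+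
  have zero: "a + 0 = a" for a :: "('a, 'b, 'c) point"
    unfolding defs by (rule B.add_zero) (rule U)
  then show "0 + a = a"
    by (simp add: comm[of 0])
  have neg: "a + - a = 0" for a :: "('a, 'b, 'c) point"
    unfolding defs by (rule B.add_neg) (rule U)
  then show "- a + a = 0"
    by (simp add: comm[of "- a"])
  show "a * b * c = a * (b * c)"
    unfolding defs by (rule B.mul_assoc) (rule U)+
  show mcomm: "a * b = b * a" for a b :: "('a, 'b, 'c) point"
    unfolding defs by (rule B.mul_comm) (rule U)+
  have "a * 1 = a"
    unfolding defs by (rule B.mul_one) (rule U)
  then show "1 * a = a"
    by (simp add: mcomm[of 1])
  show "(0 :: ('a, 'b, 'c) point) \<noteq> 1"
    unfolding defs by (rule B.zero_not_one)
  have distr: "c * (a + b) = c * a + c * b" for a b c :: "('a, 'b, 'c) point"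
    unfolding defs by (rule B.distrib) (rule U)+
  show "(a + b) * c = a * c + b * c"
    unfolding mcomm[of _ c] by (rule distr)
  have cancel: "x = y" if "a + x = a + y" for a x y :: "('a, 'b, 'c) point"
  proof -
    have "- a + (a + x) = - a + (a + y)" using that by simp
    then show ?thesis
      by (metis assoc comm neg zero)
  qed
  show mzero: "a * 0 = 0" for a :: "('a, 'b, 'c) point"
    by (rule cancel[of "a * 0"]) (metis distr zero)
  then show "0 * a = 0"
    by (simp add: mcomm[of 0])
  have ab: "a + (b + - a) = b" for a b :: "('a, 'b, 'c) point"
    by (metis assoc comm neg zero)
  then show "a + b - a = b"
    by (simp add: minus_point_def assoc)
  have "- (b + c) = - b + - c"
  proof (rule cancel[of "b + c"])
    have "b + (c + (- b + - c)) = b + - b"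
      by (simp only: ab)
    then show "b + c + - (b + c) = b + c + (- b + - c)"
      by (simp add: neg assoc)
  qed
  then show "a - b - c = a - (b + c)"
    by (simp add: minus_point_def assoc)
  show "a - b = a + - b" by (simp add: minus_point_def)
  show "a div b = a * inverse b" by (simp add: divide_point_def)
  show "inverse (0 :: ('a, 'b, 'c) point) = 0" by (simp add: inverse_point_def)
  show "\<bar>a\<bar> = (if a < 0 then - a else a)" by (simp add: abs_point_def)
  show "sgn a = (if a = 0 then 0 else if 0 < a then 1 else - 1)" by (simp add: sgn_point_def)
  have irr: "\<not> a < a" for a :: "('a, 'b, 'c) point"
    unfolding defs by (rule B.less_irrefl) (rule U)
  have tr: "a < b \<Longrightarrow> b < c \<Longrightarrow> a < c" for a b c :: "('a, 'b, 'c) point"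
    unfolding defs by (rule B.less_trans[where y = "Rep_point b"]) (rule U | assumption)+
  have tri: "a < b \<or> a = b \<or> b < a" for a b :: "('a, 'b, 'c) point"
    unfolding defs by (rule B.less_linear) (rule U)+
  show "a < b \<longleftrightarrow> a \<le> b \<and> \<not> b \<le> a"
    unfolding less_eq_point_def using irr[of a] irr[of b] tr[of a b a] by metis
  show "a \<le> a" "a \<le> b \<or> b \<le> a"
    using tri[of a b] unfolding less_eq_point_def by auto
  show "a \<le> c" if "a \<le> b" "b \<le> c"
    using tr[of a b c] that unfolding less_eq_point_def by blast
  show "a = b" if "a \<le> b" "b \<le> a"
    using irr[of a] tr[of a b a] that unfolding less_eq_point_def by metis
  have add_less: "a < b \<Longrightarrow> a + c < b + c" for a b c :: "('a, 'b, 'c) point"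
    unfolding defs by (rule B.add_mono) (rule U | assumption)+
  show "c + a \<le> c + b" if "a \<le> b"
    using add_less[of a b c] that comm[of c] unfolding less_eq_point_def by auto
  have inv: "\<exists>y. a * y = 1" if "a \<noteq> 0" for a :: "('a, 'b, 'c) point"
    using B.inverse_ex[OF U, of a] that unfolding defs by (metis Abs_point_inverse)
  show "inverse a * a = 1" if "a \<noteq> 0"
    using someI_ex[OF inv[OF that]] that by (simp add: inverse_point_def mcomm[of _ a])
  have pos: "0 < a \<Longrightarrow> 0 < b \<Longrightarrow> 0 < a * b" for a b :: "('a, 'b, 'c) point"
    unfolding defs by (rule B.mul_pos) (rule U | assumption)+
  show "c * a < c * b" if "a < b" "0 < c"
  proof -
    have "0 < c * (b + - a)"
      using pos[of c "b + - a"] add_less[of a b "- a"] that neg[of a] by simp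
    then have "0 + c * a < c * (b + - a) + c * a" by (rule add_less)
    moreover have "c * (b + - a) + c * a = c * b"
      using distr[of c "b + - a" a] assoc[of b "- a" a] comm[of "- a" a] neg[of a] zero[of b] by simp
    ultimately show ?thesis using comm[of 0 "c * a"] zero[of "c * a"] by simp
  qed
qed
end

text \<open>What is obtained is the fixed counterexample, in general with a language, structure and
  derivation other than the given ones: the hypothesis only ensures that the choice of
  \<open>violator\<close> was meaningful.\<close>

lemma point_model:
  fixes L :: "('f, 'r) lang" and M :: "('f, 'r, 'a) fo_structure" and \<delta> :: "'a \<Rightarrow> 'a"
  assumes "violates L M \<delta>"
  obtains L' M' \<delta>' and rep :: "('f, 'r, 'a) point \<Rightarrow> 'a"
  where "violates L' (M' :: ('f, 'r, 'a) fo_structure) \<delta>'" "bij_betw rep UNIV (universe M')"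
    "rep 0 = fn M' Zero []" "rep 1 = fn M' One []" "\<And>x y. rep (x + y) = fn M' Plus [rep x, rep y]"
    "\<And>x. rep (- x) = fn M' Minus [rep x]" "\<And>x y. rep (x * y) = fn M' Times [rep x, rep y]"
    "\<And>x y. rl M' Less [rep x, rep y] \<longleftrightarrow> x < y"
proof -
  let ?M = "violator :: ('f, 'r, 'a) fo_structure"
  have "\<exists>L \<delta>. violates L ?M \<delta>"
    unfolding violator_def by (rule someI[where P = "\<lambda>M :: ('f, 'r, 'a) fo_structure. \<exists>(L :: ('f, 'r) lang) \<delta>. violates L M \<delta>" and x = M])
      (use assms in blast)
  then obtain L' \<delta>' where v: "violates L' ?M \<delta>'" by blast
  then have of: "ordered_field ?M" by (simp add: violates_def)
  define rep :: "('f, 'r, 'a) point \<Rightarrow> 'a" where "rep = projl \<circ> Rep_point"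
  have U: "universe (base_structure :: ('f, 'r, 'a + rat) fo_structure) = Inl ` universe ?M"
    using of by (simp add: base_structure_def)
  have R: "Rep_point x = Inl (rep x)" "rep x \<in> universe ?M" for x :: "('f, 'r, 'a) point"
    using Rep_point[of x] unfolding U rep_def by auto
  have fnB: "fn (base_structure :: ('f, 'r, 'a + rat) fo_structure) f xs = Inl (fn ?M f (map projl xs))"
    and rlB: "rl (base_structure :: ('f, 'r, 'a + rat) fo_structure) r xs = rl ?M r (map projl xs)" for f r xs
    using of by (simp_all add: base_structure_def)
  have "bij_betw rep UNIV (universe ?M)"
    unfolding bij_betw_def
  proof
    show "inj rep" by (rule injI) (metis R(1) Rep_point_inject)
    show "range rep = universe ?M"
    proof safe
      fix x assume "x \<in> universe ?M"
      then have "Inl x \<in> universe (base_structure :: ('f, 'r, 'a + rat) fo_structure)" by (simp add: U)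
      then have "rep (Abs_point (Inl x)) = x" by (simp add: rep_def Abs_point_inverse)
      then show "x \<in> range rep" by (metis rangeI)
    qed (use R in auto)
  qed
  moreover have "rep 0 = fn ?M Zero []" "rep 1 = fn ?M One []" "\<And>x y. rep (x + y) = fn ?M Plus [rep x, rep y]"
    "\<And>x. rep (- x) = fn ?M Minus [rep x]" "\<And>x y. rep (x * y) = fn ?M Times [rep x, rep y]"
    by (simp_all add: rep_def Rep_point_ops fnB)
  moreover have "\<And>x y. rl ?M Less [rep x, rep y] \<longleftrightarrow> x < y"
    by (simp add: less_point_def rlB R(1))
  ultimately show thesis using v that by blast
qed

section \<open>Renaming of variables and elementary substructures\<close>

primrec ren_trm :: "(nat \<Rightarrow> nat) \<Rightarrow> 'f trm \<Rightarrow> 'f trm" where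
  "ren_trm \<sigma> (Var i) = Var (\<sigma> i)"
| "ren_trm \<sigma> (App f ts) = App f (map (ren_trm \<sigma>) ts)"

primrec ren :: "(nat \<Rightarrow> nat) \<Rightarrow> ('f, 'r) fm \<Rightarrow> ('f, 'r) fm" where
  "ren \<sigma> (Eq s t) = Eq (ren_trm \<sigma> s) (ren_trm \<sigma> t)"
| "ren \<sigma> (Rel r ts) = Rel r (map (ren_trm \<sigma>) ts)"
| "ren \<sigma> (FNot p) = FNot (ren \<sigma> p)"
| "ren \<sigma> (FAnd p q) = FAnd (ren \<sigma> p) (ren \<sigma> q)"
| "ren \<sigma> (FEx p) = FEx (ren (case_nat 0 (\<lambda>i. Suc (\<sigma> i))) p)"

lemma val_ren: "val M v (ren_trm \<sigma> t) = val M (\<lambda>i. v (\<sigma> i)) t"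
  by (induction t) (auto cong: map_cong simp: comp_def intro!: arg_cong[where f = "fn M _"])

lemma sat_ren: "sat M v (ren \<sigma> p) = sat M (\<lambda>i. v (\<sigma> i)) p"
proof (induction p arbitrary: v \<sigma>)
  case (FEx p)
  have "(\<lambda>i. case_nat a v (case_nat 0 (\<lambda>i. Suc (\<sigma> i)) i)) = case_nat a (\<lambda>i. v (\<sigma> i))" for a
    by (auto split: nat.split)
  then show ?case using FEx by simp
qed (auto simp: val_ren comp_def)

lemma wf_ren_trm: "wf_trm L (ren_trm \<sigma> t) = wf_trm L t"
  by (induction t) (auto simp: list_all_iff)

lemma wf_ren: "wf_fm L (ren \<sigma> p) = wf_fm L p"
  by (induction p arbitrary: \<sigma>) (auto simp: wf_ren_trm list_all_iff)

lemma fv_ren_trm: "fv_trm (ren_trm \<sigma> t) = \<sigma> ` fv_trm t"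
  by (induction t) auto

lemma fv_ren: "fv (ren \<sigma> p) = \<sigma> ` fv p"
proof (induction p arbitrary: \<sigma>)
  case (FEx p)
  show ?case
  proof (safe; simp add: FEx image_iff)
    fix i assume "\<exists>j\<in>fv p. Suc i = case_nat 0 (\<lambda>i. Suc (\<sigma> i)) j"
    then show "\<exists>j. Suc j \<in> fv p \<and> i = \<sigma> j" by (metis Suc_inject nat.case nat.exhaust nat.simps(3))
  next
    fix i assume "Suc i \<in> fv p"
    then show "\<exists>j\<in>fv p. Suc (\<sigma> i) = case_nat 0 (\<lambda>i. Suc (\<sigma> i)) j" by (intro bexI[of _ "Suc i"]) auto
  qed
qed (auto simp: fv_ren_trm)

lemma finite_fv_trm: "finite (fv_trm t)"
  by (induction t) auto

lemma finite_fv: "finite (fv p)"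
proof (induction p)
  case (FEx p)
  have "{i. Suc i \<in> fv p} = Suc -` fv p" by auto
  then show ?case using FEx by (simp add: finite_vimageI)
qed (auto simp: finite_fv_trm)

lemma val_cong: "(\<And>i. i \<in> fv_trm t \<Longrightarrow> v i = w i) \<Longrightarrow> val M v t = val M w t"
proof (induction t)
  case (App f ts)
  then have "map (val M v) ts = map (val M w) ts" by simp blast
  then show ?case by (simp only: val.simps)
qed simp

lemma sat_cong: "(\<And>i. i \<in> fv p \<Longrightarrow> v i = w i) \<Longrightarrow> sat M v p = sat M w p"
proof (induction p arbitrary: v w)
  case (FEx p)
  have "sat M (case_nat a v) p = sat M (case_nat a w) p" for a
    using FEx by (intro FEx) (auto split: nat.split)
  then show ?case by simp
next
  case (Rel r ts)
  then have "map (val M v) ts = map (val M w) ts"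
    by (auto intro!: val_cong)
  then show ?case by (simp only: sat.simps)
next
  case (FAnd p q)
  have "sat M v p = sat M w p" "sat M v q = sat M w q"
    by (rule FAnd.IH, rule FAnd.prems, simp)+
  then show ?case by simp
next
  case (FNot p)
  have "sat M v p = sat M w p"
    by (rule FNot.IH, rule FNot.prems) simp
  then show ?case by simp
next
  case (Eq s t)
  then have "val M v s = val M w s" "val M v t = val M w t"
    by (auto intro!: val_cong)
  then show ?case by simp
qed

text \<open>Merges two parameter assignments, so that formulas with unrelated parameters can be
  joined to one formula.\<close>

definition interleave :: "(nat \<Rightarrow> 'a) \<Rightarrow> (nat \<Rightarrow> 'a) \<Rightarrow> nat \<Rightarrow> 'a" where
  "interleave v w i = (if even i then v (i div 2) else w (i div 2))"

lemma interleave_simps [simp]: "interleave v w (2 * i) = v i" "interleave v w (Suc (2 * i)) = w i"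
  by (simp_all add: interleave_def)

lemma range_interleave: "range v \<subseteq> U \<Longrightarrow> range w \<subseteq> U \<Longrightarrow> range (interleave v w) \<subseteq> U"
  by (auto simp: interleave_def)

subsection \<open>The downward Loewenheim-Skolem theorem\<close>

text \<open>
  Formulas serve as codes for the elements of the Skolem hull of a list \<open>A\<close> of parameters: \<open>FAnd p q\<close>
  stands for a witness of \<open>p\<close> with the list coded by \<open>q\<close> as parameters, and it also concatenates
  the lists coded by \<open>p\<close> and \<open>q\<close>.
\<close>

definition list_env :: "'a list \<Rightarrow> nat \<Rightarrow> 'a" where
  "list_env l i = (if i < length l then l ! i else hd l)"

definition witness :: "('f, 'r, 'a) fo_structure \<Rightarrow> ('f, 'r) fm \<Rightarrow> 'a list \<Rightarrow> 'a" where
  "witness M p l = (if \<exists>a\<in>universe M. sat M (case_nat a (list_env l)) p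
     then (SOME a. a \<in> universe M \<and> sat M (case_nat a (list_env l)) p) else hd l)"

primrec hull_list :: "('f, 'r, 'a) fo_structure \<Rightarrow> 'a list \<Rightarrow> ('f, 'r) fm \<Rightarrow> 'a list" where
  "hull_list M A (Eq s t) = A"
| "hull_list M A (Rel r ts) = A"
| "hull_list M A (FNot p) = hull_list M A p"
| "hull_list M A (FEx p) = hull_list M A p"
| "hull_list M A (FAnd p q) = witness M p (hull_list M A q) # hull_list M A p @ hull_list M A q"

definition hull_elem :: "('f, 'r, 'a) fo_structure \<Rightarrow> 'a list \<Rightarrow> ('f, 'r) fm \<Rightarrow> 'a" where
  "hull_elem M A q = hd (hull_list M A q)"

text \<open>The elements of the Skolem hull are coded by formulas, because the underlying set of N
  has to consist of formulas. Hence N comes with an elementary embedding j instead of being a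
  substructure.\<close>

lemma downward_Loewenheim_Skolem:
  fixes M :: "('f, 'r, 'a) fo_structure"
  assumes st: "is_structure L M" and A: "finite A0" "A0 \<subseteq> universe M"
  obtains N :: "('f, 'r) small_structure" and j where "is_structure L N" "j ` universe N \<subseteq> universe M"
    "A0 \<subseteq> j ` universe N" "\<And>p v. wf_fm L p \<Longrightarrow> range v \<subseteq> universe N \<Longrightarrow> sat N v p \<longleftrightarrow> sat M (\<lambda>i. j (v i)) p"
proof -
  obtain a0 where a0: "a0 \<in> universe M" using st by (auto simp: is_structure_def)
  obtain A' where A': "set A' = A0" using A finite_list by blast
  define A where "A = a0 # A'"
  have A: "A \<noteq> []" "set A \<subseteq> universe M" "A0 \<subseteq> set A" using a0 A A' by (auto simp: A_def)
  define h where "h = hull_elem M A"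
  have ne: "hull_list M A q \<noteq> []" and sub: "set (hull_list M A q) \<subseteq> universe M" for q :: "('f, 'r) fm"
  proof (induction q)
    case (FAnd p q)
    { case 2
      have "witness M p (hull_list M A q) \<in> universe M"
        unfolding witness_def
        using someI_ex[of "\<lambda>a. a \<in> universe M \<and> sat M (case_nat a (list_env (hull_list M A q))) p"] FAnd(4) FAnd(3) hd_in_set
        by (auto; blast)
      then show ?case using FAnd by auto }
  qed (use A in auto)
  have h_in: "h q \<in> set (hull_list M A q)" for q
    using ne by (simp add: h_def hull_elem_def)
  have hU: "h q \<in> universe M" for q
    using h_in sub by blast
  have wit: "witness M p (hull_list M A q) = h (FAnd p q)" for p q
    by (simp add: h_def hull_elem_def)
  \<comment> \<open>The entry at position i is the only witness of
    \<open>Eq (Var 0) (Var (Suc i))\<close>, hence the head of another hull list.\<close>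
  have elem: "x \<in> range h" if x: "x \<in> set (hull_list M A q)" for x q
  proof -
    obtain i where i: "i < length (hull_list M A q)" "x = hull_list M A q ! i"
      using x by (auto simp: in_set_conv_nth)
    have "witness M (Eq (Var 0) (Var (Suc i))) (hull_list M A q) = x"
      unfolding witness_def using i x subsetD[OF sub x] by (auto simp: list_env_def)
    then show ?thesis by (metis wit rangeI)
  qed
  have fin: "\<exists>q. F \<subseteq> set (hull_list M A q)" if "finite F" "F \<subseteq> range h" for F
    using that
  proof (induction F)
    case (insert x F)
    then obtain q q' where "F \<subseteq> set (hull_list M A q)" "x = h q'" by auto
    then have "insert x F \<subseteq> set (hull_list M A (FAnd q' q))" using h_in[of q'] by auto
    then show ?case by blast
  qed auto
  \<comment> \<open>The Tarski-Vaught criterion. The finitely many parameters that p mentions occur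
    together in one hull list, and p is renamed so as to look them up there by position.\<close>
  have TV: "\<exists>a\<in>range h. sat M (case_nat a v) p" if v: "range v \<subseteq> range h" and a: "a \<in> universe M" "sat M (case_nat a v) p" for p v a
  proof -
    obtain q where q: "v ` fv (FEx p) \<subseteq> set (hull_list M A q)"
    proof -
      have "v ` fv (FEx p) \<subseteq> range h" using v by blast
      from fin[OF finite_imageI[OF finite_fv] this] show thesis using that by blast
    qed
    define \<sigma> where "\<sigma> i = (SOME k. k < length (hull_list M A q) \<and> hull_list M A q ! k = v i)" for i
    have \<sigma>: "list_env (hull_list M A q) (\<sigma> i) = v i" if "Suc i \<in> fv p" for i
    proof -
      have "\<exists>k. k < length (hull_list M A q) \<and> hull_list M A q ! k = v i"
        using q that by (auto simp: in_set_conv_nth image_subset_iff)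
      from someI_ex[OF this] show ?thesis by (simp add: \<sigma>_def list_env_def)
    qed
    define p' where "p' = ren (case_nat 0 (\<lambda>i. Suc (\<sigma> i))) p"
    have p': "sat M (case_nat b (list_env (hull_list M A q))) p' = sat M (case_nat b v) p" for b
      unfolding p'_def sat_ren by (rule sat_cong) (auto split: nat.split simp: \<sigma>)
    have "sat M (case_nat (witness M p' (hull_list M A q)) (list_env (hull_list M A q))) p'"
      using someI_ex[of "\<lambda>a. a \<in> universe M \<and> sat M (case_nat a (list_env (hull_list M A q))) p'"] a p'
      by (auto simp: witness_def)
    then show ?thesis using p' wit by auto
  qed
  \<comment> \<open>The criterion applied to the formula x = f(x_1, ..., x_n).\<close>
  have closed: "fn M f xs \<in> range h" if f: "farity L f = Some (length xs)" and xs: "set xs \<subseteq> range h" for f xs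
  proof -
    define v where "v i = (if i < length xs then xs ! i else h undefined)" for i
    have v: "range v \<subseteq> range h" using xs by (auto simp: v_def)
    have m: "map (\<lambda>i. v i) [0..<length xs] = xs"
      by (rule nth_equalityI) (auto simp: v_def)
    have "set xs \<subseteq> universe M" using xs hU by blast
    then have "fn M f xs \<in> universe M" using st f by (auto simp: is_structure_def)
    with TV[OF v this, of "Eq (Var 0) (App f (map (\<lambda>i. Var (Suc i)) [0..<length xs]))"]
    show ?thesis using m by (auto simp: comp_def)
  qed
  \<comment> \<open>One code is selected for each element of the hull, so that h becomes injective
    on the universe of N.\<close>
  define \<kappa> where "\<kappa> x = (SOME q. h q = x)" for x
  have \<kappa>: "h (\<kappa> x) = x" if "x \<in> range h" for x
    unfolding \<kappa>_def by (rule someI_ex) (use that in auto)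
  define N :: "('f, 'r) small_structure" where "N = \<lparr>universe = \<kappa> ` range h, fn = (\<lambda>f xs. \<kappa> (fn M f (map h xs))), rl = (\<lambda>r xs. rl M r (map h xs))\<rparr>"
  have \<kappa>h: "\<kappa> (h q) = q" if "q \<in> universe N" for q
    using that \<kappa> by (auto simp: N_def)
  have inj: "h x = h y \<longleftrightarrow> x = y" if "x \<in> universe N" "y \<in> universe N" for x y
    using that \<kappa>h by metis
  have UN: "\<kappa> x \<in> universe N" if "x \<in> range h" for x
    using that by (auto simp: N_def)
  have stN: "is_structure L N"
    unfolding is_structure_def
  proof (intro conjI allI impI)
    show "universe N \<noteq> {}" by (simp add: N_def)
    fix f xs assume "farity L f = Some (length xs) \<and> set xs \<subseteq> universe N"
    then have "fn M f (map h xs) \<in> range h" by (intro closed) auto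
    then show "fn N f xs \<in> universe N" by (simp add: N_def)
  qed
  have val: "wf_trm L t \<Longrightarrow> range v \<subseteq> universe N \<Longrightarrow> val N v t \<in> universe N \<and> h (val N v t) = val M (\<lambda>i. h (v i)) t" for t v
  proof (induction t)
    case (App f ts)
    then have *: "farity L f = Some (length ts)" "\<And>t. t \<in> set ts \<Longrightarrow> val N v t \<in> universe N \<and> h (val N v t) = val M (\<lambda>i. h (v i)) t"
      by (auto simp: list_all_iff)
    have "val N v (App f ts) \<in> universe N"
    proof -
      have "set (map (val N v) ts) \<subseteq> universe N" "farity L f = Some (length (map (val N v) ts))" using * by auto
      then show ?thesis using stN unfolding is_structure_def val.simps by blast
    qed
    moreover have "map h (map (val N v) ts) = map (val M (\<lambda>i. h (v i))) ts"
      using * by auto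
    moreover have "fn M f (map h (map (val N v) ts)) \<in> range h"
      using * by (intro closed) (auto, metis rangeI)
    ultimately show ?case using \<kappa> by (auto simp: N_def simp del: map_map)
  qed auto
  have sat: "sat N v p \<longleftrightarrow> sat M (\<lambda>i. h (v i)) p" if "wf_fm L p" "range v \<subseteq> universe N" for p v
    using that
  proof (induction p arbitrary: v)
    case (Eq s t)
    then have "val N v s \<in> universe N" "val N v t \<in> universe N" "h (val N v s) = val M (\<lambda>i. h (v i)) s" "h (val N v t) = val M (\<lambda>i. h (v i)) t"
      using val by auto
    then show ?case using inj by (metis sat.simps(1))
  next
    case (Rel r ts)
    then have "map h (map (val N v) ts) = map (val M (\<lambda>i. h (v i))) ts"
      using val by (auto simp: list_all_iff)
    moreover have "rl N r xs = rl M r (map h xs)" for xs by (simp add: N_def)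
    ultimately show ?case by (simp only: sat.simps)
  next
    case (FEx p)
    have c: "(\<lambda>i. h (case_nat a v i)) = case_nat (h a) (\<lambda>i. h (v i))" for a
      by (auto split: nat.split)
    have IH: "sat N (case_nat a v) p \<longleftrightarrow> sat M (case_nat (h a) (\<lambda>i. h (v i))) p" if "a \<in> universe N" for a
      unfolding c[symmetric] using FEx.prems that by (intro FEx.IH) (auto split: nat.split simp: image_subset_iff)
    show ?case
    proof
      assume "sat N v (FEx p)"
      then show "sat M (\<lambda>i. h (v i)) (FEx p)" using IH hU by auto
    next
      assume "sat M (\<lambda>i. h (v i)) (FEx p)"
      then obtain b where "b \<in> range h" "sat M (case_nat b (\<lambda>i. h (v i))) p"
      proof -
        obtain a where a: "a \<in> universe M" "sat M (case_nat a (\<lambda>i. h (v i))) p"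
          using \<open>sat M (\<lambda>i. h (v i)) (FEx p)\<close> by auto
        have "range (\<lambda>i. h (v i)) \<subseteq> range h" by auto
        from TV[OF this a] show thesis using that by blast
      qed
      then have "sat N (case_nat (\<kappa> b) v) p" using IH[OF UN, of b] \<kappa>[of b] by simp
      then show "sat N v (FEx p)" using UN[OF \<open>b \<in> range h\<close>] unfolding sat.simps by blast
    qed
  qed auto
  have "A0 \<subseteq> h ` universe N"
  proof
    fix x assume "x \<in> A0"
    then have "x \<in> range h" using A(3) elem[of x "Eq (Var 0) (Var 0)"] by auto
    then show "x \<in> h ` universe N" using \<kappa> UN by (metis image_eqI)
  qed
  moreover have "h ` universe N \<subseteq> universe M" using hU by blast
  ultimately show thesis using stN sat by (intro that[of N h])
qed

section \<open>From the theory T to the model M: ordered field and o-minimality\<close>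

lemma models_elementary:
  assumes "\<forall>p\<in>T. sentence L p" "models L M T" "is_structure L N" "j ` universe N \<subseteq> universe M"
    and "\<And>p v. wf_fm L p \<Longrightarrow> range v \<subseteq> universe N \<Longrightarrow> sat N v p \<longleftrightarrow> sat M (\<lambda>i. j (v i)) p"
  shows "models L N T"
proof -
  have "sat N v p" if "p \<in> T" "range v \<subseteq> universe N" for p v
    using assms that by (auto simp: models_def holds_def sentence_def image_subset_iff)
  then show ?thesis using assms by (simp add: models_def holds_def)
qed

text \<open>\<open>entails\<close> ranges over small models only. The sentence is evaluated in a
  small elementary hull of the empty set and carried back to M.\<close>

lemma holds_if_entails:
  fixes L :: "('f, 'r) lang"
  assumes T: "\<forall>p\<in>T. sentence L p" and M: "models L M T" and p: "sentence L p" "entails L T p"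
  shows "holds M p"
proof -
  have "is_structure L M" using M by (simp add: models_def)
  then show ?thesis
  proof (rule downward_Loewenheim_Skolem[OF _ finite.emptyI empty_subsetI])
    fix N :: "('f, 'r) small_structure" and j
    assume N: "is_structure L N" "j ` universe N \<subseteq> universe M"
      "\<And>p v. wf_fm L p \<Longrightarrow> range v \<subseteq> universe N \<Longrightarrow> sat N v p \<longleftrightarrow> sat M (\<lambda>i. j (v i)) p"
    from T M N have "models L N T" by (rule models_elementary)
    then have "holds N p" using p by (simp add: entails_def)
    moreover obtain a where "a \<in> universe N" using N by (auto simp: is_structure_def)
    ultimately have "sat M (\<lambda>i. j a) p" using N(3)[of p "\<lambda>_. a"] p by (auto simp: holds_def sentence_def)
    then have "sat M v p" for v using p sat_cong[of p v "\<lambda>i. j a" M] by (auto simp: sentence_def)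
    then show "holds M p" by (simp add: holds_def)
  qed
qed

lemma ordered_field_if_extends_RCF:
  fixes L :: "('f, 'r) lang"
  assumes T: "\<forall>p\<in>T. sentence L p" and M: "models L M T" and ext: "extends_RCF L T"
  shows "ordered_field M"
proof -
  have sat: "sat M v p" if "p \<in> RCF" "sentence L p" "range v \<subseteq> universe M" for v p
    using holds_if_entails[OF T M, of p] ext that by (auto simp: extends_RCF_def holds_def)
  have st: "is_structure L M" using M by (simp add: models_def)
  then obtain a where a: "a \<in> universe M" by (auto simp: is_structure_def)
  define v where "v = (\<lambda>_ :: nat. a)"
  have v: "range v \<subseteq> universe M" using a by (auto simp: v_def)
  have cl: "fn M f xs \<in> universe M" if "farity L f = Some (length xs)" "set xs \<subseteq> universe M" for f xs
    using st that by (auto simp: is_structure_def)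
  let ?x = "Var 0" and ?y = "Var 1" and ?z = "Var 2"
  show ?thesis
  proof
    show "fn M Zero [] \<in> universe M" "fn M One [] \<in> universe M" by (auto intro: cl)
    \<comment> \<open>Here and below, the axiom is located by running through the enumeration of
      \<open>RCF\<close>; evaluating its quantifiers then gives the algebraic law on the universe of
      M.\<close>
    have "sat M v (FNot (Eq tzero tone))"
      by (rule sat[OF _ _ v]) (unfold RCF_def Let_def, rule UnI1, (rule insertI1 | rule insertI2)+, simp add: sentence_def)
    then show "fn M Zero [] \<noteq> fn M One []" by simp
    fix x assume x: "x \<in> universe M"
    show "fn M Minus [x] \<in> universe M" using x by (auto intro: cl)
    have "sat M v (FAll (Eq (tadd ?x tzero) ?x))"
      by (rule sat[OF _ _ v]) (unfold RCF_def Let_def, rule UnI1, (rule insertI1 | rule insertI2)+, simp add: sentence_def)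
    then show "fn M Plus [x, fn M Zero []] = x"
      using x unfolding sat.simps val.simps list.map numeral_2_eq_2 One_nat_def nat.case by blast
    have "sat M v (FAll (Eq (tadd ?x (tneg ?x)) tzero))"
      by (rule sat[OF _ _ v]) (unfold RCF_def Let_def, rule UnI1, (rule insertI1 | rule insertI2)+, simp add: sentence_def)
    then show "fn M Plus [x, fn M Minus [x]] = fn M Zero []"
      using x unfolding sat.simps val.simps list.map numeral_2_eq_2 One_nat_def nat.case by blast
    have "sat M v (FAll (Eq (tmul ?x tone) ?x))"
      by (rule sat[OF _ _ v]) (unfold RCF_def Let_def, rule UnI1, (rule insertI1 | rule insertI2)+, simp add: sentence_def)
    then show "fn M Times [x, fn M One []] = x"
      using x unfolding sat.simps val.simps list.map numeral_2_eq_2 One_nat_def nat.case by blast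
    have "sat M v (FAll (FImp (FNot (Eq ?x tzero)) (FEx (Eq (tmul (Var 1) (Var 0)) tone))))"
      by (rule sat[OF _ _ v]) (unfold RCF_def Let_def, rule UnI1, (rule insertI1 | rule insertI2)+, simp add: sentence_def)
    then show "\<exists>y\<in>universe M. fn M Times [x, y] = fn M One []" if "x \<noteq> fn M Zero []"
      using x that unfolding sat.simps val.simps list.map numeral_2_eq_2 One_nat_def nat.case by blast
    have "sat M v (FAll (FNot (FLess ?x ?x)))"
      by (rule sat[OF _ _ v]) (unfold RCF_def Let_def, rule UnI1, (rule insertI1 | rule insertI2)+, simp add: sentence_def)
    then show "\<not> rl M Less [x, x]"
      using x unfolding sat.simps val.simps list.map numeral_2_eq_2 One_nat_def nat.case by blast
    fix y assume y: "y \<in> universe M"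
    show "fn M Plus [x, y] \<in> universe M" "fn M Times [x, y] \<in> universe M" using x y by (auto intro: cl)
    have "sat M v (FAll (FAll (Eq (tadd ?x ?y) (tadd ?y ?x))))"
      by (rule sat[OF _ _ v]) (unfold RCF_def Let_def, rule UnI1, (rule insertI1 | rule insertI2)+, simp add: sentence_def)
    then show "fn M Plus [x, y] = fn M Plus [y, x]"
      using x y unfolding sat.simps val.simps list.map numeral_2_eq_2 One_nat_def nat.case by blast
    have "sat M v (FAll (FAll (Eq (tmul ?x ?y) (tmul ?y ?x))))"
      by (rule sat[OF _ _ v]) (unfold RCF_def Let_def, rule UnI1, (rule insertI1 | rule insertI2)+, simp add: sentence_def)
    then show "fn M Times [x, y] = fn M Times [y, x]"
      using x y unfolding sat.simps val.simps list.map numeral_2_eq_2 One_nat_def nat.case by blast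
    have "sat M v (FAll (FAll (FOr (FLess ?x ?y) (FOr (Eq ?x ?y) (FLess ?y ?x)))))"
      by (rule sat[OF _ _ v]) (unfold RCF_def Let_def, rule UnI1, (rule insertI1 | rule insertI2)+, simp add: sentence_def)
    then show "rl M Less [x, y] \<or> x = y \<or> rl M Less [y, x]"
      using x y unfolding sat.simps val.simps list.map numeral_2_eq_2 One_nat_def nat.case by blast
    have "sat M v (FAll (FAll (FImp (FAnd (FLess tzero ?x) (FLess tzero ?y)) (FLess tzero (tmul ?x ?y)))))"
      by (rule sat[OF _ _ v]) (unfold RCF_def Let_def, rule UnI1, (rule insertI1 | rule insertI2)+, simp add: sentence_def)
    then show "rl M Less [fn M Zero [], fn M Times [x, y]]" if "rl M Less [fn M Zero [], x]" "rl M Less [fn M Zero [], y]"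
      using x y that unfolding sat.simps val.simps list.map numeral_2_eq_2 One_nat_def nat.case by blast
    fix z assume z: "z \<in> universe M"
    have "sat M v (FAll (FAll (FAll (Eq (tadd (tadd ?x ?y) ?z) (tadd ?x (tadd ?y ?z))))))"
      by (rule sat[OF _ _ v]) (unfold RCF_def Let_def, rule UnI1, (rule insertI1 | rule insertI2)+, simp add: sentence_def)
    then show "fn M Plus [fn M Plus [x, y], z] = fn M Plus [x, fn M Plus [y, z]]"
      using x y z unfolding sat.simps val.simps list.map numeral_2_eq_2 One_nat_def nat.case by blast
    have "sat M v (FAll (FAll (FAll (Eq (tmul (tmul ?x ?y) ?z) (tmul ?x (tmul ?y ?z))))))"
      by (rule sat[OF _ _ v]) (unfold RCF_def Let_def, rule UnI1, (rule insertI1 | rule insertI2)+, simp add: sentence_def)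
    then show "fn M Times [fn M Times [x, y], z] = fn M Times [x, fn M Times [y, z]]"
      using x y z unfolding sat.simps val.simps list.map numeral_2_eq_2 One_nat_def nat.case by blast
    have "sat M v (FAll (FAll (FAll (Eq (tmul ?x (tadd ?y ?z)) (tadd (tmul ?x ?y) (tmul ?x ?z))))))"
      by (rule sat[OF _ _ v]) (unfold RCF_def Let_def, rule UnI1, (rule insertI1 | rule insertI2)+, simp add: sentence_def)
    then show "fn M Times [x, fn M Plus [y, z]] = fn M Plus [fn M Times [x, y], fn M Times [x, z]]"
      using x y z unfolding sat.simps val.simps list.map numeral_2_eq_2 One_nat_def nat.case by blast
    have "sat M v (FAll (FAll (FAll (FImp (FAnd (FLess ?x ?y) (FLess ?y ?z)) (FLess ?x ?z)))))"
      by (rule sat[OF _ _ v]) (unfold RCF_def Let_def, rule UnI1, (rule insertI1 | rule insertI2)+, simp add: sentence_def)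
    then show "rl M Less [x, z]" if "rl M Less [x, y]" "rl M Less [y, z]"
      using x y z that unfolding sat.simps val.simps list.map numeral_2_eq_2 One_nat_def nat.case by blast
    have "sat M v (FAll (FAll (FAll (FImp (FLess ?x ?y) (FLess (tadd ?x ?z) (tadd ?y ?z))))))"
      by (rule sat[OF _ _ v]) (unfold RCF_def Let_def, rule UnI1, (rule insertI1 | rule insertI2)+, simp add: sentence_def)
    then show "rl M Less [fn M Plus [x, z], fn M Plus [y, z]]" if "rl M Less [x, y]"
      using x y z that unfolding sat.simps val.simps list.map numeral_2_eq_2 One_nat_def nat.case by blast
  qed
qed

text \<open>The hypothesis concerns small models only. The parameters of a definable set lie in the
  image of a small elementary N; there the set is a finite union of points and intervals, hence
  given by a second formula with parameters for the endpoints. The equivalence of both formulas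
  transfers to M.\<close>

lemma o_minimal_if_o_minimal_theory:
  fixes L :: "('f, 'r) lang" and M :: "('f, 'r, 'a) fo_structure"
  assumes T: "\<forall>p\<in>T. sentence L p" and M: "models L M T" and om: "o_minimal_theory L T" and ord: "ordered_field M"
  shows "o_minimal L M"
  unfolding o_minimal_def
proof (intro conjI allI impI)
  interpret carrier_ordered_field "universe M" "fn M Zero []" "fn M One []" "\<lambda>x y. fn M Plus [x, y]" "\<lambda>x. fn M Minus [x]"
    "\<lambda>x y. fn M Times [x, y]" "\<lambda>x y. rl M Less [x, y]" by (rule ord)
  show "linearly_ordered M"
    unfolding linearly_ordered_def lt_def using less_irrefl less_trans less_linear by blast
  fix A assume "definable L M (universe M) 1 A"
  then obtain p e where p: "wf_fm L p" and e: "\<And>i. i \<in> fv p \<Longrightarrow> 1 \<le> i \<Longrightarrow> e i \<in> universe M"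
    and A: "A = {xs \<in> tuples M 1. sat M (\<lambda>i. if i < 1 then xs ! i else e i) p}"
    unfolding definable_def by blast
  have st: "is_structure L M" using M by (simp add: models_def)
  have fin: "finite (e ` (fv p - {0}))" using finite_fv by blast
  have sub: "e ` (fv p - {0}) \<subseteq> universe M" using e by (auto simp: Suc_le_eq)
  obtain N :: "('f, 'r) small_structure" and j where N: "is_structure L N" "j ` universe N \<subseteq> universe M"
    and e_sub: "e ` (fv p - {0}) \<subseteq> j ` universe N"
    and sat: "\<And>p v. wf_fm L p \<Longrightarrow> range v \<subseteq> universe N \<Longrightarrow> sat N v p \<longleftrightarrow> sat M (\<lambda>i. j (v i)) p"
    by (rule downward_Loewenheim_Skolem[OF st fin sub]) blast
  from T M N(1,2) sat have "models L N T" by (rule models_elementary)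
  then have omN: "o_minimal L N" using om by (simp add: o_minimal_theory_def)
  obtain n0 where n0: "n0 \<in> universe N" using N by (auto simp: is_structure_def)
  \<comment> \<open>Preimages in N of the parameters, shifted by one place because
    \<open>Var 0\<close> is the coordinate; \<open>n0\<close> is a filler.\<close>
  define w where "w i = (if Suc i \<in> fv p then SOME q. q \<in> universe N \<and> j q = e (Suc i) else n0)" for i
  have w: "w i \<in> universe N" "Suc i \<in> fv p \<Longrightarrow> j (w i) = e (Suc i)" for i
  proof -
    have "Suc i \<in> fv p \<Longrightarrow> \<exists>q. q \<in> universe N \<and> j q = e (Suc i)" using e_sub by fastforce
    then show "w i \<in> universe N" "Suc i \<in> fv p \<Longrightarrow> j (w i) = e (Suc i)"
      using someI_ex[of "\<lambda>q. q \<in> universe N \<and> j q = e (Suc i)"] n0 by (auto simp: w_def)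
  qed
  define AN where "AN = {xs \<in> tuples N 1. sat N (\<lambda>i. if i < 1 then xs ! i else w (i - 1)) p}"
  have "definable L N (universe N) 1 AN"
    unfolding definable_def AN_def using p w by (intro exI[of _ p] exI[of _ "\<lambda>i. w (i - 1)"]) auto
  then obtain F where F: "finite F" "\<forall>S\<in>F. point_or_interval N S" "{x. [x] \<in> AN} = \<Union>F"
    using omN by (auto simp: o_minimal_def)
  \<comment> \<open>One formula \<psi> is read in both structures: in N it defines the given union,
    in M the union \<open>F'\<close> of the points and intervals with the corresponding
    endpoints.\<close>
  have "\<exists>\<psi> u F'. wf_fm L \<psi> \<and> range u \<subseteq> universe N \<and> finite F' \<and> (\<forall>S\<in>F'. point_or_interval M S) \<and>
      (\<forall>x\<in>universe N. x \<in> \<Union>F \<longleftrightarrow> sat N (case_nat x u) \<psi>) \<and>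
      {x \<in> universe M. sat M (case_nat x (\<lambda>i. j (u i))) \<psi>} = \<Union>F'"
    using F(1,2)
  proof (induction F)
    case empty
    show ?case
      using n0 by (intro exI[of _ "FNot (Eq (Var 0) (Var 0))"] exI[of _ "\<lambda>_. n0"] exI[of _ "{}"]) auto
  next
    case (insert S F)
    then obtain \<psi> u F' where IH: "wf_fm L \<psi>" "range u \<subseteq> universe N" "finite F'" "\<forall>S\<in>F'. point_or_interval M S"
      "\<forall>x\<in>universe N. x \<in> \<Union>F \<longleftrightarrow> sat N (case_nat x u) \<psi>"
      "{x \<in> universe M. sat M (case_nat x (\<lambda>i. j (u i))) \<psi>} = \<Union>F'" by auto
    have "\<exists>\<phi> t. wf_fm L \<phi> \<and> range t \<subseteq> universe N \<and> (\<forall>x\<in>universe N. x \<in> S \<longleftrightarrow> sat N (case_nat x t) \<phi>) \<and>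
      point_or_interval M {x \<in> universe M. sat M (case_nat x (\<lambda>i. j (t i))) \<phi>}"
    proof -
      have "point_or_interval N S" using insert by auto
      then consider a where "a \<in> universe N" "S = {a}"
        | l u where "set_option l \<subseteq> universe N" "set_option u \<subseteq> universe N" "S = {x \<in> universe N. above N l x \<and> below N x u}"
        unfolding point_or_interval_def by blast
      then show ?thesis
      proof cases
        case 1
        then have "{x \<in> universe M. sat M (case_nat x (\<lambda>i. j a)) (Eq (Var 0) (Var 1))} = {j a}" using N by auto
        moreover have "j a \<in> universe M" using 1 N by auto
        ultimately show ?thesis using 1
          by (intro exI[of _ "Eq (Var 0) (Var 1)"] exI[of _ "\<lambda>_. a"]) (auto simp: point_or_interval_def)
      next
        case 2
        \<comment> \<open>\<open>Var 1\<close> and \<open>Var 2\<close> will be the endpoints of the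
          interval; \<open>n0\<close> is a filler for infinite ones.\<close>
        define t where "t i = (case (if i = 0 then l else u) of None \<Rightarrow> n0 | Some a \<Rightarrow> a)" for i :: nat
        have t: "range t \<subseteq> universe N" using 2 n0 by (auto simp: t_def split: option.split)
        define \<phi> :: "('f, 'r) fm" where "\<phi> = FAnd (case l of None \<Rightarrow> Eq (Var 0) (Var 0) | Some _ \<Rightarrow> FLess (Var 1) (Var 0))
           (case u of None \<Rightarrow> Eq (Var 0) (Var 0) | Some _ \<Rightarrow> FLess (Var 0) (Var 2))"
        have \<phi>: "wf_fm L \<phi>" by (auto simp: \<phi>_def split: option.split)
        have N': "sat N (case_nat x t) \<phi> \<longleftrightarrow> above N l x \<and> below N x u" for x
          by (auto simp: \<phi>_def above_def below_def t_def lt_def numeral_2_eq_2 split: option.split)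
        have M': "sat M (case_nat x (\<lambda>i. j (t i))) \<phi> \<longleftrightarrow> above M (map_option j l) x \<and> below M x (map_option j u)" for x
          by (auto simp: \<phi>_def above_def below_def t_def lt_def numeral_2_eq_2 split: option.split)
        have "set_option (map_option j l) \<subseteq> universe M" "set_option (map_option j u) \<subseteq> universe M" using 2 N by auto
        then have "point_or_interval M {x \<in> universe M. sat M (case_nat x (\<lambda>i. j (t i))) \<phi>}"
          unfolding M' point_or_interval_def by blast
        then show ?thesis using \<phi> t 2 N' by blast
      qed
    qed
    then obtain \<phi> t where \<phi>: "wf_fm L \<phi>" "range t \<subseteq> universe N" "\<forall>x\<in>universe N. x \<in> S \<longleftrightarrow> sat N (case_nat x t) \<phi>"
      "point_or_interval M {x \<in> universe M. sat M (case_nat x (\<lambda>i. j (t i))) \<phi>}" by blast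
    define \<chi> where "\<chi> = FOr (ren (case_nat 0 (\<lambda>i. Suc (2 * i))) \<phi>) (ren (case_nat 0 (\<lambda>i. Suc (Suc (2 * i)))) \<psi>)"
    have c: "(\<lambda>i. case_nat x (interleave a b) (case_nat 0 (\<lambda>i. Suc (2 * i)) i)) = case_nat x a"
      "(\<lambda>i. case_nat x (interleave a b) (case_nat 0 (\<lambda>i. Suc (Suc (2 * i))) i)) = case_nat x b" for x :: 'c and a b
      by (auto split: nat.split)
    have "sat N (case_nat x (interleave t u)) \<chi> \<longleftrightarrow> sat N (case_nat x t) \<phi> \<or> sat N (case_nat x u) \<psi>" for x
      by (simp add: \<chi>_def sat_ren c)
    moreover have "(\<lambda>i. j (interleave t u i)) = interleave (\<lambda>i. j (t i)) (\<lambda>i. j (u i))"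
      by (auto simp: interleave_def)
    then have "sat M (case_nat x (\<lambda>i. j (interleave t u i))) \<chi> \<longleftrightarrow>
       sat M (case_nat x (\<lambda>i. j (t i))) \<phi> \<or> sat M (case_nat x (\<lambda>i. j (u i))) \<psi>" for x
      by (simp add: \<chi>_def sat_ren c)
    then have "{x \<in> universe M. sat M (case_nat x (\<lambda>i. j (interleave t u i))) \<chi>} =
       \<Union>(insert {x \<in> universe M. sat M (case_nat x (\<lambda>i. j (t i))) \<phi>} F')"
      using IH(6) by auto
    moreover have "wf_fm L \<chi>" using IH \<phi> by (simp add: \<chi>_def wf_ren)
    ultimately show ?case
      using IH \<phi> range_interleave[of t "universe N" u]
      by (intro exI[of _ \<chi>] exI[of _ "interleave t u"] exI[of _ "insert {x \<in> universe M. sat M (case_nat x (\<lambda>i. j (t i))) \<phi>} F'"])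
        auto
  qed
  then obtain \<psi> u F' where \<psi>: "wf_fm L \<psi>" "range u \<subseteq> universe N" "finite F'" "\<forall>S\<in>F'. point_or_interval M S"
      "\<forall>x\<in>universe N. x \<in> \<Union>F \<longleftrightarrow> sat N (case_nat x u) \<psi>"
      "{x \<in> universe M. sat M (case_nat x (\<lambda>i. j (u i))) \<psi>} = \<Union>F'" by blast
  \<comment> \<open>The equivalence of p and \<psi> for all values of the coordinate, with the two
    lists of parameters interleaved.\<close>
  define \<chi> where "\<chi> = FAll (FAnd (FImp (ren (case_nat 0 (\<lambda>i. Suc (2 * i))) p) (ren (case_nat 0 (\<lambda>i. Suc (Suc (2 * i)))) \<psi>))
     (FImp (ren (case_nat 0 (\<lambda>i. Suc (Suc (2 * i)))) \<psi>) (ren (case_nat 0 (\<lambda>i. Suc (2 * i))) p)))"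
  have c: "(\<lambda>i. case_nat x (interleave a b) (case_nat 0 (\<lambda>i. Suc (2 * i)) i)) = case_nat x a"
    "(\<lambda>i. case_nat x (interleave a b) (case_nat 0 (\<lambda>i. Suc (Suc (2 * i))) i)) = case_nat x b" for x :: 'c and a b
    by (auto split: nat.split)
  have wr: "range w \<subseteq> universe N" using w by auto
  have "sat N (\<lambda>i. if i < 1 then [x] ! i else w (i - 1)) p = sat N (case_nat x w) p" for x
    by (rule sat_cong) (auto split: nat.split)
  then have "{x. [x] \<in> AN} = {x \<in> universe N. sat N (case_nat x w) p}"
    unfolding AN_def tuples_def by auto
  then have "sat N (case_nat x w) p \<longleftrightarrow> sat N (case_nat x u) \<psi>" if "x \<in> universe N" for x
    using \<psi>(5) F(3) that by blast
  then have "sat N (interleave w u) \<chi>"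
    by (simp add: \<chi>_def sat_ren c)
  moreover have "wf_fm L \<chi>" using p \<psi> by (simp add: \<chi>_def wf_ren)
  moreover have j_il: "(\<lambda>i. j (interleave w u i)) = interleave (\<lambda>i. j (w i)) (\<lambda>i. j (u i))"
    by (auto simp: interleave_def)
  ultimately have "sat M (interleave (\<lambda>i. j (w i)) (\<lambda>i. j (u i))) \<chi>"
    using sat[of \<chi> "interleave w u"] range_interleave[OF wr \<psi>(2)] by simp
  then have "sat M (case_nat x (\<lambda>i. j (w i))) p \<longleftrightarrow> sat M (case_nat x (\<lambda>i. j (u i))) \<psi>" if "x \<in> universe M" for x
    using that by (auto simp: \<chi>_def sat_ren c)
  moreover have "sat M (\<lambda>i. if i < 1 then [x] ! i else e i) p = sat M (case_nat x (\<lambda>i. j (w i))) p" for x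
    by (rule sat_cong) (auto split: nat.split simp: w)
  ultimately have "{x. [x] \<in> A} = \<Union>F'"
    unfolding \<psi>(6)[symmetric] A by (auto simp: tuples_def)
  then show "\<exists>F. finite F \<and> (\<forall>S\<in>F. point_or_interval M S) \<and> {x. [x] \<in> A} = \<Union>F"
    using \<psi> by blast
qed

section \<open>A calculus of definable predicates\<close>

definition interval_or_point :: "'k::linorder set \<Rightarrow> bool" where
  "interval_or_point S \<longleftrightarrow> (\<exists>a. S = {a}) \<or>
     (\<exists>l u. S = {x. (\<forall>a\<in>set_option l. a < x) \<and> (\<forall>b\<in>set_option u. x < b)})"

definition tame :: "'k::linorder set \<Rightarrow> bool" where
  "tame S \<longleftrightarrow> (\<exists>F. finite F \<and> (\<forall>S\<in>F. interval_or_point S) \<and> S = \<Union>F)"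

text \<open>
  The elements of \<open>D\<close> are the predicates on environments that are definable without parameters.
\<close>

locale definable_predicates =
  fixes D :: "((nat \<Rightarrow> 'k::linordered_field) \<Rightarrow> bool) set"
  assumes D_not: "P \<in> D \<Longrightarrow> (\<lambda>v. \<not> P v) \<in> D"
    and D_and: "P \<in> D \<Longrightarrow> Q \<in> D \<Longrightarrow> (\<lambda>v. P v \<and> Q v) \<in> D"
    and D_ex: "P \<in> D \<Longrightarrow> (\<lambda>v. \<exists>a. P (case_nat a v)) \<in> D"
    and D_ren: "P \<in> D \<Longrightarrow> (\<lambda>v. P (\<lambda>i. v (\<sigma> i))) \<in> D"
    and D_eq: "(\<lambda>v. v 0 = v 1) \<in> D" and D_less: "(\<lambda>v. v 0 < v 1) \<in> D"
    and D_add: "(\<lambda>v. v 0 + v 1 = v 2) \<in> D" and D_mul: "(\<lambda>v. v 0 * v 1 = v 2) \<in> D"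
    and D_supp: "P \<in> D \<Longrightarrow> \<exists>N. \<forall>v w. (\<forall>i<N. v i = w i) \<longrightarrow> P v = P w"
    and D_tame: "P \<in> D \<Longrightarrow> tame {a. P (case_nat a v)}"
begin

text \<open>
  \<open>Df X P\<close>: the predicate \<open>P\<close> on a type of contexts is definable in terms of the
  coordinate functions in \<open>X\<close>; parameters are constant coordinate functions.
  The constant 0 is always admitted, so that \<open>X\<close> may be empty.
\<close>

definition Df :: "('c \<Rightarrow> 'k) set \<Rightarrow> ('c \<Rightarrow> bool) \<Rightarrow> bool" where
  "Df X P \<longleftrightarrow> (\<exists>R\<in>D. \<exists>\<rho>. (\<forall>i. \<rho> i \<in> insert (\<lambda>_. 0) X) \<and> (\<forall>c. P c = R (\<lambda>i. \<rho> i c)))"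

definition ext :: "('c \<Rightarrow> 'k) set \<Rightarrow> ('c \<times> 'k \<Rightarrow> 'k) set" where
  "ext X = insert snd ((\<lambda>x p. x (fst p)) ` X)"

definition exts :: "nat \<Rightarrow> ('c \<Rightarrow> 'k) set \<Rightarrow> ('c \<times> (nat \<Rightarrow> 'k) \<Rightarrow> 'k) set" where
  "exts n X = (\<lambda>x p. x (fst p)) ` X \<union> (\<lambda>i p. snd p i) ` {..<n}"

definition Dt :: "('c \<Rightarrow> 'k) set \<Rightarrow> ('c \<Rightarrow> 'k) \<Rightarrow> bool" where
  "Dt X t \<longleftrightarrow> Df (ext X) (\<lambda>p. snd p = t (fst p))"

text \<open>\<open>V {} n\<close> stands for parameter-free definability on M^n, the case in which
  the chain rule is available, and \<open>V UNIV n\<close> for definability with arbitrary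
  parameters.\<close>

definition V :: "'k set \<Rightarrow> nat \<Rightarrow> ((nat \<Rightarrow> 'k) \<Rightarrow> 'k) set" where
  "V A n = (\<lambda>a _. a) ` A \<union> (\<lambda>i x. x i) ` {..<n}"

lemma DfI: "R \<in> D \<Longrightarrow> (\<And>i. \<rho> i \<in> insert (\<lambda>_. 0) X) \<Longrightarrow> (\<And>c. P c = R (\<lambda>i. \<rho> i c)) \<Longrightarrow> Df X P"
  unfolding Df_def by blast

lemma DfE:
  assumes "Df X P"
  obtains R \<rho> where "R \<in> D" "\<forall>i. \<rho> i \<in> insert (\<lambda>_. 0) X" "\<forall>c. P c = R (\<lambda>i. \<rho> i c)"
  using assms unfolding Df_def by blast

lemma Df_not:
  assumes "Df X P"
  shows "Df X (\<lambda>c. \<not> P c)"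
  using assms
proof (rule DfE)
  fix R \<rho> assume 1: "R \<in> D" "\<forall>i. \<rho> i \<in> insert (\<lambda>_. 0) X" "\<forall>c. P c = R (\<lambda>i. \<rho> i c)"
  show ?thesis by (rule DfI[OF D_not[OF 1(1)] 1(2)[rule_format]]) (simp add: 1(3))
qed

lemma Df_and:
  assumes "Df X P" "Df X Q"
  shows "Df X (\<lambda>c. P c \<and> Q c)"
proof -
  obtain R \<rho> where 1: "R \<in> D" "\<forall>i. \<rho> i \<in> insert (\<lambda>_. 0) X" "\<forall>c. P c = R (\<lambda>i. \<rho> i c)"
    using assms(1) by (rule DfE)
  obtain R' \<rho>' where 2: "R' \<in> D" "\<forall>i. \<rho>' i \<in> insert (\<lambda>_. 0) X" "\<forall>c. Q c = R' (\<lambda>i. \<rho>' i c)"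
    using assms(2) by (rule DfE)
  have "(\<lambda>v. R (\<lambda>i. v (2 * i)) \<and> R' (\<lambda>i. v (Suc (2 * i)))) \<in> D"
    by (rule D_and[OF D_ren[OF 1(1)] D_ren[OF 2(1)]])
  then show ?thesis
  proof (rule DfI[where \<rho> = "interleave \<rho> \<rho>'"])
    show "interleave \<rho> \<rho>' i \<in> insert (\<lambda>_. 0) X" for i
      unfolding interleave_def using 1(2) 2(2) by presburger
  qed (simp add: 1 2)
qed

lemma Df_or: "Df X (\<lambda>c. P c \<or> Q c)" if "Df X P" "Df X Q"
  using Df_not[OF Df_and[OF Df_not[OF that(1)] Df_not[OF that(2)]]] by simp

lemma Df_imp: "Df X (\<lambda>c. P c \<longrightarrow> Q c)" if "Df X P" "Df X Q"
  unfolding imp_conv_disj by (rule Df_or[OF Df_not[OF that(1)] that(2)])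

lemma Df_sub:
  assumes "Df X' P" and "\<And>x. x \<in> X' \<Longrightarrow> (\<lambda>c. x (h c)) \<in> insert (\<lambda>_. 0) X"
  shows "Df X (\<lambda>c. P (h c))"
  using assms(1)
proof (rule DfE)
  fix R \<rho> assume 1: "R \<in> D" "\<forall>i. \<rho> i \<in> insert (\<lambda>_. 0) X'" "\<forall>c. P c = R (\<lambda>i. \<rho> i c)"
  show ?thesis
  proof (rule DfI[OF 1(1), where \<rho> = "\<lambda>i c. \<rho> i (h c)"])
    show "(\<lambda>c. \<rho> i (h c)) \<in> insert (\<lambda>_. 0) X" for i
      using 1(2)[rule_format, of i] assms(2)[of "\<rho> i"] by auto
  qed (simp add: 1)
qed

lemma Df_mono: "Df X P \<Longrightarrow> X \<subseteq> Y \<Longrightarrow> Df Y P"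
  by (rule Df_sub[where h = "\<lambda>c. c", simplified]) auto

lemma Df_ex:
  assumes "Df (ext X) (\<lambda>p. Q (fst p) (snd p))"
  shows "Df X (\<lambda>c. \<exists>a. Q c a)"
  using assms
proof (rule DfE)
  fix R \<rho> assume 1: "R \<in> D" "\<forall>i. \<rho> i \<in> insert (\<lambda>_. 0) (ext X)" "\<forall>p. Q (fst p) (snd p) = R (\<lambda>i. \<rho> i p)"
  have "\<exists>x\<in>insert (\<lambda>_. 0) X. \<rho> i = snd \<or> \<rho> i = (\<lambda>p. x (fst p))" for i
    using 1(2)[rule_format, of i] by (auto simp: ext_def)
  then obtain x where x: "\<And>i. x i \<in> insert (\<lambda>_. 0) X" "\<And>i. \<rho> i = snd \<or> \<rho> i = (\<lambda>p. x i (fst p))"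
    by metis
  have "(\<lambda>v. \<exists>a. R (\<lambda>i. case_nat a v (if \<rho> i = snd then 0 else Suc i))) \<in> D"
    by (rule D_ex[OF D_ren, OF 1(1)])
  then show ?thesis
  proof (rule DfI[where \<rho> = x])
    fix c
    have "\<rho> i (c, a) = case_nat a (\<lambda>i. x i c) (if \<rho> i = snd then 0 else Suc i)" for i a
      using x(2)[of i] by auto
    then have "R (\<lambda>i. \<rho> i (c, a)) = R (\<lambda>i. case_nat a (\<lambda>i. x i c) (if \<rho> i = snd then 0 else Suc i))" for a
      by presburger
    then show "(\<exists>a. Q c a) = (\<exists>a. R (\<lambda>i. case_nat a (\<lambda>i. x i c) (if \<rho> i = snd then 0 else Suc i)))"
      using 1(3)[rule_format, of "(c, a)" for a] by simp
  qed (rule x)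
qed

lemma Df_all: "Df X (\<lambda>c. \<forall>a. Q c a)" if "Df (ext X) (\<lambda>p. Q (fst p) (snd p))"
  using Df_not[OF Df_ex[OF Df_not[OF that]]] by simp

lemma if_case_nat: "(if i < n then w i else case_nat a v (i - n)) = (if i < Suc n then (w(n := a)) i else v (i - Suc n))"
proof -
  consider "i < n" | "i = n" | "n < i" by linarith
  then show ?thesis
  proof cases
    case 3
    then have "i - n = Suc (i - Suc n)" by simp
    then show ?thesis using 3 by simp
  qed simp_all
qed

lemma D_exs: "R \<in> D \<Longrightarrow> (\<lambda>v. \<exists>w. R (\<lambda>i. if i < n then w i else v (i - n))) \<in> D"
proof (induction n)
  case (Suc n)
  have "(\<lambda>v. \<exists>a. \<exists>w. R (\<lambda>i. if i < n then w i else case_nat a v (i - n))) \<in> D"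
    using D_ex[OF Suc.IH[OF Suc.prems]] .
  moreover have "(\<exists>a. \<exists>w. R (\<lambda>i. if i < n then w i else case_nat a v (i - n))) = (\<exists>w. R (\<lambda>i. if i < Suc n then w i else v (i - Suc n)))" for v
    unfolding if_case_nat
  proof
    assume "\<exists>w. R (\<lambda>i. if i < Suc n then w i else v (i - Suc n))"
    then obtain w where "R (\<lambda>i. if i < Suc n then w i else v (i - Suc n))" by blast
    then have "R (\<lambda>i. if i < Suc n then (w(n := w n)) i else v (i - Suc n))" by (simp only: fun_upd_triv)
    then show "\<exists>a w. R (\<lambda>i. if i < Suc n then (w(n := a)) i else v (i - Suc n))" by blast
  qed blast
  ultimately show ?case by simp
qed simp

text \<open>One quantifier over a function does the work of n quantifiers, since Q depends only on
  the first n values of w. Points and corners of boxes can thus be bound as a whole.\<close>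

lemma Df_exs:
  assumes "Df (exts n X) (\<lambda>p. Q (fst p) (snd p))"
  shows "Df X (\<lambda>c. \<exists>w. Q c w)"
  using assms
proof (rule DfE)
  fix R \<rho> assume 1: "R \<in> D" "\<forall>i. \<rho> i \<in> insert (\<lambda>_. 0) (exts n X)" "\<forall>p. Q (fst p) (snd p) = R (\<lambda>i. \<rho> i p)"
  have "\<exists>x\<in>insert (\<lambda>_. 0) X. \<exists>k. (k < n \<and> \<rho> i = (\<lambda>p. snd p k)) \<or> (n \<le> k \<and> \<rho> i = (\<lambda>p. x (fst p)))" for i
    using 1(2)[rule_format, of i] by (fastforce simp: exts_def)
  then obtain x k where x: "\<And>i. x i \<in> insert (\<lambda>_. 0) X"
    "\<And>i. (k i < n \<and> \<rho> i = (\<lambda>p. snd p (k i))) \<or> (n \<le> k i \<and> \<rho> i = (\<lambda>p. x i (fst p)))"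
    by metis
  define \<sigma> where "\<sigma> i = (if k i < n then k i else i + n)" for i
  have "(\<lambda>v. \<exists>w. (\<lambda>v. R (\<lambda>i. v (\<sigma> i))) (\<lambda>i. if i < n then w i else v (i - n))) \<in> D"
    by (rule D_exs[OF D_ren, OF 1(1)])
  then show ?thesis
  proof (rule DfI[where \<rho> = x])
    fix c
    have "\<rho> i (c, w) = (if \<sigma> i < n then w (\<sigma> i) else x (\<sigma> i - n) c)" for i w
      using x(2)[of i] by (auto simp: \<sigma>_def)
    then have "R (\<lambda>i. \<rho> i (c, w)) = R (\<lambda>i. if \<sigma> i < n then w (\<sigma> i) else x (\<sigma> i - n) c)" for w
      by presburger
    then show "(\<exists>w. Q c w) = (\<exists>w. R (\<lambda>i. if \<sigma> i < n then w (\<sigma> i) else x (\<sigma> i - n) c))"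
      using 1(3)[rule_format, of "(c, w)" for w] by simp
  qed (rule x)
qed

lemma Df_alls: "Df X (\<lambda>c. \<forall>w. Q c w)" if "Df (exts n X) (\<lambda>p. Q (fst p) (snd p))"
  using Df_not[OF Df_exs[OF Df_not[OF that]]] by simp

lemma Df_coord:
  assumes "x \<in> insert (\<lambda>_. 0) X" "y \<in> insert (\<lambda>_. 0) X" "z \<in> insert (\<lambda>_. 0) X"
  shows "Df X (\<lambda>c. x c = y c)" "Df X (\<lambda>c. x c < y c)" "Df X (\<lambda>c. x c + y c = z c)" "Df X (\<lambda>c. x c * y c = z c)"
proof -
  define \<rho> where "\<rho> i = (if i = 0 then x else if i = 1 then y else z)" for i :: nat
  have "\<rho> i \<in> insert (\<lambda>_. 0) X" for i using assms by (simp add: \<rho>_def)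
  note * = this
  show "Df X (\<lambda>c. x c = y c)" by (rule DfI[where \<rho> = \<rho>, OF D_eq *]) (simp add: \<rho>_def)
  show "Df X (\<lambda>c. x c < y c)" by (rule DfI[where \<rho> = \<rho>, OF D_less *]) (simp add: \<rho>_def)
  show "Df X (\<lambda>c. x c + y c = z c)" by (rule DfI[where \<rho> = \<rho>, OF D_add *]) (simp add: \<rho>_def)
  show "Df X (\<lambda>c. x c * y c = z c)" by (rule DfI[where \<rho> = \<rho>, OF D_mul *]) (simp add: \<rho>_def)
qed

lemma Dt_coord: "x \<in> insert (\<lambda>_. 0) X \<Longrightarrow> Dt X x"
  unfolding Dt_def by (rule Df_coord) (auto simp: ext_def)

lemma Dt_snd: "Dt (ext X) snd"
  by (rule Dt_coord) (simp add: ext_def)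

lemma Dt_snds: "i < n \<Longrightarrow> Dt (exts n X) (\<lambda>p. snd p i)"
  by (rule Dt_coord) (auto simp: exts_def)

lemma Df_true: "Df X (\<lambda>_. b)"
  using Df_coord(1)[of "\<lambda>_. 0" X "\<lambda>_. 0"] Df_not[OF Df_coord(1)[of "\<lambda>_. 0" X "\<lambda>_. 0"]] by (cases b) auto

text \<open>The value of a definable function is replaced by a bound variable that satisfies its
  graph. By \<open>D_supp\<close> finitely many terms matter, and each step of the induction
  eliminates one of them.\<close>

lemma Df_terms:
  assumes "Df {t. Dt X t} P"
  shows "Df X P"
  using assms
proof (rule DfE)
  fix R \<rho> assume 1: "R \<in> D" "\<forall>i. \<rho> i \<in> insert (\<lambda>_. 0) {t. Dt X t}" "\<forall>c. P c = R (\<lambda>i. \<rho> i c)"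
  obtain N where N: "\<And>v w. (\<forall>i<N. v i = w i) \<Longrightarrow> R v = R w" using D_supp[OF 1(1)] by blast
  have main: "Df X (\<lambda>c. R (\<lambda>i. \<rho> i c))"
    if "finite {i. \<rho> i \<notin> insert (\<lambda>_. 0) X}" "\<forall>i. Dt X (\<rho> i)" "R \<in> D" for \<rho> R
    using that
  proof (induction "card {i. \<rho> i \<notin> insert (\<lambda>_. 0) X}" arbitrary: R \<rho>)
    case 0
    then show ?case by (intro DfI[of R \<rho>]) auto
  next
    case (Suc m)
    then obtain k where k: "\<rho> k \<notin> insert (\<lambda>_. 0) X" by (metis (mono_tags, lifting) card.empty empty_Collect_eq nat.distinct(1))
    have "Df (ext X) (\<lambda>p. snd p = \<rho> k (fst p))" using Suc.prems by (simp add: Dt_def)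
    then obtain Q \<tau> where Q: "Q \<in> D" "\<forall>i. \<tau> i \<in> insert (\<lambda>_. 0) (ext X)" "\<forall>p. (snd p = \<rho> k (fst p)) = Q (\<lambda>i. \<tau> i p)"
      by (rule DfE)
    have "\<exists>x\<in>insert (\<lambda>_. 0) X. \<tau> i = snd \<or> \<tau> i = (\<lambda>p. x (fst p))" for i
      using Q(2)[rule_format, of i] by (auto simp: ext_def)
    then obtain x where x: "\<And>i. x i \<in> insert (\<lambda>_. 0) X" "\<And>i. \<tau> i = snd \<or> \<tau> i = (\<lambda>p. x i (fst p))"
      by metis
    \<comment> \<open>Even places carry the coordinates that the graph of \<open>\<rho> k\<close>
      needs, odd places the old assignment with place k vacated.\<close>
    define \<rho>' where "\<rho>' = interleave x (\<rho>(k := (\<lambda>_. 0)))"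
    define R' where "R' v = (\<exists>a. Q (\<lambda>i. case_nat a v (if \<tau> i = snd then 0 else Suc (2 * i))) \<and>
      R (\<lambda>i. case_nat a v (if i = k then 0 else Suc (Suc (2 * i)))))" for v
    have "R' \<in> D"
      unfolding R'_def by (rule D_ex[OF D_and[OF D_ren[OF Q(1)] D_ren[OF Suc.prems(3)]]])
    have bad: "{i. \<rho>' i \<notin> insert (\<lambda>_. 0) X} = (\<lambda>i. Suc (2 * i)) ` ({i. \<rho> i \<notin> insert (\<lambda>_. 0) X} - {k})"
    proof (intro equalityI subsetI)
      fix i assume i: "i \<in> {i. \<rho>' i \<notin> insert (\<lambda>_. 0) X}"
      then have "odd i" using x by (auto simp: \<rho>'_def interleave_def split: if_splits)
      then obtain j where j: "i = Suc (2 * j)" by (metis Suc_eq_plus1 oddE)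
      then show "i \<in> (\<lambda>i. Suc (2 * i)) ` ({i. \<rho> i \<notin> insert (\<lambda>_. 0) X} - {k})"
        using i by (auto simp: \<rho>'_def split: if_splits)
    qed (auto simp: \<rho>'_def split: if_splits)
    have "card {i. \<rho>' i \<notin> insert (\<lambda>_. 0) X} = card ({i. \<rho> i \<notin> insert (\<lambda>_. 0) X} - {k})"
      unfolding bad by (rule card_image) (auto simp: inj_on_def)
    also have "\<dots> = m" using Suc k by simp
    finally have "m = card {i. \<rho>' i \<notin> insert (\<lambda>_. 0) X}" by simp
    moreover have "finite {i. \<rho>' i \<notin> insert (\<lambda>_. 0) X}" unfolding bad using Suc.prems by simp
    moreover have "\<forall>i. Dt X (\<rho>' i)"
      using x(1) Suc.prems(2) Dt_coord[of _ X] by (simp add: \<rho>'_def interleave_def)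
    ultimately have "Df X (\<lambda>c. R' (\<lambda>i. \<rho>' i c))" using \<open>R' \<in> D\<close> by (intro Suc.hyps(1))
    moreover have "R' (\<lambda>i. \<rho>' i c) = R (\<lambda>i. \<rho> i c)" for c
    proof -
      have "(\<lambda>i. case_nat a (\<lambda>i. \<rho>' i c) (if \<tau> i = snd then 0 else Suc (2 * i))) = (\<lambda>i. \<tau> i (c, a))" for a
      proof
        show "case_nat a (\<lambda>i. \<rho>' i c) (if \<tau> i = snd then 0 else Suc (2 * i)) = \<tau> i (c, a)" for i
          using x(2)[of i] by (auto simp: \<rho>'_def)
      qed
      then have "Q (\<lambda>i. case_nat a (\<lambda>i. \<rho>' i c) (if \<tau> i = snd then 0 else Suc (2 * i))) = (a = \<rho> k c)" for a
        using Q(3)[rule_format, of "(c, a)"] by simp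
      moreover have "case_nat (\<rho> k c) (\<lambda>i. \<rho>' i c) (if i = k then 0 else Suc (Suc (2 * i))) = \<rho> i c" for i
        by (auto simp: \<rho>'_def)
      ultimately show ?thesis unfolding R'_def by simp
    qed
    ultimately show ?case by simp
  qed
  \<comment> \<open>From place N on, R does not see the terms; the coordinate 0 replaces them to
    make the number of proper terms finite.\<close>
  have "finite {i. (if i < N then \<rho> i else (\<lambda>_. 0)) \<notin> insert (\<lambda>_. 0) X}"
    by (rule finite_subset[of _ "{..<N}"]) auto
  moreover have "\<forall>i. Dt X (if i < N then \<rho> i else (\<lambda>_. 0))"
    using 1(2) Dt_coord[OF insertI1, of X] by (metis insertE mem_Collect_eq)
  ultimately have "Df X (\<lambda>c. R (\<lambda>i. (if i < N then \<rho> i else (\<lambda>_. 0)) c))"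
    by (rule main[OF _ _ 1(1)])
  moreover have "R (\<lambda>i. (if i < N then \<rho> i else (\<lambda>_. 0)) c) = P c" for c
    unfolding 1(3)[rule_format] by (rule N) auto
  ultimately show ?thesis by simp
qed

lemma Df_subst:
  assumes "Df X' P" and "\<And>x. x \<in> X' \<Longrightarrow> Dt X (\<lambda>c. x (h c))"
  shows "Df X (\<lambda>c. P (h c))"
  by (rule Df_terms, rule Df_sub[OF assms(1)]) (use assms(2) in auto)

lemma Dt_fst: "Dt X t \<Longrightarrow> Dt (ext X) (\<lambda>p. t (fst p))"
  unfolding Dt_def by (drule Df_sub[where h = "\<lambda>p. (fst (fst p), snd p)" and X = "ext (ext X)"]) (auto simp: ext_def image_iff)

lemma Dt_fsts: "Dt X t \<Longrightarrow> Dt (exts n X) (\<lambda>p. t (fst p))"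
  unfolding Dt_def
  by (drule Df_sub[where h = "\<lambda>p. (fst (fst p), snd p)" and X = "ext (exts n X)"]) (auto simp: ext_def exts_def image_iff)

lemma Dt_subst:
  assumes "Dt X' t" and "\<And>x. x \<in> X' \<Longrightarrow> Dt X (\<lambda>c. x (h c))"
  shows "Dt X (\<lambda>c. t (h c))"
proof -
  have "Df (ext X) (\<lambda>p. (\<lambda>p. snd p = t (fst p)) (h (fst p), snd p))"
  proof (rule Df_subst[OF assms(1)[unfolded Dt_def]])
    fix x assume "x \<in> ext X'"
    then consider "x = snd" | y where "y \<in> X'" "x = (\<lambda>p. y (fst p))" by (auto simp: ext_def)
    then show "Dt (ext X) (\<lambda>c. x (h (fst c), snd c))"
    proof cases
      case 1
      then show ?thesis using Dt_snd by simp
    next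
      case 2
      then show ?thesis using Dt_fst[OF assms(2)[OF 2(1)]] by simp
    qed
  qed
  then show ?thesis by (simp add: Dt_def)
qed

lemma Df_less: "Dt X s \<Longrightarrow> Dt X t \<Longrightarrow> Df X (\<lambda>c. s c < t c)"
  by (rule Df_terms, rule Df_coord(2)[of _ _ _ "\<lambda>_. 0"]) auto

lemma Df_eq: "Dt X s \<Longrightarrow> Dt X t \<Longrightarrow> Df X (\<lambda>c. s c = t c)"
  by (rule Df_terms, rule Df_coord(1)[of _ _ _ "\<lambda>_. 0"]) auto

lemma Df_fst: "Df X P \<Longrightarrow> Df (ext X) (\<lambda>p. P (fst p))"
  by (erule Df_sub) (auto simp: ext_def)

lemma Df_ext_subst:
  assumes "Df (ext X) (\<lambda>p. G (fst p) (snd p))" "\<And>x. x \<in> X \<Longrightarrow> Dt Y (\<lambda>c. x (h c))" "Dt Y s"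
  shows "Df Y (\<lambda>c. G (h c) (s c))"
proof -
  have "Df Y (\<lambda>c. (\<lambda>p. G (fst p) (snd p)) (h c, s c))"
    by (rule Df_subst[OF assms(1)]) (auto simp: ext_def intro: assms)
  then show ?thesis by simp
qed

lemma Df_le: "Dt X s \<Longrightarrow> Dt X t \<Longrightarrow> Df X (\<lambda>c. s c \<le> t c)"
  unfolding le_less by (intro Df_or Df_less Df_eq)

lemma Dt_graph:
  assumes "Df (ext X) (\<lambda>p. G (fst p) (snd p))" and "\<And>c a. G c a \<longleftrightarrow> a = t c"
  shows "Dt X t"
  using assms by (simp add: Dt_def)

lemma Dt_add: "Dt X s \<Longrightarrow> Dt X t \<Longrightarrow> Dt X (\<lambda>c. s c + t c)"
  unfolding Dt_def[of X "\<lambda>c. s c + t c"] eq_commute[of "snd _"]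
  by (rule Df_terms, rule Df_coord(3)) (auto intro: Dt_fst Dt_snd)

lemma Dt_mult: "Dt X s \<Longrightarrow> Dt X t \<Longrightarrow> Dt X (\<lambda>c. s c * t c)"
  unfolding Dt_def[of X "\<lambda>c. s c * t c"] eq_commute[of "snd _"]
  by (rule Df_terms, rule Df_coord(4)) (auto intro: Dt_fst Dt_snd)

lemma Dt_0: "Dt X (\<lambda>_. 0)"
  by (rule Dt_coord) simp

lemma Dt_1: "Dt X (\<lambda>_. 1)"
\<comment> \<open>The constant 1 is not among the basic predicates, but it is the only nonzero
  idempotent.\<close>
proof (rule Dt_graph[where G = "\<lambda>_ a. a * a = a \<and> a \<noteq> 0"])
  show "Df (ext X) (\<lambda>p. snd p * snd p = snd p \<and> snd p \<noteq> 0)"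
    by (intro Df_and Df_not Df_eq Dt_mult Dt_snd Dt_0)
qed auto

lemma Dt_minus: "Dt X s \<Longrightarrow> Dt X t \<Longrightarrow> Dt X (\<lambda>c. s c - t c)"
  by (rule Dt_graph[where G = "\<lambda>c a. a + t c = s c"]) (auto intro!: Df_eq Dt_add Dt_snd Dt_fst simp: algebra_simps)

lemma Dt_uminus: "Dt X t \<Longrightarrow> Dt X (\<lambda>c. - t c)"
  using Dt_minus[OF Dt_0] by fastforce

lemma Dt_if: "Dt X (\<lambda>c. if P c then s c else t c)" if "Df X P" "Dt X s" "Dt X t"
proof (rule Dt_graph[where G = "\<lambda>c a. (P c \<and> a = s c) \<or> (\<not> P c \<and> a = t c)"])
  show "Df (ext X) (\<lambda>p. (P (fst p) \<and> snd p = s (fst p)) \<or> (\<not> P (fst p) \<and> snd p = t (fst p)))"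
    by (intro Df_or Df_and Df_not Df_eq Dt_snd Dt_fst Df_fst that)
qed auto

lemma Dt_inverse: "Dt X (\<lambda>c. inverse (t c))" if "Dt X t"
proof (rule Dt_graph[where G = "\<lambda>c a. (t c = 0 \<and> a = 0) \<or> a * t c = 1"])
  show "Df (ext X) (\<lambda>p. (t (fst p) = 0 \<and> snd p = 0) \<or> snd p * t (fst p) = 1)"
    by (intro Df_or Df_and Df_eq Dt_mult Dt_snd Dt_fst Dt_0 Dt_1 that)
  show "((t c = 0 \<and> a = 0) \<or> a * t c = 1) = (a = inverse (t c))" for c a
    by (cases "t c = 0") (simp_all add: nonzero_eq_divide_eq inverse_eq_divide)
qed

lemma Dt_divide: "Dt X s \<Longrightarrow> Dt X t \<Longrightarrow> Dt X (\<lambda>c. s c / t c)"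
  unfolding divide_inverse by (intro Dt_mult Dt_inverse)

lemma Dt_abs: "Dt X t \<Longrightarrow> Dt X (\<lambda>c. \<bar>t c\<bar>)"
  unfolding abs_if by (intro Dt_if Df_less Dt_uminus Dt_0)

lemma Dt_of_nat: "Dt X (\<lambda>_. of_nat n)"
  by (induction n) (auto intro!: Dt_0 Dt_1 Dt_add)

lemma Dt_numeral: "Dt X (\<lambda>_. numeral n)"
  using Dt_of_nat[of X "numeral n"] by simp

lemma Dt_sum: "(\<And>i. i \<in> I \<Longrightarrow> Dt X (t i)) \<Longrightarrow> Dt X (\<lambda>c. \<Sum>i\<in>I. t i c)"
  by (induction I rule: infinite_finite_induct) (auto intro!: Dt_0 Dt_add)

lemma Df_ball: "finite I \<Longrightarrow> (\<And>i. i \<in> I \<Longrightarrow> Df X (P i)) \<Longrightarrow> Df X (\<lambda>c. \<forall>i\<in>I. P i c)"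
  by (induction I rule: finite_induct) (auto intro!: Df_true Df_and)

lemma Df_all_less: "(\<And>i. i < n \<Longrightarrow> Df X (P i)) \<Longrightarrow> Df X (\<lambda>c. \<forall>i<n::nat. P i c)"
  using Df_ball[of "{..<n}" X P] by (simp add: Ball_def)

lemma Dt_V: "i < n \<Longrightarrow> Dt (V A n) (\<lambda>x. x i)" "a \<in> A \<Longrightarrow> Dt (V A n) (\<lambda>_. a)"
  by (auto intro!: Dt_coord simp: V_def)

lemma Df_app:
  assumes "Df (V A n) P" "\<And>i. i < n \<Longrightarrow> Dt X (\<lambda>c. w c i)" "\<And>a. a \<in> A \<Longrightarrow> Dt X (\<lambda>_. a)"
  shows "Df X (\<lambda>c. P (w c))"
  using assms(1) by (rule Df_subst) (auto simp: V_def intro: assms)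

lemma Dt_app:
  assumes "Dt (V A n) f" "\<And>i. i < n \<Longrightarrow> Dt X (\<lambda>c. w c i)" "\<And>a. a \<in> A \<Longrightarrow> Dt X (\<lambda>_. a)"
  shows "Dt X (\<lambda>c. f (w c))"
  using assms(1) by (rule Dt_subst) (auto simp: V_def intro: assms)

text \<open>Definite description with default 0: in this form suprema and partial derivatives become
  total definable functions.\<close>

lemma Dt_The:
  assumes "Df (ext X) (\<lambda>p. G (fst p) (snd p))"
  shows "Dt X (\<lambda>c. if \<exists>!a. G c a then THE a. G c a else 0)"
proof (rule Dt_graph[where G = "\<lambda>c a. (G c a \<and> (\<forall>b. G c b \<longrightarrow> b = a)) \<or> ((\<forall>a. G c a \<longrightarrow> (\<exists>b. G c b \<and> b \<noteq> a)) \<and> a = 0)"])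
  have G1: "Df (ext (ext X)) (\<lambda>p. G (fst (fst p)) (snd p))"
    by (rule Df_ext_subst[OF assms]) (auto intro: Dt_snd Dt_fst[OF Dt_fst[OF Dt_coord]])
  have G2: "Df (ext (ext (ext X))) (\<lambda>p. G (fst (fst (fst p))) (snd p))"
    by (rule Df_ext_subst[OF assms]) (auto intro: Dt_snd Dt_fst[OF Dt_fst[OF Dt_fst[OF Dt_coord]]])
  show "Df (ext X) (\<lambda>p. (G (fst p) (snd p) \<and> (\<forall>b. G (fst p) b \<longrightarrow> b = snd p)) \<or>
     ((\<forall>a. G (fst p) a \<longrightarrow> (\<exists>b. G (fst p) b \<and> b \<noteq> a)) \<and> snd p = 0))"
    by (intro Df_or Df_and Df_all Df_imp Df_not Df_ex Df_eq Dt_snd Dt_fst Dt_0 assms G1 G2)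
  show "((G c a \<and> (\<forall>b. G c b \<longrightarrow> b = a)) \<or> ((\<forall>a. G c a \<longrightarrow> (\<exists>b. G c b \<and> b \<noteq> a)) \<and> a = 0)) =
     (a = (if \<exists>!a. G c a then THE a. G c a else 0))" for c a
  proof (cases "\<exists>!a. G c a")
    case True
    then obtain b where b: "G c b" "\<And>x. G c x \<Longrightarrow> x = b" by blast
    then have "(THE a. G c a) = b" by blast
    then show ?thesis unfolding if_P[OF True] using b by metis
  next
    case False
    then show ?thesis unfolding if_not_P[OF False] by metis
  qed
qed

lemmas df_intros = Df_and Df_or Df_imp Df_not Df_all Df_ex Df_less Df_le Df_eq Df_all_less
lemmas dt_intros = Dt_snd Dt_0 Dt_1 Dt_numeral Dt_of_nat Dt_add Dt_minus Dt_uminus Dt_mult Dt_divide Dt_inverse Dt_abs Dt_snds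

end

section \<open>Tame sets and definable functions of one variable\<close>

lemma interval_or_point_convex:
  assumes "interval_or_point S" "x \<in> S" "y \<in> S" "x < z" "z < (y :: 'k::linorder)"
  shows "z \<in> S"
proof -
  consider a where "S = {a}" | l u where "S = {x. (\<forall>a\<in>set_option l. a < x) \<and> (\<forall>b\<in>set_option u. x < b)}"
    using assms(1) unfolding interval_or_point_def by blast
  then show ?thesis
  proof cases
    case 1
    then show ?thesis using assms by auto
  next
    case 2
    then have "\<forall>a\<in>set_option l. a < z" "\<forall>b\<in>set_option u. z < b"
      using assms by (auto intro: less_trans)
    then show ?thesis using 2 by simp
  qed
qed

text \<open>One of the finitely many parts is infinite, and by convexity two of its points bound an
  interval. This is the only way in which intervals are produced from o-minimality, apart from the
  germs below.\<close>

lemma tame_infinite: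
  fixes S :: "'k::linorder set"
  assumes "tame S" "infinite S"
  shows "\<exists>l u. l < u \<and> {l<..<u} \<subseteq> S"
proof -
  obtain F where F: "finite F" "\<forall>T\<in>F. interval_or_point T" "S = \<Union>F"
    using assms by (auto simp: tame_def)
  then obtain T where T: "T \<in> F" "infinite T" using assms by blast
  obtain x where x: "x \<in> T" using T by (metis ex_in_conv finite.emptyI)
  obtain y where y: "y \<in> T" "y \<noteq> x" using T by (metis finite.simps finite_subset insertI1 insert_iff subsetI)
  have conv: "{a<..<b} \<subseteq> S" if "a \<in> T" "b \<in> T" for a b
    using interval_or_point_convex[of T a b] F T that by auto
  show ?thesis
  proof (cases "x < y")
    case True
    then show ?thesis using conv[OF x y(1)] by blast
  next
    case False
    then have "y < x" using y by auto
    then show ?thesis using conv[OF y(1) x] by blast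
  qed
qed

text \<open>For a single convex part T with a point y to the right of a, either everything between a
  and y belongs to T, or a missing point z shuts out all points between a and z. Finitely many parts
  allow for a common radius.\<close>

lemma tame_right_germ:
  fixes a :: "'k::linordered_field"
  assumes "tame S"
  shows "\<exists>e>0. {a<..<a + e} \<subseteq> S \<or> {a<..<a + e} \<inter> S = {}"
proof -
  obtain F where F: "finite F" "\<forall>T\<in>F. interval_or_point T" "S = \<Union>F"
    using assms by (auto simp: tame_def)
  have "\<exists>e>0. {a<..<a + e} \<subseteq> \<Union>F \<or> {a<..<a + e} \<inter> \<Union>F = {}" using F(1,2)
  proof (induction F)
    case empty
    show ?case by (intro exI[of _ 1]) simp
  next
    case (insert T F)
    then obtain e where e: "e > 0" "{a<..<a + e} \<subseteq> \<Union>F \<or> {a<..<a + e} \<inter> \<Union>F = {}" by auto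
    have T: "interval_or_point T" using insert by simp
    have "\<exists>d>0. {a<..<a + d} \<subseteq> T \<or> {a<..<a + d} \<inter> T = {}"
    proof (cases "\<exists>y\<in>T. a < y")
      case False
      then show ?thesis by (intro exI[of _ 1]) auto
    next
      case True
      then obtain y where y: "y \<in> T" "a < y" by blast
      show ?thesis
      proof (cases "{a<..<y} \<subseteq> T")
        case True
        then show ?thesis using y by (intro exI[of _ "y - a"]) simp
      next
        case False
        then obtain z where z: "a < z" "z < y" "z \<notin> T"
          unfolding subset_eq Ball_def greaterThanLessThan_iff by blast
        have "w \<notin> T" if "a < w" "w < z" for w
          using interval_or_point_convex[OF T _ y(1) that(2) z(2)] z by blast
        then show ?thesis using z by (intro exI[of _ "z - a"]) auto
      qed
    qed
    then obtain d where d: "d > 0" "{a<..<a + d} \<subseteq> T \<or> {a<..<a + d} \<inter> T = {}" by blast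
    have sub: "{a<..<a + min d e} \<subseteq> {a<..<a + d}" "{a<..<a + min d e} \<subseteq> {a<..<a + e}" by auto
    show ?case
    proof (intro exI[of _ "min d e"] conjI)
      show "{a<..<a + min d e} \<subseteq> \<Union>(insert T F) \<or> {a<..<a + min d e} \<inter> \<Union>(insert T F) = {}"
        using d(2) e(2) sub unfolding Union_insert by blast
    qed (use d e in simp)
  qed
  then show ?thesis using F by simp
qed

lemma tame_Sup:
  fixes S :: "'k::linordered_field set"
  assumes "tame S" "S \<noteq> {}" "\<forall>x\<in>S. x \<le> b"
  shows "\<exists>s. (\<forall>x\<in>S. x \<le> s) \<and> (\<forall>y. (\<forall>x\<in>S. x \<le> y) \<longrightarrow> s \<le> y)"
proof -
  obtain F where F: "finite F" "\<forall>T\<in>F. interval_or_point T" "S = \<Union>F"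
    using assms by (auto simp: tame_def)
  have "\<exists>s. (\<forall>x\<in>\<Union>F. x \<le> s) \<and> (\<forall>y. (\<forall>x\<in>\<Union>F. x \<le> y) \<longrightarrow> s \<le> y)"
    using F(1,2) assms(2,3)[unfolded F(3)]
  proof (induction F)
    case (insert T F)
    have Ti: "interval_or_point T" using insert.prems by simp
    have T: "\<exists>s. (\<forall>x\<in>T. x \<le> s) \<and> (\<forall>y. (\<forall>x\<in>T. x \<le> y) \<longrightarrow> s \<le> y)" if ne: "T \<noteq> {}"
    proof -
      consider a where "T = {a}" | l u where "T = {x. (\<forall>a\<in>set_option l. a < x) \<and> (\<forall>b\<in>set_option u. x < b)}"
        using Ti unfolding interval_or_point_def by blast
      then show ?thesis
      proof cases
        case 1
        then show ?thesis by (intro exI[of _ a]) simp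
      next
        case 2
        obtain t where t: "t \<in> T" using ne by blast
        have tb: "\<forall>x\<in>T. x \<le> b" using insert.prems by auto
        \<comment> \<open>This element lies above the lower endpoint but not in T, so T has an upper
          endpoint \<open>u0\<close>.\<close>
        have "max t b + 1 > b" "max t b + 1 > t" by (simp_all add: max_def add_strict_increasing2 less_le_trans)
        then have "max t b + 1 \<notin> T" using tb by (metis not_le)
        moreover have "\<forall>a\<in>set_option l. a < max t b + 1" using t 2 \<open>max t b + 1 > t\<close> by (auto intro: less_trans)
        ultimately obtain u0 where u0: "u = Some u0" using 2 by (cases u) auto
        have "u0 \<le> y" if y: "\<forall>x\<in>T. x \<le> y" for y
        proof (rule ccontr)
          assume "\<not> u0 \<le> y"
          define z where "z = (max t y + u0) / 2"
          have "t < u0" using t 2 u0 by auto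
          then have "max t y < u0" using \<open>\<not> u0 \<le> y\<close> by simp
          then have z: "max t y < z" "z < u0" by (simp_all add: z_def)
          then have "z \<in> T" using t 2 u0 by (auto intro: less_trans)
          then show False using y z by fastforce
        qed
        moreover have "\<forall>x\<in>T. x \<le> u0" using 2 u0 by auto
        ultimately show ?thesis by blast
      qed
    qed
    show ?case
    proof (cases "T = {} \<or> \<Union>F = {}")
      case True
      then show ?thesis
      proof
        assume "T = {}"
        then show ?thesis using insert by simp
      next
        assume "\<Union>F = {}"
        then have "\<Union>(insert T F) = T" by (simp only: Union_insert Un_empty_right)
        then show ?thesis using T insert.prems(2) by (simp only: not_False_eq_True simp_thms)
      qed
    next
      case False
      then obtain s where s: "\<forall>x\<in>T. x \<le> s" "\<forall>y. (\<forall>x\<in>T. x \<le> y) \<longrightarrow> s \<le> y" using T by blast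
      have "\<exists>s. (\<forall>x\<in>\<Union>F. x \<le> s) \<and> (\<forall>y. (\<forall>x\<in>\<Union>F. x \<le> y) \<longrightarrow> s \<le> y)"
        using False insert.prems by (intro insert.IH) auto
      then obtain s' where s': "\<forall>x\<in>\<Union>F. x \<le> s'" "\<forall>y. (\<forall>x\<in>\<Union>F. x \<le> y) \<longrightarrow> s' \<le> y" by blast
      show ?thesis
      proof (intro exI[of _ "max s s'"] conjI allI impI)
        show "\<forall>x\<in>\<Union>(insert T F). x \<le> max s s'"
          using s(1) s'(1) by (auto simp: le_max_iff_disj)
        show "max s s' \<le> y" if "\<forall>x\<in>\<Union>(insert T F). x \<le> y" for y
        proof -
          have "\<forall>x\<in>T. x \<le> y" "\<forall>x\<in>\<Union>F. x \<le> y" using that by auto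
          then show ?thesis using s(2) s'(2) max.boundedI by blast
        qed
      qed
    qed
  qed simp
  then show ?thesis using F by simp
qed

definition cont1 :: "('k::linordered_field \<Rightarrow> 'k) \<Rightarrow> 'k \<Rightarrow> bool" where
  "cont1 g x \<longleftrightarrow> (\<forall>e>0. \<exists>d>0. \<forall>y. \<bar>y - x\<bar> < d \<longrightarrow> \<bar>g y - g x\<bar> < e)"

section \<open>One variable with parameters: suprema, definable choice, monotonicity\<close>

context definable_predicates
begin

definition full :: "('c \<Rightarrow> 'k) set \<Rightarrow> bool" where
  "full X \<longleftrightarrow> (\<forall>a. Dt X (\<lambda>_. a))"

definition X1 :: "('k \<Rightarrow> 'k) set" where
  "X1 = insert (\<lambda>a. a) (range (\<lambda>a _. a))"

lemma Dt_const: "full X \<Longrightarrow> Dt X (\<lambda>_. a)"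
  by (simp add: full_def)

lemma full_ext: "full X \<Longrightarrow> full (ext X)"
  unfolding full_def using Dt_fst[of X "\<lambda>_. a" for a] by blast

lemma full_exts: "full X \<Longrightarrow> full (exts n X)"
  unfolding full_def using Dt_fsts[of X "\<lambda>_. a" for a] by blast

lemma full_X1: "full X1"
  unfolding full_def X1_def by (auto intro: Dt_coord)

lemma full_V: "full (V UNIV n)"
  unfolding full_def by (auto intro: Dt_V)

lemma Dt_X1: "Dt X1 (\<lambda>a. a)"
  by (rule Dt_coord) (simp add: X1_def)

lemma Dt_app1: "Dt X1 g \<Longrightarrow> full X \<Longrightarrow> Dt X s \<Longrightarrow> Dt X (\<lambda>c. g (s c))"
  by (rule Dt_subst) (auto simp: X1_def intro: Dt_const)

lemmas def_rules = df_intros dt_intros Dt_fst Dt_fsts Dt_const full_ext full_exts full_X1 full_V Dt_X1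

lemma Df_slice: "Df (ext X) (\<lambda>p. Q (fst p) (snd p)) \<Longrightarrow> Df X1 (\<lambda>a. Q c a)"
  by (drule Df_sub[where h = "\<lambda>a. (c, a)" and X = X1]) (auto simp: ext_def X1_def)

lemma Df_tame1:
  assumes "Df X1 P"
  shows "tame {a. P a}"
  using assms
proof (rule DfE)
  fix R \<rho> assume 1: "R \<in> D" "\<forall>i. \<rho> i \<in> insert (\<lambda>_. 0) X1" "\<forall>c. P c = R (\<lambda>i. \<rho> i c)"
  \<comment> \<open>Each \<open>\<rho> i\<close> is the identity or a constant; its value at 0
    recovers the constant, which the environment then supplies as a parameter.\<close>
  define \<sigma> where "\<sigma> i = (if \<rho> i = (\<lambda>a. a) then 0 else Suc i)" for i
  have "tame {a. R (\<lambda>i. case_nat a (\<lambda>i. \<rho> i 0) (\<sigma> i))}"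
    by (rule D_tame[OF D_ren[OF 1(1)]])
  moreover have "(\<lambda>i. case_nat a (\<lambda>i. \<rho> i 0) (\<sigma> i)) = (\<lambda>i. \<rho> i a)" for a
  proof
    show "case_nat a (\<lambda>i. \<rho> i 0) (\<sigma> i) = \<rho> i a" for i
      using 1(2)[rule_format, of i] by (auto simp: \<sigma>_def X1_def)
  qed
  ultimately show ?thesis by (simp add: 1(3))
qed

lemma Df_tame: "Df (ext X) (\<lambda>p. Q (fst p) (snd p)) \<Longrightarrow> tame {a. Q c a}"
  by (rule Df_tame1, rule Df_slice)

text \<open>The right germ of P at the midpoint decides: P holds just to the right of it, or fails
  there, and then Q holds.\<close>

lemma interval_split:
  assumes "Df X1 P" "Df X1 Q" "l < u" "\<And>x. l < x \<Longrightarrow> x < u \<Longrightarrow> P x \<or> Q x"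
  obtains l' u' where "l \<le> l'" "l' < u'" "u' \<le> u" "(\<forall>x. l' < x \<and> x < u' \<longrightarrow> P x) \<or> (\<forall>x. l' < x \<and> x < u' \<longrightarrow> Q x)"
proof -
  define m where "m = (l + u) / 2"
  have m: "l < m" "m < u" using assms(3) by (simp_all add: m_def)
  obtain e where e: "e > 0" "{m<..<m + e} \<subseteq> {x. P x} \<or> {m<..<m + e} \<inter> {x. P x} = {}"
    using tame_right_germ[OF Df_tame1[OF assms(1)]] by blast
  show thesis
  proof (rule that[of m "min u (m + e)"])
    show "(\<forall>x. m < x \<and> x < min u (m + e) \<longrightarrow> P x) \<or> (\<forall>x. m < x \<and> x < min u (m + e) \<longrightarrow> Q x)"
      using e(2)
    proof
      assume "{m<..<m + e} \<subseteq> {x. P x}"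
      then show ?thesis by auto
    next
      assume *: "{m<..<m + e} \<inter> {x. P x} = {}"
      have "Q x" if "m < x" "x < min u (m + e)" for x
      proof -
        have "x \<in> {m<..<m + e}" using that by simp
        then have "\<not> P x" using * by blast
        then show ?thesis using assms(4)[of x] that m by auto
      qed
      then show ?thesis by blast
    qed
  qed (use m e in auto)
qed

definition Lub :: "('k \<Rightarrow> bool) \<Rightarrow> 'k \<Rightarrow> bool" where
  "Lub P s \<longleftrightarrow> (\<forall>x. P x \<longrightarrow> x \<le> s) \<and> (\<forall>y. (\<forall>x. P x \<longrightarrow> x \<le> y) \<longrightarrow> s \<le> y)"

definition lub :: "('k \<Rightarrow> bool) \<Rightarrow> 'k" where
  "lub P = (if \<exists>!s. Lub P s then THE s. Lub P s else 0)"

lemma Lub_unique: "Lub P s \<Longrightarrow> Lub P t \<Longrightarrow> s = t"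
  unfolding Lub_def by (meson order_antisym)

lemma Lub_lub:
  assumes "Df X1 P" "P x" "\<And>x. P x \<Longrightarrow> x \<le> b"
  shows "Lub P (lub P)"
proof -
  have "\<exists>s. Lub P s"
    using tame_Sup[OF Df_tame1[OF assms(1)], of b] assms unfolding Lub_def by auto
  then have "\<exists>!s. Lub P s" using Lub_unique by blast
  then show ?thesis unfolding lub_def using theI'[of "Lub P"] by simp
qed

lemma Dt_lub:
  assumes "Df (ext X) (\<lambda>p. Q (fst p) (snd p))"
  shows "Dt X (\<lambda>c. lub (Q c))"
  unfolding lub_def
proof (rule Dt_The)
  have 1: "Df (ext (ext X)) (\<lambda>p. Q (fst (fst p)) (snd p))"
    by (rule Df_ext_subst[OF assms]) (auto intro: Dt_snd Dt_fst[OF Dt_fst[OF Dt_coord]])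
  have 2: "Df (ext (ext (ext X))) (\<lambda>p. Q (fst (fst (fst p))) (snd p))"
    by (rule Df_ext_subst[OF assms]) (auto intro: Dt_snd Dt_fst[OF Dt_fst[OF Dt_fst[OF Dt_coord]]])
  show "Df (ext X) (\<lambda>p. Lub (Q (fst p)) (snd p))"
    unfolding Lub_def by (intro Df_and Df_all Df_imp Df_le Dt_snd Dt_fst 1 2)
qed

text \<open>
  Definable choice: reflecting at 0 makes the fibre bounded below, so it has an infimum \<open>m\<close>;
  if \<open>m\<close> does not belong to the fibre, an interval to the right of \<open>m\<close> does.
\<close>

lemma definable_choice:
  assumes Q: "Df (ext X) (\<lambda>p. Q (fst p) (snd p))"
  obtains f where "Dt X f" "\<And>c a. Q c a \<Longrightarrow> Q c (f c)"
proof -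
  define A where "A c b \<longleftrightarrow> 0 \<le> b \<and> (Q c b \<or> Q c (- b))" for c b
  have XX: "Dt X x" if "x \<in> X" for x using that by (auto intro: Dt_coord)
  have dA0: "Df (ext X) (\<lambda>p. A (fst p) (snd p))"
    unfolding A_def by (intro Df_and Df_or Df_le Dt_0 Dt_uminus Dt_snd Dt_fst XX Df_ext_subst[OF Q])
  define m where "m c = - lub (\<lambda>b. A c (- b))" for c
  have dm: "Dt X m"
    unfolding m_def by (intro Dt_uminus Dt_lub Df_ext_subst[OF dA0] Dt_snd Dt_fst XX)
  \<comment> \<open>Admissible lengths of an interval in the fibre to the right of the infimum,
    capped by 1 to have a supremum; half of this supremum is then a definable admissible
    step.\<close>
  define E where "E c e \<longleftrightarrow> 0 < e \<and> e \<le> 1 \<and> (\<forall>x. m c < x \<and> x < m c + e \<longrightarrow> A c x)" for c e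
  define s where "s c = lub (E c)" for c
  have dE: "Df (ext X) (\<lambda>p. E (fst p) (snd p))"
    unfolding E_def by (intro Df_and Df_less Df_le Df_all Df_imp Dt_0 Dt_1 Dt_add Dt_snd Dt_fst dm Df_ext_subst[OF dA0] XX)
  have ds: "Dt X s"
    unfolding s_def by (rule Dt_lub[OF dE])
  define t where "t c = (if A c (m c) then m c else m c + s c / 2)" for c
  have dt: "Dt X t"
    unfolding t_def by (intro Dt_if Df_ext_subst[OF dA0, where h = "\<lambda>c. c"] dm Dt_add ds Dt_divide Dt_numeral XX)
  define f where "f c = (if Q c (t c) then t c else - t c)" for c
  have df: "Dt X f"
    unfolding f_def by (intro Dt_if Df_ext_subst[OF Q, where h = "\<lambda>c. c"] dt Dt_uminus XX)
  have "Q c (f c)" if "Q c a" for c a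
  proof -
    have Aa: "A c \<bar>a\<bar>" using that by (auto simp: A_def abs_if)
    have "Df X1 (\<lambda>b. A c (- b))"
      by (rule Df_ext_subst[OF dA0, where h = "\<lambda>_. c"]) (intro Dt_const full_X1 Dt_uminus Dt_X1)+
    then have "Lub (\<lambda>b. A c (- b)) (lub (\<lambda>b. A c (- b)))"
      by (rule Lub_lub[where b = 0 and x = "- \<bar>a\<bar>"]) (use Aa in \<open>auto simp: A_def\<close>)
    then have m: "\<And>b. A c b \<Longrightarrow> m c \<le> b" "\<And>y. (\<And>b. A c b \<Longrightarrow> y \<le> b) \<Longrightarrow> y \<le> m c"
    proof -
      assume L: "Lub (\<lambda>b. A c (- b)) (lub (\<lambda>b. A c (- b)))"
      show "m c \<le> b" if "A c b" for b
        using L that unfolding Lub_def m_def by (metis minus_le_iff minus_minus)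
      show "y \<le> m c" if "\<And>b. A c b \<Longrightarrow> y \<le> b" for y
      proof -
        have "\<forall>x. A c (- x) \<longrightarrow> x \<le> - y"
        proof (intro allI impI)
          fix x assume "A c (- x)"
          then have "y \<le> - x" by (rule that)
          then show "x \<le> - y" by simp
        qed
        then have "lub (\<lambda>b. A c (- b)) \<le> - y" using L unfolding Lub_def by blast
        then show ?thesis by (simp add: m_def le_minus_iff)
      qed
    qed
    have "A c (t c)"
    proof (cases "A c (m c)")
      case False
      have dA: "Df X1 (A c)"
        using Df_ext_subst[OF dA0, where h = "\<lambda>_. c" and s = "\<lambda>b. b" and Y = X1] by (simp add: Dt_const full_X1 Dt_X1)
      obtain e where e: "e > 0" "{m c<..<m c + e} \<subseteq> {x. A c x} \<or> {m c<..<m c + e} \<inter> {x. A c x} = {}"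
        using tame_right_germ[OF Df_tame1[OF dA]] by blast
      have "\<not> {m c<..<m c + e} \<inter> {x. A c x} = {}"
      proof
        assume *: "{m c<..<m c + e} \<inter> {x. A c x} = {}"
        have "m c + e \<le> b" if "A c b" for b
        proof (rule ccontr)
          assume "\<not> m c + e \<le> b"
          moreover have "m c < b" using m(1)[OF that] that False by (metis le_less)
          ultimately have "b \<in> {m c<..<m c + e} \<inter> {x. A c x}" using that by simp
          then show False using * by blast
        qed
        then have "m c + e \<le> m c" by (rule m(2))
        then show False using e by simp
      qed
      then have sub: "{m c<..<m c + e} \<subseteq> {x. A c x}" using e by blast
      have "A c x" if "m c < x" "x < m c + min e 1" for x
      proof -
        have "x \<in> {m c<..<m c + e}" using that by (simp add: min_def split: if_splits)
        then show ?thesis using sub by blast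
      qed
      then have "E c (min e 1)"
        unfolding E_def using e(1) by simp
      have "Lub (E c) (s c)"
        unfolding s_def by (rule Lub_lub[OF Df_slice[OF dE] \<open>E c (min e 1)\<close>, of 1]) (simp add: E_def)
      note L = this
      have "min e 1 \<le> s c" using L \<open>E c (min e 1)\<close> unfolding Lub_def by blast
      moreover have "0 < min e 1" using e(1) by simp
      ultimately have s: "0 < s c" by (rule less_le_trans[rotated])
      then have "\<not> s c \<le> s c / 2" by simp
      then obtain e' where e': "E c e'" "\<not> e' \<le> s c / 2" using L unfolding Lub_def by blast
      have "m c < m c + s c / 2" "m c + s c / 2 < m c + e'" using s e' by auto
      then have "A c (m c + s c / 2)" using e' unfolding E_def by blast
      then show ?thesis using False by (simp add: t_def)
    qed (simp add: t_def)
    then show ?thesis by (auto simp: A_def f_def)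
  qed
  then show thesis using that df by blast
qed

text \<open>Induction on the number of coordinates: the last one is chosen with the others
  quantified away, then its choice is substituted and the others are chosen.\<close>

lemma definable_choices:
  assumes "Df (exts n X) (\<lambda>p. Q (fst p) (snd p))"
  shows "\<exists>F. (\<forall>i<n. Dt X (\<lambda>c. F c i)) \<and> (\<forall>c w. Q c w \<longrightarrow> Q c (F c))"
  using assms
proof (induction n arbitrary: Q)
  case 0
  have "Q c w = Q c w'" for c w w'
    using 0
  proof (rule DfE)
    fix R \<rho> assume 1: "\<forall>i. \<rho> i \<in> insert (\<lambda>_. 0) (exts 0 X)" "\<forall>p. Q (fst p) (snd p) = R (\<lambda>i. \<rho> i p)"
    have "(\<lambda>i. \<rho> i (c, w)) = (\<lambda>i. \<rho> i (c, w'))"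
    proof
      show "\<rho> i (c, w) = \<rho> i (c, w')" for i using 1(1)[rule_format, of i] by (auto simp: exts_def)
    qed
    then show ?thesis using 1(2)[rule_format, of "(c, w)"] 1(2)[rule_format, of "(c, w')"] by simp
  qed
  then show ?case by (intro exI[of _ "\<lambda>_ _. 0"]) blast
next
  case (Suc n)
  have X: "Dt X x" if "x \<in> X" for x using that by (auto intro: Dt_coord)
  have "Df (exts n (ext X)) (\<lambda>p. (\<lambda>p. Q (fst p) (snd p)) (fst (fst p), (snd p)(n := snd (fst p))))"
  proof (rule Df_subst[OF Suc.prems])
    fix x assume "x \<in> exts (Suc n) X"
    then consider y where "y \<in> X" "x = (\<lambda>p. y (fst p))" | i where "i < Suc n" "x = (\<lambda>p. snd p i)"
      by (auto simp: exts_def)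
    then show "Dt (exts n (ext X)) (\<lambda>p. x (fst (fst p), (snd p)(n := snd (fst p))))"
    proof cases
      case 1
      then show ?thesis using Dt_fsts[OF Dt_fst[OF X[OF 1(1)]]] by simp
    next
      case 2
      show ?thesis
        by (cases "i = n") (use 2 in \<open>auto intro: Dt_snds Dt_fsts[OF Dt_snd]\<close>)
    qed
  qed
  then have "Df (ext X) (\<lambda>p. \<exists>w. Q (fst p) (w(n := snd p)))"
    by (intro Df_exs[where n = n]) simp
  then obtain f where f: "Dt X f" "\<And>c a. \<exists>w. Q c (w(n := a)) \<Longrightarrow> \<exists>w. Q c (w(n := f c))"
    by (rule definable_choice) blast
  have "Df (exts n X) (\<lambda>p. (\<lambda>p. Q (fst p) (snd p)) (fst p, (snd p)(n := f (fst p))))"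
  proof (rule Df_subst[OF Suc.prems])
    fix x assume "x \<in> exts (Suc n) X"
    then consider y where "y \<in> X" "x = (\<lambda>p. y (fst p))" | i where "i < Suc n" "x = (\<lambda>p. snd p i)"
      by (auto simp: exts_def)
    then show "Dt (exts n X) (\<lambda>p. x (fst p, (snd p)(n := f (fst p))))"
    proof cases
      case 1
      then show ?thesis using Dt_fsts[OF X[OF 1(1)]] by simp
    next
      case 2
      show ?thesis
        by (cases "i = n") (use 2 in \<open>auto intro: Dt_snds Dt_fsts[OF f(1)]\<close>)
    qed
  qed
  then have "Df (exts n X) (\<lambda>p. Q (fst p) ((snd p)(n := f (fst p))))" by simp
  from Suc.IH[OF this] obtain F where F: "\<forall>i<n. Dt X (\<lambda>c. F c i)"
    "\<forall>c w. Q c (w(n := f c)) \<longrightarrow> Q c ((F c)(n := f c))" by blast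
  show ?case
  proof (intro exI[of _ "\<lambda>c. (F c)(n := f c)"] conjI allI impI)
    show "Dt X (\<lambda>c. ((F c)(n := f c)) i)" if "i < Suc n" for i
      by (cases "i = n") (use that F(1) f(1) in auto)
    show "Q c ((F c)(n := f c))" if "Q c w" for c w
    proof -
      have "\<exists>w'. Q c (w'(n := w n))" using that by (metis fun_upd_triv)
      then show ?thesis using f(2) F(2) by blast
    qed
  qed
qed

text \<open>If g takes infinitely many values, its range contains an interval, and the points where
  g exceeds the midpoint of that interval form an infinite tame set. Otherwise half the least value
  is a bound. The lemma makes definably chosen radii uniform.\<close>

lemma positive_bounded_below:
  assumes g: "Dt X1 g" and lu: "l < u" and pos: "\<And>x. l < x \<Longrightarrow> x < u \<Longrightarrow> 0 < g x"
  obtains l' u' c where "l \<le> l'" "l' < u'" "u' \<le> u" "0 < c" "\<And>x. l' < x \<Longrightarrow> x < u' \<Longrightarrow> c < g x"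
proof -
  let ?I = "{y. \<exists>x. l < x \<and> x < u \<and> g x = y}"
  have I: "?I = g ` {l<..<u}" by auto
  have "Df (ext X1) (\<lambda>p. \<exists>x. l < x \<and> x < u \<and> g x = snd p)"
    by (intro def_rules Dt_app1[OF g])
  then have "tame ?I" by (rule Df_tame)
  show thesis
  proof (cases "finite ?I")
    case True
    obtain m where "l < m" "m < u" using lu dense by blast
    then have ne: "?I \<noteq> {}" by blast
    define c where "c = Min ?I / 2"
    have "Min ?I \<in> ?I" using True ne by (rule Min_in)
    then obtain x where "l < x" "x < u" "g x = Min ?I" by blast
    then have M: "0 < Min ?I" using pos[of x] by simp
    have "c < g x" if "l < x" "x < u" for x
    proof -
      have "Min ?I \<le> g x" using True that by (intro Min_le) auto
      then show ?thesis using M by (simp add: c_def)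
    qed
    then show ?thesis using lu M by (intro that[of l u c]) (auto simp: c_def)
  next
    case False
    then obtain p q where pq: "p < q" "{p<..<q} \<subseteq> ?I"
      using tame_infinite[OF \<open>tame ?I\<close>] by blast
    define c where "c = (p + q) / 2"
    have c: "p < c" "c < q" using pq by (simp_all add: c_def)
    then have "c \<in> ?I" using pq by (intro subsetD[OF pq(2)]) simp
    then have "0 < c" using pos by auto
    let ?S = "{x. l < x \<and> x < u \<and> c < g x}"
    have "{c<..<q} \<subseteq> g ` ?S"
    proof
      fix y assume y: "y \<in> {c<..<q}"
      then have "y \<in> ?I" using c by (intro subsetD[OF pq(2)]) auto
      then show "y \<in> g ` ?S" using y by auto
    qed
    moreover have "infinite {c<..<q}" using c by (simp add: infinite_Ioo)
    ultimately have "infinite ?S" using finite_surj by blast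
    moreover have "Df X1 (\<lambda>x. l < x \<and> x < u \<and> c < g x)"
      by (intro def_rules g)
    then have "tame ?S" by (rule Df_tame1)
    ultimately obtain l' u' where lu': "l' < u'" "{l'<..<u'} \<subseteq> ?S" using tame_infinite by blast
    then have "{l'<..<u'} \<subseteq> {l<..<u}" by auto
    then have "l \<le> l'" "u' \<le> u" using lu'(1) by (auto simp: greaterThanLessThan_subseteq_greaterThanLessThan)
    then show ?thesis using lu' \<open>0 < c\<close> by (intro that[of l' u' c]) auto
  qed
qed

lemma Df_rel: "r \<in> {(<), (=), (>)} \<Longrightarrow> Dt X s \<Longrightarrow> Dt X t \<Longrightarrow> Df X (\<lambda>c. r (s c) (t c))"
  by (auto intro: Df_less Df_eq)

text \<open>To the right of each x, the value at x stands in one of the relations <, =, > to the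
  values nearby. One relation prevails on a subinterval. The radius up to which it holds is chosen
  definably and is bounded below by some c on a smaller interval; on one of length at most c, the
  relation holds for all pairs.\<close>

lemma monotone_on_subinterval:
  assumes g: "Dt X1 g" and lu: "l < u"
  obtains l' u' r where "l \<le> l'" "l' < u'" "u' \<le> u" "r \<in> {(<), (=), (>)}" "\<And>x y. l' < x \<Longrightarrow> x < y \<Longrightarrow> y < u' \<Longrightarrow> r (g x) (g y)"
proof -
  define G where "G r x \<longleftrightarrow> (\<exists>e>0. \<forall>y. x < y \<and> y < x + e \<longrightarrow> r (g x) (g y))" for r x
  have dG: "Df X1 (G r)" if "r \<in> {(<), (=), (>)}" for r
    unfolding G_def by (intro def_rules Df_rel[OF that] Dt_app1[OF g])
  have germ: "G (<) x \<or> G (=) x \<or> G (>) x" for x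
  proof -
    have t: "tame {y. g x < g y}" "tame {y. g y < g x}"
      by (rule Df_tame1, intro def_rules g)+
    obtain e where e: "e > 0" "{x<..<x + e} \<subseteq> {y. g x < g y} \<or> {x<..<x + e} \<inter> {y. g x < g y} = {}"
      using tame_right_germ[OF t(1)] by blast
    obtain d where d: "d > 0" "{x<..<x + d} \<subseteq> {y. g y < g x} \<or> {x<..<x + d} \<inter> {y. g y < g x} = {}"
      using tame_right_germ[OF t(2)] by blast
    consider "{x<..<x + e} \<subseteq> {y. g x < g y}" | "{x<..<x + d} \<subseteq> {y. g y < g x}"
      | "{x<..<x + e} \<inter> {y. g x < g y} = {}" "{x<..<x + d} \<inter> {y. g y < g x} = {}" using e d by blast
    then show ?thesis
    proof cases
      case 1
      then have "G (<) x" unfolding G_def using e by (intro exI[of _ e]) auto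
      then show ?thesis by blast
    next
      case 2
      then have "G (>) x" unfolding G_def using d by (intro exI[of _ d]) auto
      then show ?thesis by blast
    next
      case 3
      have "g x = g y" if "x < y" "y < x + min d e" for y
      proof -
        have "y \<in> {x<..<x + e}" "y \<in> {x<..<x + d}" using that by auto
        then have "\<not> g x < g y" "\<not> g y < g x" using 3 by blast+
        then show ?thesis by simp
      qed
      then have "G (=) x" unfolding G_def using d e by (intro exI[of _ "min d e"]) auto
      then show ?thesis by blast
    qed
  qed
  have "\<exists>r\<in>{(<), (=), (>)}. \<exists>l' u'. l \<le> l' \<and> l' < u' \<and> u' \<le> u \<and> (\<forall>x. l' < x \<and> x < u' \<longrightarrow> G r x)"
  proof -
    have d: "Df X1 (G (<))" "Df X1 (G (=))" "Df X1 (G (>))" by (rule dG, simp)+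
    obtain l1 u1 where 1: "l \<le> l1" "l1 < u1" "u1 \<le> u"
      "(\<forall>x. l1 < x \<and> x < u1 \<longrightarrow> G (<) x) \<or> (\<forall>x. l1 < x \<and> x < u1 \<longrightarrow> G (=) x \<or> G (>) x)"
      using interval_split[OF d(1) Df_or[OF d(2,3)] lu germ] by blast
    show ?thesis
    proof (cases "\<forall>x. l1 < x \<and> x < u1 \<longrightarrow> G (<) x")
      case True
      then show ?thesis using 1 by (intro bexI[of _ "(<)"] exI[of _ l1] exI[of _ u1]) auto
    next
      case False
      then have *: "\<And>x. l1 < x \<Longrightarrow> x < u1 \<Longrightarrow> G (=) x \<or> G (>) x" using 1 by blast
      from interval_split[OF d(2,3) 1(2) *] obtain l2 u2 where 2: "l1 \<le> l2" "l2 < u2" "u2 \<le> u1"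
        "(\<forall>x. l2 < x \<and> x < u2 \<longrightarrow> G (=) x) \<or> (\<forall>x. l2 < x \<and> x < u2 \<longrightarrow> G (>) x)"
        by blast
      have le: "l \<le> l2" "u2 \<le> u" using 1 2 by auto
      show ?thesis using 2(4)
      proof
        assume "\<forall>x. l2 < x \<and> x < u2 \<longrightarrow> G (=) x"
        then show ?thesis using le 2(2) by (intro bexI[of _ "(=)"] exI[of _ l2] exI[of _ u2]) simp_all
      next
        assume "\<forall>x. l2 < x \<and> x < u2 \<longrightarrow> G (>) x"
        then show ?thesis using le 2(2) by (intro bexI[of _ "(>)"] exI[of _ l2] exI[of _ u2]) simp_all
      qed
    qed
  qed
  then obtain r l1 u1 where r: "r \<in> {(<), (=), (>)}" and 1: "l \<le> l1" "l1 < u1" "u1 \<le> u" "\<And>x. l1 < x \<Longrightarrow> x < u1 \<Longrightarrow> G r x"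
    by blast
  define Q where "Q x e \<longleftrightarrow> e > 0 \<and> (\<forall>y. x < y \<and> y < x + e \<longrightarrow> r (g x) (g y))" for x e
  have "Df (ext X1) (\<lambda>p. Q (fst p) (snd p))"
    unfolding Q_def by (intro def_rules Df_rel[OF r] Dt_app1[OF g])
  then obtain \<epsilon> where \<epsilon>: "Dt X1 \<epsilon>" "\<And>x e. Q x e \<Longrightarrow> Q x (\<epsilon> x)" by (rule definable_choice) blast
  have Q\<epsilon>: "Q x (\<epsilon> x)" if "l1 < x" "x < u1" for x
    using 1(4)[OF that] \<epsilon>(2) unfolding G_def Q_def by blast
  obtain l2 u2 c where 2: "l1 \<le> l2" "l2 < u2" "u2 \<le> u1" "0 < c" "\<And>x. l2 < x \<Longrightarrow> x < u2 \<Longrightarrow> c < \<epsilon> x"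
  proof (rule positive_bounded_below[OF \<epsilon>(1) 1(2)])
    show "0 < \<epsilon> x" if "l1 < x" "x < u1" for x using Q\<epsilon>[OF that] by (simp add: Q_def)
  qed blast
  show thesis
  proof (rule that[OF _ _ _ r])
    show "l \<le> l2" "l2 < min u2 (l2 + c)" "min u2 (l2 + c) \<le> u" using 1 2 by auto
    fix x y assume xy: "l2 < x" "x < y" "y < min u2 (l2 + c)"
    then have "c < \<epsilon> x" "Q x (\<epsilon> x)" using 1 2 by (auto intro!: Q\<epsilon>)
    moreover have "y < x + c" using xy by auto
    ultimately show "r (g x) (g y)" using xy unfolding Q_def by auto
  qed
qed

text \<open>The range is infinite by injectivity and so contains an interval; a monotone function
  that takes all values of an interval has no jumps there.\<close>

lemma continuous_if_strictly_increasing: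
  assumes g: "Dt X1 g" and lu: "l < u" and mono: "\<And>x y. l < x \<Longrightarrow> x < y \<Longrightarrow> y < u \<Longrightarrow> g x < g y"
  obtains l' u' where "l \<le> l'" "l' < u'" "u' \<le> u" "\<And>x. l' < x \<Longrightarrow> x < u' \<Longrightarrow> cont1 g x"
proof -
  let ?I = "{y. \<exists>x. l < x \<and> x < u \<and> g x = y}"
  have I: "?I = g ` {l<..<u}" by auto
  have "Df (ext X1) (\<lambda>p. \<exists>x. l < x \<and> x < u \<and> g x = snd p)"
    by (intro def_rules Dt_app1[OF g])
  then have "tame ?I" by (rule Df_tame)
  moreover have "inj_on g {l<..<u}"
  proof (rule inj_onI)
    fix x y assume xy: "x \<in> {l<..<u}" "y \<in> {l<..<u}" "g x = g y"
    then show "x = y" using mono[of x y] mono[of y x] by (cases x y rule: linorder_cases) auto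
  qed
  then have "infinite ?I" unfolding I using lu by (simp add: finite_image_iff infinite_Ioo)
  ultimately obtain p q where pq: "p < q" "{p<..<q} \<subseteq> ?I" using tame_infinite by blast
  \<comment> \<open>Strictly inside the interval, so that \<open>p'\<close> and \<open>q'\<close>
    are themselves attained; their preimages bound the domain of continuity.\<close>
  define p' where "p' = (p + (p + q) / 2) / 2"
  define q' where "q' = ((p + q) / 2 + q) / 2"
  have p': "p < p'" "p' < q'" "q' < q" using pq by (simp_all add: p'_def q'_def)
  have "p' \<in> ?I" "q' \<in> ?I" by (rule subsetD[OF pq(2)], use p' in simp)+
  then obtain a b where ab: "l < a" "a < u" "g a = p'" "l < b" "b < u" "g b = q'" by blast
  have inv: "x < y" if "g x < g y" "l < x" "x < u" "l < y" "y < u" for x y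
    using mono[of y x] that by (cases x y rule: linorder_cases) auto
  have "a < b" using inv[of a b] ab p' by simp
  show thesis
  proof (rule that[of a b])
    fix x assume x: "a < x" "x < b"
    have gx: "p' < g x" "g x < q'" using mono[of a x] mono[of x b] ab x by auto
    show "cont1 g x"
      unfolding cont1_def
    proof (intro allI impI)
      fix e :: 'k assume e: "e > 0"
      define w where "w = max p' (g x - e / 2)"
      define z where "z = min q' (g x + e / 2)"
      have w: "p' \<le> w" "w < g x" "g x - w < e" using gx e by (auto simp: w_def max_def field_simps)
      have z: "z \<le> q'" "g x < z" "z - g x < e" using gx e by (auto simp: z_def min_def field_simps)
      have "w \<in> ?I" "z \<in> ?I" by (rule subsetD[OF pq(2)], use p' w z gx in simp)+
      then obtain x1 x2 where 1: "l < x1" "x1 < u" "g x1 = w" "l < x2" "x2 < u" "g x2 = z" by blast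
      have x12: "x1 < x" "x < x2" using inv[of x1 x] inv[of x x2] 1 w z x ab by auto
      show "\<exists>d>0. \<forall>y. \<bar>y - x\<bar> < d \<longrightarrow> \<bar>g y - g x\<bar> < e"
      proof (intro exI[of _ "min (x - x1) (x2 - x)"] conjI allI impI)
        show "0 < min (x - x1) (x2 - x)" using x12 by simp
        fix y assume y: "\<bar>y - x\<bar> < min (x - x1) (x2 - x)"
        then have "x1 < y" "y < x2" by (auto simp: abs_less_iff)
        then have "w < g y" "g y < z" using mono[of x1 y] mono[of y x2] 1 by auto
        then show "\<bar>g y - g x\<bar> < e" using w z by (auto simp: abs_less_iff)
      qed
    qed
  qed (use ab \<open>a < b\<close> in auto)
qed

lemma monotone_continuous_on_subinterval:
  assumes g: "Dt X1 g" and lu: "l < u"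
  obtains l' u' r where "l \<le> l'" "l' < u'" "u' \<le> u" "r \<in> {(<), (=), (>)}"
    "\<And>x y. l' < x \<Longrightarrow> x < y \<Longrightarrow> y < u' \<Longrightarrow> r (g x) (g y)" "\<And>x. l' < x \<Longrightarrow> x < u' \<Longrightarrow> cont1 g x"
proof -
  obtain l1 u1 r where 1: "l \<le> l1" "l1 < u1" "u1 \<le> u" "r \<in> {(<), (=), (>)}"
    "\<And>x y. l1 < x \<Longrightarrow> x < y \<Longrightarrow> y < u1 \<Longrightarrow> r (g x) (g y)"
    using monotone_on_subinterval[OF g lu] by blast
  have "\<exists>l2 u2. l1 \<le> l2 \<and> l2 < u2 \<and> u2 \<le> u1 \<and> (\<forall>x. l2 < x \<and> x < u2 \<longrightarrow> cont1 g x)"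
    using 1(4)
  proof (elim insertE emptyE)
    assume r: "r = (<)"
    obtain l2 u2 where "l1 \<le> l2" "l2 < u2" "u2 \<le> u1" "\<And>x. l2 < x \<Longrightarrow> x < u2 \<Longrightarrow> cont1 g x"
      using continuous_if_strictly_increasing[OF g 1(2)] 1(5) r by blast
    then show ?thesis by blast
  next
    assume r: "r = (>)"
    obtain l2 u2 where "l1 \<le> l2" "l2 < u2" "u2 \<le> u1" "\<And>x. l2 < x \<Longrightarrow> x < u2 \<Longrightarrow> cont1 (\<lambda>x. - g x) x"
    proof (rule continuous_if_strictly_increasing[OF Dt_uminus[OF g] 1(2)])
      show "- g x < - g y" if "l1 < x" "x < y" "y < u1" for x y
        using 1(5)[OF that] r by simp
    qed blast
    moreover have "cont1 g x" if "cont1 (\<lambda>x. - g x) x" for x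
    proof -
      have "\<bar>- g y - - g x\<bar> = \<bar>g y - g x\<bar>" for y by (simp add: abs_minus_commute)
      then show ?thesis using that unfolding cont1_def by simp
    qed
    ultimately show ?thesis by blast
  next
    assume r: "r = (=)"
    have "cont1 g x" if x: "l1 < x" "x < u1" for x
      unfolding cont1_def
    proof (intro allI impI)
      fix e :: 'k assume e: "e > 0"
      show "\<exists>d>0. \<forall>y. \<bar>y - x\<bar> < d \<longrightarrow> \<bar>g y - g x\<bar> < e"
      proof (intro exI[of _ "min (x - l1) (u1 - x)"] conjI allI impI)
        show "0 < min (x - l1) (u1 - x)" using x by simp
        fix y assume "\<bar>y - x\<bar> < min (x - l1) (u1 - x)"
        then have "l1 < y" "y < u1" by (auto simp: abs_less_iff)
        then have "g y = g x" using 1(5)[of x y] 1(5)[of y x] x r by (cases x y rule: linorder_cases) auto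
        then show "\<bar>g y - g x\<bar> < e" using e by simp
      qed
    qed
    then show ?thesis using 1(2) by (intro exI[of _ l1] exI[of _ u1]) simp
  qed
  then obtain l2 u2 where 2: "l1 \<le> l2" "l2 < u2" "u2 \<le> u1" "\<And>x. l2 < x \<Longrightarrow> x < u2 \<Longrightarrow> cont1 g x" by blast
  show thesis
  proof (rule that[OF _ _ _ 1(4)])
    show "l \<le> l2" "l2 < u2" "u2 \<le> u" using 1 2 by auto
    show "r (g x) (g y)" if "l2 < x" "x < y" "y < u2" for x y using 1(5)[of x y] 2 that by simp
  qed (rule 2)
qed

end

section \<open>Boxes, generic continuity and the Fubini property\<close>

text \<open>
  Points of \<open>M^n\<close> are functions on \<open>nat\<close> of which only the first \<open>n\<close> values matter.
\<close>

definition box :: "nat \<Rightarrow> (nat \<Rightarrow> 'k::linordered_field) \<Rightarrow> (nat \<Rightarrow> 'k) \<Rightarrow> (nat \<Rightarrow> 'k) set" where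
  "box n l u = {x. \<forall>i<n. l i < x i \<and> x i < u i}"

definition good :: "nat \<Rightarrow> (nat \<Rightarrow> 'k::linordered_field) \<Rightarrow> (nat \<Rightarrow> 'k) \<Rightarrow> bool" where
  "good n l u \<longleftrightarrow> (\<forall>i<n. l i < u i)"

definition fat :: "nat \<Rightarrow> ((nat \<Rightarrow> 'k::linordered_field) \<Rightarrow> bool) \<Rightarrow> bool" where
  "fat n P \<longleftrightarrow> (\<exists>l u. good n l u \<and> (\<forall>x\<in>box n l u. P x))"

definition contn :: "nat \<Rightarrow> ((nat \<Rightarrow> 'k::linordered_field) \<Rightarrow> 'k) \<Rightarrow> (nat \<Rightarrow> 'k) \<Rightarrow> bool" where
  "contn n f x \<longleftrightarrow> (\<forall>e>0. \<exists>d>0. \<forall>y. (\<forall>i<n. \<bar>y i - x i\<bar> < d) \<longrightarrow> \<bar>f y - f x\<bar> < e)"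

definition mid :: "(nat \<Rightarrow> 'k::linordered_field) \<Rightarrow> (nat \<Rightarrow> 'k) \<Rightarrow> nat \<Rightarrow> 'k" where
  "mid l u i = (l i + u i) / 2"

definition cat :: "nat \<Rightarrow> (nat \<Rightarrow> 'k) \<Rightarrow> (nat \<Rightarrow> 'k) \<Rightarrow> nat \<Rightarrow> 'k" where
  "cat n x z i = (if i < n then x i else z (i - n))"

lemma mid_in_box: "good n l u \<Longrightarrow> mid l u \<in> box n l u"
  by (simp add: good_def box_def mid_def)

lemma good_Suc: "good (Suc n) l u \<longleftrightarrow> good n l u \<and> l n < u n"
  by (auto simp: good_def less_Suc_eq)

lemma box_Suc: "x \<in> box (Suc n) l u \<longleftrightarrow> x \<in> box n l u \<and> l n < x n \<and> x n < u n"
  by (auto simp: box_def less_Suc_eq)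

lemma box_upd: "x(n := t) \<in> box n l u \<longleftrightarrow> x \<in> box n l u"
  by (simp add: box_def)

lemma box_upd_bounds: "box n (l(n := a)) (u(n := b)) = box n l u"
  by (simp add: box_def)

lemma box_open:
  assumes "y \<in> box n l u"
  shows "\<exists>d>0. \<forall>x. (\<forall>i<n. \<bar>x i - y i\<bar> < d) \<longrightarrow> x \<in> box n l u"
  using assms
proof (induction n)
  case 0
  then show ?case by (intro exI[of _ 1]) (simp add: box_def)
next
  case (Suc n)
  then obtain d where d: "d > 0" "\<forall>x. (\<forall>i<n. \<bar>x i - y i\<bar> < d) \<longrightarrow> x \<in> box n l u"
    by (auto simp: box_Suc)
  define e where "e = min d (min (y n - l n) (u n - y n))"
  have e: "e > 0" "e \<le> d" "e \<le> y n - l n" "e \<le> u n - y n" using Suc.prems d by (auto simp: e_def box_Suc)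
  have "x \<in> box (Suc n) l u" if x: "\<forall>i<Suc n. \<bar>x i - y i\<bar> < e" for x
  proof -
    have "\<forall>i<n. \<bar>x i - y i\<bar> < d" using x e by (meson less_SucI less_le_trans)
    moreover have "\<bar>x n - y n\<bar> < e" using x by simp
    then have "l n < x n" "x n < u n" using e by (auto simp: abs_less_iff)
    ultimately show ?thesis using d by (simp add: box_Suc)
  qed
  then show ?case using e by blast
qed

lemma contn_box:
  assumes "contn n f x" "x \<in> box n l u" "e > 0"
  shows "\<exists>l' u'. good n l' u' \<and> box n l' u' \<subseteq> box n l u \<and> x \<in> box n l' u' \<and> (\<forall>y\<in>box n l' u'. \<bar>f y - f x\<bar> < e)"
proof -
  obtain d where d: "d > 0" "\<forall>y. (\<forall>i<n. \<bar>y i - x i\<bar> < d) \<longrightarrow> y \<in> box n l u"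
    using box_open[OF assms(2)] by blast
  obtain d' where d': "d' > 0" "\<forall>y. (\<forall>i<n. \<bar>y i - x i\<bar> < d') \<longrightarrow> \<bar>f y - f x\<bar> < e"
    using assms unfolding contn_def by blast
  define m where "m = min d d'"
  have m: "m > 0" "m \<le> d" "m \<le> d'" using d d' by (auto simp: m_def)
  have near: "\<forall>i<n. \<bar>y i - x i\<bar> < m" if "y \<in> box n (\<lambda>i. x i - m) (\<lambda>i. x i + m)" for y
    using that by (auto simp: box_def abs_less_iff algebra_simps)
  have a: "y \<in> box n l u" "\<bar>f y - f x\<bar> < e" if "y \<in> box n (\<lambda>i. x i - m) (\<lambda>i. x i + m)" for y
  proof -
    have "\<forall>i<n. \<bar>y i - x i\<bar> < d" "\<forall>i<n. \<bar>y i - x i\<bar> < d'"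
      using near[OF that] m by (meson less_le_trans)+
    then show "y \<in> box n l u" "\<bar>f y - f x\<bar> < e" using d d' by blast+
  qed
  show ?thesis
  proof (intro exI conjI)
    show "good n (\<lambda>i. x i - m) (\<lambda>i. x i + m)" "x \<in> box n (\<lambda>i. x i - m) (\<lambda>i. x i + m)"
      using m by (simp_all add: good_def box_def)
  qed (use a in blast)+
qed

lemma contn_box_multi:
  assumes "\<And>j. j < (k::nat) \<Longrightarrow> contn n (f j) x \<and> e j > 0" "x \<in> box n l u"
  shows "\<exists>l' u'. good n l' u' \<and> box n l' u' \<subseteq> box n l u \<and> x \<in> box n l' u' \<and> (\<forall>j<k. \<forall>y\<in>box n l' u'. \<bar>f j y - f j x\<bar> < e j)"
  using assms(1)
proof (induction k)
  case 0
  show ?case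
  proof (intro exI conjI)
    show "good n l u" using assms(2) by (auto simp: good_def box_def intro: less_trans)
    show "x \<in> box n l u" by (rule assms)
  qed auto
next
  case (Suc k)
  have "\<exists>l' u'. good n l' u' \<and> box n l' u' \<subseteq> box n l u \<and> x \<in> box n l' u' \<and> (\<forall>j<k. \<forall>y\<in>box n l' u'. \<bar>f j y - f j x\<bar> < e j)"
  proof (rule Suc.IH)
    show "contn n (f j) x \<and> e j > 0" if "j < k" for j by (rule Suc.prems) (use that in simp)
  qed
  then obtain l' u' where 1: "good n l' u'" "box n l' u' \<subseteq> box n l u" "x \<in> box n l' u'"
    "\<forall>j<k. \<forall>y\<in>box n l' u'. \<bar>f j y - f j x\<bar> < e j" by blast
  have "contn n (f k) x" "e k > 0" using Suc.prems by auto
  from contn_box[OF this(1) 1(3) this(2)] obtain l2 u2 where 2: "good n l2 u2" "box n l2 u2 \<subseteq> box n l' u'" "x \<in> box n l2 u2"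
    "\<forall>y\<in>box n l2 u2. \<bar>f k y - f k x\<bar> < e k" by blast
  show ?case
  proof (intro exI conjI)
    show "\<forall>j<Suc k. \<forall>y\<in>box n l2 u2. \<bar>f j y - f j x\<bar> < e j"
      using 1(4) 2(2,4) unfolding less_Suc_eq by blast
  qed (use 1 2 in auto)
qed

text \<open>Every \<open>P j\<close> can be reached inside an arbitrary box, hence finitely many of
  them are reached by shrinking repeatedly.\<close>

lemma box_all:
  assumes "\<And>j l u. j < k \<Longrightarrow> good n l u \<Longrightarrow> \<exists>l' u'. good n l' u' \<and> box n l' u' \<subseteq> box n l u \<and> (\<forall>x\<in>box n l' u'. P j x)"
    and "good n l u"
  shows "\<exists>l' u'. good n l' u' \<and> box n l' u' \<subseteq> box n l u \<and> (\<forall>j<(k::nat). \<forall>x\<in>box n l' u'. P j x)"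
  using assms(1)
proof (induction k)
  case 0
  show ?case using assms(2) by (intro exI[of _ l] exI[of _ u]) simp
next
  case (Suc k)
  have "\<exists>l' u'. good n l' u' \<and> box n l' u' \<subseteq> box n l u \<and> (\<forall>j<k. \<forall>x\<in>box n l' u'. P j x)"
  proof (rule Suc.IH)
    show "\<exists>l' u'. good n l' u' \<and> box n l' u' \<subseteq> box n l u \<and> (\<forall>x\<in>box n l' u'. P j x)" if "j < k" "good n l u" for j l u
      by (rule Suc.prems) (use that in simp_all)
  qed
  then obtain l' u' where 1: "good n l' u'" "box n l' u' \<subseteq> box n l u" "\<forall>j<k. \<forall>x\<in>box n l' u'. P j x"
    by blast
  from Suc.prems[OF lessI 1(1)] obtain l2 u2 where 2: "good n l2 u2" "box n l2 u2 \<subseteq> box n l' u'" "\<forall>x\<in>box n l2 u2. P k x"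
    by blast
  show ?case
  proof (intro exI conjI)
    show "\<forall>j<Suc k. \<forall>x\<in>box n l2 u2. P j x"
      using 1(3) 2(2,3) unfolding less_Suc_eq by blast
  qed (use 1 2 in auto)
qed

section \<open>Simultaneous induction: fat unions and generic continuity\<close>

context definable_predicates
begin

abbreviation W :: "nat \<Rightarrow> ((nat \<Rightarrow> 'k) \<Rightarrow> 'k) set" where "W \<equiv> V UNIV"

lemma Df_V_cong:
  assumes "Df (V A n) P" "\<And>i. i < n \<Longrightarrow> x i = y i"
  shows "P x = P y"
  using assms(1)
proof (rule DfE)
  fix R \<rho> assume 1: "\<forall>i. \<rho> i \<in> insert (\<lambda>_. 0) (V A n)" "\<forall>c. P c = R (\<lambda>i. \<rho> i c)"
  have "(\<lambda>i. \<rho> i x) = (\<lambda>i. \<rho> i y)"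
  proof
    show "\<rho> i x = \<rho> i y" for i using 1(1)[rule_format, of i] assms(2) by (auto simp: V_def)
  qed
  then show ?thesis using 1(2) by simp
qed

lemma Dt_V_cong:
  assumes "Dt (V A n) f" "\<And>i. i < n \<Longrightarrow> x i = y i"
  shows "f x = f y"
proof -
  have "Df (V A n) (\<lambda>z. f y = f z)" if "f y \<in> A" for y
    using assms(1) that by (intro Df_eq Dt_V)
  have "Df (V UNIV n) (\<lambda>z. f y = f z)"
  proof -
    have "Dt (V UNIV n) f" by (rule Dt_app[OF assms(1), where w = "\<lambda>c. c"]) (auto intro: Dt_V)
    then show ?thesis by (intro Df_eq Dt_V UNIV_I)
  qed
  then show ?thesis using Df_V_cong[of UNIV n "\<lambda>z. f y = f z" x y] assms(2) by simp
qed

lemma Dt_W_upd: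
  assumes "Dt (W (Suc n)) f" "full X" "\<And>i. i < n \<Longrightarrow> Dt X (\<lambda>c. x c i)" "Dt X s"
  shows "Dt X (\<lambda>c. f ((x c)(n := s c)))"
proof (rule Dt_app[OF assms(1)])
  show "Dt X (\<lambda>c. ((x c)(n := s c)) i)" if "i < Suc n" for i
    by (cases "i = n") (use that assms in auto)
qed (use assms in \<open>auto intro: Dt_const\<close>)

lemma Df_W_upd:
  assumes "Df (W (Suc n)) P" "full X" "\<And>i. i < n \<Longrightarrow> Dt X (\<lambda>c. x c i)" "Dt X s"
  shows "Df X (\<lambda>c. P ((x c)(n := s c)))"
proof (rule Df_app[OF assms(1)])
  show "Dt X (\<lambda>c. ((x c)(n := s c)) i)" if "i < Suc n" for i
    by (cases "i = n") (use that assms in auto)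
qed (use assms in \<open>auto intro: Dt_const\<close>)

lemma Dt_ext_subst:
  assumes "Dt (ext X) (\<lambda>p. F (fst p) (snd p))" "\<And>x. x \<in> X \<Longrightarrow> Dt Y (\<lambda>c. x (h c))" "Dt Y s"
  shows "Dt Y (\<lambda>c. F (h c) (s c))"
proof -
  have "Dt Y (\<lambda>c. (\<lambda>p. F (fst p) (snd p)) (h c, s c))"
    by (rule Dt_subst[OF assms(1)]) (auto simp: ext_def intro: assms)
  then show ?thesis by simp
qed

lemma Dt_exts_subst:
  assumes "Dt (exts n X) (\<lambda>p. F (fst p) (snd p))" "\<And>x. x \<in> X \<Longrightarrow> Dt Y (\<lambda>c. x (h c))" "\<And>i. i < n \<Longrightarrow> Dt Y (\<lambda>c. w c i)"
  shows "Dt Y (\<lambda>c. F (h c) (w c))"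
proof -
  have "Dt Y (\<lambda>c. (\<lambda>p. F (fst p) (snd p)) (h c, w c))"
    by (rule Dt_subst[OF assms(1)]) (auto simp: exts_def intro: assms)
  then show ?thesis by simp
qed

lemma Df_cont1:
  assumes F: "Dt (ext X) (\<lambda>p. F (fst p) (snd p))" and s: "Dt X s"
  shows "Df X (\<lambda>c. cont1 (F c) (s c))"
proof -
  have X: "Dt X x" if "x \<in> X" for x using that by (auto intro: Dt_coord)
  show ?thesis
    unfolding cont1_def by (intro def_rules Dt_ext_subst[OF F] s X)
qed

lemma Df_contn:
  assumes F: "Dt (exts n X) (\<lambda>p. F (fst p) (snd p))" and y: "\<And>i. i < n \<Longrightarrow> Dt X (\<lambda>c. y c i)"
  shows "Df X (\<lambda>c. contn n (F c) (y c))"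
proof -
  have X: "Dt X x" if "x \<in> X" for x using that by (auto intro: Dt_coord)
  have 1: "Dt X (\<lambda>c. F c (y c))"
    by (rule Dt_exts_subst[OF F, where h = "\<lambda>c. c"]) (auto intro: X y)
  have 2: "Dt (exts n (ext (ext X))) (\<lambda>p. F (fst (fst (fst p))) (snd p))"
    by (rule Dt_exts_subst[OF F], rule Dt_fsts[OF Dt_fst[OF Dt_fst[OF X]]], assumption, rule Dt_snds, assumption)
  have 3: "Dt (exts n (ext (ext X))) (\<lambda>p. F (fst (fst (fst p))) (y (fst (fst (fst p)))))"
    by (rule Dt_fsts[OF Dt_fst[OF Dt_fst[OF 1]]])
  have 5: "Dt (exts n (ext (ext X))) (\<lambda>p. snd (fst p))"
    by (rule Dt_fsts[OF Dt_snd])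
  have 6: "Dt (exts n (ext (ext X))) (\<lambda>p. snd (fst (fst p)))"
    by (rule Dt_fsts[OF Dt_fst[OF Dt_snd]])
  have 4: "Dt (exts n (ext (ext X))) (\<lambda>p. y (fst (fst (fst p))) i)" if "i < n" for i
    by (rule Dt_fsts[OF Dt_fst[OF Dt_fst[OF y[OF that]]]])
  show ?thesis
    unfolding contn_def
    by (intro Df_all Df_imp Df_ex Df_and Df_alls[where n = n] Df_less Df_all_less Dt_abs Dt_minus Dt_0 Dt_snd Dt_snds 2 3 4 5 6)
qed

lemma Df_box: "(\<And>i. i < n \<Longrightarrow> Dt X (\<lambda>c. x c i)) \<Longrightarrow> (\<And>i. i < n \<Longrightarrow> Dt X (\<lambda>c. l c i)) \<Longrightarrow>
    (\<And>i. i < n \<Longrightarrow> Dt X (\<lambda>c. u c i)) \<Longrightarrow> Df X (\<lambda>c. x c \<in> box n (l c) (u c))"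
  unfolding box_def mem_Collect_eq by (intro Df_all_less Df_and Df_less)

text \<open>This and the next property are proved together: the union property in n + 1 variables
  uses continuity in n variables to make intervals uniform, and continuity in n + 1 variables uses
  the union property in n + 1 variables.\<close>

definition union_property :: "nat \<Rightarrow> bool" where
  "union_property n \<longleftrightarrow> (\<forall>P Q. Df (W n) P \<longrightarrow> Df (W n) Q \<longrightarrow> fat n (\<lambda>x. P x \<or> Q x) \<longrightarrow> fat n P \<or> fat n Q)"

definition continuity_property :: "nat \<Rightarrow> bool" where
  "continuity_property n \<longleftrightarrow> (\<forall>f l u. Dt (W n) f \<longrightarrow> good n l u \<longrightarrow>
     (\<exists>l' u'. good n l' u' \<and> box n l' u' \<subseteq> box n l u \<and> (\<forall>x\<in>box n l' u'. contn n f x)))"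

text \<open>The endpoints of the intervals are chosen definably and are continuous on a smaller box.
  Near one point they move by less than \<eta>, a third of the length there, which leaves a common
  interval.\<close>

lemma uniform_interval:
  assumes C: "continuity_property n" and Q: "Df (exts 2 (W n)) (\<lambda>p. Q (fst p) (snd p 0) (snd p 1))"
    and her: "\<And>x a b a' b'. Q x a b \<Longrightarrow> a \<le> a' \<Longrightarrow> a' < b' \<Longrightarrow> b' \<le> b \<Longrightarrow> Q x a' b'"
    and lu: "good n l u" and ex: "\<And>x. x \<in> box n l u \<Longrightarrow> \<exists>a b. a < b \<and> Q x a b"
  shows "\<exists>l' u' a b. good n l' u' \<and> box n l' u' \<subseteq> box n l u \<and> a < b \<and> (\<forall>x\<in>box n l' u'. Q x a b)"
proof -
  define Q' where "Q' x w \<longleftrightarrow> w 0 < w 1 \<and> Q x (w 0) (w 1)" for x and w :: "nat \<Rightarrow> 'k"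
  have "Df (exts 2 (W n)) (\<lambda>p. Q' (fst p) (snd p))"
    unfolding Q'_def by (intro Df_and Df_less Q Dt_snds) simp_all
  from definable_choices[OF this] obtain F where F: "\<forall>i<2. Dt (W n) (\<lambda>c. F c i)" "\<forall>c w. Q' c w \<longrightarrow> Q' c (F c)"
    by blast
  have dF: "Dt (W n) (\<lambda>c. F c 0)" "Dt (W n) (\<lambda>c. F c 1)" using F(1) by simp_all
  have QF: "F x 0 < F x 1 \<and> Q x (F x 0) (F x 1)" if x: "x \<in> box n l u" for x
  proof -
    obtain a b where "a < b" "Q x a b" using ex[OF x] by blast
    then have "Q' x (\<lambda>i. if i = 0 then a else b)" by (simp add: Q'_def)
    then have "Q' x (F x)" using F(2) by blast
    then show ?thesis by (simp add: Q'_def)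
  qed
  obtain l1 u1 where 1: "good n l1 u1" "box n l1 u1 \<subseteq> box n l u" "\<forall>x\<in>box n l1 u1. contn n (\<lambda>c. F c 0) x"
    using C dF(1) lu unfolding continuity_property_def by blast
  obtain l2 u2 where 2: "good n l2 u2" "box n l2 u2 \<subseteq> box n l1 u1" "\<forall>x\<in>box n l2 u2. contn n (\<lambda>c. F c 1) x"
    using C dF(2) 1(1) unfolding continuity_property_def by blast
  define x0 where "x0 = mid l2 u2"
  have x0: "x0 \<in> box n l2 u2" using 2 by (simp add: x0_def mid_in_box)
  then have x0': "x0 \<in> box n l1 u1" "x0 \<in> box n l u" using 1 2 by auto
  define \<eta> where "\<eta> = (F x0 1 - F x0 0) / 3"
  have \<eta>: "\<eta> > 0" "F x0 0 + \<eta> < F x0 1 - \<eta>" using QF[OF x0'(2)] by (simp_all add: \<eta>_def field_simps)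
  have c: "contn n (\<lambda>c. F c 0) x0" "contn n (\<lambda>c. F c 1) x0" using 1 2 x0 x0' by auto
  obtain l3 u3 where 3: "good n l3 u3" "box n l3 u3 \<subseteq> box n l2 u2" "x0 \<in> box n l3 u3" "\<forall>y\<in>box n l3 u3. \<bar>F y 0 - F x0 0\<bar> < \<eta>"
    using contn_box[OF c(1) x0 \<eta>(1)] by blast
  obtain l4 u4 where 4: "good n l4 u4" "box n l4 u4 \<subseteq> box n l3 u3" "x0 \<in> box n l4 u4" "\<forall>y\<in>box n l4 u4. \<bar>F y 1 - F x0 1\<bar> < \<eta>"
    using contn_box[OF c(2) 3(3) \<eta>(1)] by blast
  have "Q x (F x0 0 + \<eta>) (F x0 1 - \<eta>)" if x: "x \<in> box n l4 u4" for x
  proof (rule her[OF _ _ \<eta>(2)])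
    have "x \<in> box n l u" using x 1 2 3 4 by blast
    then show "Q x (F x 0) (F x 1)" using QF by blast
    have "\<bar>F x 0 - F x0 0\<bar> < \<eta>" "\<bar>F x 1 - F x0 1\<bar> < \<eta>" using x 3 4 by blast+
    then show "F x 0 \<le> F x0 0 + \<eta>" "F x0 1 - \<eta> \<le> F x 1" by (auto simp: abs_less_iff)
  qed
  then show ?thesis using 1 2 3 4 \<eta> by (intro exI[of _ l4] exI[of _ u4] exI[of _ "F x0 0 + \<eta>"] exI[of _ "F x0 1 - \<eta>"]) auto
qed

definition fibre_fat :: "nat \<Rightarrow> ((nat \<Rightarrow> 'k) \<Rightarrow> bool) \<Rightarrow> (nat \<Rightarrow> 'k) \<Rightarrow> bool" where
  "fibre_fat n P x \<longleftrightarrow> (\<exists>a b. a < b \<and> (\<forall>t. a < t \<and> t < b \<longrightarrow> P (x(n := t))))"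

lemma Df_fibre_fat:
  assumes "Df (V A (Suc n)) P"
  shows "Df (V A n) (fibre_fat n P)"
proof -
  have P: "Df X (\<lambda>c. P ((x c)(n := s c)))" if "\<And>i. i < n \<Longrightarrow> Dt X (\<lambda>c. x c i)" "Dt X s" "\<And>a. a \<in> A \<Longrightarrow> Dt X (\<lambda>_. a)"
    for X :: "((((nat \<Rightarrow> 'k) \<times> 'k) \<times> 'k) \<times> 'k \<Rightarrow> 'k) set" and x s
  proof (rule Df_app[OF assms _ that(3)])
    show "Dt X (\<lambda>c. ((x c)(n := s c)) i)" if "i < Suc n" for i
      by (cases "i = n") (use that \<open>\<And>i. i < n \<Longrightarrow> Dt X (\<lambda>c. x c i)\<close> \<open>Dt X s\<close> in auto)
  qed
  have 1: "Df (ext (ext (ext (V A n)))) (\<lambda>p. P ((fst (fst (fst p)))(n := snd p)))"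
    by (rule P) (auto intro: Dt_snd Dt_fst[OF Dt_fst[OF Dt_fst[OF Dt_V(1)]]] Dt_fst[OF Dt_fst[OF Dt_fst[OF Dt_V(2)]]])
  show ?thesis
    unfolding fibre_fat_def by (intro df_intros dt_intros Dt_fst 1)
qed

text \<open>Half of a Fubini theorem: the intervals in the fibres over a box are made uniform on a
  smaller box, and the product is a box.\<close>

lemma fat_if_fibres_fat:
  assumes C: "continuity_property n" and P: "Df (W (Suc n)) P" and f: "fat n (fibre_fat n P)"
  shows "fat (Suc n) P"
proof -
  obtain l u where lu: "good n l u" "\<forall>x\<in>box n l u. fibre_fat n P x" using f by (auto simp: fat_def)
  have P': "Df (ext (exts 2 (W n))) (\<lambda>p. P ((fst (fst p))(n := snd p)))"
    by (rule Df_W_upd[OF P]) (auto intro: full_ext full_exts full_V Dt_snd Dt_fst[OF Dt_fsts[OF Dt_V(1)]])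
  have "Df (exts 2 (W n)) (\<lambda>p. \<forall>t. snd p 0 < t \<and> t < snd p 1 \<longrightarrow> P ((fst p)(n := t)))"
    by (intro df_intros dt_intros Dt_fst P') simp_all
  note dP = this
  have "\<exists>l' u' a b. good n l' u' \<and> box n l' u' \<subseteq> box n l u \<and> a < b \<and> (\<forall>x\<in>box n l' u'. \<forall>t. a < t \<and> t < b \<longrightarrow> P (x(n := t)))"
  proof (rule uniform_interval[OF C, where Q = "\<lambda>x a b. \<forall>t. a < t \<and> t < b \<longrightarrow> P (x(n := t))", OF dP _ lu(1)])
    show "\<forall>t. a' < t \<and> t < b' \<longrightarrow> P (x(n := t))"
      if "\<forall>t. a < t \<and> t < b \<longrightarrow> P (x(n := t))" "a \<le> a'" "b' \<le> b" for x a b a' b'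
    proof (intro allI impI)
      fix t assume "a' < t \<and> t < b'"
      then have "a < t \<and> t < b" using that(2,3) by simp
      then show "P (x(n := t))" using that(1) by blast
    qed
    show "\<exists>a b. a < b \<and> (\<forall>t. a < t \<and> t < b \<longrightarrow> P (x(n := t)))" if "x \<in> box n l u" for x
      using lu(2) that unfolding fibre_fat_def by blast
  qed
  then obtain l' u' a b where 1: "good n l' u'" "a < b" "\<forall>x\<in>box n l' u'. \<forall>t. a < t \<and> t < b \<longrightarrow> P (x(n := t))"
    by blast
  show ?thesis
    unfolding fat_def
  proof (intro exI conjI ballI)
    show "good (Suc n) (l'(n := a)) (u'(n := b))" using 1 by (simp add: good_Suc) (simp add: good_def)
    fix x assume "x \<in> box (Suc n) (l'(n := a)) (u'(n := b))"
    then have "x \<in> box n l' u'" "a < x n" "x n < b" by (simp_all add: box_Suc box_upd_bounds)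
    then have "P (x(n := x n))" using 1 by blast
    then show "P x" by simp
  qed
qed

lemma union_property_0: "union_property 0"
  unfolding union_property_def fat_def good_def box_def
proof (intro allI impI)
  fix P Q :: "(nat \<Rightarrow> 'k) \<Rightarrow> bool"
  assume d: "Df (W 0) P" "Df (W 0) Q" and "\<exists>l u. (\<forall>i<0. l i < u i) \<and> (\<forall>x\<in>{x :: nat \<Rightarrow> 'k. \<forall>i<0. l i < x i \<and> x i < u i}. P x \<or> Q x)"
  then have "P x \<or> Q x" for x by simp
  moreover have "P x = P y" "Q x = Q y" for x y using Df_V_cong[OF d(1)] Df_V_cong[OF d(2)] by simp_all
  ultimately have "(\<forall>x. P x) \<or> (\<forall>x. Q x)" by metis
  then show "(\<exists>l u. (\<forall>i<0. l i < u i) \<and> (\<forall>x\<in>{x. \<forall>i<0. l i < x i \<and> x i < u i}. P x)) \<or>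
    (\<exists>l u. (\<forall>i<0. l i < u i) \<and> (\<forall>x\<in>{x. \<forall>i<0. l i < x i \<and> x i < u i}. Q x))" by simp
qed

lemma continuity_property_0: "continuity_property 0"
  unfolding continuity_property_def
proof (intro allI impI)
  fix f and l u :: "nat \<Rightarrow> 'k" assume "Dt (W 0) f" "good 0 l u"
  moreover have "f x = f y" for x y using Dt_V_cong[OF \<open>Dt (W 0) f\<close>] by simp
  then have "contn 0 f x" for x unfolding contn_def by (metis abs_zero diff_self)
  ultimately show "\<exists>l' u'. good 0 l' u' \<and> box 0 l' u' \<subseteq> box 0 l u \<and> (\<forall>x\<in>box 0 l' u'. contn 0 f x)"
    by blast
qed

text \<open>In every fibre over the box an interval is covered, and \<open>interval_split\<close>
  assigns a part of it to P or to Q. The union property in n variables makes one of the two cases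
  prevail on a box.\<close>

lemma union_property_Suc:
  assumes C: "continuity_property n" and U: "union_property n"
  shows "union_property (Suc n)"
  unfolding union_property_def
proof (intro allI impI)
  fix P Q assume d: "Df (W (Suc n)) P" "Df (W (Suc n)) Q" and "fat (Suc n) (\<lambda>x. P x \<or> Q x)"
  then obtain l u where lu: "good (Suc n) l u" "\<forall>x\<in>box (Suc n) l u. P x \<or> Q x" by (auto simp: fat_def)
  have "fibre_fat n P x \<or> fibre_fat n Q x" if x: "x \<in> box n l u" for x
  proof -
    have d1: "Df X1 (\<lambda>t. P (x(n := t)))" "Df X1 (\<lambda>t. Q (x(n := t)))"
      by (rule Df_W_upd[OF d(1)] Df_W_upd[OF d(2)]; intro full_X1 Dt_const Dt_X1)+
    have "P (x(n := t)) \<or> Q (x(n := t))" if "l n < t" "t < u n" for t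
      using lu(2)[rule_format, of "x(n := t)"] x that by (simp add: box_Suc box_upd)
    note PQ = this
    have ln: "l n < u n" using lu(1) by (simp add: good_Suc)
    obtain l' u' where "l n \<le> l'" "l' < u'" "u' \<le> u n"
      "(\<forall>t. l' < t \<and> t < u' \<longrightarrow> P (x(n := t))) \<or> (\<forall>t. l' < t \<and> t < u' \<longrightarrow> Q (x(n := t)))"
      by (rule interval_split[OF d1 ln PQ])
    then show ?thesis unfolding fibre_fat_def by blast
  qed
  then have "fat n (\<lambda>x. fibre_fat n P x \<or> fibre_fat n Q x)"
    using lu unfolding fat_def good_Suc by blast
  then have "fat n (fibre_fat n P) \<or> fat n (fibre_fat n Q)"
    using U Df_fibre_fat[OF d(1)] Df_fibre_fat[OF d(2)] unfolding union_property_def by blast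
  then show "fat (Suc n) P \<or> fat (Suc n) Q"
    using fat_if_fibres_fat[OF C d(1)] fat_if_fibres_fat[OF C d(2)] by blast
qed

text \<open>Monotonicity in the last variable turns separate continuity into joint continuity: near
  y, the function is squeezed between its values on two nearby hyperplanes, where it is continuous
  in the first n variables.\<close>

lemma continuity_property_Suc:
  assumes C: "continuity_property n" and U: "union_property (Suc n)"
  shows "continuity_property (Suc n)"
  unfolding continuity_property_def
proof (intro allI impI)
  fix f and l u :: "nat \<Rightarrow> 'k" assume f: "Dt (W (Suc n)) f" and lu: "good (Suc n) l u"
  \<comment> \<open>Only the interval is uniform in x. Whether f increases or decreases may depend
    on x, hence the disjunction within Q.\<close>
  define Q where "Q x a b \<longleftrightarrow> l n \<le> a \<and> b \<le> u n \<and>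
     ((\<forall>s t. a < s \<and> s < t \<and> t < b \<longrightarrow> f (x(n := s)) \<le> f (x(n := t))) \<or>
      (\<forall>s t. a < s \<and> s < t \<and> t < b \<longrightarrow> f (x(n := t)) \<le> f (x(n := s)))) \<and>
     (\<forall>t. a < t \<and> t < b \<longrightarrow> cont1 (\<lambda>s. f (x(n := s))) t)" for x :: "nat \<Rightarrow> 'k" and a b :: 'k
  have f': "Dt (ext (exts 2 (W n))) (\<lambda>p. f ((fst (fst p))(n := snd p)))"
    by (rule Dt_W_upd[OF f]) (auto intro: full_ext full_exts full_V Dt_snd Dt_fst[OF Dt_fsts[OF Dt_V(1)]])
  have f'': "Dt (ext (ext (exts 2 (W n)))) (\<lambda>p. f ((fst (fst (fst p)))(n := snd p)))"
    "Dt (ext (ext (exts 2 (W n)))) (\<lambda>p. f ((fst (fst (fst p)))(n := snd (fst p))))"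
    by (rule Dt_W_upd[OF f]; auto intro: full_ext full_exts full_V Dt_snd Dt_fst[OF Dt_snd] Dt_fst[OF Dt_fst[OF Dt_fsts[OF Dt_V(1)]]])+
  have c: "Df (ext (exts 2 (W n))) (\<lambda>p. cont1 (\<lambda>s. f ((fst (fst p))(n := s))) (snd p))"
    by (rule Df_cont1[OF f''(1) Dt_snd])
  have Qd: "Df (exts 2 (W n)) (\<lambda>p. Q (fst p) (snd p 0) (snd p 1))"
    unfolding Q_def by (intro df_intros dt_intros Dt_fst Dt_const full_exts full_V f'' c) simp_all
  have her: "Q x a' b'" if "Q x a b" "a \<le> a'" "a' < b'" "b' \<le> b" for x a b a' b'
  proof -
    have "a < t" if "a' < t" for t using \<open>a \<le> a'\<close> that by simp
    moreover have "t < b" if "t < b'" for t using \<open>b' \<le> b\<close> that by simp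
    moreover have "l n \<le> a'" "b' \<le> u n" using that unfolding Q_def by auto
    ultimately show ?thesis using that(1) unfolding Q_def by blast
  qed
  have ex: "\<exists>a b. a < b \<and> Q x a b" if "x \<in> box n l u" for x
  proof -
    have g: "Dt X1 (\<lambda>t. f (x(n := t)))"
      by (rule Dt_W_upd[OF f]; intro full_X1 Dt_const Dt_X1)
    have "l n < u n" using lu by (simp add: good_Suc)
    from monotone_continuous_on_subinterval[OF g this] obtain l' u' r where 1: "l n \<le> l'" "l' < u'" "u' \<le> u n"
      "r \<in> {(<), (=), (>)}" "\<And>s t. l' < s \<Longrightarrow> s < t \<Longrightarrow> t < u' \<Longrightarrow> r (f (x(n := s))) (f (x(n := t)))"
      "\<And>t. l' < t \<Longrightarrow> t < u' \<Longrightarrow> cont1 (\<lambda>t. f (x(n := t))) t" by blast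
    have "(\<forall>s t. l' < s \<and> s < t \<and> t < u' \<longrightarrow> f (x(n := s)) \<le> f (x(n := t))) \<or>
      (\<forall>s t. l' < s \<and> s < t \<and> t < u' \<longrightarrow> f (x(n := t)) \<le> f (x(n := s)))"
      using 1(4)
    proof (elim insertE emptyE)
      assume r: "r = (<)"
      have "f (x(n := s)) \<le> f (x(n := t))" if "l' < s" "s < t" "t < u'" for s t using 1(5)[OF that] r by simp
      then show ?thesis by blast
    next
      assume r: "r = (=)"
      have "f (x(n := s)) \<le> f (x(n := t))" if "l' < s" "s < t" "t < u'" for s t using 1(5)[OF that] r by simp
      then show ?thesis by blast
    next
      assume r: "r = (>)"
      have "f (x(n := t)) \<le> f (x(n := s))" if "l' < s" "s < t" "t < u'" for s t using 1(5)[OF that] r by simp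
      then show ?thesis by blast
    qed
    then have "Q x l' u'" unfolding Q_def using 1(1,3,6) by simp
    then show ?thesis using 1(2) by blast
  qed
  have "good n l u" using lu by (simp add: good_Suc)
  note gnlu = this
  have "\<exists>l' u' a b. good n l' u' \<and> box n l' u' \<subseteq> box n l u \<and> a < b \<and> (\<forall>x\<in>box n l' u'. Q x a b)"
    using C Qd
  proof (rule uniform_interval[OF _ _ _ gnlu])
    show "Q x a' b'" if "Q x a b" "a \<le> a'" "a' < b'" "b' \<le> b" for x a b a' b'
      using that by (rule her)
    show "\<exists>a b. a < b \<and> Q x a b" if "x \<in> box n l u" for x
      using that by (rule ex)
  qed
  then obtain l1 u1 a b where 1: "good n l1 u1" "box n l1 u1 \<subseteq> box n l u" "a < b"
    "\<forall>x\<in>box n l1 u1. Q x a b" by blast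
  define B where "B = box (Suc n) (l1(n := a)) (u1(n := b))"
  have inB: "y \<in> B \<longleftrightarrow> y \<in> box n l1 u1 \<and> a < y n \<and> y n < b" for y
    unfolding B_def by (simp add: box_Suc box_upd_bounds)
  \<comment> \<open>Continuity in the first n variables with the last one fixed. Failure on a box
    would mean failure on a box in a hyperplane, against the continuity property in n
    variables.\<close>
  define G where "G y = contn n (\<lambda>x. f (x(n := y n))) y" for y
  have dG: "Df (W (Suc n)) G"
    unfolding G_def
  proof (rule Df_contn)
    show "Dt (exts n (W (Suc n))) (\<lambda>p. f ((snd p)(n := fst p n)))"
      by (rule Dt_W_upd[OF f]) (auto intro: full_exts full_V Dt_snds Dt_fsts[OF Dt_V(1)])
  qed (auto intro: Dt_V)
  have dB: "Df (W (Suc n)) (\<lambda>y. y \<in> B)"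
    unfolding B_def by (rule Df_box) (auto intro: Dt_V)
  have goodB: "good (Suc n) (l1(n := a)) (u1(n := b))" using 1 by (auto simp: good_def less_Suc_eq)
  have "fat (Suc n) (\<lambda>y. (y \<in> B \<and> G y) \<or> (y \<in> B \<and> \<not> G y))"
    unfolding fat_def B_def using goodB by blast
  then have "fat (Suc n) (\<lambda>y. y \<in> B \<and> G y) \<or> fat (Suc n) (\<lambda>y. y \<in> B \<and> \<not> G y)"
    using U Df_and[OF dB dG] Df_and[OF dB Df_not[OF dG]] unfolding union_property_def by blast
  moreover have "\<not> fat (Suc n) (\<lambda>y. y \<in> B \<and> \<not> G y)"
  proof
    assume "fat (Suc n) (\<lambda>y. y \<in> B \<and> \<not> G y)"
    then obtain l2 u2 where 2: "good (Suc n) l2 u2" "\<forall>y\<in>box (Suc n) l2 u2. y \<in> B \<and> \<not> G y"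
      by (auto simp: fat_def)
    define t where "t = (l2 n + u2 n) / 2"
    have t: "l2 n < t" "t < u2 n" using 2 by (auto simp: t_def good_Suc)
    have "Dt (W n) (\<lambda>x. f (x(n := t)))"
      by (rule Dt_W_upd[OF f]) (auto intro: full_V Dt_const Dt_V)
    moreover have "good n l2 u2" using 2 by (simp add: good_Suc)
    ultimately obtain l3 u3 where 3: "good n l3 u3" "box n l3 u3 \<subseteq> box n l2 u2" "\<forall>x\<in>box n l3 u3. contn n (\<lambda>x. f (x(n := t))) x"
      using C unfolding continuity_property_def by blast
    define x where "x = mid l3 u3"
    have x: "x \<in> box n l3 u3" using 3 by (simp add: x_def mid_in_box)
    then have "contn n (\<lambda>x. f (x(n := t))) x" using 3 by blast
    then have "G (x(n := t))" unfolding G_def contn_def by simp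
    moreover have "x(n := t) \<in> box (Suc n) l2 u2" using x 3 t by (auto simp: box_Suc box_upd)
    ultimately show False using 2 by blast
  qed
  ultimately have "fat (Suc n) (\<lambda>y. y \<in> B \<and> G y)" by blast
  then obtain l2 u2 where 2: "good (Suc n) l2 u2" "\<forall>y\<in>box (Suc n) l2 u2. y \<in> B \<and> G y"
    unfolding fat_def by blast
  have "contn (Suc n) f y" if y: "y \<in> box (Suc n) l2 u2" for y
    unfolding contn_def
  proof (intro allI impI)
    fix e :: 'k assume e: "e > 0"
    have yB: "y \<in> B" using 2 y by blast
    have yn: "l2 n < y n" "y n < u2 n" using y by (auto simp: box_Suc)
    have "cont1 (\<lambda>s. f (y(n := s))) (y n)" using 1(4) yB unfolding inB Q_def by blast
    moreover have "e / 2 > 0" using e by simp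
    ultimately obtain d1 where d1: "d1 > 0" "\<forall>s. \<bar>s - y n\<bar> < d1 \<longrightarrow> \<bar>f (y(n := s)) - f (y(n := y n))\<bar> < e / 2"
      unfolding cont1_def by blast
    \<comment> \<open>The hyperplanes at distance \<theta> below and above y must meet the box where
      G holds and be close enough for continuity in the last variable.\<close>
    define \<theta> where "\<theta> = min (d1 / 2) (min ((y n - l2 n) / 2) ((u2 n - y n) / 2))"
    have "0 < d1 / 2" "0 < (y n - l2 n) / 2" "0 < (u2 n - y n) / 2" using d1(1) yn by simp_all
    then have \<theta>: "\<theta> > 0" by (simp add: \<theta>_def)
    have "\<theta> \<le> d1 / 2" "\<theta> \<le> (y n - l2 n) / 2" "\<theta> \<le> (u2 n - y n) / 2"
      unfolding \<theta>_def by (rule min.cobounded1, rule min.coboundedI2[OF min.cobounded1], rule min.coboundedI2[OF min.cobounded2])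
    moreover have "d1 / 2 < d1" "(y n - l2 n) / 2 < y n - l2 n" "(u2 n - y n) / 2 < u2 n - y n" using d1(1) yn by simp_all
    ultimately have \<theta>': "\<theta> < d1" "\<theta> < y n - l2 n" "\<theta> < u2 n - y n" by (meson le_less_trans)+
    define r1 where "r1 = y n - \<theta>"
    define r2 where "r2 = y n + \<theta>"
    have near: "\<bar>f (y(n := r1)) - f y\<bar> < e / 2" "\<bar>f (y(n := r2)) - f y\<bar> < e / 2"
      using d1(2)[rule_format, of r1] d1(2)[rule_format, of r2] \<theta> \<theta>' by (simp_all add: r1_def r2_def)
    have in2: "y(n := r1) \<in> box (Suc n) l2 u2" "y(n := r2) \<in> box (Suc n) l2 u2"
      using y \<theta> \<theta>' by (simp_all add: box_Suc box_upd r1_def r2_def)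
    have "y(n := r1) \<in> B" "y(n := r2) \<in> B" and G12: "G (y(n := r1))" "G (y(n := r2))" using in2 2 by blast+
    then have r12: "a < r1" "r1 < r2" "r2 < b" using \<theta> unfolding inB by (simp_all add: r1_def r2_def)
    have e2: "e / 2 > 0" using e by simp
    obtain d2 where d2: "d2 > 0" "\<forall>x. (\<forall>i<n. \<bar>x i - (y(n := r1)) i\<bar> < d2) \<longrightarrow> \<bar>f (x(n := r1)) - f (y(n := r1))\<bar> < e / 2"
      using G12(1) e2 unfolding G_def contn_def fun_upd_upd fun_upd_same by blast
    obtain d3 where d3: "d3 > 0" "\<forall>x. (\<forall>i<n. \<bar>x i - (y(n := r2)) i\<bar> < d3) \<longrightarrow> \<bar>f (x(n := r2)) - f (y(n := r2))\<bar> < e / 2"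
      using G12(2) e2 unfolding G_def contn_def fun_upd_upd fun_upd_same by blast
    have "y \<in> box n l1 u1" using yB by (simp add: inB)
    from box_open[OF this] obtain d4 where d4: "d4 > 0" "\<forall>x. (\<forall>i<n. \<bar>x i - y i\<bar> < d4) \<longrightarrow> x \<in> box n l1 u1" by blast
    define d where "d = min \<theta> (min d2 (min d3 d4))"
    have d: "d > 0" "d \<le> \<theta>" "d \<le> d2" "d \<le> d3" "d \<le> d4" using \<theta> d2 d3 d4 by (auto simp: d_def)
    show "\<exists>d>0. \<forall>z. (\<forall>i<Suc n. \<bar>z i - y i\<bar> < d) \<longrightarrow> \<bar>f z - f y\<bar> < e"
    proof (intro exI[of _ d] conjI allI impI)
      fix z assume z: "\<forall>i<Suc n. \<bar>z i - y i\<bar> < d"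
      have z2: "\<forall>i<n. \<bar>z i - (y(n := r1)) i\<bar> < d2" "\<forall>i<n. \<bar>z i - (y(n := r2)) i\<bar> < d3" "\<forall>i<n. \<bar>z i - y i\<bar> < d4"
      proof -
        have "\<bar>z i - y i\<bar> < d2 \<and> \<bar>z i - y i\<bar> < d3 \<and> \<bar>z i - y i\<bar> < d4" if "i < n" for i
          using z[rule_format, of i] d(3-5) that by linarith
        then show "\<forall>i<n. \<bar>z i - (y(n := r1)) i\<bar> < d2" "\<forall>i<n. \<bar>z i - (y(n := r2)) i\<bar> < d3" "\<forall>i<n. \<bar>z i - y i\<bar> < d4"
          by simp_all
      qed
      have "\<bar>f (z(n := r1)) - f (y(n := r1))\<bar> < e / 2" "\<bar>f (z(n := r2)) - f (y(n := r2))\<bar> < e / 2"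
        using d2(2) d3(2) z2 by blast+
      moreover have "e / 2 + e / 2 = e" by simp
      ultimately have n12: "\<bar>f (z(n := r1)) - f y\<bar> < e" "\<bar>f (z(n := r2)) - f y\<bar> < e" using near by linarith+
      have "\<bar>z n - y n\<bar> < \<theta>" using z d(2) by (meson lessI less_le_trans)
      then have zn: "r1 < z n" "z n < r2" unfolding r1_def r2_def by linarith+
      have "z \<in> box n l1 u1" using d4 z2 by blast
      then have "Q z a b" using 1(4) by blast
      then have "(\<forall>s t. a < s \<and> s < t \<and> t < b \<longrightarrow> f (z(n := s)) \<le> f (z(n := t))) \<or>
         (\<forall>s t. a < s \<and> s < t \<and> t < b \<longrightarrow> f (z(n := t)) \<le> f (z(n := s)))" unfolding Q_def by blast
      moreover have "a < z n" "z n < b" using r12 zn by linarith+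
      ultimately have "(f (z(n := r1)) \<le> f (z(n := z n)) \<and> f (z(n := z n)) \<le> f (z(n := r2))) \<or>
        (f (z(n := r2)) \<le> f (z(n := z n)) \<and> f (z(n := z n)) \<le> f (z(n := r1)))"
        using r12 zn by blast
      then show "\<bar>f z - f y\<bar> < e" using n12 unfolding fun_upd_triv by linarith
    qed (rule d)
  qed
  moreover have "box (Suc n) l2 u2 \<subseteq> box (Suc n) l u"
  proof
    fix y assume "y \<in> box (Suc n) l2 u2"
    then have "y \<in> B" using 2 by blast
    then have "y \<in> box n l1 u1" "a < y n" "y n < b" by (simp_all add: inB)
    moreover have "l n \<le> a" "b \<le> u n" using 1(4) \<open>y \<in> box n l1 u1\<close> unfolding Q_def by blast+
    ultimately show "y \<in> box (Suc n) l u" using 1(2) by (auto simp: box_Suc)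
  qed
  ultimately show "\<exists>l' u'. good (Suc n) l' u' \<and> box (Suc n) l' u' \<subseteq> box (Suc n) l u \<and> (\<forall>x\<in>box (Suc n) l' u'. contn (Suc n) f x)"
    using 2 by blast
qed

lemma union_and_continuity: "union_property n \<and> continuity_property n"
  by (induction n) (auto intro: union_property_0 continuity_property_0 union_property_Suc continuity_property_Suc)

lemma fat_union: "Df (W n) P \<Longrightarrow> Df (W n) Q \<Longrightarrow> fat n (\<lambda>x. P x \<or> Q x) \<Longrightarrow> fat n P \<or> fat n Q"
  using union_and_continuity[of n] unfolding union_property_def by blast

lemma continuous_on_subbox:
  "Dt (W n) f \<Longrightarrow> good n l u \<Longrightarrow> \<exists>l' u'. good n l' u' \<and> box n l' u' \<subseteq> box n l u \<and> (\<forall>x\<in>box n l' u'. contn n f x)"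
  using union_and_continuity[of n] unfolding continuity_property_def by blast

lemma fat_Suc_if_fibres_fat: "Df (W (Suc n)) P \<Longrightarrow> fat n (fibre_fat n P) \<Longrightarrow> fat (Suc n) P"
  using fat_if_fibres_fat union_and_continuity by blast

text \<open>The box is the union of its parts inside and outside P, and the second part is not fat.
  This converts statements about exceptional sets into statements on smaller boxes.\<close>

lemma subbox_if_not_fat:
  assumes "Df (W n) P" "\<not> fat n (\<lambda>x. \<not> P x)" "good n l u"
  shows "\<exists>l' u'. good n l' u' \<and> box n l' u' \<subseteq> box n l u \<and> (\<forall>x\<in>box n l' u'. P x)"
proof -
  have B: "Df (W n) (\<lambda>x. x \<in> box n l u)" by (rule Df_box) (auto intro: Dt_V)
  have "fat n (\<lambda>x. (x \<in> box n l u \<and> P x) \<or> (x \<in> box n l u \<and> \<not> P x))" using assms(3) unfolding fat_def by blast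
  then have "fat n (\<lambda>x. x \<in> box n l u \<and> P x) \<or> fat n (\<lambda>x. x \<in> box n l u \<and> \<not> P x)"
    by (rule fat_union[rotated 2]) (intro Df_and Df_not B assms)+
  moreover have "\<not> fat n (\<lambda>x. x \<in> box n l u \<and> \<not> P x)" using assms(2) unfolding fat_def by blast
  ultimately show ?thesis unfolding fat_def by blast
qed

text \<open>As for fibres of dimension one, but with 2n chosen bounds: \<open>w i\<close> and
  \<open>w (n + i)\<close> are the i-th lower and upper bound of a box in the fibre over z. The
  variables of the fibre come first.\<close>

lemma fat_if_tuple_fibres_fat:
  assumes S: "Df (W (n + r)) S" and f: "fat r (\<lambda>z. fat n (\<lambda>x. S (cat n x z)))"
  shows "fat (n + r) S"
proof -
  obtain l u where lu: "good r l u" "\<forall>z\<in>box r l u. fat n (\<lambda>x. S (cat n x z))" using f by (auto simp: fat_def)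
  define Q where "Q z w \<longleftrightarrow> (\<forall>i<n. w i < w (n + i)) \<and> (\<forall>x. (\<forall>i<n. w i < x i \<and> x i < w (n + i)) \<longrightarrow> S (cat n x z))" for z w
  have S': "Df (exts n (exts (n + n) (W r))) (\<lambda>p. S (cat n (snd p) (fst (fst p))))"
  proof (rule Df_app[OF S])
    show "Dt (exts n (exts (n + n) (W r))) (\<lambda>p. cat n (snd p) (fst (fst p)) i)" if "i < n + r" for i
      by (cases "i < n") (use that in \<open>auto simp: cat_def intro: Dt_snds Dt_fsts[OF Dt_fsts[OF Dt_V(1)]]\<close>)
  qed (intro Dt_const full_exts full_V)
  have "Df (exts (n + n) (W r)) (\<lambda>p. Q (fst p) (snd p))"
    unfolding Q_def by (intro Df_and Df_imp Df_all_less Df_alls[where n = n] Df_less Dt_snds Dt_fsts S') simp_all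
  from definable_choices[OF this] obtain F where F: "\<forall>i<n + n. Dt (W r) (\<lambda>z. F z i)" "\<forall>z w. Q z w \<longrightarrow> Q z (F z)"
    by blast
  have QF: "Q z (F z)" if z: "z \<in> box r l u" for z
  proof -
    obtain l' u' where lu': "good n l' u'" "\<forall>x\<in>box n l' u'. S (cat n x z)"
      using lu(2) z unfolding fat_def by blast
    then have "Q z (\<lambda>i. if i < n then l' i else u' (i - n))" unfolding Q_def by (auto simp: good_def box_def)
    then show ?thesis using F by blast
  qed
  have "\<exists>l' u'. good r l' u' \<and> box r l' u' \<subseteq> box r l u \<and> (\<forall>j<n + n. \<forall>z\<in>box r l' u'. contn r (\<lambda>z. F z j) z)"
    by (rule box_all[OF _ lu(1)]) (rule continuous_on_subbox, use F in auto)
  then obtain l1 u1 where 1: "good r l1 u1" "box r l1 u1 \<subseteq> box r l u" "\<forall>j<n + n. \<forall>z\<in>box r l1 u1. contn r (\<lambda>z. F z j) z"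
    by blast
  define z0 where "z0 = mid l1 u1"
  have z0: "z0 \<in> box r l1 u1" using 1 by (simp add: z0_def mid_in_box)
  have Fz0: "F z0 i < F z0 (n + i)" if "i < n" for i using QF[of z0] z0 1 that unfolding Q_def by blast
  define \<eta> where "\<eta> i = (F z0 (n + i) - F z0 i) / 3" for i
  have \<eta>: "\<eta> i > 0" "F z0 i + \<eta> i < F z0 (n + i) - \<eta> i" if "i < n" for i
    using Fz0[OF that] by (simp_all add: \<eta>_def field_simps)
  have "\<exists>l' u'. good r l' u' \<and> box r l' u' \<subseteq> box r l1 u1 \<and> z0 \<in> box r l' u' \<and>
     (\<forall>j<n + n. \<forall>z\<in>box r l' u'. \<bar>F z j - F z0 j\<bar> < \<eta> (if j < n then j else j - n))"
  proof (rule contn_box_multi[OF _ z0])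
    show "contn r (\<lambda>z. F z j) z0 \<and> 0 < \<eta> (if j < n then j else j - n)" if "j < n + n" for j
      using 1(3) z0 that \<eta>(1)[of j] \<eta>(1)[of "j - n"] by auto
  qed
  then obtain l2 u2 where 2: "good r l2 u2" "box r l2 u2 \<subseteq> box r l1 u1"
    "\<forall>j<n + n. \<forall>z\<in>box r l2 u2. \<bar>F z j - F z0 j\<bar> < \<eta> (if j < n then j else j - n)" by blast
  define l3 where "l3 = cat n (\<lambda>i. F z0 i + \<eta> i) l2"
  define u3 where "u3 = cat n (\<lambda>i. F z0 (n + i) - \<eta> i) u2"
  show ?thesis
    unfolding fat_def
  proof (intro exI conjI ballI)
    show "good (n + r) l3 u3"
      using \<eta>(2) 2(1) by (simp add: good_def l3_def u3_def cat_def)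
    fix y assume y: "y \<in> box (n + r) l3 u3"
    define z where "z i = y (n + i)" for i
    have yz: "y = cat n y z" by (auto simp: cat_def z_def)
    have z: "z \<in> box r l2 u2"
      unfolding box_def
    proof (intro CollectI allI impI)
      fix i assume "i < r"
      then have "l3 (n + i) < y (n + i) \<and> y (n + i) < u3 (n + i)" using y by (simp add: box_def)
      then show "l2 i < z i \<and> z i < u2 i" by (simp add: l3_def u3_def cat_def z_def)
    qed
    then have "Q z (F z)" using QF 1 2 by blast
    moreover have "F z i < y i \<and> y i < F z (n + i)" if i: "i < n" for i
    proof -
      have "l3 i < y i \<and> y i < u3 i" using y i by (simp add: box_def)
      then have "F z0 i + \<eta> i < y i" "y i < F z0 (n + i) - \<eta> i"
        using i by (simp_all add: l3_def u3_def cat_def)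
      moreover have "\<bar>F z i - F z0 i\<bar> < \<eta> i" "\<bar>F z (n + i) - F z0 (n + i)\<bar> < \<eta> i"
        using 2(3)[rule_format, of i z] 2(3)[rule_format, of "n + i" z] i z by simp_all
      ultimately show ?thesis by linarith
    qed
    ultimately have "S (cat n y z)" unfolding Q_def by blast
    then show "S y" using yz by simp
  qed
qed

end

section \<open>Differentiation of definable functions\<close>

definition has_deriv1 :: "('k::linordered_field \<Rightarrow> 'k) \<Rightarrow> 'k \<Rightarrow> 'k \<Rightarrow> bool" where
  "has_deriv1 g x d \<longleftrightarrow> (\<forall>e>0. \<exists>r>0. \<forall>h. h \<noteq> 0 \<and> \<bar>h\<bar> < r \<longrightarrow> \<bar>g (x + h) - g x - d * h\<bar> < e * \<bar>h\<bar>)"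

definition has_pderiv :: "((nat \<Rightarrow> 'k::linordered_field) \<Rightarrow> 'k) \<Rightarrow> nat \<Rightarrow> (nat \<Rightarrow> 'k) \<Rightarrow> 'k \<Rightarrow> bool" where
  "has_pderiv f i x d \<longleftrightarrow> has_deriv1 (\<lambda>t. f (x(i := t))) (x i) d"

lemma has_deriv1_unique:
  assumes "has_deriv1 g x d" "has_deriv1 g x d'"
  shows "d = d'"
proof (rule ccontr)
  assume "d \<noteq> d'"
  define e where "e = \<bar>d - d'\<bar> / 2"
  have e: "e > 0" using \<open>d \<noteq> d'\<close> by (simp add: e_def)
  obtain r where r: "r > 0" "\<forall>h. h \<noteq> 0 \<and> \<bar>h\<bar> < r \<longrightarrow> \<bar>g (x + h) - g x - d * h\<bar> < e * \<bar>h\<bar>"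
    using assms(1) e unfolding has_deriv1_def by blast
  obtain r' where r': "r' > 0" "\<forall>h. h \<noteq> 0 \<and> \<bar>h\<bar> < r' \<longrightarrow> \<bar>g (x + h) - g x - d' * h\<bar> < e * \<bar>h\<bar>"
    using assms(2) e unfolding has_deriv1_def by blast
  define h where "h = min r r' / 2"
  have h: "h > 0" "h < r" "h < r'" using r(1) r'(1) by (auto simp: h_def min_def)
  then have "\<bar>g (x + h) - g x - d * h\<bar> < e * h" "\<bar>g (x + h) - g x - d' * h\<bar> < e * h"
    using r(2)[rule_format, of h] r'(2)[rule_format, of h] by simp_all
  then have "\<bar>d' * h - d * h\<bar> < 2 * (e * h)" by linarith
  moreover have "\<bar>d' * h - d * h\<bar> = \<bar>d - d'\<bar> * h"
    using h(1) by (simp add: left_diff_distrib[symmetric] abs_mult abs_minus_commute)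
  moreover have "2 * (e * h) = \<bar>d - d'\<bar> * h" by (simp add: e_def)
  ultimately show False by simp
qed

lemma has_pderiv_unique: "has_pderiv f i x d \<Longrightarrow> has_pderiv f i x d' \<Longrightarrow> d = d'"
  unfolding has_pderiv_def by (rule has_deriv1_unique)

lemma has_deriv1_add:
  assumes "has_deriv1 f x a" "has_deriv1 g x b"
  shows "has_deriv1 (\<lambda>t. f t + g t) x (a + b)"
  unfolding has_deriv1_def
proof (intro allI impI)
  fix e :: 'a assume "e > 0"
  then have e: "e / 2 > 0" by simp
  obtain r where r: "r > 0" "\<forall>h. h \<noteq> 0 \<and> \<bar>h\<bar> < r \<longrightarrow> \<bar>f (x + h) - f x - a * h\<bar> < e / 2 * \<bar>h\<bar>"
    using assms(1) e unfolding has_deriv1_def by blast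
  obtain r' where r': "r' > 0" "\<forall>h. h \<noteq> 0 \<and> \<bar>h\<bar> < r' \<longrightarrow> \<bar>g (x + h) - g x - b * h\<bar> < e / 2 * \<bar>h\<bar>"
    using assms(2) e unfolding has_deriv1_def by blast
  show "\<exists>r>0. \<forall>h. h \<noteq> 0 \<and> \<bar>h\<bar> < r \<longrightarrow> \<bar>f (x + h) + g (x + h) - (f x + g x) - (a + b) * h\<bar> < e * \<bar>h\<bar>"
  proof (intro exI[of _ "min r r'"] conjI allI impI)
    fix h assume h: "h \<noteq> 0 \<and> \<bar>h\<bar> < min r r'"
    then have "\<bar>f (x + h) - f x - a * h\<bar> < e / 2 * \<bar>h\<bar>" "\<bar>g (x + h) - g x - b * h\<bar> < e / 2 * \<bar>h\<bar>"
      using r(2) r'(2) by simp_all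
    moreover have "e / 2 * \<bar>h\<bar> + e / 2 * \<bar>h\<bar> = e * \<bar>h\<bar>" by (simp add: distrib_right[symmetric])
    moreover have "(a + b) * h = a * h + b * h" by (simp add: distrib_right)
    ultimately show "\<bar>f (x + h) + g (x + h) - (f x + g x) - (a + b) * h\<bar> < e * \<bar>h\<bar>" by linarith
  qed (use r r' in simp)
qed

lemma has_deriv1_cmult:
  assumes "has_deriv1 f x a"
  shows "has_deriv1 (\<lambda>t. c * f t) x (c * a)"
  unfolding has_deriv1_def
proof (intro allI impI)
  fix e :: 'a assume e: "e > 0"
  define e' where "e' = e / (\<bar>c\<bar> + 1)"
  have "0 < \<bar>c\<bar> + 1" by (simp add: add_nonneg_pos)
  then have e': "e' > 0" "(\<bar>c\<bar> + 1) * e' = e" using e by (simp_all add: e'_def)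
  obtain r where r: "r > 0" "\<forall>h. h \<noteq> 0 \<and> \<bar>h\<bar> < r \<longrightarrow> \<bar>f (x + h) - f x - a * h\<bar> < e' * \<bar>h\<bar>"
    using assms(1) e' unfolding has_deriv1_def by blast
  show "\<exists>r>0. \<forall>h. h \<noteq> 0 \<and> \<bar>h\<bar> < r \<longrightarrow> \<bar>c * f (x + h) - c * f x - c * a * h\<bar> < e * \<bar>h\<bar>"
  proof (intro exI[of _ r] conjI allI impI)
    fix h assume h: "h \<noteq> 0 \<and> \<bar>h\<bar> < r"
    then have 1: "\<bar>f (x + h) - f x - a * h\<bar> < e' * \<bar>h\<bar>" using r by blast
    have "c * f (x + h) - c * f x - c * a * h = c * (f (x + h) - f x - a * h)" by (simp add: algebra_simps)
    then have "\<bar>c * f (x + h) - c * f x - c * a * h\<bar> = \<bar>c\<bar> * \<bar>f (x + h) - f x - a * h\<bar>" by (simp add: abs_mult)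
    also have "\<dots> \<le> \<bar>c\<bar> * (e' * \<bar>h\<bar>)" using 1 by (intro mult_left_mono) simp_all
    also have "\<dots> < (\<bar>c\<bar> + 1) * (e' * \<bar>h\<bar>)" using e' h by simp
    also have "\<dots> = e * \<bar>h\<bar>" using e'(2) by (simp add: mult.assoc[symmetric])
    finally show "\<bar>c * f (x + h) - c * f x - c * a * h\<bar> < e * \<bar>h\<bar>" .
  qed (rule r)
qed

lemma has_deriv1_const: "has_deriv1 (\<lambda>_. c) x 0"
  unfolding has_deriv1_def by (auto intro!: exI[of _ 1])

lemma has_deriv1_id: "has_deriv1 (\<lambda>t. t) x 1"
  unfolding has_deriv1_def by (auto intro!: exI[of _ 1])

lemma has_pderiv_sum:
  "(\<And>j. j \<in> I \<Longrightarrow> has_pderiv (f j) i x (d j)) \<Longrightarrow> has_pderiv (\<lambda>x. \<Sum>j\<in>I. f j x) i x (\<Sum>j\<in>I. d j)"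
  unfolding has_pderiv_def
  by (induction I rule: infinite_finite_induct) (simp_all add: has_deriv1_const has_deriv1_add)

lemma has_pderiv_cmult: "has_pderiv f i x d \<Longrightarrow> has_pderiv (\<lambda>x. c * f x) i x (c * d)"
  unfolding has_pderiv_def by (rule has_deriv1_cmult)

lemma has_pderiv_add: "has_pderiv f i x a \<Longrightarrow> has_pderiv g i x b \<Longrightarrow> has_pderiv (\<lambda>x. f x + g x) i x (a + b)"
  unfolding has_pderiv_def by (rule has_deriv1_add)

lemma has_pderiv_coord: "has_pderiv (\<lambda>x. x j) i x (if i = j then 1 else 0)"
  unfolding has_pderiv_def by (simp add: has_deriv1_id has_deriv1_const)

definition pderivn :: "((nat \<Rightarrow> 'k::linordered_field) \<Rightarrow> 'k) \<Rightarrow> nat \<Rightarrow> (nat \<Rightarrow> 'k) \<Rightarrow> 'k" where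
  "pderivn f i x = (if \<exists>!d. has_pderiv f i x d then THE d. has_pderiv f i x d else 0)"

lemma pderivn_eq: "has_pderiv f i x d \<Longrightarrow> pderivn f i x = d"
  unfolding pderivn_def using has_pderiv_unique by (metis (mono_tags, lifting) the_equality)

lemma has_pderiv_pderivn: "\<exists>d. has_pderiv f i x d \<Longrightarrow> has_pderiv f i x (pderivn f i x)"
  using pderivn_eq by metis

definition C1_at :: "nat \<Rightarrow> ((nat \<Rightarrow> 'k::linordered_field) \<Rightarrow> 'k) \<Rightarrow> (nat \<Rightarrow> 'k) \<Rightarrow> bool" where
  "C1_at n f x \<longleftrightarrow> (\<forall>i<n. (\<exists>d. has_pderiv f i x d) \<and> contn n (pderivn f i) x)"

section \<open>Mean value inequality and generic differentiability\<close>

context definable_predicates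
begin

text \<open>The points up to which h stays above \<open>h a\<close> form a definable set and so have
  a supremum s; local increase at s is contradictory unless s = b.\<close>

lemma locally_increasing:
  assumes h: "Dt X1 h" and loc: "\<And>t. l < t \<Longrightarrow> t < u \<Longrightarrow> \<exists>e>0. (\<forall>s. t - e < s \<and> s < t \<longrightarrow> h s < h t) \<and> (\<forall>s. t < s \<and> s < t + e \<longrightarrow> h t < h s)"
    and ab: "l < a" "a < b" "b < u"
  shows "h a < h b"
proof -
  define P where "P t \<longleftrightarrow> a < t \<and> t \<le> b \<and> (\<forall>r. a < r \<and> r \<le> t \<longrightarrow> h a < h r)" for t
  have dP: "Df X1 P"
    unfolding P_def by (intro def_rules Dt_app1[OF h])
  have "a < u" using ab by simp
  from loc[OF ab(1) this] obtain e where e: "e > 0" "\<forall>s. a < s \<and> s < a + e \<longrightarrow> h a < h s" by blast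
  define t0 where "t0 = min (a + e / 2) b"
  have "t0 \<le> a + e / 2" by (simp add: t0_def)
  moreover have "a + e / 2 < a + e" using e by simp
  ultimately have t0: "a < t0" "t0 < a + e" "t0 \<le> b" using e ab by (simp_all add: t0_def)
  have "h a < h r" if "a < r" "r \<le> t0" for r using e(2) t0 that by (meson le_less_trans)
  then have Pt0: "P t0" unfolding P_def using t0 by blast
  define s where "s = lub P"
  have L: "Lub P s"
    unfolding s_def by (rule Lub_lub[OF dP Pt0, of b]) (simp add: P_def)
  have s: "t0 \<le> s" "s \<le> b" using L Pt0 unfolding Lub_def P_def by blast+
  then have las: "l < s" "s < u" using t0 ab by (meson le_less_trans less_le_trans less_trans)+
  from loc[OF this] obtain e' where e': "e' > 0" "\<forall>r. s - e' < r \<and> r < s \<longrightarrow> h r < h s" "\<forall>r. s < r \<and> r < s + e' \<longrightarrow> h s < h r"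
    by blast
  have big: "\<exists>t. P t \<and> r < t" if "r < s" for r
  proof (rule ccontr)
    assume "\<not> ?thesis"
    then have "\<forall>t. P t \<longrightarrow> t \<le> r" by (meson not_le)
    then have "s \<le> r" using L unfolding Lub_def by blast
    then show False using that by simp
  qed
  have below: "h a < h r" if r: "a < r" "r < s" for r
  proof -
    obtain t where "P t" "r < t" using big[OF r(2)] by blast
    then show ?thesis using r(1) unfolding P_def by (meson less_imp_le)
  qed
  have hs: "h a < h s"
  proof -
    define r where "r = max ((a + s) / 2) (s - e' / 2)"
    have "a < s" using t0 s by simp
    then have r: "a < r" "r < s" "s - e' < r" using e' by (auto simp: r_def less_max_iff_disj)
    have "h a < h r" using below[OF r(1,2)] .
    also have "h r < h s" using e'(2) r by blast
    finally show ?thesis .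
  qed
  have "s = b"
  proof (rule ccontr)
    assume "s \<noteq> b"
    then have "s < b" using s by simp
    define t where "t = min (s + e' / 2) b"
    have "t \<le> s + e' / 2" by (simp add: t_def)
    moreover have "s + e' / 2 < s + e'" using e' by simp
    ultimately have t: "s < t" "t < s + e'" "t \<le> b" using e' \<open>s < b\<close> by (simp_all add: t_def)
    have "h a < h r" if "a < r" "r \<le> t" for r
    proof -
      consider "r < s" | "r = s" | "s < r" by linarith
      then show ?thesis
      proof cases
        case 3
        then have "h s < h r" using e'(3) that t by (meson le_less_trans)
        then show ?thesis using hs by simp
      qed (use below[OF that(1)] hs in auto)
    qed
    then have "P t" unfolding P_def using t t0 s by auto
    then have "t \<le> s" using L unfolding Lub_def by blast
    then show False using t by simp
  qed
  then show ?thesis using hs by simp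
qed

text \<open>A substitute for the mean value theorem: for positive \<epsilon>, both (K + \<epsilon>)
  * t + g t and (K + \<epsilon>) * t - g t increase locally, hence globally.\<close>

lemma lipschitz1:
  assumes g: "Dt X1 g" and d: "\<And>t. l < t \<Longrightarrow> t < u \<Longrightarrow> \<exists>d. has_deriv1 g t d \<and> \<bar>d\<bar> \<le> K"
    and ab: "l < a" "a < b" "b < u"
  shows "\<bar>g b - g a\<bar> \<le> K * (b - a)"
proof -
  have main: "\<bar>g b - g a\<bar> < (K + \<epsilon>) * (b - a)" if \<epsilon>: "\<epsilon> > 0" for \<epsilon>
  proof -
    have loc: "\<exists>e>0. \<forall>s. s \<noteq> t \<and> \<bar>s - t\<bar> < e \<longrightarrow> \<bar>g s - g t\<bar> < (K + \<epsilon>) * \<bar>s - t\<bar>" if t: "l < t" "t < u" for t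
    proof -
      obtain c where c: "has_deriv1 g t c" "\<bar>c\<bar> \<le> K" using d[OF t] by blast
      then obtain r where r: "r > 0" "\<forall>h. h \<noteq> 0 \<and> \<bar>h\<bar> < r \<longrightarrow> \<bar>g (t + h) - g t - c * h\<bar> < \<epsilon> * \<bar>h\<bar>"
        using \<epsilon> unfolding has_deriv1_def by blast
      have "\<bar>g s - g t\<bar> < (K + \<epsilon>) * \<bar>s - t\<bar>" if "s \<noteq> t" "\<bar>s - t\<bar> < r" for s
      proof -
        have "\<bar>g s - g t - c * (s - t)\<bar> < \<epsilon> * \<bar>s - t\<bar>" using r(2)[rule_format, of "s - t"] that by simp
        moreover have "\<bar>c * (s - t)\<bar> \<le> K * \<bar>s - t\<bar>" unfolding abs_mult using c(2) by (intro mult_right_mono) simp_all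
        moreover have "(K + \<epsilon>) * \<bar>s - t\<bar> = K * \<bar>s - t\<bar> + \<epsilon> * \<bar>s - t\<bar>" by (simp add: distrib_right)
        ultimately show ?thesis by linarith
      qed
      then show ?thesis using r(1) by blast
    qed
    have inc: "(K + \<epsilon>) * a + \<sigma> * g a < (K + \<epsilon>) * b + \<sigma> * g b" if \<sigma>: "\<sigma> = 1 \<or> \<sigma> = - 1" for \<sigma>
    proof (rule locally_increasing[where h = "\<lambda>t. (K + \<epsilon>) * t + \<sigma> * g t", OF _ _ ab])
      show "Dt X1 (\<lambda>t. (K + \<epsilon>) * t + \<sigma> * g t)"
        by (intro def_rules g)
      fix t assume t: "l < t" "t < u"
      obtain e where e: "e > 0" "\<forall>s. s \<noteq> t \<and> \<bar>s - t\<bar> < e \<longrightarrow> \<bar>g s - g t\<bar> < (K + \<epsilon>) * \<bar>s - t\<bar>"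
        using loc[OF t] by blast
      have ab\<sigma>: "\<bar>\<sigma> * g s - \<sigma> * g t\<bar> = \<bar>g s - g t\<bar>" for s using \<sigma> by (auto simp: abs_minus_commute)
      show "\<exists>e>0. (\<forall>s. t - e < s \<and> s < t \<longrightarrow> (K + \<epsilon>) * s + \<sigma> * g s < (K + \<epsilon>) * t + \<sigma> * g t) \<and>
         (\<forall>s. t < s \<and> s < t + e \<longrightarrow> (K + \<epsilon>) * t + \<sigma> * g t < (K + \<epsilon>) * s + \<sigma> * g s)"
      proof (intro exI[of _ e] conjI allI impI)
        fix s assume s: "t - e < s \<and> s < t"
        then have "\<bar>\<sigma> * g s - \<sigma> * g t\<bar> < (K + \<epsilon>) * (t - s)" using e(2)[rule_format, of s] unfolding ab\<sigma> by simp
        then show "(K + \<epsilon>) * s + \<sigma> * g s < (K + \<epsilon>) * t + \<sigma> * g t" unfolding right_diff_distrib by linarith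
      next
        fix s assume s: "t < s \<and> s < t + e"
        then have "\<bar>\<sigma> * g s - \<sigma> * g t\<bar> < (K + \<epsilon>) * (s - t)" using e(2)[rule_format, of s] unfolding ab\<sigma> by simp
        then show "(K + \<epsilon>) * t + \<sigma> * g t < (K + \<epsilon>) * s + \<sigma> * g s" unfolding right_diff_distrib by linarith
      qed (rule e)
    qed
    have "(K + \<epsilon>) * (b - a) = (K + \<epsilon>) * b - (K + \<epsilon>) * a" by (simp add: right_diff_distrib)
    then show ?thesis using inc[of 1] inc[of "- 1"] by (simp add: abs_less_iff)
  qed
  show ?thesis
  proof (rule ccontr)
    assume "\<not> ?thesis"
    then have "0 < \<bar>g b - g a\<bar> - K * (b - a)" by simp
    \<comment> \<open>This quotient is taken as \<epsilon>: the strict inequality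
      \<open>main\<close> then compares a number with itself.\<close>
    then have "0 < (\<bar>g b - g a\<bar> - K * (b - a)) / (b - a)" using ab by simp
    from main[OF this] have "\<bar>g b - g a\<bar> < K * (b - a) + (\<bar>g b - g a\<bar> - K * (b - a)) / (b - a) * (b - a)"
      by (simp only: distrib_right)
    then show False using ab by simp
  qed
qed

lemma Df_has_deriv1:
  assumes F: "Dt (ext X) (\<lambda>p. F (fst p) (snd p))" and s: "Dt X s" and d: "Dt X d"
  shows "Df X (\<lambda>c. has_deriv1 (F c) (s c) (d c))"
proof -
  have X: "Dt X x" if "x \<in> X" for x using that by (auto intro: Dt_coord)
  show ?thesis
    unfolding has_deriv1_def by (intro def_rules Dt_ext_subst[OF F] s d X)
qed

text \<open>Unless g is affine on an interval, the pairs (x, c) for which \<open>g t - c * t\<close>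
  is neither increasing nor decreasing near x form a set that is not fat. For suitable x, the slopes
  c with \<open>inc\<close> and those with \<open>dec\<close> therefore form an initial and a final
  segment without an interval between them, and the cut is the derivative. If one segment were empty
  throughout an interval, g would be steeper than its own chord.\<close>

lemma differentiable_somewhere:
  assumes g: "Dt X1 g" and lu: "l < u"
  shows "\<exists>x d. l < x \<and> x < u \<and> has_deriv1 g x d"
proof (cases "\<exists>c l' u'. l' < u' \<and> (\<forall>s. l' < s \<and> s < u' \<longrightarrow> l < s \<and> s < u) \<and> (\<forall>s t. l' < s \<and> s < t \<and> t < u' \<longrightarrow> g s - c * s = g t - c * t)")
  case True
  then obtain c l' u' where 1: "l' < u'" "\<forall>s. l' < s \<and> s < u' \<longrightarrow> l < s \<and> s < u"
    "\<forall>s t. l' < s \<and> s < t \<and> t < u' \<longrightarrow> g s - c * s = g t - c * t" by blast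
  define x where "x = (l' + u') / 2"
  have x: "l' < x" "x < u'" using 1(1) by (simp_all add: x_def)
  have "has_deriv1 g x c"
    unfolding has_deriv1_def
  proof (intro allI impI exI[of _ "min (x - l') (u' - x)"] conjI)
    show "0 < min (x - l') (u' - x)" using x by simp
    fix e h :: 'k assume e: "e > 0" and h: "h \<noteq> 0 \<and> \<bar>h\<bar> < min (x - l') (u' - x)"
    then have "l' < x + h" "x + h < u'" by (auto simp: abs_less_iff)
    then have "g (x + h) - c * (x + h) = g x - c * x"
      using 1(3)[rule_format, of x "x + h"] 1(3)[rule_format, of "x + h" x] x h by (cases "h > 0") auto
    then have "g (x + h) - g x - c * h = 0" by (simp add: algebra_simps)
    then show "\<bar>g (x + h) - g x - c * h\<bar> < e * \<bar>h\<bar>" using e h by simp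
  qed
  then show ?thesis using 1 x by blast
next
  case False
  define inc where "inc c x \<longleftrightarrow> (\<exists>e>0. \<forall>y z. x - e < y \<and> y < z \<and> z < x + e \<longrightarrow> g y - c * y < g z - c * z)" for c x
  define dec where "dec c x \<longleftrightarrow> (\<exists>e>0. \<forall>y z. x - e < y \<and> y < z \<and> z < x + e \<longrightarrow> g z - c * z < g y - c * y)" for c x
  have inc_down: "inc c' x" if "inc c x" "c' \<le> c" for c c' x
  proof -
    obtain e where e: "e > 0" "\<forall>y z. x - e < y \<and> y < z \<and> z < x + e \<longrightarrow> g y - c * y < g z - c * z"
      using \<open>inc c x\<close> unfolding inc_def by blast
    have "g y - c' * y < g z - c' * z" if yz: "x - e < y" "y < z" "z < x + e" for y z
    proof -
      have "g y - c * y < g z - c * z" using e(2) yz by blast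
      moreover have "0 \<le> (c - c') * (z - y)" using \<open>c' \<le> c\<close> yz by simp
      ultimately show ?thesis by (simp add: algebra_simps)
    qed
    then show ?thesis unfolding inc_def using e(1) by blast
  qed
  have dec_up: "dec c' x" if "dec c x" "c \<le> c'" for c c' x
  proof -
    obtain e where e: "e > 0" "\<forall>y z. x - e < y \<and> y < z \<and> z < x + e \<longrightarrow> g z - c * z < g y - c * y"
      using \<open>dec c x\<close> unfolding dec_def by blast
    have "g z - c' * z < g y - c' * y" if yz: "x - e < y" "y < z" "z < x + e" for y z
    proof -
      have "g z - c * z < g y - c * y" using e(2) yz by blast
      moreover have "0 \<le> (c' - c) * (z - y)" using \<open>c \<le> c'\<close> yz by simp
      ultimately show ?thesis by (simp add: algebra_simps)
    qed
    then show ?thesis unfolding dec_def using e(1) by blast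
  qed
  have not_both: "\<not> (inc c x \<and> dec c x)" for c x
  proof
    assume "inc c x \<and> dec c x"
    then obtain e e' where e: "e > 0" "\<forall>y z. x - e < y \<and> y < z \<and> z < x + e \<longrightarrow> g y - c * y < g z - c * z"
      and e': "e' > 0" "\<forall>y z. x - e' < y \<and> y < z \<and> z < x + e' \<longrightarrow> g z - c * z < g y - c * y"
      unfolding inc_def dec_def by blast
    define z where "z = x + min e e' / 2"
    have z: "x < z" "z < x + e" "z < x + e'" using e(1) e'(1) by (auto simp: z_def min_def)
    then have "g x - c * x < g z - c * z" "g z - c * z < g x - c * x"
      using e(2)[rule_format, of x z] e'(2)[rule_format, of x z] e(1) e'(1) by simp_all
    then show False by simp
  qed
  have d_inc1: "Df (ext X1) (\<lambda>p. inc (snd p) (fst p))" "Df (ext X1) (\<lambda>p. dec (snd p) (fst p))"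
    unfolding inc_def dec_def by (intro def_rules Dt_app1[OF g])+
  have d_inc2: "Df (W 2) (\<lambda>v. inc (v 1) (v 0))" "Df (W 2) (\<lambda>v. dec (v 1) (v 0))"
    unfolding inc_def dec_def by (intro def_rules Dt_app1[OF g] Dt_V; simp)+
  define P where "P v \<longleftrightarrow> l < v 0 \<and> v 0 < u \<and> \<not> inc (v 1) (v 0) \<and> \<not> dec (v 1) (v (0::nat))" for v
  have dP: "Df (W (Suc 1)) P"
    unfolding P_def using d_inc2 by (simp only: Suc_1) (intro def_rules Dt_V; simp)
  \<comment> \<open>A box in P would contain a whole interval of points x for one fixed c. There
    \<open>g t - c * t\<close> is monotone on a subinterval, and the constant case has been
    excluded.\<close>
  have "\<not> fat (Suc 1) P"
  proof
    assume "fat (Suc 1) P"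
    then obtain l2 u2 where 2: "good (Suc 1) l2 u2" "\<forall>v\<in>box (Suc 1) l2 u2. P v" unfolding fat_def by blast
    have g2: "l2 0 < u2 0" "l2 1 < u2 1" using 2(1) by (simp_all add: good_def)
    define c where "c = (l2 1 + u2 1) / 2"
    have c: "l2 1 < c" "c < u2 1" using g2 by (simp_all add: c_def)
    have Px: "l < x \<and> x < u \<and> \<not> inc c x \<and> \<not> dec c x" if "l2 0 < x" "x < u2 0" for x
    proof -
      have "(\<lambda>i. if i = 0 then x else c) \<in> box (Suc 1) l2 u2" using that c by (auto simp: box_def less_Suc_eq)
      then have "P (\<lambda>i. if i = 0 then x else c)" using 2 by blast
      then show ?thesis by (simp add: P_def)
    qed
    have "Dt X1 (\<lambda>t. g t - c * t)" by (intro def_rules g)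
    from monotone_on_subinterval[OF this g2(1)] obtain l' u' r where 3: "l2 0 \<le> l'" "l' < u'" "u' \<le> u2 0"
      "r \<in> {(<), (=), (>)}" "\<And>s t. l' < s \<Longrightarrow> s < t \<Longrightarrow> t < u' \<Longrightarrow> r (g s - c * s) (g t - c * t)" by blast
    define x where "x = (l' + u') / 2"
    have x: "l' < x" "x < u'" using 3(2) by (simp_all add: x_def)
    have Nx: "\<not> inc c x" "\<not> dec c x" using Px[of x] x 3 by auto
    define e where "e = min (x - l') (u' - x)"
    have e: "e > 0" "l' \<le> x - e" "x + e \<le> u'" using x by (simp_all add: e_def)
    have re: "r (g y - c * y) (g z - c * z)" if "x - e < y" "y < z" "z < x + e" for y z
      using 3(5)[of y z] that e by simp
    show False using 3(4)
    proof (elim insertE emptyE)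
      assume r: "r = (<)"
      have "inc c x" unfolding inc_def using e(1) re r by blast
      then show False using Nx by blast
    next
      assume r: "r = (>)"
      have "dec c x" unfolding dec_def using e(1) re r by blast
      then show False using Nx by blast
    next
      assume r: "r = (=)"
      have "\<forall>s. l' < s \<and> s < u' \<longrightarrow> l < s \<and> s < u" using Px 3(1,3) by (meson le_less_trans less_le_trans)
      moreover have "\<forall>s t. l' < s \<and> s < t \<and> t < u' \<longrightarrow> g s - c * s = g t - c * t" using 3(5) r by blast
      ultimately show False using False 3(2) by blast
    qed
  qed
  \<comment> \<open>The Fubini property yields points x whose slopes with neither property contain
    no interval; the double negation is the form required by
    \<open>subbox_if_not_fat\<close>.\<close>
  then have nf: "\<not> fat 1 (\<lambda>x. \<not> \<not> fibre_fat 1 P x)"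
    unfolding not_not using fat_Suc_if_fibres_fat[OF dP] by blast
  have g1: "good 1 (\<lambda>_. l) (\<lambda>_. u)" using lu by (simp add: good_def)
  from subbox_if_not_fat[OF Df_not[OF Df_fibre_fat[OF dP]] nf g1] obtain l' u' where
    1: "good 1 l' u'" "box 1 l' u' \<subseteq> box 1 (\<lambda>_. l) (\<lambda>_. u)" "\<forall>x\<in>box 1 l' u'. \<not> fibre_fat 1 P x" by blast
  define l1 where "l1 = l' 0"
  define u1 where "u1 = u' 0"
  have lu1: "l1 < u1" using 1(1) by (simp add: l1_def u1_def good_def)
  have in1: "l < t \<and> t < u" and nofat: "\<not> (\<forall>c. a < c \<and> c < b \<longrightarrow> \<not> inc c t \<and> \<not> dec c t)"
    if t: "l1 < t" "t < u1" and ab: "a < b" for t a b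
  proof -
    have tb: "(\<lambda>_. t) \<in> box 1 l' u'" using t by (simp add: box_def l1_def u1_def)
    then have "(\<lambda>_. t) \<in> box 1 (\<lambda>_. l) (\<lambda>_. u)" using 1(2) by blast
    then show in1: "l < t \<and> t < u" by (simp add: box_def)
    have "\<not> fibre_fat 1 P (\<lambda>_. t)" using 1(3) tb by blast
    then have "\<not> (\<forall>c. a < c \<and> c < b \<longrightarrow> P ((\<lambda>_. t)(1 := c)))" unfolding fibre_fat_def using ab by blast
    then show "\<not> (\<forall>c. a < c \<and> c < b \<longrightarrow> \<not> inc c t \<and> \<not> dec c t)" using in1 by (simp add: P_def)
  qed
  show ?thesis
  proof (cases "\<exists>t. l1 < t \<and> t < u1 \<and> (\<exists>c. inc c t) \<and> (\<exists>c. dec c t)")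
    case True
    then obtain t c0 c1 where t: "l1 < t" "t < u1" and c0: "inc c0 t" and c1: "dec c1 t" by blast
    have "Df X1 (\<lambda>c. inc c t)"
      unfolding inc_def by (intro def_rules Dt_app1[OF g])
    moreover have "c \<le> c1" if "inc c t" for c
      using not_both inc_down[OF that] dec_up[OF c1] by (meson linear)
    ultimately have L: "Lub (\<lambda>c. inc c t) (lub (\<lambda>c. inc c t))"
      by (rule Lub_lub[where P = "\<lambda>c. inc c t" and x = c0 and b = c1, OF _ c0])
    \<comment> \<open>The cut between the slopes: those below d are \<open>inc\<close>, and those
      above d are \<open>dec\<close>, since otherwise an interval of slopes would be
      neither.\<close>
    define d where "d = lub (\<lambda>c. inc c t)"
    have lo: "inc c t" if "c < d" for c
    proof (rule ccontr)
      assume n: "\<not> inc c t"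
      have "\<forall>c'. inc c' t \<longrightarrow> c' \<le> c" using inc_down n by (meson linear)
      then have "d \<le> c" using L unfolding Lub_def d_def by blast
      then show False using that by simp
    qed
    have hi: "dec c t" if "d < c" for c
    proof (rule ccontr)
      assume n: "\<not> dec c t"
      have "\<not> inc c' t \<and> \<not> dec c' t" if c': "d < c'" "c' < c" for c'
      proof
        show "\<not> inc c' t"
        proof
          assume "inc c' t"
          then have "c' \<le> d" using L unfolding Lub_def d_def by blast
          then show False using c' by simp
        qed
        show "\<not> dec c' t" using dec_up n c' by (meson less_imp_le)
      qed
      then show False using nofat[OF t that] by blast
    qed
    have "has_deriv1 g t d"
      unfolding has_deriv1_def
    proof (intro allI impI)
      fix e :: 'k assume e: "e > 0"
      have "inc (d - e / 2) t" "dec (d + e / 2) t" using e by (auto intro: lo hi)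
      then obtain r r' where r: "r > 0" "\<forall>y z. t - r < y \<and> y < z \<and> z < t + r \<longrightarrow> g y - (d - e / 2) * y < g z - (d - e / 2) * z"
        and r': "r' > 0" "\<forall>y z. t - r' < y \<and> y < z \<and> z < t + r' \<longrightarrow> g z - (d + e / 2) * z < g y - (d + e / 2) * y"
        unfolding inc_def dec_def by blast
      show "\<exists>r>0. \<forall>h. h \<noteq> 0 \<and> \<bar>h\<bar> < r \<longrightarrow> \<bar>g (t + h) - g t - d * h\<bar> < e * \<bar>h\<bar>"
      proof (intro exI[of _ "min r r'"] conjI allI impI)
        show "0 < min r r'" using r r' by simp
        fix h assume h: "h \<noteq> 0 \<and> \<bar>h\<bar> < min r r'"
        then have h': "\<bar>h\<bar> < r" "\<bar>h\<bar> < r'" by simp_all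
        have E: "e / 2 * \<bar>h\<bar> < e * \<bar>h\<bar>" using e h by simp
        show "\<bar>g (t + h) - g t - d * h\<bar> < e * \<bar>h\<bar>"
        proof (cases "h > 0")
          case True
          have "g t - (d - e / 2) * t < g (t + h) - (d - e / 2) * (t + h)" "g (t + h) - (d + e / 2) * (t + h) < g t - (d + e / 2) * t"
            using r(2)[rule_format, of t "t + h"] r'(2)[rule_format, of t "t + h"] h' True r(1) r'(1) by simp_all
          then have "- (e / 2 * h) < g (t + h) - g t - d * h" "g (t + h) - g t - d * h < e / 2 * h"
            unfolding distrib_left distrib_right left_diff_distrib right_diff_distrib by linarith+
          then show ?thesis using E True by (simp add: abs_less_iff)
        next
          case False
          then have hn: "h < 0" using h by simp
          have "g (t + h) - (d - e / 2) * (t + h) < g t - (d - e / 2) * t" "g t - (d + e / 2) * t < g (t + h) - (d + e / 2) * (t + h)"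
            using r(2)[rule_format, of "t + h" t] r'(2)[rule_format, of "t + h" t] h' hn r(1) r'(1) by simp_all
          then have "g (t + h) - g t - d * h < - (e / 2 * h)" "e / 2 * h < g (t + h) - g t - d * h"
            unfolding distrib_left distrib_right left_diff_distrib right_diff_distrib by linarith+
          then show ?thesis using E hn by (simp add: abs_less_iff)
        qed
      qed
    qed
    then show ?thesis using in1[OF t zero_less_one] by blast
  next
    case nobth: False
    have "Df X1 (\<lambda>t. \<exists>c. inc c t)" "Df X1 (\<lambda>t. \<exists>c. dec c t)"
      by (intro Df_ex d_inc1)+
    note dd = Df_not[OF this(1)] Df_not[OF this(2)]
    have "(\<not> (\<exists>c. inc c t)) \<or> (\<not> (\<exists>c. dec c t))" if "l1 < t" "t < u1" for t
      using nobth that by blast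
    from interval_split[OF dd lu1 this] obtain l2 u2 where 2: "l1 \<le> l2" "l2 < u2" "u2 \<le> u1"
      "(\<forall>t. l2 < t \<and> t < u2 \<longrightarrow> \<not> (\<exists>c. inc c t)) \<or> (\<forall>t. l2 < t \<and> t < u2 \<longrightarrow> \<not> (\<exists>c. dec c t))" by metis
    \<comment> \<open>The points at one and two thirds, both interior as
      \<open>locally_increasing\<close> requires.\<close>
    define a where "a = (2 * l2 + u2) / 3"
    define b where "b = (l2 + 2 * u2) / 3"
    have ab: "l2 < a" "a < b" "b < u2" using 2(2) by (simp_all add: a_def b_def field_simps)
    have in12: "l1 < t" "t < u1" if "l2 < t" "t < u2" for t using 2 that by simp_all
    define q where "q = (g b - g a) / (b - a)"
    have q: "q * (b - a) = g b - g a" using ab by (simp add: q_def)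
    from 2(4) have False
    proof
      assume no: "\<forall>t. l2 < t \<and> t < u2 \<longrightarrow> \<not> (\<exists>c. dec c t)"
      have all: "inc c t" if t: "l2 < t" "t < u2" for c t
      proof (rule ccontr)
        assume n: "\<not> inc c t"
        have "\<not> inc c' t \<and> \<not> dec c' t" if "c < c'" "c' < c + 1" for c'
          using inc_down[of c' t c] n no t that by auto
        then show False using nofat[OF in12[OF t], of c "c + 1"] by simp
      qed
      \<comment> \<open>q is the slope of the chord from a to b, so this inequality states that the
        chord is steeper than itself by more than 1.\<close>
      have "g a - (q + 1) * a < g b - (q + 1) * b"
      proof (rule locally_increasing[where h = "\<lambda>t. g t - (q + 1) * t", OF _ _ ab])
        show "Dt X1 (\<lambda>t. g t - (q + 1) * t)" by (intro def_rules g)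
        fix t assume "l2 < t" "t < u2"
        from all[OF this, of "q + 1"] obtain e where e: "e > 0"
          "\<forall>y z. t - e < y \<and> y < z \<and> z < t + e \<longrightarrow> g y - (q + 1) * y < g z - (q + 1) * z" unfolding inc_def by blast
        then show "\<exists>e>0. (\<forall>s. t - e < s \<and> s < t \<longrightarrow> g s - (q + 1) * s < g t - (q + 1) * t) \<and>
           (\<forall>s. t < s \<and> s < t + e \<longrightarrow> g t - (q + 1) * t < g s - (q + 1) * s)"
          by (intro exI[of _ e]) simp
      qed
      then have "(q + 1) * (b - a) < g b - g a" unfolding right_diff_distrib by linarith
      then show False using q ab by (simp add: distrib_right)
    next
      assume no: "\<forall>t. l2 < t \<and> t < u2 \<longrightarrow> \<not> (\<exists>c. inc c t)"
      have all: "dec c t" if t: "l2 < t" "t < u2" for c t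
      proof (rule ccontr)
        assume n: "\<not> dec c t"
        have "\<not> inc c' t \<and> \<not> dec c' t" if "c - 1 < c'" "c' < c" for c'
          using dec_up[of c' t c] n no t that by auto
        then show False using nofat[OF in12[OF t], of "c - 1" c] by simp
      qed
      have "(q - 1) * a - g a < (q - 1) * b - g b"
      proof (rule locally_increasing[where h = "\<lambda>t. (q - 1) * t - g t", OF _ _ ab])
        show "Dt X1 (\<lambda>t. (q - 1) * t - g t)" by (intro def_rules g)
        fix t assume "l2 < t" "t < u2"
        from all[OF this, of "q - 1"] obtain e where e: "e > 0"
          "\<forall>y z. t - e < y \<and> y < z \<and> z < t + e \<longrightarrow> g z - (q - 1) * z < g y - (q - 1) * y" unfolding dec_def by blast
        have "(q - 1) * y - g y < (q - 1) * z - g z" if "t - e < y" "y < z" "z < t + e" for y z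
          using e(2)[rule_format, of y z] that by simp
        then show "\<exists>e>0. (\<forall>s. t - e < s \<and> s < t \<longrightarrow> (q - 1) * s - g s < (q - 1) * t - g t) \<and>
           (\<forall>s. t < s \<and> s < t + e \<longrightarrow> (q - 1) * t - g t < (q - 1) * s - g s)"
          using e(1) by (intro exI[of _ e]) simp
      qed
      then have "g b - g a < (q - 1) * (b - a)" unfolding right_diff_distrib by linarith
      then show False using q ab by (simp add: left_diff_distrib)
    qed
    then show ?thesis ..
  qed
qed

lemma Dt_line:
  assumes "Dt (W n) f"
  shows "Dt X1 (\<lambda>t. f (x(i := t)))"
proof (rule Dt_app[OF assms])
  show "Dt X1 (\<lambda>t. (x(i := t)) j)" for j
    by (cases "i = j") (simp_all add: Dt_const full_X1 Dt_X1)
qed (intro Dt_const full_X1)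

lemma Df_has_pderiv:
  assumes f: "Dt (V A n) f" and d: "Dt X d" and x: "\<And>j. j < n \<Longrightarrow> Dt X (\<lambda>c. x c j)" and i: "i < n"
    and A: "\<And>a. a \<in> A \<Longrightarrow> Dt X (\<lambda>_. a)"
  shows "Df X (\<lambda>c. has_pderiv f i (x c) (d c))"
  unfolding has_pderiv_def
proof (rule Df_has_deriv1[OF _ x[OF i] d])
  show "Dt (ext X) (\<lambda>p. f ((x (fst p))(i := snd p)))"
  proof (rule Dt_app[OF f])
    show "Dt (ext X) (\<lambda>p. ((x (fst p))(i := snd p)) j)" if "j < n" for j
      by (cases "i = j") (use that in \<open>auto intro: Dt_snd Dt_fst[OF x]\<close>)
    show "Dt (ext X) (\<lambda>_. a)" if "a \<in> A" for a using Dt_fst[OF A[OF that]] .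
  qed
qed

lemma Dt_pderivn:
  assumes f: "Dt (V A n) f" and i: "i < n"
  shows "Dt (V A n) (pderivn f i)"
  unfolding pderivn_def
proof (rule Dt_The, rule Df_has_pderiv[OF f Dt_snd _ i])
  show "Dt (ext (V A n)) (\<lambda>p. fst p j)" if "j < n" for j by (rule Dt_fst[OF Dt_V(1)[OF that]])
  show "Dt (ext (V A n)) (\<lambda>_. a)" if "a \<in> A" for a using Dt_fst[OF Dt_V(2)[OF that]] .
qed

text \<open>A box of exceptional points would contain a segment in direction i, on which the
  one-variable result provides a derivative.\<close>

lemma differentiable_on_subbox:
  assumes f: "Dt (W n) f" and i: "i < n" and lu: "good n l u"
  shows "\<exists>l' u'. good n l' u' \<and> box n l' u' \<subseteq> box n l u \<and> (\<forall>x\<in>box n l' u'. \<exists>d. has_pderiv f i x d)"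
proof (rule subbox_if_not_fat[OF _ _ lu])
  show "Df (W n) (\<lambda>x. \<exists>d. has_pderiv f i x d)"
  proof (rule Df_ex, rule Df_has_pderiv[OF f Dt_snd _ i])
    show "Dt (ext (W n)) (\<lambda>p. fst p j)" if "j < n" for j by (rule Dt_fst[OF Dt_V(1)[OF that]])
    show "Dt (ext (W n)) (\<lambda>_. a)" for a by (intro Dt_const full_ext full_V)
  qed
  show "\<not> fat n (\<lambda>x. \<not> (\<exists>d. has_pderiv f i x d))"
  proof
    assume "fat n (\<lambda>x. \<not> (\<exists>d. has_pderiv f i x d))"
    then obtain l2 u2 where 2: "good n l2 u2" "\<forall>x\<in>box n l2 u2. \<not> (\<exists>d. has_pderiv f i x d)" unfolding fat_def by blast
    define x where "x = mid l2 u2"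
    have x: "x \<in> box n l2 u2" using 2(1) by (simp add: x_def mid_in_box)
    have "l2 i < u2 i" using 2(1) i by (simp add: good_def)
    from differentiable_somewhere[OF Dt_line[OF f] this, of x i] obtain t d where
      t: "l2 i < t" "t < u2 i" "has_deriv1 (\<lambda>s. f (x(i := s))) t d" by blast
    have "x(i := t) \<in> box n l2 u2" using x t by (simp add: box_def)
    moreover have "has_pderiv f i (x(i := t)) d" using t by (simp add: has_pderiv_def)
    ultimately show False using 2 by blast
  qed
qed

text \<open>Partial derivatives exist on a smaller box and, being definable functions, are
  continuous on a still smaller one.\<close>

lemma C1_on_subbox:
  assumes f: "Dt (W n) f" and lu: "good n l u"
  shows "\<exists>l' u'. good n l' u' \<and> box n l' u' \<subseteq> box n l u \<and> (\<forall>x\<in>box n l' u'. C1_at n f x)"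
proof -
  have "\<exists>l' u'. good n l' u' \<and> box n l' u' \<subseteq> box n l u \<and> (\<forall>i<n. \<forall>x\<in>box n l' u'. \<exists>d. has_pderiv f i x d)"
    by (rule box_all[OF _ lu], rule differentiable_on_subbox[OF f])
  then obtain l1 u1 where 1: "good n l1 u1" "box n l1 u1 \<subseteq> box n l u" "\<forall>i<n. \<forall>x\<in>box n l1 u1. \<exists>d. has_pderiv f i x d" by blast
  have "\<exists>l' u'. good n l' u' \<and> box n l' u' \<subseteq> box n l1 u1 \<and> (\<forall>i<n. \<forall>x\<in>box n l' u'. contn n (pderivn f i) x)"
    by (rule box_all[OF _ 1(1)], rule continuous_on_subbox, rule Dt_pderivn[OF f])
  then obtain l2 u2 where 2: "good n l2 u2" "box n l2 u2 \<subseteq> box n l1 u1" "\<forall>i<n. \<forall>x\<in>box n l2 u2. contn n (pderivn f i) x" by blast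
  have "\<forall>x\<in>box n l2 u2. C1_at n f x" unfolding C1_at_def using 1 2 by blast
  then show ?thesis using 1 2 by blast
qed

section \<open>Lipschitz bounds and images of perturbations of the identity\<close>

text \<open>Coordinates are exchanged one at a time: \<open>z k\<close> has the first k coordinates
  of x and the remaining ones of y. This costs the factor n in front of the bound for one
  variable.\<close>

lemma lipschitz_box:
  assumes f: "Dt (W n) f" and d: "\<And>x i. x \<in> box n l u \<Longrightarrow> i < n \<Longrightarrow> \<exists>d. has_pderiv f i x d \<and> \<bar>d\<bar> \<le> K"
    and x: "x \<in> box n l u" and y: "y \<in> box n l u" and B: "\<And>i. i < n \<Longrightarrow> \<bar>x i - y i\<bar> \<le> B"
  shows "\<bar>f x - f y\<bar> \<le> of_nat n * (K * B)"
proof -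
  define z where "z k = (\<lambda>i. if i < k then x i else y i)" for k :: nat
  have "k \<le> n \<Longrightarrow> \<bar>f (z k) - f y\<bar> \<le> of_nat k * (K * B)" for k
  proof (induction k)
    case 0
    then show ?case by (simp add: z_def)
  next
    case (Suc k)
    then have k: "k < n" by simp
    have zb: "z k \<in> box n l u" using x y by (simp add: z_def box_def)
    have zk: "z (Suc k) = (z k)(k := x k)" "z k = (z k)(k := y k)" by (auto simp: z_def fun_eq_iff less_Suc_eq)
    obtain d0 where "\<bar>d0\<bar> \<le> K" using d[OF x k] by blast
    then have K: "0 \<le> K" using abs_ge_zero order_trans by blast
    have lip: "\<bar>f ((z k)(k := b)) - f ((z k)(k := a))\<bar> \<le> K * (b - a)" if ab: "l k < a" "a < b" "b < u k" for a b
    proof (rule lipschitz1[OF Dt_line[OF f] _ ab])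
      fix t assume t: "l k < t" "t < u k"
      then have "(z k)(k := t) \<in> box n l u" using zb by (simp add: box_def)
      from d[OF this k] show "\<exists>d. has_deriv1 (\<lambda>t. f ((z k)(k := t))) t d \<and> \<bar>d\<bar> \<le> K"
        by (simp add: has_pderiv_def)
    qed
    have bd: "l k < x k" "x k < u k" "l k < y k" "y k < u k" using x y k by (simp_all add: box_def)
    have "\<bar>f ((z k)(k := x k)) - f ((z k)(k := y k))\<bar> \<le> K * \<bar>x k - y k\<bar>"
    proof (cases "x k" "y k" rule: linorder_cases)
      case less
      then show ?thesis using lip[OF bd(1) less bd(4)] by (simp add: abs_minus_commute)
    next
      case greater
      then show ?thesis using lip[OF bd(3) greater bd(2)] by simp
    qed simp
    also have "\<dots> \<le> K * B" using B[OF k] K by (intro mult_left_mono)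
    finally have "\<bar>f (z (Suc k)) - f (z k)\<bar> \<le> K * B" using zk by simp
    moreover have "\<bar>f (z k) - f y\<bar> \<le> of_nat k * (K * B)" using Suc by simp
    moreover have "of_nat (Suc k) * (K * B) = of_nat k * (K * B) + K * B" by (simp add: distrib_right)
    ultimately show ?case by linarith
  qed
  from this[of n] have "\<bar>f (z n) - f y\<bar> \<le> of_nat n * (K * B)" by simp
  moreover have "f (z n) = f x" by (rule Dt_V_cong[OF f]) (simp add: z_def)
  ultimately show ?thesis by simp
qed

text \<open>
  A definable map that differs from the identity by a contraction has fat image: solve the last
  coordinate for \<open>x n\<close>, on a uniform interval of values, and substitute.
\<close>

lemma near_identity_image_fat:
  assumes "\<And>i. i < n \<Longrightarrow> Dt (W n) (\<eta> i)" "good n l u"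
    and "\<And>x y B i. x \<in> box n l u \<Longrightarrow> y \<in> box n l u \<Longrightarrow> (\<forall>j<n. \<bar>x j - y j\<bar> \<le> B) \<Longrightarrow> i < n \<Longrightarrow> \<bar>\<eta> i x - \<eta> i y\<bar> \<le> B / 2"
  shows "fat n (\<lambda>y. \<exists>x\<in>box n l u. \<forall>i<n. y i = x i + \<eta> i x)"
  using assms
proof (induction n arbitrary: \<eta> l u)
  case 0
  show ?case unfolding fat_def by (auto simp: good_def box_def)
next
  case (Suc n)
  have d\<eta>: "Dt (W (Suc n)) (\<eta> i)" if "i < Suc n" for i by (rule Suc.prems(1)[OF that])
  have lu: "good n l u" "l n < u n" using Suc.prems(2) by (simp_all add: good_Suc)
  have lip: "\<bar>\<eta> i x - \<eta> i y\<bar> \<le> B / 2"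
    if "x \<in> box (Suc n) l u" "y \<in> box (Suc n) l u" "\<forall>j<Suc n. \<bar>x j - y j\<bar> \<le> B" "i < Suc n" for x y B i
    by (rule Suc.prems(3)[OF that])
  have up: "x(n := s) \<in> box (Suc n) l u" if "x \<in> box n l u" "l n < s" "s < u n" for x s
    using that by (simp add: box_Suc box_upd)
  \<comment> \<open>The values t between a and b are attained by the last component of the map when
    only coordinate n of x varies; such an interval of values is then made uniform in x.\<close>
  define Q where "Q x a b \<longleftrightarrow> (\<forall>t. a < t \<and> t < b \<longrightarrow> (\<exists>s. l n < s \<and> s < u n \<and> t = s + \<eta> n (x(n := s))))" for x a b
  have e1: "Dt (ext (ext (exts 2 (W n)))) (\<lambda>p. \<eta> n ((fst (fst (fst p)))(n := snd p)))"
    by (rule Dt_W_upd[OF d\<eta>[OF lessI]]) (intro full_ext full_exts full_V Dt_snd Dt_fst Dt_fsts Dt_V(1); assumption)+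
  have "Df (exts 2 (W n)) (\<lambda>p. Q (fst p) (snd p 0) (snd p 1))"
    unfolding Q_def
    by (intro df_intros Dt_add Dt_snd e1 Dt_fst Dt_snds Dt_const full_ext full_exts full_V) simp_all
  moreover have "\<exists>a b. a < b \<and> Q x a b" if x: "x \<in> box n l u" for x
  proof -
    define h where "h s = s + \<eta> n (x(n := s))" for s
    have dh: "Dt X1 h" unfolding h_def by (intro Dt_add Dt_X1 Dt_line[OF d\<eta>[OF lessI]])
    let ?I = "{y. \<exists>s. l n < s \<and> s < u n \<and> y = h s}"
    have I: "?I = h ` {l n<..<u n}" by auto
    \<comment> \<open>Equal values would require \<open>\<eta> n\<close> to vary by the full
      distance of the arguments, but it varies by at most half of it.\<close>
    have "inj_on h {l n<..<u n}"
    proof (rule inj_onI)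
      fix s t assume st: "s \<in> {l n<..<u n}" "t \<in> {l n<..<u n}" "h s = h t"
      have "\<bar>\<eta> n (x(n := s)) - \<eta> n (x(n := t))\<bar> \<le> \<bar>s - t\<bar> / 2"
      proof (rule lip)
        show "\<forall>j<Suc n. \<bar>(x(n := s)) j - (x(n := t)) j\<bar> \<le> \<bar>s - t\<bar>" by (simp add: less_Suc_eq)
      qed (use st x up in auto)
      moreover have "\<bar>\<eta> n (x(n := s)) - \<eta> n (x(n := t))\<bar> = \<bar>s - t\<bar>"
        using st(3) unfolding h_def by linarith
      ultimately show "s = t" by simp
    qed
    then have "infinite ?I" unfolding I using lu(2) by (simp add: finite_image_iff infinite_Ioo)
    moreover have "Df (ext X1) (\<lambda>p. \<exists>s. l n < s \<and> s < u n \<and> snd p = h s)"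
      by (intro def_rules Dt_app1[OF dh])
    then have "tame ?I" by (rule Df_tame)
    ultimately obtain a b where ab: "a < b" "{a<..<b} \<subseteq> ?I" using tame_infinite by blast
    then have "Q x a b" unfolding Q_def h_def by auto
    then show ?thesis using ab by blast
  qed
  moreover have "Q x a' b'" if "Q x a b" "a \<le> a'" "b' \<le> b" for x a b a' b'
    unfolding Q_def
  proof (intro allI impI)
    fix t assume "a' < t \<and> t < b'"
    then have "a < t \<and> t < b" using that(2,3) by simp
    then show "\<exists>s. l n < s \<and> s < u n \<and> t = s + \<eta> n (x(n := s))" using that(1) unfolding Q_def by blast
  qed
  ultimately have "\<exists>l' u' a b. good n l' u' \<and> box n l' u' \<subseteq> box n l u \<and> a < b \<and> (\<forall>x\<in>box n l' u'. Q x a b)"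
    using union_and_continuity[of n] lu(1) by (intro uniform_interval[of n Q l u]) blast+
  then obtain l1 u1 a b where 1: "good n l1 u1" "box n l1 u1 \<subseteq> box n l u" "a < b" "\<forall>x\<in>box n l1 u1. Q x a b" by blast
  define S where "S y \<longleftrightarrow> (\<exists>x\<in>box (Suc n) l u. \<forall>i<Suc n. y i = x i + \<eta> i x)" for y
  have dS: "Df (W (n + 1)) S"
  proof -
    have "Df (W (Suc n)) (\<lambda>y. \<exists>x. x \<in> box (Suc n) l u \<and> (\<forall>i<Suc n. y i = x i + \<eta> i x))"
    proof (rule Df_exs[where n = "Suc n"], intro Df_and Df_all_less Df_eq Dt_add)
      show "Df (exts (Suc n) (W (Suc n))) (\<lambda>p. snd p \<in> box (Suc n) l u)"
        by (rule Df_box) (auto intro: Dt_snds Dt_const full_exts full_V)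
      fix i assume i: "i < Suc n"
      show "Dt (exts (Suc n) (W (Suc n))) (\<lambda>p. fst p i)" by (rule Dt_fsts[OF Dt_V(1)[OF i]])
      show "Dt (exts (Suc n) (W (Suc n))) (\<lambda>p. snd p i)" by (rule Dt_snds[OF i])
      show "Dt (exts (Suc n) (W (Suc n))) (\<lambda>p. \<eta> i (snd p))"
        by (rule Dt_app[OF d\<eta>[OF i]]) (auto intro: Dt_snds Dt_const full_exts full_V)
    qed
    then show ?thesis by (simp add: S_def[abs_def] Bex_def)
  qed
  have "fat n (\<lambda>y. S (cat n y z))" if z: "a < z 0" "z 0 < b" for z
  proof -
    have "Df (ext (W n)) (\<lambda>p. l n < snd p \<and> snd p < u n \<and> z 0 = snd p + \<eta> n ((fst p)(n := snd p)))"
    proof (intro Df_and Df_less Df_eq Dt_add Dt_snd Dt_const full_ext full_V)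
      show "Dt (ext (W n)) (\<lambda>p. \<eta> n ((fst p)(n := snd p)))"
        by (rule Dt_W_upd[OF d\<eta>[OF lessI]]) (intro full_ext full_V Dt_snd Dt_fst Dt_V(1); assumption)+
    qed
    \<comment> \<open>\<psi> solves the last equation for coordinate n, for the prescribed value
      \<open>z 0\<close>; the remaining n equations are left to the induction hypothesis.\<close>
    then obtain \<psi> where \<psi>: "Dt (W n) \<psi>"
      "\<And>x s. l n < s \<and> s < u n \<and> z 0 = s + \<eta> n (x(n := s)) \<Longrightarrow> l n < \<psi> x \<and> \<psi> x < u n \<and> z 0 = \<psi> x + \<eta> n (x(n := \<psi> x))"
      by (rule definable_choice) blast
    have \<psi>x: "l n < \<psi> x" "\<psi> x < u n" "z 0 = \<psi> x + \<eta> n (x(n := \<psi> x))" if x: "x \<in> box n l1 u1" for x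
    proof -
      obtain s where "l n < s \<and> s < u n \<and> z 0 = s + \<eta> n (x(n := s))" using 1(4) x z unfolding Q_def by blast
      from \<psi>(2)[OF this] show "l n < \<psi> x" "\<psi> x < u n" "z 0 = \<psi> x + \<eta> n (x(n := \<psi> x))" by blast+
    qed
    have "fat n (\<lambda>y. \<exists>x\<in>box n l1 u1. \<forall>i<n. y i = x i + \<eta> i (x(n := \<psi> x)))"
    proof (rule Suc.IH[OF _ 1(1)])
      show "Dt (W n) (\<lambda>x. \<eta> i (x(n := \<psi> x)))" if "i < n" for i
        by (rule Dt_W_upd[OF d\<eta>]) (use that in \<open>auto intro: full_V Dt_V \<psi>(1)\<close>)
      fix x y B i assume x: "x \<in> box n l1 u1" and y: "y \<in> box n l1 u1" and B: "\<forall>j<n. \<bar>x j - y j\<bar> \<le> B" and i: "i < n"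
      have "\<bar>x i - y i\<bar> \<le> B" using B i by blast
      then have B0: "0 \<le> B" using abs_ge_zero order_trans by blast
      have xb: "x(n := \<psi> x) \<in> box (Suc n) l u" "y(n := \<psi> y) \<in> box (Suc n) l u"
        using x y 1(2) \<psi>x by (auto intro: up)
      \<comment> \<open>By the last equation, the variation \<Delta> of \<psi> equals that of
        \<open>\<eta> n\<close>, so \<Delta> is at most half of max(B, \<Delta>), hence at most B.
        In the maximum norm, the substitution of \<psi> thus preserves the contraction constant
        1/2.\<close>
      define \<Delta> where "\<Delta> = \<bar>\<psi> x - \<psi> y\<bar>"
      have "\<bar>\<eta> n (x(n := \<psi> x)) - \<eta> n (y(n := \<psi> y))\<bar> \<le> max B \<Delta> / 2"
        by (rule lip[OF xb _ lessI]) (use B in \<open>auto simp: less_Suc_eq \<Delta>_def le_max_iff_disj\<close>)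
      moreover have "\<bar>\<eta> n (x(n := \<psi> x)) - \<eta> n (y(n := \<psi> y))\<bar> = \<Delta>"
        using \<psi>x(3)[OF x] \<psi>x(3)[OF y] unfolding \<Delta>_def by linarith
      ultimately have "\<Delta> \<le> max B \<Delta> / 2" by simp
      then have "\<Delta> \<le> B" using B0 by (auto simp: max_def split: if_splits)
      then have "\<forall>j<Suc n. \<bar>(x(n := \<psi> x)) j - (y(n := \<psi> y)) j\<bar> \<le> B"
        using B by (auto simp: less_Suc_eq \<Delta>_def)
      then show "\<bar>\<eta> i (x(n := \<psi> x)) - \<eta> i (y(n := \<psi> y))\<bar> \<le> B / 2"
        using lip[OF xb] i by simp
    qed
    then obtain l2 u2 where 2: "good n l2 u2" "\<forall>y\<in>box n l2 u2. \<exists>x\<in>box n l1 u1. \<forall>i<n. y i = x i + \<eta> i (x(n := \<psi> x))"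
      unfolding fat_def by blast
    have "S (cat n y z)" if y: "y \<in> box n l2 u2" for y
    proof -
      obtain x where x: "x \<in> box n l1 u1" "\<forall>i<n. y i = x i + \<eta> i (x(n := \<psi> x))" using 2(2) y by blast
      have "x(n := \<psi> x) \<in> box (Suc n) l u" using x(1) 1(2) \<psi>x[OF x(1)] by (auto intro: up)
      moreover have "\<forall>i<Suc n. cat n y z i = (x(n := \<psi> x)) i + \<eta> i (x(n := \<psi> x))"
        using x(2) \<psi>x(3)[OF x(1)] by (auto simp: cat_def less_Suc_eq)
      ultimately show ?thesis unfolding S_def by blast
    qed
    then show ?thesis unfolding fat_def using 2(1) by blast
  qed
  then have "fat 1 (\<lambda>z. fat n (\<lambda>y. S (cat n y z)))"
    unfolding fat_def[of 1] using 1(3) by (intro exI[of _ "\<lambda>_. a"] exI[of _ "\<lambda>_. b"]) (auto simp: good_def box_def)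
  then have "fat (n + 1) S" by (rule fat_if_tuple_fibres_fat[OF dS])
  then show ?case by (simp add: S_def[abs_def])
qed

end

section \<open>Parameters and the derivation\<close>

lemma sum_lessThan_add: "(\<Sum>k<n + r. F k) = (\<Sum>k<n. F k) + (\<Sum>j<r. F (n + j :: nat) :: 'k::comm_monoid_add)"
  by (induction r) (simp_all add: add.assoc)

lemma has_deriv1_local:
  assumes "has_deriv1 g x d" "r0 > 0" "\<And>t. \<bar>t - x\<bar> < r0 \<Longrightarrow> f t = g t"
  shows "has_deriv1 f x d"
  unfolding has_deriv1_def
proof (intro allI impI)
  fix e :: 'a assume "e > 0"
  then obtain r where r: "r > 0" "\<forall>h. h \<noteq> 0 \<and> \<bar>h\<bar> < r \<longrightarrow> \<bar>g (x + h) - g x - d * h\<bar> < e * \<bar>h\<bar>"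
    using assms(1) unfolding has_deriv1_def by blast
  show "\<exists>r>0. \<forall>h. h \<noteq> 0 \<and> \<bar>h\<bar> < r \<longrightarrow> \<bar>f (x + h) - f x - d * h\<bar> < e * \<bar>h\<bar>"
  proof (intro exI[of _ "min r r0"] conjI allI impI)
    fix h assume h: "h \<noteq> 0 \<and> \<bar>h\<bar> < min r r0"
    have "f (x + h) = g (x + h)" "f x = g x" using assms(2) h by (auto intro: assms(3))
    then show "\<bar>f (x + h) - f x - d * h\<bar> < e * \<bar>h\<bar>" using r(2) h by simp
  qed (use r assms(2) in simp)
qed

lemma contn_const: "contn n (\<lambda>_. c) x"
  unfolding contn_def by (auto intro!: exI[of _ 1])

lemma contn_coord: "i < n \<Longrightarrow> contn n (\<lambda>x. x i) x"
  unfolding contn_def by auto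

text \<open>Induction step of the Leibniz formula, where \<open>P j\<close> and \<open>Q j\<close>
  stand for the j-th derivatives of two factors: after an index shift this is Pascal's rule.\<close>

lemma pascal_sum:
  fixes P Q :: "nat \<Rightarrow> 'k::comm_ring_1"
  shows "(\<Sum>j\<le>k. of_nat (k choose j) * (P (Suc j) * Q (k - j) + P j * Q (Suc (k - j)))) =
    (\<Sum>j\<le>Suc k. of_nat (Suc k choose j) * (P j * Q (Suc k - j)))"
proof -
  have "(\<Sum>j\<le>k. of_nat (k choose j) * (P j * Q (Suc (k - j)))) = (\<Sum>j\<le>k. of_nat (k choose j) * (P j * Q (Suc k - j)))"
    by (intro sum.cong) (simp_all add: Suc_diff_le)
  also have "\<dots> = (\<Sum>j\<le>Suc k. of_nat (k choose j) * (P j * Q (Suc k - j)))" by (simp add: binomial_eq_0)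
  also have "\<dots> = P 0 * Q (Suc k) + (\<Sum>j\<le>k. of_nat (k choose Suc j) * (P (Suc j) * Q (k - j)))"
    by (subst sum.atMost_Suc_shift) simp
  finally have 1: "(\<Sum>j\<le>k. of_nat (k choose j) * (P j * Q (Suc (k - j)))) =
    P 0 * Q (Suc k) + (\<Sum>j\<le>k. of_nat (k choose Suc j) * (P (Suc j) * Q (k - j)))" .
  have "(\<Sum>j\<le>Suc k. of_nat (Suc k choose j) * (P j * Q (Suc k - j))) =
    P 0 * Q (Suc k) + (\<Sum>j\<le>k. of_nat ((k choose j) + (k choose Suc j)) * (P (Suc j) * Q (k - j)))"
    by (subst sum.atMost_Suc_shift) simp
  also have "\<dots> = P 0 * Q (Suc k) + ((\<Sum>j\<le>k. of_nat (k choose j) * (P (Suc j) * Q (k - j))) + (\<Sum>j\<le>k. of_nat (k choose Suc j) * (P (Suc j) * Q (k - j))))"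
    by (simp only: of_nat_add distrib_right sum.distrib)
  finally show ?thesis using 1 by (simp only: distrib_left sum.distrib) (simp only: add.left_commute)
qed

section \<open>Minimal families of parameters\<close>

context definable_predicates
begin

lemma Df_cong:
  assumes "Df X P" "\<And>x. x \<in> X \<Longrightarrow> x c = x c'"
  shows "P c = P c'"
  using assms(1)
proof (rule DfE)
  fix R \<rho> assume 1: "\<forall>i. \<rho> i \<in> insert (\<lambda>_. 0) X" "\<forall>c. P c = R (\<lambda>i. \<rho> i c)"
  have "(\<lambda>i. \<rho> i c) = (\<lambda>i. \<rho> i c')"
  proof
    show "\<rho> i c = \<rho> i c'" for i using 1(1)[rule_format, of i] assms(2) by auto
  qed
  then show ?thesis using 1(2) by simp
qed

lemma Df_V_UNIV: "Df (V A n) P \<Longrightarrow> Df (W n) P"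
  by (erule Df_mono) (auto simp: V_def)

lemma Dt_V_UNIV: "Dt (V A n) f \<Longrightarrow> Dt (W n) f"
  by (rule Dt_app[where w = "\<lambda>c. c"]) (auto intro: Dt_V)

text \<open>A definition looks at N places only; a constant in place i becomes entry i of m and is
  read as the variable n + i. Redundant entries are harmless, as the number is minimized
  later.\<close>

lemma extract_parameters:
  assumes "Df (ext (W n)) P"
  shows "\<exists>r m Q. Df (ext (V {} (n + r))) Q \<and> (\<forall>x y. P (x, y) = Q (cat n x m, y))"
  using assms
proof (rule DfE)
  fix R \<rho> assume 1: "R \<in> D" "\<forall>i. \<rho> i \<in> insert (\<lambda>_. 0) (ext (W n))" "\<forall>c. P c = R (\<lambda>i. \<rho> i c)"
  obtain N where N: "\<And>v w. (\<forall>i<N. v i = w i) \<Longrightarrow> R v = R w" using D_supp[OF 1(1)] by blast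
  have "\<forall>i. \<exists>\<tau> a. \<tau> \<in> insert (\<lambda>_. 0) (ext (V {} (n + N))) \<and> (i < N \<longrightarrow> (\<forall>m x y. m i = a \<longrightarrow> \<rho> i (x, y) = \<tau> (cat n x m, y)))"
  proof
    fix i
    consider "\<rho> i = (\<lambda>_. 0)" | "\<rho> i = snd" | j where "j < n" "\<rho> i = (\<lambda>p. fst p j)" | a where "\<rho> i = (\<lambda>_. a)"
      using 1(2)[rule_format, of i] by (auto simp: ext_def V_def)
    then show "\<exists>\<tau> a. \<tau> \<in> insert (\<lambda>_. 0) (ext (V {} (n + N))) \<and> (i < N \<longrightarrow> (\<forall>m x y. m i = a \<longrightarrow> \<rho> i (x, y) = \<tau> (cat n x m, y)))"
    proof cases
      case 1
      then show ?thesis by (intro exI[of _ "\<lambda>_. 0"] exI[of _ 0]) simp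
    next
      case 2
      then show ?thesis by (intro exI[of _ snd] exI[of _ 0]) (simp add: ext_def)
    next
      case (3 j)
      then show ?thesis by (intro exI[of _ "\<lambda>p. fst p j"] exI[of _ 0]) (auto simp: ext_def V_def cat_def)
    next
      case (4 a)
      show ?thesis
      proof (cases "i < N")
        case True
        then show ?thesis using 4 by (intro exI[of _ "\<lambda>p. fst p (n + i)"] exI[of _ a]) (auto simp: ext_def V_def cat_def)
      next
        case False
        then show ?thesis by (intro exI[of _ "\<lambda>_. 0"] exI[of _ 0]) simp
      qed
    qed
  qed
  then obtain \<tau> m where \<tau>: "\<And>i. \<tau> i \<in> insert (\<lambda>_. 0) (ext (V {} (n + N)))"
    "\<And>i m' x y. i < N \<Longrightarrow> m' i = m i \<Longrightarrow> \<rho> i (x, y) = \<tau> i (cat n x m', y)" by metis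
  have "Df (ext (V {} (n + N))) (\<lambda>p. R (\<lambda>i. \<tau> i p))"
    by (rule DfI[OF 1(1) \<tau>(1)]) simp
  moreover have "P (x, y) = R (\<lambda>i. \<tau> i (cat n x m, y))" for x y
    unfolding 1(3)[rule_format] by (rule N) (simp add: \<tau>(2)[of _ m])
  ultimately show ?thesis by blast
qed

text \<open>If the element q selected in the fibre over m is not \<open>m r\<close>, then removing
  the selected element from all fibres leaves a parameter-free definable set with a smaller fibre
  over m.\<close>

lemma finite_fibre_definable:
  assumes "finite {t. Z (m(r := t))}" "Z m" "Df (V {} (Suc r)) Z"
  shows "\<exists>q. Dt (V {} r) q \<and> m r = q m"
  using assms
proof (induction "card {t. Z (m(r := t))}" arbitrary: Z rule: less_induct)
  case less
  have "Df (ext (V {} r)) (\<lambda>p. Z ((fst p)(r := snd p)))"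
  proof (rule Df_app[OF less.prems(3)])
    show "Dt (ext (V {} r)) (\<lambda>p. ((fst p)(r := snd p)) i)" if "i < Suc r" for i
      by (cases "i = r") (use that in \<open>auto intro: Dt_snd Dt_fst[OF Dt_V(1)]\<close>)
  qed simp
  then obtain q where q: "Dt (V {} r) q" "\<And>c a. Z (c(r := a)) \<Longrightarrow> Z (c(r := q c))"
    by (rule definable_choice) blast
  have qm: "Z (m(r := q m))" using q(2)[of m "m r"] less.prems(2) by simp
  show ?case
  proof (cases "m r = q m")
    case True
    then show ?thesis using q(1) by blast
  next
    case False
    define Z1 where "Z1 z \<longleftrightarrow> Z z \<and> z r \<noteq> q z" for z
    have qc: "q (z(r := t)) = q z" for z t by (rule Dt_V_cong[OF q(1)]) simp
    have "{t. Z1 (m(r := t))} = {t. Z (m(r := t))} - {q m}"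
      unfolding Z1_def by (auto simp: qc)
    then have sub: "{t. Z1 (m(r := t))} \<subset> {t. Z (m(r := t))}" using qm by blast
    have "Dt (V {} (Suc r)) q" by (rule Dt_app[OF q(1), where w = "\<lambda>c. c"]) (auto intro: Dt_V)
    then have d: "Df (V {} (Suc r)) Z1"
      unfolding Z1_def by (intro Df_and Df_not Df_eq Dt_V less.prems(3)) simp_all
    show ?thesis
    proof (rule less.hyps[OF _ _ _ d])
      show "card {t. Z1 (m(r := t))} < card {t. Z (m(r := t))}" by (rule psubset_card_mono[OF less.prems(1) sub])
      show "finite {t. Z1 (m(r := t))}" using finite_subset[OF _ less.prems(1)] sub by blast
      show "Z1 m" using less.prems(2) False by (simp add: Z1_def)
    qed
  qed
qed

text \<open>A parameter-free set that is not fat imposes a relation on its points. If its fibre over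
  m is finite, the last entry of m is a function of the others. Otherwise m satisfies
  \<open>fibre_fat\<close>, which is not fat by the Fubini property, and the relation already
  concerns the other entries.\<close>

lemma dependent_if_not_fat:
  assumes "Df (V {} r) Z" "Z m" "\<not> fat r Z"
  shows "\<exists>r' m' q. r = Suc r' \<and> (\<forall>i<r. Dt (V {} r') (q i) \<and> m i = q i m')"
  using assms
proof (induction r arbitrary: Z)
  case 0
  have "Z x" for x using Df_cong[OF 0(1), of x m] 0(2) by (auto simp: V_def)
  then have "fat 0 Z" unfolding fat_def good_def by simp
  then show ?case using 0 by blast
next
  case (Suc r)
  show ?case
  proof (cases "fibre_fat r Z m")
    case True
    have "\<not> fat r (fibre_fat r Z)" using fat_Suc_if_fibres_fat[OF Df_V_UNIV[OF Suc.prems(1)]] Suc.prems(3) by blast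
    from Suc.IH[OF Df_fibre_fat[OF Suc.prems(1)] True this] obtain r' m' q where
      1: "r = Suc r'" "\<forall>i<r. Dt (V {} r') (q i) \<and> m i = q i m'" by blast
    \<comment> \<open>The unconstrained last entry is kept as an additional parameter with index
      \<open>r'\<close>.\<close>
    define q' where "q' i = (if i = r then (\<lambda>z. z r') else q i)" for i
    have "Dt (V {} r) (q' i) \<and> m i = q' i (m'(r' := m r))" if i: "i < Suc r" for i
    proof (cases "i = r")
      case True
      then show ?thesis using 1(1) by (auto simp: q'_def intro: Dt_V)
    next
      case False
      then have "i < r" using i by simp
      then have qi: "Dt (V {} r') (q i)" "m i = q i m'" using 1(2) by auto
      have "Dt (V {} r) (q i)" by (rule Dt_app[OF qi(1), where w = "\<lambda>c. c"]) (use 1(1) in \<open>auto intro: Dt_V\<close>)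
      moreover have "q i (m'(r' := m r)) = q i m'" by (rule Dt_V_cong[OF qi(1)]) simp
      ultimately show ?thesis using False qi(2) by (simp add: q'_def)
    qed
    then show ?thesis by blast
  next
    case False
    have "finite {t. Z (m(r := t))}"
    proof (rule ccontr)
      assume inf: "infinite {t. Z (m(r := t))}"
      have "tame {t. Z (m(r := t))}"
        by (rule Df_tame1, rule Df_W_upd[OF Df_V_UNIV[OF Suc.prems(1)]]) (intro full_X1 Dt_const Dt_X1)+
      then obtain a b where "a < b" "{a<..<b} \<subseteq> {t. Z (m(r := t))}" using tame_infinite inf by blast
      then have "fibre_fat r Z m" unfolding fibre_fat_def by (intro exI[of _ a] exI[of _ b]) auto
      then show False using False by blast
    qed
    from finite_fibre_definable[OF this Suc.prems(2,1)] obtain q where q: "Dt (V {} r) q" "m r = q m" by blast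
    have "\<forall>i<Suc r. Dt (V {} r) (if i = r then q else (\<lambda>z. z i)) \<and> m i = (if i = r then q else (\<lambda>z. z i)) m"
      using q by (auto intro: Dt_V)
    then show ?thesis by (intro exI[of _ r] exI[of _ m] exI[of _ "\<lambda>i. if i = r then q else (\<lambda>z. z i)"]) blast
  qed
qed

lemma Df_C1_at:
  assumes g: "Dt (V {} N) g"
  shows "Df (V {} N) (C1_at N g)"
proof -
  have "Df (V {} N) (\<lambda>x. \<exists>d. has_pderiv g i x d)" if i: "i < N" for i
    by (rule Df_ex, rule Df_has_pderiv[OF g Dt_snd _ i]) (auto intro: Dt_fst[OF Dt_V(1)])
  moreover have "Df (V {} N) (\<lambda>x. contn N (pderivn g i) x)" if i: "i < N" for i
    by (rule Df_contn, rule Dt_app[OF Dt_pderivn[OF g i]]) (auto intro: Dt_snds Dt_V)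
  ultimately show ?thesis
    unfolding C1_at_def[abs_def] by (intro Df_all_less Df_and)
qed

text \<open>
  A function definable with parameters is, on a smaller box, the specialization of a parameter-free
  function that is continuously differentiable near the graph of the parameters: if the number of
  parameters is minimal, then every parameter-free definable set containing them is fat, so they
  avoid the exceptional set.
\<close>

lemma specialization_of_C1:
  assumes f: "Dt (W n) f" and lu: "good n l u"
  shows "\<exists>l' u' r m g P. good n l' u' \<and> box n l' u' \<subseteq> box n l u \<and> Dt (V {} (n + r)) g \<and> Df (V {} (n + r)) P \<and>
    (\<forall>v. P v \<longrightarrow> C1_at (n + r) g v \<and> (\<exists>a b. v \<in> box (n + r) a b \<and> (\<forall>x\<in>box (n + r) a b. P x))) \<and>
    (\<forall>x\<in>box n l' u'. P (cat n x m) \<and> f x = g (cat n x m))"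
proof -
  \<comment> \<open>The box is part of the condition: fewer parameters may suffice after shrinking
    it.\<close>
  define Rp where "Rp r \<longleftrightarrow> (\<exists>m l' u' Q. good n l' u' \<and> box n l' u' \<subseteq> box n l u \<and> Df (ext (V {} (n + r))) Q \<and>
     (\<forall>x\<in>box n l' u'. \<forall>y. Q (cat n x m, y) \<longleftrightarrow> y = f x))" for r
  obtain r0 m0 Q0 where "Df (ext (V {} (n + r0))) Q0" "\<forall>x y. (snd (x, y) = f (fst (x, y))) = Q0 (cat n x m0, y)"
    using extract_parameters[OF f[unfolded Dt_def]] by blast
  then have "Rp r0" unfolding Rp_def using lu by (intro exI[of _ m0] exI[of _ l] exI[of _ u] exI[of _ Q0]) simp
  then obtain r where r: "Rp r" "\<And>r'. r' < r \<Longrightarrow> \<not> Rp r'" using exists_least_iff[of Rp] by blast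
  from r(1) obtain m l1 u1 Q where 1: "good n l1 u1" "box n l1 u1 \<subseteq> box n l u" and dQ: "Df (ext (V {} (n + r))) Q"
    and Q: "\<forall>x\<in>box n l1 u1. \<forall>y. Q (cat n x m, y) \<longleftrightarrow> y = f x" unfolding Rp_def by blast
  \<comment> \<open>Otherwise m consists of parameter-free functions of fewer parameters;
    substituting them into Q contradicts the minimality of r.\<close>
  have indep: "fat r Z" if Z: "Df (V {} r) Z" "Z m" for Z
  proof (rule ccontr)
    assume "\<not> fat r Z"
    from dependent_if_not_fat[OF Z this] obtain r' m' q where
      q: "r = Suc r'" "\<forall>i<r. Dt (V {} r') (q i) \<and> m i = q i m'" by blast
    define w where "w v k = (if k < n then v k else q (k - n) (\<lambda>j. v (n + j)))" for v and k :: nat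
    have dw: "Dt (ext (V {} (n + r'))) (\<lambda>p. w (fst p) k)" if k: "k < n + r" for k
    proof (cases "k < n")
      case True
      then show ?thesis unfolding w_def by (auto intro: Dt_fst[OF Dt_V(1)])
    next
      case False
      then have "k - n < r" using k by simp
      then have "Dt (V {} r') (q (k - n))" using q(2) by blast
      then have "Dt (ext (V {} (n + r'))) (\<lambda>p. q (k - n) (\<lambda>j. fst p (n + j)))"
        by (rule Dt_app) (auto intro: Dt_fst[OF Dt_V(1)])
      then show ?thesis using False by (simp add: w_def)
    qed
    have "Df (ext (V {} (n + r'))) (\<lambda>p. Q (w (fst p), snd p))"
    proof (rule Df_subst[OF dQ])
      fix x assume "x \<in> ext (V {} (n + r))"
      then consider "x = snd" | k where "k < n + r" "x = (\<lambda>p. fst p k)" by (auto simp: ext_def V_def)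
      then show "Dt (ext (V {} (n + r'))) (\<lambda>p. x (w (fst p), snd p))"
        by cases (auto intro: Dt_snd dw)
    qed
    moreover have "Q (w (cat n x m'), y) = Q (cat n x m, y)" for x y
    proof (rule Df_cong[OF dQ])
      fix z assume "z \<in> ext (V {} (n + r))"
      then consider "z = snd" | k where "k < n + r" "z = (\<lambda>p. fst p k)" by (auto simp: ext_def V_def)
      then show "z (w (cat n x m'), y) = z (cat n x m, y)"
      proof cases
        case (2 k)
        have "(\<lambda>j. cat n x m' (n + j)) = m'" by (simp add: cat_def)
        then show ?thesis using 2 q(2)[rule_format, of "k - n"] by (auto simp: w_def cat_def)
      qed simp
    qed
    ultimately have "Rp r'" unfolding Rp_def using 1 Q
      by (intro exI[of _ m'] exI[of _ l1] exI[of _ u1] exI[of _ "\<lambda>p. Q (w (fst p), snd p)"]) simp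
    then show False using r(2)[of r'] q(1) by simp
  qed
  define N where "N = n + r"
  define g where "g v = (if \<exists>!y. Q (v, y) then THE y. Q (v, y) else 0)" for v
  have dg: "Dt (V {} N) g"
    unfolding g_def N_def by (rule Dt_The) (use dQ in simp)
  have gf: "f x = g (cat n x m)" if x: "x \<in> box n l1 u1" for x
  proof -
    have "Q (cat n x m, y) \<longleftrightarrow> y = f x" for y using Q x by blast
    then show ?thesis by (simp add: g_def)
  qed
  \<comment> \<open>The interior of the set where g is continuously differentiable: open by its
    form, and still definable without parameters.\<close>
  define P where "P v \<longleftrightarrow> (\<exists>a b. v \<in> box N a b \<and> (\<forall>x. x \<in> box N a b \<longrightarrow> C1_at N g x))" for v
  have dP: "Df (V {} N) P"
    unfolding P_def
  proof (intro Df_exs[where n = N] Df_and Df_alls[where n = N] Df_imp Df_box)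
    show "Df (exts N (exts N (exts N (V {} N)))) (\<lambda>p. C1_at N g (snd p))"
      by (rule Df_app[OF Df_C1_at[OF dg]]) (auto intro: Dt_snds)
  qed (auto intro: Dt_snds Dt_fsts[OF Dt_snds] Dt_fsts[OF Dt_fsts[OF Dt_snds]] Dt_fsts[OF Dt_fsts[OF Dt_V(1)]])
  have P_open: "\<exists>a b. v \<in> box N a b \<and> (\<forall>x\<in>box N a b. P x)" if "P v" for v
    using that unfolding P_def by blast
  have P_C1: "C1_at N g v" if "P v" for v using that unfolding P_def by blast
  have "\<not> fat N (\<lambda>v. \<not> P v)"
  proof
    assume "fat N (\<lambda>v. \<not> P v)"
    then obtain a b where ab: "good N a b" "\<forall>v\<in>box N a b. \<not> P v" unfolding fat_def by blast
    from C1_on_subbox[OF Dt_V_UNIV[OF dg] ab(1)] obtain a' b' where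
      2: "good N a' b'" "box N a' b' \<subseteq> box N a b" "\<forall>x\<in>box N a' b'. C1_at N g x" by blast
    have mb: "mid a' b' \<in> box N a' b'" using 2(1) by (rule mid_in_box)
    then have "P (mid a' b')" unfolding P_def using 2(3) by blast
    then show False using ab(2) 2(2) mb by blast
  qed
  have "\<not> fat n (\<lambda>x. \<not> P (cat n x m))"
  proof
    assume bad: "fat n (\<lambda>x. \<not> P (cat n x m))"
    \<comment> \<open>The parameters for which the exceptional set has a fat fibre. Z is
      parameter-free and would contain m, so it would be fat by \<open>indep\<close>, and the Fubini
      property would make the negation of P fat.\<close>
    define Z where "Z z \<longleftrightarrow> (\<exists>a b. (\<forall>i<n. a i < b i) \<and> (\<forall>x. x \<in> box n a b \<longrightarrow> \<not> P (cat n x z)))" for z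
    have Zfat: "Z z \<longleftrightarrow> fat n (\<lambda>x. \<not> P (cat n x z))" for z unfolding Z_def fat_def good_def by blast
    have "Df (V {} r) Z"
      unfolding Z_def
    proof (intro Df_exs[where n = n] Df_and Df_alls[where n = n] Df_imp Df_box Df_not Df_all_less Df_less)
      show "Df (exts n (exts n (exts n (V {} r)))) (\<lambda>p. P (cat n (snd p) (fst (fst (fst p)))))"
      proof (rule Df_app[OF dP])
        show "Dt (exts n (exts n (exts n (V {} r)))) (\<lambda>p. cat n (snd p) (fst (fst (fst p))) i)" if i: "i < N" for i
          by (cases "i < n") (use i in \<open>auto simp: cat_def N_def intro: Dt_snds Dt_fsts[OF Dt_fsts[OF Dt_fsts[OF Dt_V(1)]]]\<close>)
      qed simp
    qed (auto intro: Dt_snds Dt_fsts[OF Dt_snds] Dt_fsts[OF Dt_fsts[OF Dt_snds]])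
    then have "fat r Z" by (rule indep) (simp add: Zfat bad)
    then have "fat r (\<lambda>z. fat n (\<lambda>x. \<not> P (cat n x z)))" by (simp add: Zfat[abs_def])
    then have "fat (n + r) (\<lambda>v. \<not> P v)"
      using dP unfolding N_def by (intro fat_if_tuple_fibres_fat Df_not Df_V_UNIV)
    then show False using \<open>\<not> fat N (\<lambda>v. \<not> P v)\<close> by (simp add: N_def)
  qed
  then obtain x where x: "x \<in> box n l1 u1" "P (cat n x m)" using 1(1) unfolding fat_def by blast
  from P_open[OF x(2)] obtain a b where ab: "cat n x m \<in> box N a b" "\<forall>x\<in>box N a b. P x" by blast
  define l2 where "l2 i = max (l1 i) (a i)" for i
  define u2 where "u2 i = min (u1 i) (b i)" for i
  have xa: "a i < x i \<and> x i < b i" if "i < n" for i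
    using ab(1) that unfolding box_def N_def by (auto simp: cat_def dest!: spec[of _ i])
  have x2: "x \<in> box n l2 u2" using x(1) xa by (simp add: box_def l2_def u2_def)
  have g2: "good n l2 u2"
    unfolding good_def
  proof (intro allI impI)
    fix i assume "i < n"
    then have "l2 i < x i" "x i < u2 i" using x2 by (simp_all add: box_def)
    then show "l2 i < u2 i" by simp
  qed
  have sub: "box n l2 u2 \<subseteq> box n l1 u1" by (auto simp: box_def l2_def u2_def)
  have "P (cat n y m)" if y: "y \<in> box n l2 u2" for y
  proof -
    have "cat n y m \<in> box N a b"
      unfolding box_def
    proof (intro CollectI allI impI)
      fix i assume i: "i < N"
      then have "a i < cat n x m i \<and> cat n x m i < b i" using ab(1) by (simp add: box_def)
      then show "a i < cat n y m i \<and> cat n y m i < b i"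
        using y by (auto simp: cat_def box_def l2_def u2_def)
    qed
    then show ?thesis using ab(2) by blast
  qed
  then have last: "\<forall>x\<in>box n l2 u2. P (cat n x m) \<and> f x = g (cat n x m)" using gf sub by blast
  show ?thesis
  proof (intro exI conjI)
    show "good n l2 u2" by (rule g2)
    show "box n l2 u2 \<subseteq> box n l u" using sub 1(2) by blast
    show "Dt (V {} (n + r)) g" "Df (V {} (n + r)) P" using dg dP by (simp_all add: N_def)
    show "\<forall>v. P v \<longrightarrow> C1_at (n + r) g v \<and> (\<exists>a b. v \<in> box (n + r) a b \<and> (\<forall>x\<in>box (n + r) a b. P x))"
      using P_open P_C1 unfolding N_def by blast
    show "\<forall>x\<in>box n l2 u2. P (cat n x m) \<and> f x = g (cat n x m)" by (rule last)
  qed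
qed

end

section \<open>The derivation: product rule and chain rule with parameters\<close>

text \<open>\<open>chain\<close> is the axiom of a T-derivation on the open set P;
  \<open>generic\<close> is genericity with \<open>fat\<close> in place of full dimension of the
  projection.\<close>

locale generic_derivation = definable_predicates +
  fixes \<delta> :: "'a \<Rightarrow> 'a"
  assumes chain: "0 < N \<Longrightarrow> Df (V {} N) P \<Longrightarrow> Dt (V {} N) g \<Longrightarrow>
      (\<And>v. P v \<Longrightarrow> \<exists>a b. v \<in> box N a b \<and> (\<forall>x\<in>box N a b. P x)) \<Longrightarrow> (\<And>v. P v \<Longrightarrow> C1_at N g v) \<Longrightarrow> P v \<Longrightarrow>
      \<delta> (g v) = (\<Sum>i<N. pderivn g i v * \<delta> (v i))"
    and generic: "Df (V UNIV (Suc n)) A \<Longrightarrow> fat n (\<lambda>x. \<exists>t. A (x(n := t))) \<Longrightarrow> \<exists>a. A (\<lambda>i. (\<delta> ^^ i) a)"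
begin

lemma chain_everywhere:
  assumes "0 < N" "Dt (V {} N) g" "\<And>v. C1_at N g v"
  shows "\<delta> (g v) = (\<Sum>i<N. pderivn g i v * \<delta> (v i))"
proof (rule chain[OF assms(1) Df_true[of _ True] assms(2)])
  show "\<exists>a b. v \<in> box N a b \<and> (\<forall>x\<in>box N a b. True)" for v
    by (intro exI[of _ "\<lambda>i. v i - 1"] exI[of _ "\<lambda>i. v i + 1"]) (simp add: box_def)
qed (simp_all add: assms)

text \<open>Addition and, below, multiplication are parameter-free C1 functions of two variables, so
  the laws of a derivation are instances of the chain rule.\<close>

lemma \<delta>_add: "\<delta> (x + y) = \<delta> x + \<delta> y"
proof -
  define g where "g = (\<lambda>v :: nat \<Rightarrow> 'a. v 0 + v 1)"
  have p: "has_pderiv g i v 1" if "i < 2" for i v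
    using has_pderiv_add[OF has_pderiv_coord[of 0 i v] has_pderiv_coord[of 1 i v]] that
    by (cases "i = 0") (simp_all add: g_def)
  then have pd: "pderivn g i = (\<lambda>_. 1)" if "i < 2" for i using that pderivn_eq by blast
  have "\<delta> (g (\<lambda>i. if i = 0 then x else y)) = (\<Sum>i<2. pderivn g i (\<lambda>i. if i = 0 then x else y) * \<delta> (if i = 0 then x else y))"
  proof (rule chain_everywhere)
    show "Dt (V {} 2) g" unfolding g_def by (intro Dt_add Dt_V) simp_all
    show "C1_at 2 g v" for v unfolding C1_at_def using p pd by (auto simp: contn_const)
  qed simp
  then show ?thesis using pd by (simp add: g_def numeral_2_eq_2)
qed

lemma \<delta>_mult: "\<delta> (x * y) = \<delta> x * y + x * \<delta> y"
proof -
  define g where "g = (\<lambda>v :: nat \<Rightarrow> 'a. v 0 * v 1)"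
  have p0: "has_pderiv g 0 v (v 1)" and p1: "has_pderiv g 1 v (v 0)" for v
    using has_deriv1_cmult[OF has_deriv1_id, of "v 0" "v 1"] has_deriv1_cmult[OF has_deriv1_id, of "v 1" "v 0"]
    by (simp_all add: has_pderiv_def g_def mult.commute)
  have pd: "pderivn g 0 = (\<lambda>v. v 1)" "pderivn g 1 = (\<lambda>v. v 0)" using p0 p1 pderivn_eq by blast+
  have "\<delta> (g (\<lambda>i. if i = 0 then x else y)) = (\<Sum>i<2. pderivn g i (\<lambda>i. if i = 0 then x else y) * \<delta> (if i = 0 then x else y))"
  proof (rule chain_everywhere)
    show "Dt (V {} 2) g" unfolding g_def by (intro Dt_mult Dt_V) simp_all
    show "C1_at 2 g v" for v
      unfolding C1_at_def
    proof (intro allI impI)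
      fix i :: nat assume "i < 2"
      then have "i = 0 \<or> i = 1" by linarith
      then show "(\<exists>d. has_pderiv g i v d) \<and> contn 2 (pderivn g i) v"
      proof
        assume "i = 0"
        then show ?thesis using p0 pd contn_coord[of 1 2 v] by auto
      next
        assume "i = 1"
        then show ?thesis using p1 pd contn_coord[of 0 2 v] by auto
      qed
    qed
  qed simp
  then show ?thesis using pd by (simp add: g_def numeral_2_eq_2 mult.commute)
qed

lemma \<delta>_0: "\<delta> 0 = 0"
  using \<delta>_add[of 0 0] by simp

lemma \<delta>_sum: "\<delta> (\<Sum>i\<in>I. f i) = (\<Sum>i\<in>I. \<delta> (f i))"
  by (induction I rule: infinite_finite_induct) (simp_all add: \<delta>_0 \<delta>_add)

lemma \<delta>_of_nat_mult: "\<delta> (of_nat k * x) = of_nat k * \<delta> x"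
  by (induction k) (simp_all add: \<delta>_0 \<delta>_add distrib_right)

text \<open>The chain rule is applied to a parameter-free g with f(a) = g(a, m). The derivatives in
  the directions of m are collected in h, which is a definable function of a because the values of
  \<delta> at the entries of m are constants.\<close>

lemma chain_rule_on_subbox:
  assumes f: "Dt (W n) f" and n: "0 < n" and lu: "good n l u"
  shows "\<exists>l' u' h. good n l' u' \<and> box n l' u' \<subseteq> box n l u \<and> Dt (W n) h \<and>
    (\<forall>a\<in>box n l' u'. (\<forall>i<n. \<exists>d. has_pderiv f i a d) \<and> \<delta> (f a) = (\<Sum>i<n. pderivn f i a * \<delta> (a i)) + h a)"
proof -
  obtain l1 u1 r m g P where 1: "good n l1 u1" "box n l1 u1 \<subseteq> box n l u" "Dt (V {} (n + r)) g" "Df (V {} (n + r)) P"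
    "\<forall>v. P v \<longrightarrow> C1_at (n + r) g v \<and> (\<exists>a b. v \<in> box (n + r) a b \<and> (\<forall>x\<in>box (n + r) a b. P x))"
    "\<forall>x\<in>box n l1 u1. P (cat n x m) \<and> f x = g (cat n x m)"
    using specialization_of_C1[OF f lu] by blast
  define h where "h a = (\<Sum>j<r. pderivn g (n + j) (cat n a m) * \<delta> (m j))" for a
  have dh: "Dt (W n) h"
    unfolding h_def
  proof (intro Dt_sum Dt_mult Dt_const full_V)
    fix j assume "j \<in> {..<r}"
    then have "n + j < n + r" by simp
    from Dt_pderivn[OF 1(3) this] show "Dt (W n) (\<lambda>a. pderivn g (n + j) (cat n a m))"
    proof (rule Dt_app)
      show "Dt (W n) (\<lambda>a. cat n a m i)" for i
        by (cases "i < n") (auto simp: cat_def intro: Dt_V)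
    qed simp
  qed
  have pf: "has_pderiv f i a (pderivn g i (cat n a m))" if a: "a \<in> box n l1 u1" and i: "i < n" for a i
  proof -
    have "P (cat n a m)" using 1(6) a by blast
    then have "C1_at (n + r) g (cat n a m)" using 1(5) by blast
    then have "\<exists>d. has_pderiv g i (cat n a m) d" using i unfolding C1_at_def by simp
    then have "has_pderiv g i (cat n a m) (pderivn g i (cat n a m))" by (rule has_pderiv_pderivn)
    then have D1: "has_deriv1 (\<lambda>t. g ((cat n a m)(i := t))) (a i) (pderivn g i (cat n a m))"
      using i by (simp add: has_pderiv_def cat_def)
    obtain d where d: "d > 0" "\<forall>x. (\<forall>i<n. \<bar>x i - a i\<bar> < d) \<longrightarrow> x \<in> box n l1 u1" using box_open[OF a] by blast
    have D2: "f (a(i := t)) = g ((cat n a m)(i := t))" if "\<bar>t - a i\<bar> < d" for t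
    proof -
      have "a(i := t) \<in> box n l1 u1" using d that by simp
      moreover have "cat n (a(i := t)) m = (cat n a m)(i := t)" using i by (auto simp: cat_def)
      ultimately show ?thesis using 1(6) by metis
    qed
    show ?thesis unfolding has_pderiv_def by (rule has_deriv1_local[OF D1 d(1) D2])
  qed
  have eq: "\<delta> (f a) = (\<Sum>i<n. pderivn f i a * \<delta> (a i)) + h a" if a: "a \<in> box n l1 u1" for a
  proof -
    have Pa: "P (cat n a m)" "f a = g (cat n a m)" using 1(6) a by auto
    have "\<delta> (g (cat n a m)) = (\<Sum>i<n + r. pderivn g i (cat n a m) * \<delta> (cat n a m i))"
      by (rule chain[OF _ 1(4,3) _ _ Pa(1)]) (use n 1(5) in auto)
    also have "\<dots> = (\<Sum>i<n. pderivn g i (cat n a m) * \<delta> (cat n a m i)) + (\<Sum>j<r. pderivn g (n + j) (cat n a m) * \<delta> (cat n a m (n + j)))"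
      by (rule sum_lessThan_add)
    also have "(\<Sum>i<n. pderivn g i (cat n a m) * \<delta> (cat n a m i)) = (\<Sum>i<n. pderivn f i a * \<delta> (a i))"
      using pderivn_eq[OF pf[OF a]] by (intro sum.cong) (simp_all add: cat_def)
    also have "(\<Sum>j<r. pderivn g (n + j) (cat n a m) * \<delta> (cat n a m (n + j))) = h a"
      unfolding h_def by (simp add: cat_def)
    finally show ?thesis using Pa(2) by simp
  qed
  have "\<forall>a\<in>box n l1 u1. (\<forall>i<n. \<exists>d. has_pderiv f i a d) \<and> \<delta> (f a) = (\<Sum>i<n. pderivn f i a * \<delta> (a i)) + h a"
    using pf eq by blast
  then show ?thesis using 1(1,2) dh by blast
qed

end

section \<open>Solving first-order systems\<close>

context generic_derivation
begin

text \<open>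
  \<open>G'\<close> is the derivative of \<open>G\<close> along solutions of the system \<open>\<delta> (a l) = F l a\<close>.
\<close>

definition derivative_along ::
  "nat \<Rightarrow> (nat \<Rightarrow> (nat \<Rightarrow> 'a) \<Rightarrow> 'a) \<Rightarrow> ((nat \<Rightarrow> 'a) \<Rightarrow> 'a) \<Rightarrow> ((nat \<Rightarrow> 'a) \<Rightarrow> 'a) \<Rightarrow> 'a \<Rightarrow> (nat \<Rightarrow> 'a) \<Rightarrow> bool" where
  "derivative_along n F G G' K a \<longleftrightarrow> (\<forall>l<n. has_pderiv G l a (pderivn G l a) \<and> \<bar>pderivn G l a\<bar> \<le> K) \<and>
     \<delta> (G a) = G' a + (\<Sum>l<n. pderivn G l a * (\<delta> (a l) - F l a))"

lemma derivative_along_mono: "derivative_along n F G G' K a \<Longrightarrow> K \<le> K' \<Longrightarrow> derivative_along n F G G' K' a"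
  unfolding derivative_along_def by (meson order_trans)

lemma ex_derivative_along:
  assumes n: "0 < n" and F: "\<forall>l<n. Dt (W n) (F l)" and G: "Dt (W n) G" and lu: "good n l u"
  shows "\<exists>l' u' G' K. good n l' u' \<and> box n l' u' \<subseteq> box n l u \<and> Dt (W n) G' \<and> (\<forall>a\<in>box n l' u'. derivative_along n F G G' K a)"
proof -
  obtain l1 u1 h where 1: "good n l1 u1" "box n l1 u1 \<subseteq> box n l u" "Dt (W n) h"
    "\<forall>a\<in>box n l1 u1. (\<forall>i<n. \<exists>d. has_pderiv G i a d) \<and> \<delta> (G a) = (\<Sum>i<n. pderivn G i a * \<delta> (a i)) + h a"
    using chain_rule_on_subbox[OF G n lu] by blast
  obtain l2 u2 where 2: "good n l2 u2" "box n l2 u2 \<subseteq> box n l1 u1" "\<forall>x\<in>box n l2 u2. C1_at n G x"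
    using C1_on_subbox[OF G 1(1)] by blast
  define x0 where "x0 = mid l2 u2"
  have x0: "x0 \<in> box n l2 u2" unfolding x0_def by (rule mid_in_box[OF 2(1)])
  then have "C1_at n G x0" using 2(3) by blast
  then have c: "contn n (pderivn G j) x0 \<and> (0::'a) < 1" if "j < n" for j using that unfolding C1_at_def by simp
  have "\<exists>l' u'. good n l' u' \<and> box n l' u' \<subseteq> box n l2 u2 \<and> x0 \<in> box n l' u' \<and>
     (\<forall>j<n. \<forall>y\<in>box n l' u'. \<bar>pderivn G j y - pderivn G j x0\<bar> < 1)"
    by (rule contn_box_multi[OF c x0])
  then obtain l3 u3 where 3: "good n l3 u3" "box n l3 u3 \<subseteq> box n l2 u2"
    "\<forall>j<n. \<forall>y\<in>box n l3 u3. \<bar>pderivn G j y - pderivn G j x0\<bar> < 1" by blast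
  \<comment> \<open>Bounds all partial derivatives at the midpoint; the summand 1 allows for their
    variation on the box.\<close>
  define K where "K = (\<Sum>j<n. \<bar>pderivn G j x0\<bar>) + 1"
  have K: "\<bar>pderivn G j y\<bar> \<le> K" if "j < n" "y \<in> box n l3 u3" for j y
  proof -
    have "\<bar>pderivn G j x0\<bar> \<le> (\<Sum>j<n. \<bar>pderivn G j x0\<bar>)"
      using that(1) by (intro member_le_sum) auto
    moreover have "\<bar>pderivn G j y - pderivn G j x0\<bar> < 1" using 3(3) that by blast
    ultimately show ?thesis unfolding K_def by linarith
  qed
  \<comment> \<open>h accounts for the parameters of G, and F is inserted for the derivatives of the
    coordinates.\<close>
  define G' where "G' a = h a + (\<Sum>l<n. pderivn G l a * F l a)" for a
  have dG': "Dt (W n) G'"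
    unfolding G'_def by (intro Dt_add 1(3) Dt_sum Dt_mult Dt_pderivn[OF G] F[rule_format]) simp_all
  have "derivative_along n F G G' K a" if a: "a \<in> box n l3 u3" for a
    unfolding derivative_along_def
  proof (intro conjI allI impI)
    have a1: "a \<in> box n l1 u1" using a 2(2) 3(2) by blast
    then have e: "\<delta> (G a) = (\<Sum>i<n. pderivn G i a * \<delta> (a i)) + h a" using 1(4) by blast
    show "\<delta> (G a) = G' a + (\<Sum>l<n. pderivn G l a * (\<delta> (a l) - F l a))"
      unfolding e G'_def by (simp add: right_diff_distrib sum_subtractf)
    fix l assume l: "l < n"
    show "has_pderiv G l a (pderivn G l a)" using 1(4) a1 l by (intro has_pderiv_pderivn) blast
    show "\<bar>pderivn G l a\<bar> \<le> K" by (rule K[OF l a])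
  qed
  then show ?thesis using 1 2 3 dG' by (intro exI[of _ l3] exI[of _ u3] exI[of _ G'] exI[of _ K]) blast
qed

lemma ex_derivatives_along:
  assumes n: "0 < n" and F: "\<forall>l<n. Dt (W n) (F l)" and G: "\<forall>i<(j::nat). Dt (W n) (G i)" and lu: "good n l u"
  shows "\<exists>l' u' G' K. good n l' u' \<and> box n l' u' \<subseteq> box n l u \<and> (\<forall>i<j. Dt (W n) (G' i)) \<and>
    (\<forall>i<j. \<forall>a\<in>box n l' u'. derivative_along n F (G i) (G' i) K a)"
  using G
proof (induction j)
  case 0
  show ?case using lu by (intro exI[of _ l] exI[of _ u]) simp
next
  case (Suc j)
  have "\<exists>l' u' G' K. good n l' u' \<and> box n l' u' \<subseteq> box n l u \<and> (\<forall>i<j. Dt (W n) (G' i)) \<and>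
    (\<forall>i<j. \<forall>a\<in>box n l' u'. derivative_along n F (G i) (G' i) K a)"
    by (rule Suc.IH) (use Suc.prems in simp)
  then obtain l1 u1 G1 K1 where 1: "good n l1 u1" "box n l1 u1 \<subseteq> box n l u" "\<forall>i<j. Dt (W n) (G1 i)"
    "\<forall>i<j. \<forall>a\<in>box n l1 u1. derivative_along n F (G i) (G1 i) K1 a" by blast
  have "Dt (W n) (G j)" using Suc.prems by simp
  from ex_derivative_along[OF n F this 1(1)] obtain l2 u2 G2 K2 where
    2: "good n l2 u2" "box n l2 u2 \<subseteq> box n l1 u1" "Dt (W n) G2" "\<forall>a\<in>box n l2 u2. derivative_along n F (G j) G2 K2 a" by blast
  define G' where "G' = G1(j := G2)"
  have "derivative_along n F (G i) (G' i) (max K1 K2) a" if i: "i < Suc j" and a: "a \<in> box n l2 u2" for i a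
  proof (cases "i = j")
    case True
    have "derivative_along n F (G j) G2 K2 a" using 2(4) a by blast
    then show ?thesis unfolding True G'_def fun_upd_same by (rule derivative_along_mono) simp
  next
    case False
    then have "derivative_along n F (G i) (G1 i) K1 a" using 1(4) 2(2) i a by (metis less_antisym subsetD)
    then have "derivative_along n F (G i) (G1 i) (max K1 K2) a" by (rule derivative_along_mono) simp
    then show ?thesis using False by (simp add: G'_def)
  qed
  moreover have "Dt (W n) (G' i)" if "i < Suc j" for i
    using 1(3) 2(3) that by (cases "i = j") (simp_all add: G'_def)
  ultimately show ?case using 1(2) 2(1,2)
    by (intro exI[of _ l2] exI[of _ u2] exI[of _ G'] exI[of _ "max K1 K2"]) blast
qed

text \<open>One box and one bound K serve all orders below m, and neither depends on the
  coefficients of the linear combination, which can therefore be adapted to K. The functions of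
  order m only have to be definable, as they enter the equation for c^(m) and no further derivative
  is taken.\<close>

lemma ex_iterated_derivatives_along:
  assumes n: "0 < n" and F: "\<forall>l<n. Dt (W n) (F l)" and lu: "good n l u"
  shows "\<exists>l' u' G K. good n l' u' \<and> box n l' u' \<subseteq> box n l u \<and> (\<forall>i<n. G i 0 = (\<lambda>x. x i)) \<and>
    (\<forall>i<n. \<forall>k\<le>m. Dt (W n) (G i k)) \<and> (\<forall>i<n. \<forall>k<m. \<forall>a\<in>box n l' u'. derivative_along n F (G i k) (G i (Suc k)) K a)"
proof (induction m)
  case 0
  show ?case
    using lu by (intro exI[of _ l] exI[of _ u] exI[of _ "\<lambda>i _ x. x i"]) (simp add: Dt_V)
next
  case (Suc m)
  then obtain l1 u1 G K1 where 1: "good n l1 u1" "box n l1 u1 \<subseteq> box n l u" "\<forall>i<n. G i 0 = (\<lambda>x. x i)"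
    "\<forall>i<n. \<forall>k\<le>m. Dt (W n) (G i k)" "\<forall>i<n. \<forall>k<m. \<forall>a\<in>box n l1 u1. derivative_along n F (G i k) (G i (Suc k)) K1 a"
    by (elim exE conjE) (rule that; assumption)
  have "\<forall>i<n. Dt (W n) (G i m)" using 1(4) by simp
  from ex_derivatives_along[OF n F this 1(1)] obtain l2 u2 G2 K2 where
    2: "good n l2 u2" "box n l2 u2 \<subseteq> box n l1 u1" "\<forall>i<n. Dt (W n) (G2 i)"
    "\<forall>i<n. \<forall>a\<in>box n l2 u2. derivative_along n F (G i m) (G2 i) K2 a" by blast
  define G' where "G' i = (G i)(Suc m := G2 i)" for i
  have "derivative_along n F (G' i k) (G' i (Suc k)) (max K1 K2) a" if i: "i < n" and k: "k < Suc m" and a: "a \<in> box n l2 u2" for i k a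
  proof (cases "k = m")
    case True
    have "derivative_along n F (G i m) (G2 i) K2 a" using 2(4) i a by blast
    then have "derivative_along n F (G i m) (G2 i) (max K1 K2) a" by (rule derivative_along_mono) simp
    then show ?thesis by (simp add: G'_def True)
  next
    case False
    then have "derivative_along n F (G i k) (G i (Suc k)) K1 a" using 1(5) 2(2) i k a by (metis less_antisym subsetD)
    then have "derivative_along n F (G i k) (G i (Suc k)) (max K1 K2) a" by (rule derivative_along_mono) simp
    then show ?thesis using False k by (simp add: G'_def)
  qed
  moreover have "Dt (W n) (G' i k)" if "i < n" "k \<le> Suc m" for i k
    using 1(4) 2(3) that by (cases "k = Suc m") (simp_all add: G'_def)
  moreover have "\<forall>i<n. G' i 0 = (\<lambda>x. x i)" using 1(3) by (simp add: G'_def)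
  ultimately show ?case using 1(2) 2(1,2)
    by (intro exI[of _ l2] exI[of _ u2] exI[of _ G'] exI[of _ "max K1 K2"]) blast
qed

text \<open>
  The \<open>k\<close>-th derivative of \<open>c = \<Sum>i<n. p i * a i\<close> along the system is a function
  \<open>\<Phi> k a\<close>. If the \<open>j\<close>-th derivative of \<open>p i\<close> is close to \<open>\<Lambda> ^ Suc i\<close> for \<open>i = j\<close>
  and close to 0 otherwise, with \<open>\<Lambda>\<close> large, then \<open>\<Phi>\<close> is near the identity after rescaling its coordinates.
  Hence its image is fat, genericity yields \<open>c\<close> whose derivatives are the values of \<open>\<Phi>\<close> at a point \<open>a\<close>,
  and \<open>a\<close> solves the system because the Jacobian matrix of \<open>\<Phi>\<close> is diagonally dominant.
\<close>

lemma generic_solution: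
  assumes n: "0 < n" and F: "\<forall>l<n. Dt (W n) (F l)" and lu: "good n l u"
  shows "\<exists>a\<in>box n l u. \<forall>i<n. \<delta> (a i) = F i a"
proof -
  obtain l1 u1 G K where 1: "good n l1 u1" "box n l1 u1 \<subseteq> box n l u" and G0: "\<forall>i<n. G i 0 = (\<lambda>x. x i)"
    and dG: "\<forall>i<n. \<forall>k\<le>n. Dt (W n) (G i k)"
    and along: "\<forall>i<n. \<forall>k<n. \<forall>a\<in>box n l1 u1. derivative_along n F (G i k) (G i (Suc k)) K a"
    using ex_iterated_derivatives_along[OF n F lu, of n] by (elim exE conjE) (rule that; assumption)
  define \<kappa> where "\<kappa> = \<bar>K\<bar>"
  define \<beta> :: 'a where "\<beta> = 2 ^ n"
  define \<nu> :: 'a where "\<nu> = of_nat n"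
  have \<nu>: "1 \<le> \<nu>" unfolding \<nu>_def using n by (simp add: Suc_le_eq)
  have \<beta>: "1 \<le> \<beta>" unfolding \<beta>_def by simp
  have \<kappa>: "0 \<le> \<kappa>" by (simp add: \<kappa>_def)
  \<comment> \<open>In the expansion of \<Phi>_k, \<kappa> bounds the partial derivatives, \<beta>
    the binomial coefficients and 2 * \<Lambda> ^ k the coefficients other than the leading one, so
    these terms are at most \<Lambda> ^ k * \<tau>. The summand 1 covers the error of the leading
    coefficient.\<close>
  define \<tau> where "\<tau> = 2 * (\<beta> * \<kappa>) + 1"
  have \<tau>: "1 \<le> \<tau>" using \<beta> \<kappa> by (simp add: \<tau>_def)
  \<comment> \<open>Chosen such that n * n terms of size \<Lambda> ^ k * \<tau> add up to \<Lambda>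
    ^ Suc k / (2 * n).\<close>
  define \<Lambda> where "\<Lambda> = 2 * \<nu> * (\<nu> * \<nu> * \<tau>)"
  have "1 * 1 \<le> \<nu> * \<nu>" using \<nu> by (intro mult_mono) simp_all
  then have \<nu>2: "1 \<le> \<nu> * \<nu>" by simp
  have "1 * 1 \<le> \<nu> * \<nu> * \<tau>" using \<nu>2 \<tau> by (intro mult_mono) simp_all
  then have \<nu>3: "1 \<le> \<nu> * \<nu> * \<tau>" by simp
  have "1 * 1 \<le> (2 * \<nu>) * (\<nu> * \<nu> * \<tau>)" using \<nu> \<nu>3 by (intro mult_mono) simp_all
  then have \<Lambda>: "1 \<le> \<Lambda>" by (simp add: \<Lambda>_def)
  have \<Lambda>0: "0 < \<Lambda>" using \<Lambda> by simp
  have \<Lambda>pos: "0 < \<Lambda> ^ k" for k using \<Lambda> by simp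
  \<comment> \<open>The conditions on the derivatives of order less than n contain a box, and order
    n is left free, so genericity applies.\<close>
  have "\<exists>p. \<forall>j<n. \<bar>(\<delta> ^^ j) p - (if i = j then \<Lambda> ^ Suc i else 0)\<bar> < 1" for i
  proof -
    define A where "A x \<longleftrightarrow> (\<forall>j<n. \<bar>x j - (if i = j then \<Lambda> ^ Suc i else 0)\<bar> < 1)" for x :: "nat \<Rightarrow> 'a"
    have "Df (W (Suc n)) A"
      unfolding A_def by (intro Df_all_less Df_less Dt_abs Dt_minus Dt_const full_V Dt_V) simp
    moreover have "fat n (\<lambda>x. \<exists>t. A (x(n := t)))"
      unfolding fat_def
    proof (intro exI conjI ballI)
      show "good n (\<lambda>j. (if i = j then \<Lambda> ^ Suc i else 0) - 1) (\<lambda>j. (if i = j then \<Lambda> ^ Suc i else 0) + 1)"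
        by (simp add: good_def)
      fix x assume "x \<in> box n (\<lambda>j. (if i = j then \<Lambda> ^ Suc i else 0) - 1) (\<lambda>j. (if i = j then \<Lambda> ^ Suc i else 0) + 1)"
      then have "\<bar>x j - (if i = j then \<Lambda> ^ Suc i else 0)\<bar> < 1" if "j < n" for j
        using that unfolding box_def abs_less_iff by (auto simp: algebra_simps)
      then show "A (x(n := 0))" by (simp add: A_def)
    qed
    ultimately obtain p where "A (\<lambda>j. (\<delta> ^^ j) p)" using generic by blast
    then show ?thesis unfolding A_def by blast
  qed
  then obtain p0 where p0: "\<And>i j. j < n \<Longrightarrow> \<bar>(\<delta> ^^ j) (p0 i) - (if i = j then \<Lambda> ^ Suc i else 0)\<bar> < 1" by metis
  define p where "p i j = (\<delta> ^^ j) (p0 i)" for i j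
  have \<delta>p: "\<delta> (p i j) = p i (Suc j)" for i j by (simp add: p_def)
  \<comment> \<open>Coefficients of the Leibniz formula for the k-th derivative of the products p_i
    * a_i, with \<open>G i m\<close> in the place of the m-th derivative of a_i.\<close>
  define c where "c k i j = of_nat (k choose j) * p i j" for k i j
  define \<Phi> where "\<Phi> k x = (\<Sum>i<n. \<Sum>j\<le>k. c k i j * G i (k - j) x)" for k x
  define d\<Phi> where "d\<Phi> k l x = (\<Sum>i<n. \<Sum>j\<le>k. c k i j * pderivn (G i (k - j)) l x)" for k l x
  have d\<Phi>D: "Dt (W n) (\<Phi> k)" if "k \<le> n" for k
    unfolding \<Phi>_def using that dG by (intro Dt_sum Dt_mult Dt_const full_V) auto
  have pd: "has_pderiv (G i k) l x (pderivn (G i k) l x)" "\<bar>pderivn (G i k) l x\<bar> \<le> \<kappa>"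
    if "i < n" "k < n" "l < n" "x \<in> box n l1 u1" for i k l x
  proof -
    have "derivative_along n F (G i k) (G i (Suc k)) K x" using along that by blast
    then show "has_pderiv (G i k) l x (pderivn (G i k) l x)" "\<bar>pderivn (G i k) l x\<bar> \<le> \<kappa>"
      using that(3) unfolding derivative_along_def \<kappa>_def by (auto intro: order_trans[OF _ abs_ge_self])
  qed
  have pd\<Phi>: "has_pderiv (\<Phi> k) l x (d\<Phi> k l x)" if "k < n" "l < n" "x \<in> box n l1 u1" for k l x
    unfolding \<Phi>_def d\<Phi>_def using that by (intro has_pderiv_sum has_pderiv_cmult pd) auto
  have dom: "\<bar>d\<Phi> k l x - (if l = k then \<Lambda> ^ Suc k else 0)\<bar> \<le> \<Lambda> ^ Suc k / (2 * \<nu>)"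
    if k: "k < n" and l: "l < n" and x: "x \<in> box n l1 u1" for k l x
  proof -
    \<comment> \<open>Deviation of a single term from its target. The leading term has i = j = k;
      there \<open>G k 0\<close> is coordinate k, whose partial derivative is 1 for l = k and 0
      otherwise.\<close>
    define t where "t i j = c k i j * pderivn (G i (k - j)) l x - (if i = k \<and> j = k \<and> l = k then \<Lambda> ^ Suc k else 0)" for i j
    have t: "\<bar>t i j\<bar> \<le> \<Lambda> ^ k * \<tau>" if i: "i < n" and j: "j \<le> k" for i j
    proof (cases "i = k \<and> j = k")
      case True
      have pdk: "pderivn (G k 0) l x = (if l = k then 1 else 0)"
        using G0 k pderivn_eq[OF has_pderiv_coord[of k l x]] by simp
      have "\<bar>p k k - \<Lambda> ^ Suc k\<bar> < 1" using p0[OF k, of k] by (simp add: p_def)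
      then have "\<bar>t i j\<bar> \<le> 1" using True pdk unfolding t_def c_def by (cases "l = k") simp_all
      moreover have "1 * 1 \<le> \<Lambda> ^ k * \<tau>" using \<Lambda> \<tau> by (intro mult_mono) simp_all
      ultimately show ?thesis by simp
    next
      case False
      have j': "j < n" using j k by simp
      have "\<bar>p i j\<bar> < (if i = j then \<Lambda> ^ Suc i else 0) + 1"
        using p0[OF j', of i] \<Lambda>pos[of "Suc i"] unfolding p_def by (auto simp: abs_less_iff split: if_splits)
      \<comment> \<open>With j at most k and the leading term excluded, i = j forces i < k. This is
        why the powers of \<Lambda> have to increase with i.\<close>
      also have "(if i = j then \<Lambda> ^ Suc i else 0) \<le> \<Lambda> ^ k"
      proof (cases "i = j")
        case True
        then have "Suc i \<le> k" using False j by auto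
        then show ?thesis using True \<Lambda> by (simp add: power_increasing del: power_Suc)
      qed (use \<Lambda> in simp)
      also have "\<Lambda> ^ k + 1 \<le> 2 * \<Lambda> ^ k" using one_le_power[OF \<Lambda>, of k] by simp
      finally have pij: "\<bar>p i j\<bar> \<le> 2 * \<Lambda> ^ k" by simp
      have "k choose j \<le> 2 ^ k" by (rule binomial_le_pow2)
      also have "(2::nat) ^ k \<le> 2 ^ n" using k by (intro power_increasing) simp_all
      finally have "(of_nat (k choose j) :: 'a) \<le> of_nat (2 ^ n)" by (simp only: of_nat_le_iff)
      then have b: "(of_nat (k choose j) :: 'a) \<le> \<beta>" by (simp add: \<beta>_def)
      have "\<bar>t i j\<bar> = of_nat (k choose j) * \<bar>p i j\<bar> * \<bar>pderivn (G i (k - j)) l x\<bar>"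
        using False unfolding t_def c_def by (auto simp: abs_mult)
      also have "\<dots> \<le> \<beta> * (2 * \<Lambda> ^ k) * \<kappa>"
        using b pij pd(2)[OF i _ l x, of "k - j"] k \<beta> \<Lambda>pos[of k] by (intro mult_mono) auto
      also have "\<dots> = \<Lambda> ^ k * (2 * (\<beta> * \<kappa>))" by (simp add: ac_simps)
      also have "\<dots> \<le> \<Lambda> ^ k * \<tau>" using \<Lambda>pos[of k] by (intro mult_left_mono) (simp_all add: \<tau>_def)
      finally show ?thesis .
    qed
    have "(\<Sum>i<n. \<Sum>j\<le>k. (if i = k \<and> j = k \<and> l = k then \<Lambda> ^ Suc k else 0)) = (\<Sum>i<n. if i = k then (if l = k then \<Lambda> ^ Suc k else 0) else 0)"
    proof (rule sum.cong[OF refl])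
      fix i
      have "(\<Sum>j\<le>k. (if i = k \<and> j = k \<and> l = k then \<Lambda> ^ Suc k else 0)) = (\<Sum>j\<le>k. if j = k then (if i = k \<and> l = k then \<Lambda> ^ Suc k else 0) else 0)"
        by (intro sum.cong) auto
      also have "\<dots> = (if i = k then (if l = k then \<Lambda> ^ Suc k else 0) else 0)" by (simp add: sum.delta)
      finally show "(\<Sum>j\<le>k. (if i = k \<and> j = k \<and> l = k then \<Lambda> ^ Suc k else 0)) = (if i = k then (if l = k then \<Lambda> ^ Suc k else 0) else 0)" .
    qed
    also have "\<dots> = (if l = k then \<Lambda> ^ Suc k else 0)" using k by (simp add: sum.delta)
    finally have "d\<Phi> k l x - (if l = k then \<Lambda> ^ Suc k else 0) = (\<Sum>i<n. \<Sum>j\<le>k. t i j)"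
      unfolding d\<Phi>_def t_def by (simp only: sum_subtractf)
    then have "\<bar>d\<Phi> k l x - (if l = k then \<Lambda> ^ Suc k else 0)\<bar> \<le> (\<Sum>i<n. \<bar>\<Sum>j\<le>k. t i j\<bar>)"
      by (simp only: sum_abs)
    also have "\<dots> \<le> (\<Sum>i<n. \<nu> * (\<Lambda> ^ k * \<tau>))"
    proof (rule sum_mono)
      fix i assume i: "i \<in> {..<n}"
      have "\<bar>\<Sum>j\<le>k. t i j\<bar> \<le> (\<Sum>j\<le>k. \<bar>t i j\<bar>)" by (rule sum_abs)
      also have "\<dots> \<le> (\<Sum>j\<le>k. \<Lambda> ^ k * \<tau>)" using i by (intro sum_mono t) simp_all
      also have "\<dots> = of_nat (Suc k) * (\<Lambda> ^ k * \<tau>)" by simp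
      also have "\<dots> \<le> \<nu> * (\<Lambda> ^ k * \<tau>)"
      proof (rule mult_right_mono)
        show "of_nat (Suc k) \<le> \<nu>" unfolding \<nu>_def of_nat_le_iff using k by simp
        show "0 \<le> \<Lambda> ^ k * \<tau>" using \<Lambda>pos[of k] \<tau> by simp
      qed
      finally show "\<bar>\<Sum>j\<le>k. t i j\<bar> \<le> \<nu> * (\<Lambda> ^ k * \<tau>)" .
    qed
    also have "\<dots> = \<nu> * (\<nu> * (\<Lambda> ^ k * \<tau>))" by (simp add: \<nu>_def)
    also have "\<dots> = \<Lambda> ^ Suc k / (2 * \<nu>)"
    proof -
      have "2 * \<nu> \<noteq> 0" using \<nu> by simp
      then show ?thesis by (subst nonzero_eq_divide_eq) (simp_all add: \<Lambda>_def ac_simps)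
    qed
    finally show ?thesis .
  qed
  \<comment> \<open>Deviation from the identity after rescaling. By \<open>dom\<close> its partial
    derivatives are at most 1 / (2 * n), and n coordinates add up to the contraction constant
    1/2.\<close>
  define \<eta> where "\<eta> k x = (1 / \<Lambda> ^ Suc k) * \<Phi> k x + (- 1) * x k" for k x
  have d\<eta>: "Dt (W n) (\<eta> k)" if "k < n" for k
    unfolding \<eta>_def using that by (intro Dt_add Dt_mult Dt_const full_V d\<Phi>D Dt_V) simp_all
  have pd\<eta>: "\<exists>d. has_pderiv (\<eta> k) i x d \<and> \<bar>d\<bar> \<le> 1 / (2 * \<nu>)" if k: "k < n" and x: "x \<in> box n l1 u1" and i: "i < n" for k x i
  proof (intro exI conjI)
    show "has_pderiv (\<eta> k) i x ((1 / \<Lambda> ^ Suc k) * d\<Phi> k i x + (- 1) * (if i = k then 1 else 0))"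
      unfolding \<eta>_def by (intro has_pderiv_add has_pderiv_cmult pd\<Phi> has_pderiv_coord k i x)
    have "(1 / \<Lambda> ^ Suc k) * d\<Phi> k i x + (- 1) * (if i = k then 1 else 0) = (d\<Phi> k i x - (if i = k then \<Lambda> ^ Suc k else 0)) / \<Lambda> ^ Suc k"
      using \<Lambda>0 \<Lambda>pos[of "Suc k"] by (auto simp: diff_divide_distrib simp del: power_Suc)
    then have "\<bar>(1 / \<Lambda> ^ Suc k) * d\<Phi> k i x + (- 1) * (if i = k then 1 else 0)\<bar> = \<bar>d\<Phi> k i x - (if i = k then \<Lambda> ^ Suc k else 0)\<bar> / \<Lambda> ^ Suc k"
      using \<Lambda>0 \<Lambda>pos[of "Suc k"] by (simp only: abs_divide abs_of_pos)
    also have "\<dots> \<le> (\<Lambda> ^ Suc k / (2 * \<nu>)) / \<Lambda> ^ Suc k"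
      using \<Lambda>0 \<Lambda>pos[of "Suc k"] dom[OF k i x] by (intro divide_right_mono) (simp_all del: power_Suc)
    also have "\<dots> = 1 / (2 * \<nu>)" using \<Lambda>0 \<Lambda>pos[of "Suc k"] by (simp del: power_Suc)
    finally show "\<bar>(1 / \<Lambda> ^ Suc k) * d\<Phi> k i x + (- 1) * (if i = k then 1 else 0)\<bar> \<le> 1 / (2 * \<nu>)" .
  qed
  have "fat n (\<lambda>y. \<exists>x\<in>box n l1 u1. \<forall>i<n. y i = x i + \<eta> i x)"
  proof (rule near_identity_image_fat[OF d\<eta> 1(1)])
    fix x y B i assume x: "x \<in> box n l1 u1" and y: "y \<in> box n l1 u1" and B: "\<forall>j<n. \<bar>x j - y j\<bar> \<le> B" and i: "i < n"
    have "\<bar>\<eta> i x - \<eta> i y\<bar> \<le> of_nat n * ((1 / (2 * \<nu>)) * B)"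
      by (rule lipschitz_box[OF d\<eta>[OF i] pd\<eta>[OF i] x y]) (use B in auto)
    also have "\<dots> = B / 2" using \<nu> by (simp add: \<nu>_def[symmetric])
    finally show "\<bar>\<eta> i x - \<eta> i y\<bar> \<le> B / 2" .
  qed
  then obtain l2 u2 where 2: "good n l2 u2" "\<forall>y\<in>box n l2 u2. \<exists>x\<in>box n l1 u1. \<forall>i<n. y i = x i + \<eta> i x"
    unfolding fat_def by blast
  \<comment> \<open>The projection to the first n coordinates is the image of (\<Phi>_0, ...,
    \<Phi>_{n-1}), which is fat. The condition on the last coordinate comes for free, since
    genericity constrains only the projection.\<close>
  define A where "A y \<longleftrightarrow> (\<exists>x. x \<in> box n l1 u1 \<and> (\<forall>k<Suc n. y k = \<Phi> k x))" for y
  have "Df (W (Suc n)) A"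
    unfolding A_def
  proof (intro Df_exs[where n = n] Df_and Df_box Df_all_less Df_eq)
    show "Dt (exts n (W (Suc n))) (\<lambda>p. \<Phi> k (snd p))" if "k < Suc n" for k
      by (rule Dt_app[OF d\<Phi>D]) (use that in \<open>auto intro: Dt_snds Dt_const full_exts full_V\<close>)
  qed (auto intro: Dt_snds Dt_fsts[OF Dt_V(1)] Dt_const full_exts full_V)
  moreover have "fat n (\<lambda>y. \<exists>t. A (y(n := t)))"
    unfolding fat_def
  proof (rule exI, rule exI, intro conjI ballI)
    show "good n (\<lambda>k. \<Lambda> ^ Suc k * l2 k) (\<lambda>k. \<Lambda> ^ Suc k * u2 k)"
      using 2(1) \<Lambda>pos unfolding good_def by (simp del: power_Suc)
    fix y assume y: "y \<in> box n (\<lambda>k. \<Lambda> ^ Suc k * l2 k) (\<lambda>k. \<Lambda> ^ Suc k * u2 k)"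
    have "(\<lambda>k. y k / \<Lambda> ^ Suc k) \<in> box n l2 u2"
      using y \<Lambda>pos unfolding box_def
      by (simp add: pos_less_divide_eq pos_divide_less_eq mult.commute del: power_Suc)
    from 2(2)[rule_format, OF this] obtain x where x: "x \<in> box n l1 u1" "\<forall>k<n. y k / \<Lambda> ^ Suc k = x k + \<eta> k x"
      by (elim bexE) (rule that; assumption)
    have "y k = \<Phi> k x" if "k < n" for k
    proof -
      have "y k / \<Lambda> ^ Suc k = \<Phi> k x / \<Lambda> ^ Suc k" using x(2) that by (simp add: \<eta>_def)
      then show ?thesis using \<Lambda>0 \<Lambda>pos[of "Suc k"] by (simp del: power_Suc)
    qed
    then have "\<forall>k<Suc n. (y(n := \<Phi> n x)) k = \<Phi> k x" by (simp add: less_Suc_eq)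
    then have "A (y(n := \<Phi> n x))" unfolding A_def using x(1) by blast
    then show "\<exists>t. A (y(n := t))" by blast
  qed
  ultimately obtain c0 where "A (\<lambda>k. (\<delta> ^^ k) c0)" using generic by blast
  then obtain a where a: "a \<in> box n l1 u1" "\<forall>k<Suc n. (\<delta> ^^ k) c0 = \<Phi> k a" unfolding A_def by blast
  \<comment> \<open>The defect of a as a solution. Applying \<delta> to the k-th equation and
    comparing it with the next one gives a homogeneous linear system for w.\<close>
  define w where "w l = \<delta> (a l) - F l a" for l
  have lin: "(\<Sum>l<n. d\<Phi> k l a * w l) = 0" if k: "k < n" for k
  proof -
    have \<delta>G: "\<delta> (G i (k - j) a) = G i (Suc (k - j)) a + (\<Sum>l<n. pderivn (G i (k - j)) l a * w l)" if "i < n" for i j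
      using along that k a(1) unfolding derivative_along_def w_def by (meson diff_le_self le_less_trans)
    have \<delta>3: "\<delta> (of_nat m * (x * y)) = of_nat m * (\<delta> x * y + x * \<delta> y)" for m x y
      unfolding \<delta>_of_nat_mult by (simp only: \<delta>_mult)
    have "\<delta> (\<Phi> k a) = (\<Sum>i<n. \<Sum>j\<le>k. of_nat (k choose j) * (p i (Suc j) * G i (k - j) a + p i j * \<delta> (G i (k - j) a)))"
      unfolding \<Phi>_def c_def by (simp only: \<delta>_sum mult.assoc \<delta>3 \<delta>p)
    also have "\<dots> = (\<Sum>i<n. \<Sum>j\<le>k. of_nat (k choose j) * (p i (Suc j) * G i (k - j) a + p i j * G i (Suc (k - j)) a) +
       (\<Sum>l<n. c k i j * pderivn (G i (k - j)) l a * w l))"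
    proof (intro sum.cong refl)
      fix i j assume "i \<in> {..<n}"
      then have "i < n" by simp
      show "of_nat (k choose j) * (p i (Suc j) * G i (k - j) a + p i j * \<delta> (G i (k - j) a)) =
        of_nat (k choose j) * (p i (Suc j) * G i (k - j) a + p i j * G i (Suc (k - j)) a) + (\<Sum>l<n. c k i j * pderivn (G i (k - j)) l a * w l)"
        unfolding \<delta>G[OF \<open>i < n\<close>] c_def by (simp add: distrib_left sum_distrib_left mult.assoc)
    qed
    also have "\<dots> = (\<Sum>i<n. \<Sum>j\<le>k. of_nat (k choose j) * (p i (Suc j) * G i (k - j) a + p i j * G i (Suc (k - j)) a)) +
       (\<Sum>i<n. \<Sum>j\<le>k. \<Sum>l<n. c k i j * pderivn (G i (k - j)) l a * w l)"
      by (simp only: sum.distrib)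
    \<comment> \<open>Apart from the defects, the Leibniz formula leads from \<Phi>_k to
      \<Phi>_{k+1}.\<close>
    also have "(\<Sum>i<n. \<Sum>j\<le>k. of_nat (k choose j) * (p i (Suc j) * G i (k - j) a + p i j * G i (Suc (k - j)) a)) = \<Phi> (Suc k) a"
      unfolding \<Phi>_def c_def mult.assoc
      by (intro sum.cong refl pascal_sum[where P = "p i" and Q = "\<lambda>m. G i m a" for i])
    also have "(\<Sum>i<n. \<Sum>j\<le>k. \<Sum>l<n. c k i j * pderivn (G i (k - j)) l a * w l) = (\<Sum>l<n. d\<Phi> k l a * w l)"
    proof -
      have "(\<Sum>i<n. \<Sum>j\<le>k. \<Sum>l<n. c k i j * pderivn (G i (k - j)) l a * w l) = (\<Sum>i<n. \<Sum>l<n. \<Sum>j\<le>k. c k i j * pderivn (G i (k - j)) l a * w l)"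
        by (intro sum.cong refl sum.swap)
      also have "\<dots> = (\<Sum>l<n. \<Sum>i<n. \<Sum>j\<le>k. c k i j * pderivn (G i (k - j)) l a * w l)" by (rule sum.swap)
      finally show ?thesis unfolding d\<Phi>_def sum_distrib_right .
    qed
    finally have "\<delta> (\<Phi> k a) = \<Phi> (Suc k) a + (\<Sum>l<n. d\<Phi> k l a * w l)" .
    moreover have "\<delta> (\<Phi> k a) = \<Phi> (Suc k) a"
      using a(2)[rule_format, of k] a(2)[rule_format, of "Suc k"] k by simp
    ultimately show ?thesis by simp
  qed
  have "w l = 0" if l: "l < n" for l
  proof -
    have fin: "finite ((\<lambda>l. \<bar>w l\<bar>) ` {..<n})" "(\<lambda>l. \<bar>w l\<bar>) ` {..<n} \<noteq> {}" using l by auto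
    \<comment> \<open>Row k of the system, for the largest absolute value of w: diagonal dominance
      bounds the diagonal term by half of itself, so it vanishes.\<close>
    obtain k where k: "k < n" "Max ((\<lambda>l. \<bar>w l\<bar>) ` {..<n}) = \<bar>w k\<bar>" using Max_in[OF fin] by auto
    have max: "\<bar>w l\<bar> \<le> \<bar>w k\<bar>" if "l < n" for l using Max_ge[OF fin(1), of "\<bar>w l\<bar>"] that k(2) by simp
    have "(\<Sum>l<n. (if l = k then \<Lambda> ^ Suc k else 0) * w l) = (\<Sum>l<n. if l = k then \<Lambda> ^ Suc k * w k else 0)"
      by (intro sum.cong) auto
    also have "\<dots> = \<Lambda> ^ Suc k * w k" using k(1) by (simp add: sum.delta)
    finally have "(\<Sum>l<n. (d\<Phi> k l a - (if l = k then \<Lambda> ^ Suc k else 0)) * w l) = - (\<Lambda> ^ Suc k * w k)"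
      unfolding left_diff_distrib sum_subtractf lin[OF k(1)] by simp
    then have "\<Lambda> ^ Suc k * \<bar>w k\<bar> = \<bar>\<Sum>l<n. (d\<Phi> k l a - (if l = k then \<Lambda> ^ Suc k else 0)) * w l\<bar>"
      using \<Lambda>0 \<Lambda>pos[of "Suc k"] by (simp add: abs_mult del: power_Suc)
    also have "\<dots> \<le> (\<Sum>l<n. \<bar>(d\<Phi> k l a - (if l = k then \<Lambda> ^ Suc k else 0)) * w l\<bar>)" by (rule sum_abs)
    also have "\<dots> \<le> (\<Sum>l<n. \<Lambda> ^ Suc k / (2 * \<nu>) * \<bar>w k\<bar>)"
    proof (rule sum_mono)
      fix l assume "l \<in> {..<n}"
      then have l: "l < n" by simp
      show "\<bar>(d\<Phi> k l a - (if l = k then \<Lambda> ^ Suc k else 0)) * w l\<bar> \<le> \<Lambda> ^ Suc k / (2 * \<nu>) * \<bar>w k\<bar>"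
        unfolding abs_mult
      proof (rule mult_mono[OF dom[OF k(1) l a(1)] max[OF l]])
        show "0 \<le> \<Lambda> ^ Suc k / (2 * \<nu>)" using \<Lambda>0 \<Lambda>pos[of "Suc k"] \<nu> by (simp del: power_Suc)
      qed simp
    qed
    also have "\<dots> = \<Lambda> ^ Suc k * \<bar>w k\<bar> / 2" using \<nu> by (simp add: \<nu>_def[symmetric] del: power_Suc)
    finally have "\<Lambda> ^ Suc k * \<bar>w k\<bar> \<le> 0" by linarith
    then have "w k = 0" using \<Lambda>0 \<Lambda>pos[of "Suc k"] by (simp add: mult_le_0_iff del: power_Suc)
    then show ?thesis using max[OF l] by simp
  qed
  then show ?thesis using a(1) 1(2) unfolding w_def by (intro bexI[of _ a]) auto
qed

end

section \<open>From structures to definable predicates\<close>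

lemma small_box:
  fixes x0 :: "nat \<Rightarrow> 'k::linordered_field"
  assumes "x0 \<in> box n l u" "d > 0"
  shows "\<exists>l' u'. good n l' u' \<and> box n l' u' \<subseteq> box n l u \<and> x0 \<in> box n l' u' \<and> (\<forall>x\<in>box n l' u'. \<forall>i<n. \<bar>x i - x0 i\<bar> < d)"
proof (intro exI conjI)
  show x0: "x0 \<in> box n (\<lambda>i. max (l i) (x0 i - d)) (\<lambda>i. min (u i) (x0 i + d))" using assms by (simp add: box_def)
  show "good n (\<lambda>i. max (l i) (x0 i - d)) (\<lambda>i. min (u i) (x0 i + d))"
    unfolding good_def
  proof (intro allI impI)
    fix i assume "i < n"
    then have "max (l i) (x0 i - d) < x0 i" "x0 i < min (u i) (x0 i + d)" using x0 unfolding box_def by blast+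
    then show "max (l i) (x0 i - d) < min (u i) (x0 i + d)" by (rule less_trans)
  qed
  show "box n (\<lambda>i. max (l i) (x0 i - d)) (\<lambda>i. min (u i) (x0 i + d)) \<subseteq> box n l u" by (auto simp: box_def)
  show "\<forall>x\<in>box n (\<lambda>i. max (l i) (x0 i - d)) (\<lambda>i. min (u i) (x0 i + d)). \<forall>i<n. \<bar>x i - x0 i\<bar> < d"
    by (simp add: box_def abs_less_iff algebra_simps)
qed

locale transported_structure =
  fixes L :: "('f, 'r) lang" and M :: "('f, 'r, 'a) fo_structure" and rep :: "'k::linordered_field \<Rightarrow> 'a"
  assumes bij: "bij_betw rep UNIV (universe M)"
    and rep_0: "rep 0 = fn M Zero []" and rep_add: "rep (x + y) = fn M Plus [rep x, rep y]"
    and rep_minus: "rep (- x) = fn M Minus [rep x]" and rep_mult: "rep (x * y) = fn M Times [rep x, rep y]"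
    and rep_less: "rl M Less [rep x, rep y] \<longleftrightarrow> x < y"
    and o_min: "o_minimal L M"
begin

definition coord :: "'a \<Rightarrow> 'k" where "coord = inv_into UNIV rep"

lemma rep_in: "rep x \<in> universe M"
  using bij by (auto simp: bij_betw_def)

lemma rep_inj: "rep x = rep y \<longleftrightarrow> x = y"
  using bij by (auto simp: bij_betw_def inj_on_def)

lemma coord_rep: "coord (rep x) = x"
  using bij by (simp add: coord_def bij_betw_def)

lemma rep_coord: "x \<in> universe M \<Longrightarrow> rep (coord x) = x"
  using bij by (simp add: coord_def bij_betw_def f_inv_into_f)

lemma range_rep: "range rep = universe M"
  using bij by (simp add: bij_betw_def)

lemma structure_ops: "mzero M = rep 0" "madd M (rep x) (rep y) = rep (x + y)" "mmul M (rep x) (rep y) = rep (x * y)"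
  "mneg M (rep x) = rep (- x)" "msub M (rep x) (rep y) = rep (x - y)" "lt M (rep x) (rep y) \<longleftrightarrow> x < y"
  "mabs M (rep x) = rep \<bar>x\<bar>"
proof -
  show 1: "mzero M = rep 0" "mneg M (rep x) = rep (- x)" "lt M (rep x) (rep y) \<longleftrightarrow> x < y"
    by (simp_all add: mzero_def mneg_def lt_def rep_0 rep_minus rep_less)
  show 2: "madd M (rep x) (rep y) = rep (x + y)" "mmul M (rep x) (rep y) = rep (x * y)" for x y
    by (simp_all add: madd_def mmul_def rep_add rep_mult)
  show "msub M (rep x) (rep y) = rep (x - y)"
    using rep_add[of x "- y"] by (simp add: msub_def mneg_def madd_def rep_minus)
  have "lt M (rep x) (rep 0) \<longleftrightarrow> x < 0" by (simp add: lt_def rep_less)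
  then show "mabs M (rep x) = rep \<bar>x\<bar>"
    by (simp add: mabs_def mzero_def mneg_def rep_0[symmetric] rep_minus[symmetric] abs_if)
qed

lemma mpos_rep: "e \<in> mpos M \<longleftrightarrow> (\<exists>x>0. e = rep x)"
  unfolding mpos_def range_rep[symmetric] structure_ops(1) using structure_ops(6) by auto

lemma ball_mpos: "(\<forall>e\<in>mpos M. P e) \<longleftrightarrow> (\<forall>x>0. P (rep x))"
  using mpos_rep by metis

lemma bex_mpos: "(\<exists>e\<in>mpos M. P e) \<longleftrightarrow> (\<exists>x>0. P (rep x))"
  using mpos_rep by metis

definition pt :: "nat \<Rightarrow> (nat \<Rightarrow> 'k) \<Rightarrow> 'a list" where
  "pt n x = map (\<lambda>i. rep (x i)) [0..<n]"

lemma length_pt: "length (pt n x) = n"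
  by (simp add: pt_def)

lemma nth_pt: "i < n \<Longrightarrow> pt n x ! i = rep (x i)"
  by (simp add: pt_def)

lemma pt_in: "pt n x \<in> tuples M n"
  by (auto simp: tuples_def pt_def rep_in)

lemma pt_eq: "pt n x = pt n y \<longleftrightarrow> (\<forall>i<n. x i = y i)"
  by (simp add: pt_def rep_inj Ball_def)

lemma pt_Suc: "pt (Suc n) x = pt n x @ [rep (x n)]"
  by (simp add: pt_def)

lemma pt_upd: "pt n (x(n := t)) = pt n x"
  by (simp add: pt_eq)

lemma take_pt: "k \<le> n \<Longrightarrow> take k (pt n x) = pt k x"
  by (simp add: pt_def take_map)

lemma pt_coord: "xs \<in> tuples M n \<Longrightarrow> pt n (\<lambda>i. coord (xs ! i)) = xs"
  by (rule nth_equalityI) (auto simp: tuples_def length_pt nth_pt intro!: rep_coord)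

lemma tuples_pt: "xs \<in> tuples M n \<longleftrightarrow> (\<exists>x. xs = pt n x)"
  using pt_coord pt_in by metis

definition Dset :: "((nat \<Rightarrow> 'k) \<Rightarrow> bool) set" where
  "Dset = {P. \<exists>p. wf_fm L p \<and> (\<forall>v. P v \<longleftrightarrow> sat M (\<lambda>i. rep (v i)) p)}"

lemma DsetI: "wf_fm L p \<Longrightarrow> (\<And>v. P v \<longleftrightarrow> sat M (\<lambda>i. rep (v i)) p) \<Longrightarrow> P \<in> Dset"
  unfolding Dset_def by blast

lemma rep_case_nat: "(\<lambda>i. rep (case_nat a v i)) = case_nat (rep a) (\<lambda>i. rep (v i))"
  by (auto split: nat.split)

lemma sat_FEx: "sat M (\<lambda>i. rep (v i)) (FEx p) \<longleftrightarrow> (\<exists>a. sat M (\<lambda>i. rep (case_nat a v i)) p)"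
  by (simp add: rep_case_nat range_rep[symmetric])

lemma point_or_interval_vimage:
  assumes "point_or_interval M S"
  shows "interval_or_point (rep -` S)"
proof -
  consider a where "a \<in> universe M" "S = {a}"
    | l u where "set_option l \<subseteq> universe M" "set_option u \<subseteq> universe M" "S = {x \<in> universe M. above M l x \<and> below M x u}"
    using assms unfolding point_or_interval_def by blast
  then show ?thesis
  proof cases
    case 1
    then obtain b where "a = rep b" using rep_coord by metis
    then have "rep -` S = {b}" using 1 by (auto simp: rep_inj)
    then show ?thesis unfolding interval_or_point_def by blast
  next
    case 2
    have a: "above M l (rep x) \<longleftrightarrow> (\<forall>a\<in>set_option (map_option coord l). a < x)" for x
    proof (cases l)
      case (Some a)
      then have "lt M a (rep x) \<longleftrightarrow> coord a < x" using 2(1) structure_ops(6)[of "coord a" x] rep_coord[of a] by simp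
      then show ?thesis using Some by (simp add: above_def)
    qed (simp add: above_def)
    have b: "below M (rep x) u \<longleftrightarrow> (\<forall>b\<in>set_option (map_option coord u). x < b)" for x
    proof (cases u)
      case (Some a)
      then have "lt M (rep x) a \<longleftrightarrow> x < coord a" using 2(2) structure_ops(6)[of x "coord a"] rep_coord[of a] by simp
      then show ?thesis using Some by (simp add: below_def)
    qed (simp add: below_def)
    have "rep -` S = {x. (\<forall>a\<in>set_option (map_option coord l). a < x) \<and> (\<forall>b\<in>set_option (map_option coord u). x < b)}"
      unfolding 2(3) using a b rep_in by blast
    then show ?thesis unfolding interval_or_point_def by blast
  qed
qed

sublocale definable_predicates Dset
proof
  show "(\<lambda>v. \<not> P v) \<in> Dset" if P: "P \<in> Dset" for P
  proof -
    obtain p where "wf_fm L p" "\<forall>v. P v \<longleftrightarrow> sat M (\<lambda>i. rep (v i)) p" using P unfolding Dset_def by blast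
    then show ?thesis by (intro DsetI[of "FNot p"]) simp_all
  qed
  show "(\<lambda>v. P v \<and> Q v) \<in> Dset" if PQ: "P \<in> Dset" "Q \<in> Dset" for P Q
  proof -
    obtain p q where "wf_fm L p" "\<forall>v. P v \<longleftrightarrow> sat M (\<lambda>i. rep (v i)) p" "wf_fm L q" "\<forall>v. Q v \<longleftrightarrow> sat M (\<lambda>i. rep (v i)) q"
      using PQ unfolding Dset_def by blast
    then show ?thesis by (intro DsetI[of "FAnd p q"]) simp_all
  qed
  show "(\<lambda>v. \<exists>a. P (case_nat a v)) \<in> Dset" if P: "P \<in> Dset" for P
  proof -
    obtain p where p: "wf_fm L p" "\<forall>v. P v \<longleftrightarrow> sat M (\<lambda>i. rep (v i)) p" using P unfolding Dset_def by blast
    show ?thesis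
    proof (rule DsetI[of "FEx p"])
      show "(\<exists>a. P (case_nat a v)) \<longleftrightarrow> sat M (\<lambda>i. rep (v i)) (FEx p)" for v
        unfolding sat_FEx using p(2) by blast
    qed (use p in simp)
  qed
  show "(\<lambda>v. P (\<lambda>i. v (\<sigma> i))) \<in> Dset" if P: "P \<in> Dset" for P \<sigma>
  proof -
    obtain p where p: "wf_fm L p" "\<forall>v. P v \<longleftrightarrow> sat M (\<lambda>i. rep (v i)) p" using P unfolding Dset_def by blast
    then show ?thesis by (intro DsetI[of "ren \<sigma> p"]) (simp_all add: wf_ren sat_ren)
  qed
  show "(\<lambda>v. v 0 = v 1) \<in> Dset" by (rule DsetI[of "Eq (Var 0) (Var 1)"]) (simp_all add: rep_inj)
  show "(\<lambda>v. v 0 < v 1) \<in> Dset" by (rule DsetI[of "FLess (Var 0) (Var 1)"]) (simp_all add: rep_less)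
  show "(\<lambda>v. v 0 + v 1 = v 2) \<in> Dset"
    by (rule DsetI[of "Eq (tadd (Var 0) (Var 1)) (Var 2)"]) (simp_all add: rep_add[symmetric] rep_inj)
  show "(\<lambda>v. v 0 * v 1 = v 2) \<in> Dset"
    by (rule DsetI[of "Eq (tmul (Var 0) (Var 1)) (Var 2)"]) (simp_all add: rep_mult[symmetric] rep_inj)
  show "\<exists>N. \<forall>v w. (\<forall>i<N. v i = w i) \<longrightarrow> P v = P w" if P: "P \<in> Dset" for P
  proof -
    obtain p where p: "wf_fm L p" "\<forall>v. P v \<longleftrightarrow> sat M (\<lambda>i. rep (v i)) p" using P unfolding Dset_def by blast
    obtain N where N: "\<forall>i\<in>fv p. i < N" using finite_fv[of p] finite_nat_set_iff_bounded by blast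
    show ?thesis
    proof (intro exI allI impI)
      fix v w :: "nat \<Rightarrow> 'k" assume "\<forall>i<N. v i = w i"
      then have "sat M (\<lambda>i. rep (v i)) p = sat M (\<lambda>i. rep (w i)) p" using N by (intro sat_cong) simp
      then show "P v = P w" using p(2) by blast
    qed
  qed
  show "tame {a. P (case_nat a v)}" if P: "P \<in> Dset" for P v
  proof -
    obtain p where p: "wf_fm L p" "\<forall>v. P v \<longleftrightarrow> sat M (\<lambda>i. rep (v i)) p" using P unfolding Dset_def by blast
    \<comment> \<open>The environment v provides the parameters, shifted by one place because
      \<open>Var 0\<close> is the coordinate.\<close>
    define e where "e i = rep (v (i - 1))" for i
    define A where "A = {xs \<in> tuples M 1. sat M (\<lambda>i. if i < 1 then xs ! i else e i) p}"
    have "definable L M (universe M) 1 A"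
      unfolding definable_def A_def using p(1) by (intro exI[of _ p] exI[of _ e]) (simp add: e_def rep_in)
    then obtain F where F: "finite F" "\<forall>S\<in>F. point_or_interval M S" "{x. [x] \<in> A} = \<Union>F"
      using o_min unfolding o_minimal_def by blast
    have "P (case_nat a v) \<longleftrightarrow> [rep a] \<in> A" for a
    proof -
      have "sat M (\<lambda>i. rep (case_nat a v i)) p = sat M (\<lambda>i. if i < 1 then [rep a] ! i else e i) p"
        by (rule sat_cong) (auto simp: e_def split: nat.split)
      then show ?thesis using p(2) by (simp add: A_def tuples_def rep_in)
    qed
    then have "{a. P (case_nat a v)} = rep -` {x. [x] \<in> A}" by simp
    also have "\<dots> = rep -` \<Union>F" by (simp only: F(3))
    also have "\<dots> = \<Union>((\<lambda>S. rep -` S) ` F)" by blast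
    finally show ?thesis
      unfolding tame_def using F point_or_interval_vimage
      by (intro exI[of _ "(\<lambda>S. rep -` S) ` F"]) auto
  qed
qed

lemma Df_if_definable:
  assumes "definable L M (universe M) n A"
  shows "Df (W n) (\<lambda>x. pt n x \<in> A)"
proof -
  obtain p e where p: "wf_fm L p" and e: "\<And>i. i \<in> fv p \<Longrightarrow> n \<le> i \<Longrightarrow> e i \<in> universe M"
    and A: "A = {xs \<in> tuples M n. sat M (\<lambda>i. if i < n then xs ! i else e i) p}"
    using assms unfolding definable_def by blast
  have "(\<lambda>v. sat M (\<lambda>i. rep (v i)) p) \<in> Dset" by (rule DsetI[OF p]) simp
  then show ?thesis
  proof (rule DfI[where \<rho> = "\<lambda>i. if i < n then (\<lambda>x. x i) else (\<lambda>_. coord (e i))"])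
    show "(if i < n then (\<lambda>x. x i) else (\<lambda>_. coord (e i))) \<in> insert (\<lambda>_. 0) (W n)" for i by (auto simp: V_def)
    fix x
    have "sat M (\<lambda>i. if i < n then pt n x ! i else e i) p = sat M (\<lambda>i. rep ((if i < n then (\<lambda>x. x i) else (\<lambda>_. coord (e i))) x)) p"
      by (rule sat_cong) (auto simp: nth_pt rep_coord e)
    then show "(pt n x \<in> A) = sat M (\<lambda>i. rep ((if i < n then (\<lambda>x. x i) else (\<lambda>_. coord (e i))) x)) p"
      by (simp add: A pt_in)
  qed
qed

lemma definable_if_Df:
  assumes "Df (V B n) P"
  shows "definable L M (rep ` B) n {pt n x |x. P x}"
  using assms
proof (rule DfE)
  fix R \<rho> assume 1: "R \<in> Dset" "\<forall>i. \<rho> i \<in> insert (\<lambda>_. 0) (V B n)" "\<forall>c. P c = R (\<lambda>i. \<rho> i c)"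
  obtain p where p: "wf_fm L p" "\<forall>v. R v \<longleftrightarrow> sat M (\<lambda>i. rep (v i)) p" using 1(1) unfolding Dset_def by blast
  \<comment> \<open>Place 0 is reserved for the constant 0, the places up to n hold the coordinates,
    and a parameter used by \<open>\<rho> i\<close> gets its own place beyond them.\<close>
  have "\<forall>i. \<exists>\<sigma> a. (\<sigma> < Suc n \<or> (\<sigma> = Suc (n + i) \<and> a \<in> B)) \<and>
     (\<forall>x w. (\<forall>j<n. w j = x j) \<longrightarrow> w (n + i) = a \<longrightarrow> \<rho> i x = case_nat 0 w \<sigma>)"
  proof
    fix i
    consider "\<rho> i = (\<lambda>_. 0)" | j where "j < n" "\<rho> i = (\<lambda>x. x j)" | a where "a \<in> B" "\<rho> i = (\<lambda>_. a)"
      using 1(2)[rule_format, of i] by (auto simp: V_def)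
    then show "\<exists>\<sigma> a. (\<sigma> < Suc n \<or> (\<sigma> = Suc (n + i) \<and> a \<in> B)) \<and>
     (\<forall>x w. (\<forall>j<n. w j = x j) \<longrightarrow> w (n + i) = a \<longrightarrow> \<rho> i x = case_nat 0 w \<sigma>)"
    proof cases
      case 1
      then show ?thesis by (intro exI[of _ 0]) simp
    next
      case (2 j)
      then show ?thesis by (intro exI[of _ "Suc j"]) simp
    next
      case (3 a)
      then show ?thesis by (intro exI[of _ "Suc (n + i)"] exI[of _ a]) simp
    qed
  qed
  then obtain \<sigma> a where \<sigma>: "\<And>i. \<sigma> i < Suc n \<or> (\<sigma> i = Suc (n + i) \<and> a i \<in> B)"
    "\<And>i x w. (\<forall>j<n. w j = x j) \<Longrightarrow> w (n + i) = a i \<Longrightarrow> \<rho> i x = case_nat 0 w (\<sigma> i)" by metis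
  \<comment> \<open>The constant 0 that \<open>Df\<close> always admits need not lie in B; it is
    bound by a quantifier as the solution of b + b = b.\<close>
  define q where "q = FEx (FAnd (Eq (tadd (Var 0) (Var 0)) (Var 0)) (ren \<sigma> p))"
  define e where "e i = rep (a (i - n))" for i
  have wf: "wf_fm L q" using p(1) by (simp add: q_def wf_ren)
  have fvq: "e i \<in> rep ` B" if "i \<in> fv q" "n \<le> i" for i
  proof -
    have "Suc i \<in> \<sigma> ` fv p" using that(1) by (simp add: q_def fv_ren)
    then obtain j where "Suc i = \<sigma> j" by blast
    then have "i = n + j \<and> a j \<in> B" using \<sigma>(1)[of j] that(2) by auto
    then show ?thesis by (auto simp: e_def)
  qed
  have sat: "sat M (\<lambda>i. if i < n then pt n x ! i else e i) q \<longleftrightarrow> P x" for x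
  proof -
    define w where "w i = (if i < n then x i else a (i - n))" for i
    have "(\<lambda>i. if i < n then pt n x ! i else e i) = (\<lambda>i. rep (w i))" by (auto simp: w_def e_def nth_pt)
    then have "sat M (\<lambda>i. if i < n then pt n x ! i else e i) q \<longleftrightarrow>
       (\<exists>b. rep (b + b) = rep b \<and> sat M (\<lambda>i. rep (case_nat b w (\<sigma> i))) p)"
      by (simp only: q_def sat_FEx) (simp add: sat_ren flip: rep_add)
    also have "\<dots> \<longleftrightarrow> sat M (\<lambda>i. rep (case_nat 0 w (\<sigma> i))) p" by (simp add: rep_inj)
    also have "(\<lambda>i. case_nat 0 w (\<sigma> i)) = (\<lambda>i. \<rho> i x)"
    proof
      show "case_nat 0 w (\<sigma> i) = \<rho> i x" for i using \<sigma>(2)[of w x i] by (simp add: w_def)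
    qed
    then have "sat M (\<lambda>i. rep (case_nat 0 w (\<sigma> i))) p \<longleftrightarrow> R (\<lambda>i. \<rho> i x)" using p(2) by metis
    finally show ?thesis using 1(3) by simp
  qed
  have "{pt n x |x. P x} = {xs \<in> tuples M n. sat M (\<lambda>i. if i < n then xs ! i else e i) q}"
    using sat by (auto simp: tuples_pt)
  then show ?thesis unfolding definable_def using wf fvq by (intro exI[of _ q] exI[of _ e]) simp
qed

subsection \<open>Cells of full dimension\<close>

text \<open>Nonemptiness of a band requires a point between its boundaries: their mean, a single
  finite boundary shifted by 1, or 0 if both are infinite.\<close>

lemma cell_props: "cell L M is C \<Longrightarrow> C \<subseteq> tuples M (length is) \<and> C \<noteq> {} \<and> set is \<subseteq> {0, 1}"
proof (induction rule: cell.induct)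
  case point
  show ?case by (simp add: tuples_def)
next
  case (graph "is" C f)
  then have "f xs \<in> universe M" if "xs \<in> C" for xs
    using that unfolding definable_cont_def definable_fun_def by blast
  then show ?case using graph unfolding tuples_def by fastforce
next
  case (band "is" C l h)
  obtain xs where xs: "xs \<in> C" using band by blast
  have "\<exists>y\<in>universe M. above M (map_option (\<lambda>f. f xs) l) y \<and> below M y (map_option (\<lambda>g. g xs) h)"
  proof -
    have lU: "f xs \<in> universe M" if "f \<in> set_option l" for f
      using that band xs unfolding definable_cont_def definable_fun_def by blast
    have hU: "g xs \<in> universe M" if "g \<in> set_option h" for g
      using that band xs unfolding definable_cont_def definable_fun_def by blast
    show ?thesis
    proof (cases l)
      case None
      show ?thesis
      proof (cases h)
        case None
        then show ?thesis using \<open>l = None\<close> rep_in by (intro bexI[of _ "rep 0"]) (simp_all add: above_def below_def)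
      next
        case (Some g)
        obtain b where b: "g xs = rep b" using hU[of g] Some rep_coord by (metis option.set_intros)
        show ?thesis using \<open>l = None\<close> Some rep_in
          by (intro bexI[of _ "rep (b - 1)"]) (simp_all add: above_def below_def b structure_ops)
      qed
    next
      case (Some f)
      obtain a where a: "f xs = rep a" using lU[of f] Some rep_coord by (metis option.set_intros)
      show ?thesis
      proof (cases h)
        case None
        then show ?thesis using Some rep_in
          by (intro bexI[of _ "rep (a + 1)"]) (simp_all add: above_def below_def a structure_ops)
      next
        case (Some g)
        obtain b where b: "g xs = rep b" using hU[of g] Some rep_coord by (metis option.set_intros)
        have "lt M (f xs) (g xs)" using band xs \<open>l = Some f\<close> Some by simp
        then have "a < b" by (simp add: a b structure_ops)
        then show ?thesis using Some \<open>l = Some f\<close> rep_in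
          by (intro bexI[of _ "rep ((a + b) / 2)"]) (simp_all add: above_def below_def a b structure_ops)
      qed
    qed
  qed
  then have "{xs @ [y] |xs y. xs \<in> C \<and> y \<in> universe M \<and> above M (map_option (\<lambda>f. f xs) l) y \<and> below M y (map_option (\<lambda>g. g xs) h)} \<noteq> {}"
    using xs by blast
  moreover have "{xs @ [y] |xs y. xs \<in> C \<and> y \<in> universe M \<and> above M (map_option (\<lambda>f. f xs) l) y \<and> below M y (map_option (\<lambda>g. g xs) h)}
    \<subseteq> tuples M (length (is @ [1]))"
    using band unfolding tuples_def by fastforce
  ultimately show ?case using band by simp
qed

lemma sum_list_le_length: "set is \<subseteq> {0, 1} \<Longrightarrow> sum_list is \<le> length (is :: nat list)"
  by (induction "is") auto

lemma all_1_if_sum_list: "set is \<subseteq> {0, 1} \<Longrightarrow> sum_list is = length (is :: nat list) \<Longrightarrow> set is \<subseteq> {1}"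
proof (induction "is")
  case (Cons i "is")
  then have "sum_list is \<le> length is" by (intro sum_list_le_length) simp
  then show ?case using Cons by auto
qed simp

lemma boundary_near:
  assumes f: "definable_cont L M n C f" and x0: "pt n x0 \<in> C" and \<eta>: "0 < \<eta>"
  obtains \<alpha> d where "f (pt n x0) = rep \<alpha>" "0 < d"
    "\<And>x. pt n x \<in> C \<Longrightarrow> (\<forall>i<n. \<bar>x i - x0 i\<bar> < d) \<Longrightarrow> \<exists>\<gamma>. f (pt n x) = rep \<gamma> \<and> \<bar>\<gamma> - \<alpha>\<bar> < \<eta>"
proof -
  have fU: "f u \<in> universe M" if "u \<in> C" for u
    using f that unfolding definable_cont_def definable_fun_def by blast
  obtain \<alpha> where \<alpha>: "f (pt n x0) = rep \<alpha>" using fU[OF x0] rep_coord by metis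
  have "cont_on M n C f" using f by (simp add: definable_cont_def)
  then have "\<exists>d\<in>mpos M. \<forall>w\<in>C. (\<forall>i<n. lt M (mabs M (msub M (w ! i) (pt n x0 ! i))) d) \<longrightarrow> lt M (mabs M (msub M (f w) (f (pt n x0)))) (rep \<eta>)"
    unfolding cont_on_def ball_mpos using x0 \<eta> by blast
  then obtain d where d: "0 < d" "\<forall>w\<in>C. (\<forall>i<n. lt M (mabs M (msub M (w ! i) (pt n x0 ! i))) (rep d)) \<longrightarrow> lt M (mabs M (msub M (f w) (f (pt n x0)))) (rep \<eta>)"
    unfolding bex_mpos by blast
  have "\<exists>\<gamma>. f (pt n x) = rep \<gamma> \<and> \<bar>\<gamma> - \<alpha>\<bar> < \<eta>" if x: "pt n x \<in> C" "\<forall>i<n. \<bar>x i - x0 i\<bar> < d" for x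
  proof -
    obtain \<gamma> where \<gamma>: "f (pt n x) = rep \<gamma>" using fU[OF x(1)] rep_coord by metis
    have "\<forall>i<n. lt M (mabs M (msub M (pt n x ! i) (pt n x0 ! i))) (rep d)"
      using x(2) by (simp add: nth_pt structure_ops)
    then have "lt M (mabs M (msub M (f (pt n x)) (f (pt n x0)))) (rep \<eta>)" using d(2) x(1) by blast
    then show ?thesis using \<gamma> \<alpha> by (simp add: structure_ops rep_inj)
  qed
  then show thesis using that[OF \<alpha> d(1)] by blast
qed

text \<open>The boundary functions of a band are continuous at the centre x0 of a box in the base;
  near x0 they stay within a third of the gap, so a fixed interval fits between them.\<close>

lemma open_cell_contains_box:
  "cell L M is C \<Longrightarrow> set is \<subseteq> {1} \<Longrightarrow> \<exists>l u. good (length is) l u \<and> (\<forall>x\<in>box (length is) l u. pt (length is) x \<in> C)"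
proof (induction rule: cell.induct)
  case point
  show ?case by (simp add: good_def pt_def)
next
  case (graph "is" C f)
  then show ?case by simp
next
  case (band "is" C l h)
  define n where "n = length is"
  have "set is \<subseteq> {1}" using band.prems by simp
  from band.IH[OF this] obtain l1 u1 where 1: "good n l1 u1" "\<forall>x\<in>box n l1 u1. pt n x \<in> C" unfolding n_def by blast
  define x0 where "x0 = mid l1 u1"
  have x0: "x0 \<in> box n l1 u1" unfolding x0_def by (rule mid_in_box[OF 1(1)])
  have xC: "pt n x0 \<in> C" using 1(2) x0 by blast
  have dl: "definable_cont L M n C f" if "l = Some f" for f using band.hyps that by (simp add: n_def)
  have dh: "definable_cont L M n C g" if "h = Some g" for g using band.hyps that by (simp add: n_def)
  have lU: "f (pt n x0) \<in> universe M" if "l = Some f" for f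
    using dl[OF that] xC unfolding definable_cont_def definable_fun_def by blast
  have hU: "g (pt n x0) \<in> universe M" if "h = Some g" for g
    using dh[OF that] xC unfolding definable_cont_def definable_fun_def by blast
  \<comment> \<open>An infinite boundary is replaced by a finite value at distance 1 from the other
    one, to give a bounded box in all cases.\<close>
  define \<beta>0 where "\<beta>0 = (case h of Some g \<Rightarrow> coord (g (pt n x0)) | None \<Rightarrow> 0)"
  define \<alpha> where "\<alpha> = (case l of Some f \<Rightarrow> coord (f (pt n x0)) | None \<Rightarrow> \<beta>0 - 1)"
  define \<beta> where "\<beta> = (case h of Some g \<Rightarrow> \<beta>0 | None \<Rightarrow> \<alpha> + 1)"
  have \<alpha>: "f (pt n x0) = rep \<alpha>" if "l = Some f" for f using that lU[OF that] by (simp add: \<alpha>_def rep_coord)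
  have \<beta>: "g (pt n x0) = rep \<beta>" if "h = Some g" for g using that hU[OF that] by (simp add: \<beta>_def \<beta>0_def rep_coord)
  have ab: "\<alpha> < \<beta>"
  proof (cases h)
    case None
    then show ?thesis by (simp add: \<beta>_def)
  next
    case (Some g)
    show ?thesis
    proof (cases l)
      case None
      then show ?thesis using Some by (simp add: \<alpha>_def \<beta>_def)
    next
      case (Some f)
      have "lt M (f (pt n x0)) (g (pt n x0))" using band.hyps xC Some \<open>h = Some g\<close> by simp
      then show ?thesis using \<alpha>[OF Some] \<beta>[OF \<open>h = Some g\<close>] by (simp add: structure_ops)
    qed
  qed
  define \<eta> where "\<eta> = (\<beta> - \<alpha>) / 3"
  have \<eta>: "0 < \<eta>" "\<alpha> + \<eta> < \<beta> - \<eta>" using ab by (simp_all add: \<eta>_def field_simps)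
  have "\<exists>d>0. \<forall>x t. pt n x \<in> C \<longrightarrow> (\<forall>i<n. \<bar>x i - x0 i\<bar> < d) \<longrightarrow> \<alpha> + \<eta> < t \<longrightarrow> above M (map_option (\<lambda>f. f (pt n x)) l) (rep t)"
  proof (cases l)
    case None
    then show ?thesis by (intro exI[of _ 1]) (simp add: above_def)
  next
    case (Some f)
    obtain \<alpha>' d where d: "f (pt n x0) = rep \<alpha>'" "0 < d"
      "\<And>x. pt n x \<in> C \<Longrightarrow> (\<forall>i<n. \<bar>x i - x0 i\<bar> < d) \<Longrightarrow> \<exists>\<gamma>. f (pt n x) = rep \<gamma> \<and> \<bar>\<gamma> - \<alpha>'\<bar> < \<eta>"
      using boundary_near[OF dl[OF Some] xC \<eta>(1)] by blast
    have [simp]: "\<alpha>' = \<alpha>" using d(1) \<alpha>[OF Some] by (simp add: rep_inj)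
    have "lt M (f (pt n x)) (rep t)" if near: "pt n x \<in> C" "\<forall>i<n. \<bar>x i - x0 i\<bar> < d" "\<alpha> + \<eta> < t" for x t
    proof -
      obtain \<gamma> where "f (pt n x) = rep \<gamma>" "\<bar>\<gamma> - \<alpha>\<bar> < \<eta>" using d(3)[OF near(1,2)] by auto
      then show ?thesis using near(3) by (simp add: structure_ops abs_less_iff)
    qed
    then show ?thesis using d(2) Some by (intro exI[of _ d]) (simp add: above_def)
  qed
  then obtain d1 where d1: "0 < d1" "\<And>x t. pt n x \<in> C \<Longrightarrow> (\<forall>i<n. \<bar>x i - x0 i\<bar> < d1) \<Longrightarrow> \<alpha> + \<eta> < t \<Longrightarrow> above M (map_option (\<lambda>f. f (pt n x)) l) (rep t)"
    by blast
  have "\<exists>d>0. \<forall>x t. pt n x \<in> C \<longrightarrow> (\<forall>i<n. \<bar>x i - x0 i\<bar> < d) \<longrightarrow> t < \<beta> - \<eta> \<longrightarrow> below M (rep t) (map_option (\<lambda>g. g (pt n x)) h)"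
  proof (cases h)
    case None
    then show ?thesis by (intro exI[of _ 1]) (simp add: below_def)
  next
    case (Some g)
    obtain \<beta>' d where d: "g (pt n x0) = rep \<beta>'" "0 < d"
      "\<And>x. pt n x \<in> C \<Longrightarrow> (\<forall>i<n. \<bar>x i - x0 i\<bar> < d) \<Longrightarrow> \<exists>\<gamma>. g (pt n x) = rep \<gamma> \<and> \<bar>\<gamma> - \<beta>'\<bar> < \<eta>"
      using boundary_near[OF dh[OF Some] xC \<eta>(1)] by blast
    have [simp]: "\<beta>' = \<beta>" using d(1) \<beta>[OF Some] by (simp add: rep_inj)
    have "lt M (rep t) (g (pt n x))" if near: "pt n x \<in> C" "\<forall>i<n. \<bar>x i - x0 i\<bar> < d" "t < \<beta> - \<eta>" for x t
    proof -
      obtain \<gamma> where "g (pt n x) = rep \<gamma>" "\<bar>\<gamma> - \<beta>\<bar> < \<eta>" using d(3)[OF near(1,2)] by auto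
      then show ?thesis using near(3) by (simp add: structure_ops abs_less_iff)
    qed
    then show ?thesis using d(2) Some by (intro exI[of _ d]) (simp add: below_def)
  qed
  then obtain d2 where d2: "0 < d2" "\<And>x t. pt n x \<in> C \<Longrightarrow> (\<forall>i<n. \<bar>x i - x0 i\<bar> < d2) \<Longrightarrow> t < \<beta> - \<eta> \<Longrightarrow> below M (rep t) (map_option (\<lambda>g. g (pt n x)) h)"
    by blast
  have "0 < min d1 d2" using d1(1) d2(1) by simp
  from small_box[OF x0 this] obtain l2 u2 where 2: "good n l2 u2" "box n l2 u2 \<subseteq> box n l1 u1"
    "\<forall>x\<in>box n l2 u2. \<forall>i<n. \<bar>x i - x0 i\<bar> < min d1 d2" by blast
  have len: "length (is @ [1]) = Suc n" by (simp add: n_def)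
  show ?case
    unfolding len
  proof (rule exI, rule exI, intro conjI ballI)
    show "good (Suc n) (l2(n := \<alpha> + \<eta>)) (u2(n := \<beta> - \<eta>))"
      using 2(1) \<eta>(2) by (simp add: good_Suc) (simp add: good_def)
    fix x assume "x \<in> box (Suc n) (l2(n := \<alpha> + \<eta>)) (u2(n := \<beta> - \<eta>))"
    then have x: "x \<in> box n l2 u2" "\<alpha> + \<eta> < x n" "x n < \<beta> - \<eta>" by (simp_all add: box_Suc box_upd_bounds)
    have xC: "pt n x \<in> C" using x(1) 2(2) 1(2) by blast
    have "\<forall>i<n. \<bar>x i - x0 i\<bar> < d1" "\<forall>i<n. \<bar>x i - x0 i\<bar> < d2" using 2(3) x(1) by simp_all
    then have "above M (map_option (\<lambda>f. f (pt n x)) l) (rep (x n))" "below M (rep (x n)) (map_option (\<lambda>g. g (pt n x)) h)"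
      using d1(2)[OF xC] d2(2)[OF xC] x(2,3) by simp_all
    then show "pt (Suc n) x \<in> {xs @ [y] |xs y. xs \<in> C \<and> y \<in> universe M \<and> above M (map_option (\<lambda>f. f xs) l) y \<and> below M y (map_option (\<lambda>g. g xs) h)}"
      using xC rep_in pt_Suc by blast
  qed
qed

lemma const_definable_cont:
  "definable_cont L M n (pt n ` box n l u) (\<lambda>_. rep c)"
  unfolding definable_cont_def definable_fun_def
proof (intro conjI ballI)
  show "pt n ` box n l u \<subseteq> tuples M n" using pt_in by blast
  show "rep c \<in> universe M" by (rule rep_in)
  have "Df (W (Suc n)) (\<lambda>y. y \<in> box n l u \<and> y n = c)"
    by (intro Df_and Df_box Df_eq Dt_V Dt_const full_V) simp_all
  from definable_if_Df[OF this] have "definable L M (universe M) (Suc n) {pt (Suc n) y |y. y \<in> box n l u \<and> y n = c}"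
    by (simp add: range_rep)
  also have "{pt (Suc n) y |y. y \<in> box n l u \<and> y n = c} = {w @ [rep c] |w. w \<in> pt n ` box n l u}"
  proof (intro equalityI subsetI)
    fix z assume "z \<in> {w @ [rep c] |w. w \<in> pt n ` box n l u}"
    then obtain x where x: "x \<in> box n l u" "z = pt n x @ [rep c]" by blast
    then have "z = pt (Suc n) (x(n := c))" by (simp add: pt_Suc pt_upd)
    moreover have "x(n := c) \<in> box n l u" using x(1) by (simp add: box_upd)
    ultimately show "z \<in> {pt (Suc n) y |y. y \<in> box n l u \<and> y n = c}" by force
  qed (auto simp: pt_Suc)
  finally show "definable L M (universe M) (Suc n) {w @ [rep c] |w. w \<in> pt n ` box n l u}" .
  show "cont_on M n (pt n ` box n l u) (\<lambda>_. rep c)"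
    unfolding cont_on_def ball_mpos bex_mpos by (auto simp: structure_ops intro!: exI[of _ 1])
qed

lemma box_cell: "good n l u \<Longrightarrow> cell L M (replicate n 1) (pt n ` box n l u)"
proof (induction n)
  case 0
  have "pt 0 ` box 0 l u = {[]}" by (auto simp: pt_def box_def)
  then show ?case using cell.point by simp
next
  case (Suc n)
  then have IH: "cell L M (replicate n 1) (pt n ` box n l u)" and ln: "l n < u n" by (simp_all add: good_Suc)
  have "cell L M (replicate n 1 @ [1]) {xs @ [y] |xs y. xs \<in> pt n ` box n l u \<and> y \<in> universe M \<and>
     above M (map_option (\<lambda>f. f xs) (Some (\<lambda>_. rep (l n)))) y \<and> below M y (map_option (\<lambda>g. g xs) (Some (\<lambda>_. rep (u n))))}"
    by (rule cell.band[OF IH]) (simp_all add: const_definable_cont structure_ops ln)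
  also have "{xs @ [y] |xs y. xs \<in> pt n ` box n l u \<and> y \<in> universe M \<and>
     above M (map_option (\<lambda>f. f xs) (Some (\<lambda>_. rep (l n)))) y \<and> below M y (map_option (\<lambda>g. g xs) (Some (\<lambda>_. rep (u n))))} = pt (Suc n) ` box (Suc n) l u"
  proof (intro equalityI subsetI)
    fix z assume "z \<in> {xs @ [y] |xs y. xs \<in> pt n ` box n l u \<and> y \<in> universe M \<and>
     above M (map_option (\<lambda>f. f xs) (Some (\<lambda>_. rep (l n)))) y \<and> below M y (map_option (\<lambda>g. g xs) (Some (\<lambda>_. rep (u n))))}"
    then obtain x y where x: "x \<in> box n l u" "y \<in> universe M" "z = pt n x @ [y]" "lt M (rep (l n)) y" "lt M y (rep (u n))"
      by (auto simp: above_def below_def)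
    obtain t where t: "y = rep t" using x(2) rep_coord by metis
    have "z = pt (Suc n) (x(n := t))" using x t by (simp add: pt_Suc pt_upd)
    moreover have "x(n := t) \<in> box (Suc n) l u" using x t by (simp add: box_Suc box_upd structure_ops)
    ultimately show "z \<in> pt (Suc n) ` box (Suc n) l u" by blast
  next
    fix z assume "z \<in> pt (Suc n) ` box (Suc n) l u"
    then obtain x where x: "x \<in> box n l u" "l n < x n" "x n < u n" "z = pt n x @ [rep (x n)]"
      by (auto simp: box_Suc pt_Suc)
    then have "above M (map_option (\<lambda>f. f (pt n x)) (Some (\<lambda>_. rep (l n)))) (rep (x n))"
      "below M (rep (x n)) (map_option (\<lambda>g. g (pt n x)) (Some (\<lambda>_. rep (u n))))"
      by (simp_all add: above_def below_def structure_ops)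
    then show "z \<in> {xs @ [y] |xs y. xs \<in> pt n ` box n l u \<and> y \<in> universe M \<and>
     above M (map_option (\<lambda>f. f xs) (Some (\<lambda>_. rep (l n)))) y \<and> below M y (map_option (\<lambda>g. g xs) (Some (\<lambda>_. rep (u n))))}"
      using x rep_in by blast
  qed
  finally show ?case by (simp add: replicate_append_same)
qed

text \<open>Cells inside A have types of length n. The sums of their types are integers, so without
  a cell of type (1, ..., 1) the supremum would be at most n - 1; and such a cell contains a box,
  which is itself a cell of that type.\<close>

lemma omin_dim_eq_iff:
  assumes A: "A \<subseteq> tuples M n"
  shows "omin_dim L M A = ereal (real n) \<longleftrightarrow> fat n (\<lambda>x. pt n x \<in> A)"
proof -
  have cells: "length is = n \<and> sum_list is \<le> n \<and> set is \<subseteq> {0, 1}" if c: "cell L M is C" "C \<subseteq> A" for "is" C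
  proof -
    have C: "C \<subseteq> tuples M (length is)" "C \<noteq> {}" "set is \<subseteq> {0, 1}" using cell_props[OF c(1)] by auto
    then obtain xs where "xs \<in> C" by blast
    then have "length xs = length is" "length xs = n" using C(1) A c(2) unfolding tuples_def by blast+
    then have "length is = n" by simp
    then show ?thesis using sum_list_le_length[OF C(3)] C(3) by simp
  qed
  show ?thesis
  proof
    assume dim: "omin_dim L M A = ereal (real n)"
    have "\<exists>is C. cell L M is C \<and> C \<subseteq> A \<and> sum_list is = n"
    proof (rule ccontr)
      assume no: "\<not> ?thesis"
      have "x \<le> ereal (real n - 1)" if x: "x \<in> {ereal (real (sum_list is)) |is C. cell L M is C \<and> C \<subseteq> A}" for x
      proof -
        obtain "is" C where c: "x = ereal (real (sum_list is))" "cell L M is C" "C \<subseteq> A" using x by blast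
        then have "sum_list is \<le> n" "sum_list is \<noteq> n" using cells[OF c(2,3)] no by auto
        then show ?thesis using c(1) by simp
      qed
      then have "omin_dim L M A \<le> ereal (real n - 1)" unfolding omin_dim_def by (rule Sup_least)
      then show False using dim by simp
    qed
    then obtain "is" C where c: "cell L M is C" "C \<subseteq> A" "sum_list is = n" by blast
    have is_len: "length is = n" "set is \<subseteq> {0, 1}" using cells[OF c(1,2)] by auto
    have "set is \<subseteq> {1}" using all_1_if_sum_list[OF is_len(2)] c(3) is_len(1) by simp
    from open_cell_contains_box[OF c(1) this] show "fat n (\<lambda>x. pt n x \<in> A)"
      unfolding fat_def is_len(1) using c(2) by blast
  next
    assume "fat n (\<lambda>x. pt n x \<in> A)"
    then obtain l u where lu: "good n l u" "\<forall>x\<in>box n l u. pt n x \<in> A" unfolding fat_def by blast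
    have "pt n ` box n l u \<subseteq> A" using lu(2) by blast
    then have mem: "ereal (real n) \<in> {ereal (real (sum_list is)) |is C. cell L M is C \<and> C \<subseteq> A}"
      using box_cell[OF lu(1)] by (intro CollectI exI[of _ "replicate n 1"] exI[of _ "pt n ` box n l u"]) (simp add: sum_list_replicate)
    show "omin_dim L M A = ereal (real n)"
      unfolding omin_dim_def
    proof (rule antisym)
      show "ereal (real n) \<le> Sup {ereal (real (sum_list is)) |is C. cell L M is C \<and> C \<subseteq> A}" by (rule Sup_upper[OF mem])
      show "Sup {ereal (real (sum_list is)) |is C. cell L M is C \<and> C \<subseteq> A} \<le> ereal (real n)"
        by (rule Sup_least) (use cells in auto)
    qed
  qed
qed

end

section \<open>The derivation on the transported structure and both implications\<close>

context transported_structure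
begin

lemma msum_rep: "msum M (map (\<lambda>i. rep (F i)) is) = rep (\<Sum>i\<leftarrow>is. F i)"
  by (induction "is") (simp_all add: msum_def structure_ops)

lemma pt_list_update: "i < n \<Longrightarrow> (pt n x)[i := rep t] = pt n (x(i := t))"
  by (rule nth_equalityI) (auto simp: length_pt nth_pt nth_list_update)

lemma open_in_pt:
  assumes "\<And>v. P v \<Longrightarrow> \<exists>a b. v \<in> box N a b \<and> (\<forall>x\<in>box N a b. P x)"
  shows "open_in M N {pt N x |x. P x}"
  unfolding open_in_def
proof (intro conjI ballI)
  show "{pt N x |x. P x} \<subseteq> tuples M N" using pt_in by blast
  fix u assume "u \<in> {pt N x |x. P x}"
  then obtain v where v: "u = pt N v" "P v" by blast
  obtain a b where ab: "v \<in> box N a b" "\<forall>x\<in>box N a b. P x" using assms[OF v(2)] by blast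
  show "\<exists>a\<in>tuples M N. \<exists>b\<in>tuples M N.
        (\<forall>i<N. lt M (a ! i) (u ! i) \<and> lt M (u ! i) (b ! i)) \<and>
        {x \<in> tuples M N. \<forall>i<N. lt M (a ! i) (x ! i) \<and> lt M (x ! i) (b ! i)} \<subseteq> {pt N x |x. P x}"
  proof (rule bexI[OF _ pt_in], rule bexI[OF _ pt_in], intro conjI)
    show "\<forall>i<N. lt M (pt N a ! i) (u ! i) \<and> lt M (u ! i) (pt N b ! i)"
      using ab(1) by (simp add: v(1) nth_pt structure_ops box_def)
    show "{x \<in> tuples M N. \<forall>i<N. lt M (pt N a ! i) (x ! i) \<and> lt M (x ! i) (pt N b ! i)} \<subseteq> {pt N x |x. P x}"
    proof
      fix z assume z: "z \<in> {x \<in> tuples M N. \<forall>i<N. lt M (pt N a ! i) (x ! i) \<and> lt M (x ! i) (pt N b ! i)}"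
      then obtain x where x: "z = pt N x" using tuples_pt by blast
      have "x \<in> box N a b" using z by (simp add: x nth_pt structure_ops box_def)
      then show "z \<in> {pt N x |x. P x}" using ab(2) x by blast
    qed
  qed
qed

definition lift :: "((nat \<Rightarrow> 'k) \<Rightarrow> 'k) \<Rightarrow> 'a list \<Rightarrow> 'a" where
  "lift g xs = rep (g (\<lambda>i. coord (xs ! i)))"

lemma lift_pt:
  assumes "Dt (V B N) g"
  shows "lift g (pt N x) = rep (g x)"
proof -
  have "g (\<lambda>i. coord (pt N x ! i)) = g x" by (rule Dt_V_cong[OF assms]) (simp add: nth_pt coord_rep)
  then show ?thesis by (simp add: lift_def)
qed

lemma definable_fun_lift:
  assumes P: "Df (V {} N) P" and g: "Dt (V {} N) g"
  shows "definable_fun L M {} N {pt N x |x. P x} (lift g)"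
  unfolding definable_fun_def
proof (intro conjI ballI)
  show "{pt N x |x. P x} \<subseteq> tuples M N" using pt_in by blast
  show "lift g u \<in> universe M" for u by (simp add: lift_def rep_in)
  have P': "Df (V {} (Suc N)) P" by (rule Df_mono[OF P]) (auto simp: V_def)
  have g': "Dt (V {} (Suc N)) g" by (rule Dt_app[OF g, where w = "\<lambda>c. c"]) (auto intro: Dt_V)
  have "Df (V {} (Suc N)) (\<lambda>y. P y \<and> y N = g y)" by (intro Df_and P' Df_eq g' Dt_V) simp
  from definable_if_Df[OF this] have "definable L M {} (Suc N) {pt (Suc N) y |y. P y \<and> y N = g y}" by simp
  also have "{pt (Suc N) y |y. P y \<and> y N = g y} = {u @ [lift g u] |u. u \<in> {pt N x |x. P x}}"
  proof (intro equalityI subsetI)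
    fix z assume "z \<in> {pt (Suc N) y |y. P y \<and> y N = g y}"
    then obtain y where "P y" "y N = g y" "z = pt (Suc N) y" by blast
    then have "z = pt N y @ [lift g (pt N y)]" by (simp add: pt_Suc lift_pt[OF g])
    then show "z \<in> {u @ [lift g u] |u. u \<in> {pt N x |x. P x}}" using \<open>P y\<close> by blast
  next
    fix z assume "z \<in> {u @ [lift g u] |u. u \<in> {pt N x |x. P x}}"
    then obtain x where x: "P x" "z = pt N x @ [lift g (pt N x)]" by blast
    have "P (x(N := g x)) = P x" by (rule Df_V_cong[OF P]) simp
    moreover have "g (x(N := g x)) = g x" by (rule Dt_V_cong[OF g]) simp
    moreover have "z = pt (Suc N) (x(N := g x))" using x(2) by (simp add: pt_Suc pt_upd lift_pt[OF g])
    ultimately show "z \<in> {pt (Suc N) y |y. P y \<and> y N = g y}" using x(1) by (intro CollectI exI[of _ "x(N := g x)"]) simp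
  qed
  finally show "definable L M {} (Suc N) {u @ [lift g u] |u. u \<in> {pt N x |x. P x}}" .
qed

text \<open>\<open>has_partial\<close> tests only those increments that stay in the domain, while
  \<open>has_pderiv\<close> uses total functions. As the domain is open at x, all small increments
  are tested.\<close>

lemma has_partial_iff:
  assumes P: "Df (V {} N) P" and g: "Dt (V {} N) g" and i: "i < N"
    and op: "\<exists>a b. x \<in> box N a b \<and> (\<forall>y\<in>box N a b. P y)"
  shows "has_partial M {pt N x |x. P x} (lift g) i (pt N x) (rep d) \<longleftrightarrow> has_pderiv g i x d"
proof -
  have mem: "pt N y \<in> {pt N x |x. P x} \<longleftrightarrow> P y" for y
  proof
    assume "pt N y \<in> {pt N x |x. P x}"
    then obtain x where "P x" "pt N x = pt N y" by auto
    then have "P x = P y" by (intro Df_V_cong[OF P]) (simp add: pt_eq)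
    then show "P y" using \<open>P x\<close> by simp
  qed blast
  obtain a b where ab: "x \<in> box N a b" "\<forall>y\<in>box N a b. P y" using op by blast
  obtain r0 where r0: "r0 > 0" "\<forall>y. (\<forall>j<N. \<bar>y j - x j\<bar> < r0) \<longrightarrow> y \<in> box N a b" using box_open[OF ab(1)] by blast
  have near: "P (x(i := x i + h))" if "\<bar>h\<bar> < r0" for h
    using that r0 ab(2) by simp
  have ball_U: "(\<forall>h\<in>universe M. R h) \<longleftrightarrow> (\<forall>h. R (rep h))" for R
    unfolding range_rep[symmetric] by blast
  have "has_partial M {pt N x |x. P x} (lift g) i (pt N x) (rep d) \<longleftrightarrow>
    (\<forall>e>0. \<exists>r>0. \<forall>h. h \<noteq> 0 \<and> \<bar>h\<bar> < r \<and> P (x(i := x i + h)) \<longrightarrow> \<bar>g (x(i := x i + h)) - g x - d * h\<bar> < e * \<bar>h\<bar>)"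
    unfolding has_partial_def ball_mpos bex_mpos ball_U
    by (simp only: nth_pt[OF i] structure_ops pt_list_update[OF i] mem lift_pt[OF g] rep_in rep_inj simp_thms)
  also have "\<dots> \<longleftrightarrow> has_pderiv g i x d"
    unfolding has_pderiv_def has_deriv1_def
  proof (intro iffI allI impI)
    fix e :: 'k
    assume *: "\<forall>e>0. \<exists>r>0. \<forall>h. h \<noteq> 0 \<and> \<bar>h\<bar> < r \<and> P (x(i := x i + h)) \<longrightarrow> \<bar>g (x(i := x i + h)) - g x - d * h\<bar> < e * \<bar>h\<bar>" and e: "0 < e"
    obtain r where r: "0 < r" "\<forall>h. h \<noteq> 0 \<and> \<bar>h\<bar> < r \<and> P (x(i := x i + h)) \<longrightarrow> \<bar>g (x(i := x i + h)) - g x - d * h\<bar> < e * \<bar>h\<bar>"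
      using *[rule_format, OF e] by blast
    show "\<exists>r>0. \<forall>h. h \<noteq> 0 \<and> \<bar>h\<bar> < r \<longrightarrow> \<bar>g (x(i := x i + h)) - g (x(i := x i)) - d * h\<bar> < e * \<bar>h\<bar>"
    proof (intro exI[of _ "min r r0"] conjI allI impI)
      show "0 < min r r0" using r(1) r0(1) by simp
      fix h assume "h \<noteq> 0 \<and> \<bar>h\<bar> < min r r0"
      then have "h \<noteq> 0 \<and> \<bar>h\<bar> < r \<and> P (x(i := x i + h))" using near by simp
      then show "\<bar>g (x(i := x i + h)) - g (x(i := x i)) - d * h\<bar> < e * \<bar>h\<bar>" using r(2) by simp
    qed
  next
    fix e :: 'k
    assume *: "\<forall>e>0. \<exists>r>0. \<forall>h. h \<noteq> 0 \<and> \<bar>h\<bar> < r \<longrightarrow> \<bar>g (x(i := x i + h)) - g (x(i := x i)) - d * h\<bar> < e * \<bar>h\<bar>" and e: "0 < e"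
    obtain r where r: "0 < r" "\<forall>h. h \<noteq> 0 \<and> \<bar>h\<bar> < r \<longrightarrow> \<bar>g (x(i := x i + h)) - g (x(i := x i)) - d * h\<bar> < e * \<bar>h\<bar>"
      using *[rule_format, OF e] by blast
    then show "\<exists>r>0. \<forall>h. h \<noteq> 0 \<and> \<bar>h\<bar> < r \<and> P (x(i := x i + h)) \<longrightarrow> \<bar>g (x(i := x i + h)) - g x - d * h\<bar> < e * \<bar>h\<bar>"
      by (intro exI[of _ r]) simp
  qed
  finally show ?thesis .
qed

text \<open>An open parameter-free P becomes a definable open set of lists and g a C1 function on
  it. Uniqueness of partial derivatives identifies \<open>partial_deriv\<close> with
  \<open>pderivn\<close>, and the product with the Jacobian matrix becomes the sum.\<close>

lemma chain_rule_transported: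
  assumes \<delta>: "T_derivation L M \<delta>"
    and N: "0 < N" and P: "Df (V {} N) P" and g: "Dt (V {} N) g"
    and op: "\<And>v. P v \<Longrightarrow> \<exists>a b. v \<in> box N a b \<and> (\<forall>x\<in>box N a b. P x)"
    and C1: "\<And>v. P v \<Longrightarrow> C1_at N g v" and v: "P v"
  shows "coord (\<delta> (rep (g v))) = (\<Sum>i<N. pderivn g i v * coord (\<delta> (rep (v i))))"
proof -
  define U where "U = {pt N x |x. P x}"
  have \<delta>U: "\<delta> (rep x) \<in> universe M" for x using \<delta> rep_in unfolding T_derivation_def by blast
  have hp: "has_partial M U (lift g) i (pt N x) (rep d) \<longleftrightarrow> has_pderiv g i x d" if "P x" "i < N" for i x d
    unfolding U_def by (rule has_partial_iff[OF P g that(2) op[OF that(1)]])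
  have pd: "has_partial M U (lift g) i (pt N x) (rep (pderivn g i x))" if "P x" "i < N" for x i
    using C1[OF that(1)] that(2) unfolding hp[OF that] C1_at_def by (intro has_pderiv_pderivn) blast
  have pe: "partial_deriv M U (lift g) i (pt N x) = rep (pderivn g i x)" if "P x" "i < N" for x i
    unfolding partial_deriv_def
  proof (rule the_equality)
    show "has_partial M U (lift g) i (pt N x) (rep (pderivn g i x))" by (rule pd[OF that])
    fix d assume d: "has_partial M U (lift g) i (pt N x) d"
    then have "d \<in> universe M" by (simp add: has_partial_def)
    then obtain d' where d': "d = rep d'" using rep_coord by metis
    then show "d = rep (pderivn g i x)" using d hp[OF that] pderivn_eq by metis
  qed
  have "C1_on M N U (lift g)"
    unfolding C1_on_def
  proof (intro allI impI conjI ballI)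
    fix i u assume i: "i < N" and "u \<in> U"
    then show "\<exists>d. has_partial M U (lift g) i u d" using pd unfolding U_def by blast
  next
    fix i assume i: "i < N"
    show "cont_on M N U (partial_deriv M U (lift g) i)"
      unfolding cont_on_def ball_mpos bex_mpos
    proof (intro ballI allI impI)
      fix u and e :: 'k assume u: "u \<in> U" and e: "0 < e"
      obtain x where x: "u = pt N x" "P x" using u unfolding U_def by blast
      have "contn N (pderivn g i) x" using C1[OF x(2)] i unfolding C1_at_def by blast
      then obtain d where d: "d > 0" "\<forall>y. (\<forall>j<N. \<bar>y j - x j\<bar> < d) \<longrightarrow> \<bar>pderivn g i y - pderivn g i x\<bar> < e"
        unfolding contn_def using e by blast
      have "lt M (mabs M (msub M (partial_deriv M U (lift g) i w) (partial_deriv M U (lift g) i u))) (rep e)"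
        if w: "w \<in> U" "\<forall>j<N. lt M (mabs M (msub M (w ! j) (u ! j))) (rep d)" for w
      proof -
        obtain y where y: "w = pt N y" "P y" using w(1) unfolding U_def by blast
        have "\<forall>j<N. \<bar>y j - x j\<bar> < d" using w(2) by (simp add: x(1) y(1) nth_pt structure_ops)
        then have "\<bar>pderivn g i y - pderivn g i x\<bar> < e" using d(2) by blast
        then show ?thesis by (simp add: x(1) y(1) pe[OF x(2) i] pe[OF y(2) i] structure_ops)
      qed
      then show "\<exists>xa>0. \<forall>w\<in>U. (\<forall>ia<N. lt M (mabs M (msub M (w ! ia) (u ! ia))) (rep xa)) \<longrightarrow>
          lt M (mabs M (msub M (partial_deriv M U (lift g) i w) (partial_deriv M U (lift g) i u))) (rep e)"
        using d(1) by blast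
    qed
  qed
  moreover have "open_in M N U" unfolding U_def by (rule open_in_pt[OF op])
  moreover have "definable_fun L M {} N U (lift g)" unfolding U_def by (rule definable_fun_lift[OF P g])
  moreover have "pt N v \<in> U" using v unfolding U_def by blast
  ultimately have "\<delta> (lift g (pt N v)) = msum M (map2 (mmul M) (jacobian M N U (lift g) (pt N v)) (map \<delta> (pt N v)))"
    using \<delta> unfolding T_derivation_def by blast
  also have "map2 (mmul M) (jacobian M N U (lift g) (pt N v)) (map \<delta> (pt N v)) =
     map (\<lambda>i. rep (pderivn g i v * coord (\<delta> (rep (v i))))) [0..<N]"
  proof (rule nth_equalityI)
    fix i assume "i < length (map2 (mmul M) (jacobian M N U (lift g) (pt N v)) (map \<delta> (pt N v)))"
    then have i: "i < N" by (simp add: jacobian_def length_pt)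
    have "mmul M (rep (pderivn g i v)) (rep (coord (\<delta> (rep (v i))))) = rep (pderivn g i v * coord (\<delta> (rep (v i))))"
      by (rule structure_ops)
    then have "mmul M (rep (pderivn g i v)) (\<delta> (rep (v i))) = rep (pderivn g i v * coord (\<delta> (rep (v i))))"
      by (simp only: rep_coord[OF \<delta>U])
    then show "map2 (mmul M) (jacobian M N U (lift g) (pt N v)) (map \<delta> (pt N v)) ! i =
      map (\<lambda>i. rep (pderivn g i v * coord (\<delta> (rep (v i))))) [0..<N] ! i"
      using i by (simp add: jacobian_def length_pt nth_pt pe[OF v i])
  qed (simp add: jacobian_def length_pt)
  also have "msum M \<dots> = rep (\<Sum>i<N. pderivn g i v * coord (\<delta> (rep (v i))))"
    unfolding msum_rep interv_sum_list_conv_sum_set_nat by (simp add: atLeast0LessThan)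
  finally show ?thesis by (simp add: lift_pt[OF g] coord_rep)
qed

lemma take_pt_image: "k \<le> n \<Longrightarrow> take k ` {pt n x |x. P x} = {pt k x |x. P x}"
proof -
  assume k: "k \<le> n"
  then have "take k ` {pt n x |x. P x} = (\<lambda>x. take k (pt n x)) ` {x. P x}" by blast
  also have "\<dots> = {pt k x |x. P x}" using take_pt[OF k] by auto
  finally show ?thesis .
qed

lemma tuples_set_pt: "X \<subseteq> tuples M n \<Longrightarrow> {pt n x |x. pt n x \<in> X} = X"
proof -
  assume "X \<subseteq> tuples M n"
  then have "\<exists>x. z = pt n x" if "z \<in> X" for z using tuples_pt that by blast
  then show ?thesis by blast
qed

lemma take_tuples: "X \<subseteq> tuples M n \<Longrightarrow> k \<le> n \<Longrightarrow> take k ` X \<subseteq> tuples M k"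
  using set_take_subset by (fastforce simp: tuples_def)

lemma definable_subset: "definable L M B n X \<Longrightarrow> X \<subseteq> tuples M n"
  unfolding definable_def by blast

context
  fixes \<delta> :: "'a \<Rightarrow> 'a"
  assumes \<delta>: "T_derivation L M \<delta>"
begin

definition \<delta>' :: "'k \<Rightarrow> 'k" where "\<delta>' x = coord (\<delta> (rep x))"

lemma rep_\<delta>': "rep (\<delta>' x) = \<delta> (rep x)"
proof -
  have "\<delta> (rep x) \<in> universe M" using \<delta> rep_in unfolding T_derivation_def by blast
  then show ?thesis by (simp add: \<delta>'_def rep_coord)
qed

lemma rep_funpow: "(\<delta> ^^ i) (rep x) = rep ((\<delta>' ^^ i) x)"
  by (induction i) (simp_all add: rep_\<delta>')

lemma jet_rep: "jet \<delta> n (rep x) = pt (Suc n) (\<lambda>i. (\<delta>' ^^ i) x)"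
  by (simp add: jet_def pt_def rep_funpow)

lemma map_pt: "map \<delta> (pt n x) = pt n (\<lambda>i. \<delta>' (x i))"
  by (simp add: pt_def rep_\<delta>')

lemma generic_derivation_transported:
  assumes gen: "generic L M \<delta>"
  shows "generic_derivation Dset \<delta>'"
proof
  fix N P v and g :: "(nat \<Rightarrow> 'k) \<Rightarrow> 'k"
  assume "0 < N" "Df (V {} N) P" "Dt (V {} N) g"
    "\<And>v. P v \<Longrightarrow> \<exists>a b. v \<in> box N a b \<and> (\<forall>x\<in>box N a b. P x)" "\<And>v. P v \<Longrightarrow> C1_at N g v" "P v"
  then show "\<delta>' (g v) = (\<Sum>i<N. pderivn g i v * \<delta>' (v i))"
    unfolding \<delta>'_def by (rule chain_rule_transported[OF \<delta>])
next
  fix n and A :: "(nat \<Rightarrow> 'k) \<Rightarrow> bool"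
  assume A: "Df (W (Suc n)) A" and f: "fat n (\<lambda>x. \<exists>t. A (x(n := t)))"
  define X where "X = {pt (Suc n) x |x. A x}"
  have dX: "definable L M (universe M) (Suc n) X" using definable_if_Df[OF A] by (simp add: X_def range_rep)
  have tX: "take n ` X = {pt n x |x. A x}" unfolding X_def by (rule take_pt_image) simp
  have sub: "take n ` X \<subseteq> tuples M n" unfolding tX using pt_in by blast
  have "fat n (\<lambda>x. pt n x \<in> take n ` X)"
  proof -
    obtain l u where lu: "good n l u" "\<forall>x\<in>box n l u. \<exists>t. A (x(n := t))" using f unfolding fat_def by blast
    have "pt n x \<in> take n ` X" if x: "x \<in> box n l u" for x
    proof -
      obtain t where t: "A (x(n := t))" using lu(2) x by blast
      have "pt n x = pt n (x(n := t))" by (simp add: pt_upd)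
      then show ?thesis unfolding tX using t by blast
    qed
    then show ?thesis unfolding fat_def using lu(1) by blast
  qed
  then have "omin_dim L M (take n ` X) = ereal (real n)" using omin_dim_eq_iff[OF sub] by simp
  then obtain b where b: "b \<in> universe M" "jet \<delta> n b \<in> X" using gen dX unfolding generic_def by blast
  obtain a where a: "b = rep a" using b(1) rep_coord by metis
  obtain x where x: "A x" "pt (Suc n) (\<lambda>i. (\<delta>' ^^ i) a) = pt (Suc n) x" using b(2) unfolding a jet_rep X_def by blast
  have "A (\<lambda>i. (\<delta>' ^^ i) a) = A x" by (rule Df_V_cong[OF A]) (use x(2) in \<open>simp add: pt_eq\<close>)
  then show "\<exists>a. A (\<lambda>i. (\<delta>' ^^ i) a)" using x(1) by blast
qed

lemma pt_append: "pt n x @ pt n y = pt (n + n) (cat n x y)"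
  by (rule nth_equalityI) (auto simp: length_pt nth_append nth_pt cat_def)

text \<open>Over a box in the projection, definable choice selects a point F a of the fibre of X; a
  solution of the system with right-hand side F then gives a point of X.\<close>

lemma solution_if_generic:
  assumes gen: "generic L M \<delta>" and X: "definable L M (universe M) (2 * n) X"
    and dim: "omin_dim L M (take n ` X) = ereal (real n)"
  shows "\<exists>a\<in>tuples M n. a @ map \<delta> a \<in> X"
proof -
  interpret generic_derivation Dset \<delta>' by (rule generic_derivation_transported[OF gen])
  have X': "definable L M (universe M) (n + n) X" using X by (simp add: mult_2)
  have sub: "X \<subseteq> tuples M (n + n)" by (rule definable_subset[OF X'])
  have "fat n (\<lambda>x. pt n x \<in> take n ` X)" using omin_dim_eq_iff[OF take_tuples[OF sub]] dim by simp
  then obtain l u where lu: "good n l u" "\<forall>x\<in>box n l u. pt n x \<in> take n ` X" unfolding fat_def by blast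
  define Q where "Q x w \<longleftrightarrow> pt (n + n) (cat n x w) \<in> X" for x w
  have ex: "\<exists>w. Q x w" if x: "x \<in> box n l u" for x
  proof -
    obtain z where z: "z \<in> X" "pt n x = take n z" using lu(2) x by blast
    obtain y where y: "z = pt (n + n) y" using z(1) sub tuples_pt by blast
    have "pt n x = pt n y" using z(2) y by (simp add: take_pt)
    then have "pt (n + n) (cat n x (\<lambda>i. y (n + i))) = pt (n + n) y" by (auto simp: pt_eq cat_def)
    then show ?thesis using z(1) y unfolding Q_def by (intro exI[of _ "\<lambda>i. y (n + i)"]) simp
  qed
  have dQ: "Df (exts n (W n)) (\<lambda>p. Q (fst p) (snd p))"
    unfolding Q_def
  proof (rule Df_app[OF Df_if_definable[OF X']])
    show "Dt (exts n (W n)) (\<lambda>p. cat n (fst p) (snd p) i)" if "i < n + n" for i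
      by (cases "i < n") (use that in \<open>auto simp: cat_def intro: Dt_snds Dt_fsts[OF Dt_V(1)]\<close>)
    show "Dt (exts n (W n)) (\<lambda>_. a)" for a by (rule Dt_fsts[OF Dt_V(2)]) simp
  qed
  from definable_choices[OF dQ] obtain F where F: "\<forall>i<n. Dt (W n) (\<lambda>c. F c i)" "\<forall>c w. Q c w \<longrightarrow> Q c (F c)" by blast
  have "\<exists>a\<in>box n l u. \<forall>i<n. \<delta>' (a i) = F a i"
  proof (cases "n = 0")
    case True
    then show ?thesis by (simp add: box_def)
  next
    case False
    then show ?thesis using generic_solution[of n "\<lambda>i x. F x i" l u] F(1) lu(1) by simp
  qed
  then obtain a where a: "a \<in> box n l u" "\<forall>i<n. \<delta>' (a i) = F a i" by blast
  have "Q a (F a)" using ex[OF a(1)] F(2) by blast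
  moreover have "pt n a @ map \<delta> (pt n a) = pt (n + n) (cat n a (F a))"
  proof -
    have "pt n (\<lambda>i. \<delta>' (a i)) = pt n (F a)" using a(2) by (simp add: pt_eq)
    then show ?thesis by (simp add: map_pt pt_append)
  qed
  ultimately show ?thesis unfolding Q_def using pt_in by (intro bexI[of _ "pt n a"]) simp_all
qed

text \<open>An equation of order n is rewritten as a first-order system in the usual way: the
  unknowns are the successive derivatives, and only the last component of \<delta> a carries the
  original condition.\<close>

lemma generic_if_solution:
  assumes sol: "\<And>n X. definable L M (universe M) (2 * n) X \<Longrightarrow> omin_dim L M (take n ` X) = ereal (real n) \<Longrightarrow>
    \<exists>a\<in>tuples M n. a @ map \<delta> a \<in> X"
  shows "generic L M \<delta>"
  unfolding generic_def
proof (intro allI impI)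
  fix n A assume "definable L M (universe M) (Suc n) A \<and> omin_dim L M (take n ` A) = ereal (real n)"
  then have A: "definable L M (universe M) (Suc n) A" and dim: "omin_dim L M (take n ` A) = ereal (real n)" by auto
  have sub: "A \<subseteq> tuples M (Suc n)" by (rule definable_subset[OF A])
  have dA: "Df (W (Suc n)) (\<lambda>x. pt (Suc n) x \<in> A)" by (rule Df_if_definable[OF A])
  show "\<exists>a\<in>universe M. jet \<delta> n a \<in> A"
  proof (cases "n = 0")
    \<comment> \<open>For n = 0 full dimension of the projection only says that A is nonempty, and
      the jet is a single element.\<close>
    case True
    have "take n ` A \<subseteq> tuples M n" by (rule take_tuples[OF sub]) simp
    then have "fat n (\<lambda>x. pt n x \<in> take n ` A)" using omin_dim_eq_iff dim by blast
    then obtain z where z: "z \<in> A" using True by (auto simp: fat_def box_def)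
    then obtain x where x: "z = pt (Suc n) x" using sub tuples_pt by blast
    have "jet \<delta> n (rep (x 0)) = z" unfolding jet_rep x pt_eq using True by simp
    then show ?thesis using z rep_in by blast
  next
    case False
    \<comment> \<open>Reads the n + 1 entries of a jet off a pair (a, b) in M^(2n): the entries of
      a, followed by the last entry of b at index 2n - 1.\<close>
    define \<tau> where "\<tau> i = (if i < n then i else n + n - 1)" for i
    define P where "P y \<longleftrightarrow> pt (Suc n) (\<lambda>i. y (\<tau> i)) \<in> A \<and> (\<forall>i<n - 1. y (n + i) = y (Suc i))" for y
    have \<tau>: "\<tau> i < n + n" if "i < Suc n" for i using that False by (auto simp: \<tau>_def)
    have dP: "Df (W (n + n)) P"
      unfolding P_def
    proof (intro Df_and Df_all_less Df_eq Dt_V)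
      show "Df (W (n + n)) (\<lambda>y. pt (Suc n) (\<lambda>i. y (\<tau> i)) \<in> A)"
      proof (rule Df_app[OF dA])
        show "Dt (W (n + n)) (\<lambda>y. y (\<tau> i))" if "i < Suc n" for i using \<tau>[OF that] by (rule Dt_V(1))
        show "Dt (W (n + n)) (\<lambda>_. a)" for a by (rule Dt_V(2)) simp
      qed
    qed auto
    define X where "X = {pt (n + n) y |y. P y}"
    have dX: "definable L M (universe M) (2 * n) X" using definable_if_Df[OF dP] by (simp add: X_def range_rep mult_2)
    have "take n ` X = take n ` A"
    proof -
      have "take n ` X = {pt n y |y. P y}" unfolding X_def by (rule take_pt_image) simp
      also have "\<dots> = {pt n x |x. pt (Suc n) x \<in> A}"
      proof (intro equalityI subsetI)
        fix z assume "z \<in> {pt n y |y. P y}"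
        then obtain y where y: "z = pt n y" "P y" by blast
        have "z = pt n (\<lambda>i. y (\<tau> i))" by (simp add: y(1) pt_eq \<tau>_def)
        then show "z \<in> {pt n x |x. pt (Suc n) x \<in> A}" using y(2) unfolding P_def by blast
      next
        fix z assume "z \<in> {pt n x |x. pt (Suc n) x \<in> A}"
        then obtain x where x: "z = pt n x" "pt (Suc n) x \<in> A" by blast
        \<comment> \<open>Unfolds x to (x_0, ..., x_{n-1}, x_1, ..., x_n), so the projection of X is
          that of A.\<close>
        define y where "y i = (if i < n then x i else x (Suc (i - n)))" for i
        have "pt (Suc n) (\<lambda>i. y (\<tau> i)) = pt (Suc n) x"
          unfolding pt_eq using False by (auto simp: y_def \<tau>_def less_Suc_eq)
        moreover have "\<forall>i<n - 1. y (n + i) = y (Suc i)" by (simp add: y_def less_diff_conv)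
        ultimately have "P y" using x(2) unfolding P_def by simp
        moreover have "z = pt n y" by (simp add: x(1) pt_eq y_def)
        ultimately show "z \<in> {pt n y |y. P y}" by blast
      qed
      also have "\<dots> = take n ` {pt (Suc n) x |x. pt (Suc n) x \<in> A}" by (rule take_pt_image[symmetric]) simp
      also have "\<dots> = take n ` A" by (simp only: tuples_set_pt[OF sub])
      finally show ?thesis .
    qed
    then have "omin_dim L M (take n ` X) = ereal (real n)" using dim by simp
    from sol[OF dX this] obtain a where a: "a \<in> tuples M n" "a @ map \<delta> a \<in> X" by blast
    obtain x where x: "a = pt n x" using a(1) tuples_pt by blast
    obtain y where y: "pt (n + n) (cat n x (\<lambda>i. \<delta>' (x i))) = pt (n + n) y" "P y"
      using a(2) unfolding x map_pt pt_append X_def by blast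
    have y': "y i = (if i < n then x i else \<delta>' (x (i - n)))" if "i < n + n" for i
      using y(1) that unfolding pt_eq cat_def by simp
    have step: "x (Suc i) = \<delta>' (x i)" if "i < n - 1" for i
    proof -
      have "y (n + i) = y (Suc i)" using y(2) that unfolding P_def by blast
      then show ?thesis using y'[of "n + i"] y'[of "Suc i"] that by auto
    qed
    have iter: "i < n \<Longrightarrow> x i = (\<delta>' ^^ i) (x 0)" for i
      by (induction i) (simp_all add: step)
    have "pt (Suc n) (\<lambda>i. y (\<tau> i)) = pt (Suc n) (\<lambda>i. (\<delta>' ^^ i) (x 0))"
      unfolding pt_eq
    proof (intro allI impI)
      fix i assume "i < Suc n"
      show "y (\<tau> i) = (\<delta>' ^^ i) (x 0)"
      proof (cases "i < n")
        case True
        then show ?thesis using y'[of i] iter[of i] by (simp add: \<tau>_def)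
      next
        case i: False
        then obtain m where m: "i = Suc m" "n = Suc m" using \<open>i < Suc n\<close> False by (cases n) auto
        have "y (\<tau> i) = \<delta>' (x m)" using y'[of "n + n - 1"] m by (simp add: \<tau>_def)
        also have "\<dots> = \<delta>' ((\<delta>' ^^ m) (x 0))" using iter[of m] m by simp
        finally show ?thesis by (simp add: m(1))
      qed
    qed
    then have "jet \<delta> n (rep (x 0)) \<in> A" using y(2) unfolding P_def jet_rep by simp
    then show ?thesis using rep_in by blast
  qed
qed

end

end

text \<open>Both implications hold for the structure behind \<open>point\<close>, although it was
  chosen as a counterexample; hence there is none on the given types.\<close>

lemma not_violates:
  fixes L :: "('f, 'r) lang" and M :: "('f, 'r, 'a) fo_structure"
  shows "\<not> violates L M \<delta>"
proof
  assume v: "violates L M \<delta>"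
  obtain L' M' \<delta>' and rep :: "('f, 'r, 'a) point \<Rightarrow> 'a" where
    V: "violates L' (M' :: ('f, 'r, 'a) fo_structure) \<delta>'" and b: "bij_betw rep UNIV (universe M')"
    and r: "rep 0 = fn M' Zero []" "\<And>x y. rep (x + y) = fn M' Plus [rep x, rep y]" "\<And>x. rep (- x) = fn M' Minus [rep x]"
      "\<And>x y. rep (x * y) = fn M' Times [rep x, rep y]" "\<And>x y. rl M' Less [rep x, rep y] \<longleftrightarrow> x < y"
    by (rule point_model[OF v]) (rule that; assumption)
  interpret transported_structure L' M' rep
    using V b r unfolding violates_def by unfold_locales auto
  have d: "T_derivation L' M' \<delta>'" using V unfolding violates_def by blast
  have "generic L' M' \<delta>' \<longleftrightarrow> (\<forall>n X. definable L' M' (universe M') (2*n) X \<and> omin_dim L' M' (take n ` X) = ereal (real n) \<longrightarrow>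
     (\<exists>a\<in>tuples M' n. a @ map \<delta>' a \<in> X))"
    using solution_if_generic[OF d] generic_if_solution[OF d] by blast
  then show False using V unfolding violates_def by blast
qed

theorem corollary4p9:
  fixes L :: "('f, 'r) lang"
    and T :: "('f, 'r) fm set"
    and M :: "('f, 'r, 'a) fo_structure"
    and \<delta> :: "'a \<Rightarrow> 'a"
  assumes "\<forall>p\<in>T. sentence L p"
    and "complete_theory L T"
    and "model_complete L T"
    and "o_minimal_theory L T"
    and "extends_RCF L T"
    and "models L M T"
    and "T_derivation L M \<delta>"
  shows "models_T_delta_G L T M \<delta> \<longleftrightarrow>
    (\<forall>n X. definable L M (universe M) (2 * n) X \<and> omin_dim L M (take n ` X) = ereal (real n) \<longrightarrow>
      (\<exists>a\<in>tuples M n. a @ map \<delta> a \<in> X))"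
proof -
  have F: "ordered_field M" by (rule ordered_field_if_extends_RCF[OF assms(1,6,5)])
  have O: "o_minimal L M" by (rule o_minimal_if_o_minimal_theory[OF assms(1,6,4) F])
  have S: "is_structure L M" using assms(6) by (simp add: models_def)
  have "\<not> violates L M \<delta>" by (rule not_violates)
  then show ?thesis
    using F O S assms(6,7) unfolding violates_def models_T_delta_G_def models_T_delta_def by blast
qed

end
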